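(* Let $Q$ be the quiver with two vertices $1,2$, two arrows $a_1,a_2:1\to 2$ and two arrows $b_1,b_2:2\to 1$, and let $$A=\mathbb{C}Q/\langle a_ib_ja_k-a_kb_ja_i,\ b_ia_jb_k-b_ka_jb_i \mid i,j,k\in\{1,2\}\rangle$$ be the conifold quiver algebra, whose center is isomorphic to the conifold ring $R=\mathbb{C}[xz,xw,yz,yw]\cong\mathbb{C}[s,t,u,v]/(sv-tu)$, with $s=xz$, $t=xw$, $u=yz$, $v=yw$. Let $\pi_\pm:Y^\pm\to\operatorname{Max}R$ be its two crepant resolutions, with the singular point $0\in\operatorname{Max}R$, where $\pi_+^{-1}(0)=\mathbb{P}^1$ has homogeneous coordinates $(z:w)$ and $\pi_-^{-1}(0)=\mathbb{P}^1$ has homogeneous coordinates $(x:y)$. Then: (1) the isoclasses of large $A$-modules are parameterized by the smooth locus of $\operatorname{Max}R$; (2) the isoclasses of almost large $A$-modules with socle isomorphic to the vertex simple $S_2$ (resp. $S_1$) are parameterized by the exceptional locus $\pi_-^{-1}(0)=\mathbb{P}^1$ (resp. $\pi_+^{-1}(0)=\mathbb{P}^1$), having coordinates $(x:y)$ (resp. $(z:w)$). Moreover, the coordinates on $Y^{\pm}$ obtained from the impression $(\tau,\mathbb{C}[x,y,z,w])$ of $A$, i.e. those given by $\mathcal{O}_X(U):=\bar\tau(e_iA(U)e_i)$, agree with those obtained by blowing up.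
   Context: All modules are left modules over $\mathbb{C}$-algebras; paths are multiplied right to left. For a quiver algebra $A=\mathbb{C}Q/I$ and $i\in Q_0$, $e_i$ is the vertex idempotent and $S_i$ is the vertex simple module: one-dimensional at vertex $i$, zero elsewhere, all arrows acting by zero. $Q_{\ge0}$ is the set of all paths. $\operatorname{Soc}V$ is the largest semisimple submodule of $V$. *Large modules.* A simple $A$-module is large if its $\mathbb{C}$-dimension is maximal among all simple $A$-modules. Large modules $V$ correspond to points of $\operatorname{Max}Z$ ($Z$ the center) by $V\mapsto\operatorname{ann}_ZV$. *Path-like sets.* For a basic $k$-algebra $A$, a subset $\mathcal{P}\subset A$ is path-like if $\mathcal{P}\setminus\{0\}$ is a $k$-basis of $A$, $\mathcal{P}$ contains a basic set of idempotents (primitive orthogonal idempotents $e_1,\dots,e_n$ summing to $1$, with $Ae_1,\dots,Ae_n$ a complete non-redundant list of the modules $Ae$ with $e$ primitive idempotent), and $a,b\in\mathcal{P}$ implies $ab\in\mathcal{P}$. For a quiver algebra the images of $Q_{\ge0}\cup\{0\}$ are an example here. *Almost large modules.* Let $A$ be a finitely generated basic algebra, module-finite over its center $Z$, an integral domain. Let $d$ be the dimension vector of a large module and $\operatorname{Rep}_dA$ the set of $A$-modules $V$ with dimension vector $(\dim e_iV)_i=d$. For $1\le\ell\le\dim Z$, a subset $P\subset A$ has codimension $\ell$ if there is a path-like set $\mathcal{P}$ and a maximal chain of subsets $0\subsetneq P_1\subsetneq\cdots\subsetneq P_\ell=P$ such that each $P_j$ is the $\mathcal{P}$-annihilator $\operatorname{ann}_{\mathcal{P}}W=\{p\in\mathcal{P}: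 pW=0\}$ of some module $W\in\operatorname{Rep}_dA$. A non-simple $V\in\operatorname{Rep}_dA$ with $\operatorname{ann}_{\mathcal{P}}V=P$ for such $P$ is an almost large $A$-module. (For the conifold algebra $d=(1,1)$.) *Parameterization.* A set of module isoclasses is parameterized by a variety when the isoclasses correspond bijectively to its points. That the modules with socle $S_2$ (resp. $S_1$) have coordinates $(x:y)$ (resp. $(z:w)$) refers to the scalars $x,y$ by which $a_1,a_2$ act (resp. $z,w$ by which $b_1,b_2$ act). *The two resolutions.* $Y^+=\{((s,t,u,v),(s':t')) : st'=s't,\ s'v=t'u\}\subset \mathbb{C}^4\times\mathbb{P}^1$ and $Y^-=\{((s,t,u,v),(s':u')) : su'=s'u,\ s'v=u't\}\subset\mathbb{C}^4\times\mathbb{P}^1$ (with $sv=tu$), where $(s':t')=(z:w)$ and $(s':u')=(x:y)$. *Impression and induced structure sheaf.* $\tau:A\to\operatorname{Mat}_2(B)$, $B=\mathbb{C}[x,y,z,w]$, is the algebra monomorphism with $\tau(e_i)=E_{ii}$, $\tau(a_1)=xE_{21}$, $\tau(a_2)=yE_{21}$, $\tau(b_1)=zE_{12}$, $\tau(b_2)=wE_{12}$. For $a\in e_jAe_i$, $\bar\tau(a)\in B$ is the $(j,i)$ entry of $\tau(a)$. Let $X$ be the space parameterizing the isoclasses of large modules together with almost large modules with the fixed vertex simple socle ($S_2$ for $Y^-$, $S_1$ for $Y^+$). For $p\in X$ let $Q(p)\subseteq Q$ be the supporting subquiver of the corresponding module (the arrows acting by nonzero scalars). For $U\subset X$ Zariski-open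 affine, set $Q(U)=\bigcap_{p\in U}Q(p)$; let $Q'(U)$ be obtained from $Q$ by adding an arrow $a^*$ from $\operatorname{h}(a)$ to $\operatorname{t}(a)$ for each arrow $a$ of $Q(U)$; let $A(U)=\mathbb{C}Q'(U)/\langle I,\ aa^*-e_{\operatorname{h}(a)},\ a^*a-e_{\operatorname{t}(a)}\mid a\in Q_1(U)\rangle$, where $I$ is the ideal of relations of $A$. Extend $\tau$ to $A(U)\to\operatorname{Mat}_2(\operatorname{Frac}B)$ by $\tau(a^* )=\bar\tau(a)^{-1}E_{\operatorname{t}(a),\operatorname{h}(a)}$, and set $\mathcal{O}_X(U):=\bar\tau(e_iA(U)e_i)$ (for any vertex $i$).
   Formalization: Agreement of O_X(U) with regular functions on Y^± is equality only for U cut out by nonvanishing of arrows (including the blow-up charts); for other open U it is an inclusion, as equality fails, e.g. 1/(s-1) on z≠0, s≠1. Modules are taken of countable dimension. *)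

theory Defs
  imports
    "HOL-Analysis.Analysis"
    "HOL-Library.Poly_Mapping"
    "HOL-Library.Extended_Nat"
    "HOL-Computational_Algebra.Fraction_Field"
    "HOL-Algebra.QuotRing"
    "HOL-Algebra.Module"
    "Graph_Theory.Arc_Walk"
begin

section \<open>Vector spaces and modules over a complex algebra\<close>

definition pm_scale :: "complex \<Rightarrow> ('k \<Rightarrow>\<^sub>0 complex) \<Rightarrow> ('k \<Rightarrow>\<^sub>0 complex)"
  where "pm_scale c f = Poly_Mapping.map ((*) c) f"

lemma lookup_pm_scale: "Poly_Mapping.lookup (pm_scale c f) k = c * Poly_Mapping.lookup f k"
  unfolding pm_scale_def by transfer (simp add: when_def)

global_interpretation pm: vector_space "pm_scale :: complex \<Rightarrow> ('k \<Rightarrow>\<^sub>0 complex) \<Rightarrow> _"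
  by unfold_locales
    (auto intro!: poly_mapping_eqI simp: lookup_pm_scale lookup_add algebra_simps)

text \<open>
  A complex algebra (not necessarily commutative) is a record of type
  \<^typ>\<open>(complex, 'a) module\<close>.  Its left modules live on complex subspaces of the space of
  finitely supported sequences, which contains a copy of every complex vector space of countable
  dimension, hence, over a finitely generated algebra, of every simple module.
\<close>

type_synonym cvec = "nat \<Rightarrow>\<^sub>0 complex"

record 'a lmod =
  space :: "cvec set"
  act :: "'a \<Rightarrow> cvec \<Rightarrow> cvec"

definition is_module :: "(complex, 'a) module \<Rightarrow> 'a lmod \<Rightarrow> bool" where
  "is_module A V \<longleftrightarrow>
     pm.subspace (space V) \<and>
     (\<forall>a\<in>carrier A. \<forall>v\<in>space V. act V a v \<in> space V) \<and>
     (\<forall>a\<in>carrier A. \<forall>v\<in>space V. \<forall>w\<in>space V. act V a (v + w) = act V a v + act V a w) \<and>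
     (\<forall>a\<in>carrier A. \<forall>c. \<forall>v\<in>space V. act V a (pm_scale c v) = pm_scale c (act V a v)) \<and>
     (\<forall>a\<in>carrier A. \<forall>b\<in>carrier A. \<forall>v\<in>space V.
        act V (a \<oplus>\<^bsub>A\<^esub> b) v = act V a v + act V b v) \<and>
     (\<forall>a\<in>carrier A. \<forall>c. \<forall>v\<in>space V. act V (c \<odot>\<^bsub>A\<^esub> a) v = pm_scale c (act V a v)) \<and>
     (\<forall>a\<in>carrier A. \<forall>b\<in>carrier A. \<forall>v\<in>space V.
        act V (a \<otimes>\<^bsub>A\<^esub> b) v = act V a (act V b v)) \<and>
     (\<forall>v\<in>space V. act V \<one>\<^bsub>A\<^esub> v = v)"

definition module_iso :: "(complex, 'a) module \<Rightarrow> 'a lmod \<Rightarrow> 'a lmod \<Rightarrow> bool" where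
  "module_iso A V W \<longleftrightarrow> is_module A V \<and> is_module A W \<and>
     (\<exists>\<phi>. bij_betw \<phi> (space V) (space W) \<and>
          (\<forall>v\<in>space V. \<forall>w\<in>space V. \<phi> (v + w) = \<phi> v + \<phi> w) \<and>
          (\<forall>c. \<forall>v\<in>space V. \<phi> (pm_scale c v) = pm_scale c (\<phi> v)) \<and>
          (\<forall>a\<in>carrier A. \<forall>v\<in>space V. \<phi> (act V a v) = act W a (\<phi> v)))"

definition iso_rel :: "(complex, 'a) module \<Rightarrow> 'a lmod rel" where
  "iso_rel A = {(V, W). module_iso A V W}"

text \<open>
  The isoclasses of the modules in \<open>\<V>\<close> correspond bijectively to the points of \<open>X\<close>,
  in such a way that \<open>\<rho> V x\<close> holds for the point \<open>x\<close> of the isoclass of \<open>V\<close>.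
\<close>

definition parameterized_by ::
    "(complex, 'a) module \<Rightarrow> 'a lmod set \<Rightarrow> 'x set \<Rightarrow> ('a lmod \<Rightarrow> 'x \<Rightarrow> bool) \<Rightarrow> bool" where
  "parameterized_by A \<V> X \<rho> \<longleftrightarrow>
     (\<exists>F. bij_betw F (\<V> // iso_rel A) X \<and> (\<forall>V\<in>\<V>. \<rho> V (F (iso_rel A `` {V}))))"

definition submodule :: "(complex, 'a) module \<Rightarrow> 'a lmod \<Rightarrow> cvec set \<Rightarrow> bool" where
  "submodule A V W \<longleftrightarrow> pm.subspace W \<and> W \<subseteq> space V \<and>
     (\<forall>a\<in>carrier A. \<forall>v\<in>W. act V a v \<in> W)"

definition simple_module :: "(complex, 'a) module \<Rightarrow> 'a lmod \<Rightarrow> bool" where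
  "simple_module A V \<longleftrightarrow> is_module A V \<and> space V \<noteq> {0} \<and>
     (\<forall>W. submodule A V W \<longrightarrow> W = {0} \<or> W = space V)"

text \<open>A module is semisimple if it is the sum of its simple submodules.\<close>

definition semisimple_module :: "(complex, 'a) module \<Rightarrow> 'a lmod \<Rightarrow> bool" where
  "semisimple_module A V \<longleftrightarrow> is_module A V \<and>
     space V = pm.span (\<Union>{W. submodule A V W \<and> simple_module A (V\<lparr>space := W\<rparr>)})"

definition socle :: "(complex, 'a) module \<Rightarrow> 'a lmod \<Rightarrow> 'a lmod" where
  "socle A V = V\<lparr>space :=
     (GREATEST W. submodule A V W \<and> semisimple_module A (V\<lparr>space := W\<rparr>))\<rparr>"

text \<open>\<open>pm.dim\<close> is \<open>0\<close> on infinite-dimensional subspaces, which must not pass for small ones.\<close>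

definition edim :: "cvec set \<Rightarrow> enat" where
  "edim W = (if \<exists>B. finite B \<and> W \<subseteq> pm.span B then enat (pm.dim W) else \<infinity>)"

definition large_module :: "(complex, 'a) module \<Rightarrow> 'a lmod \<Rightarrow> bool" where
  "large_module A V \<longleftrightarrow> simple_module A V \<and>
     (\<forall>W. simple_module A W \<longrightarrow> edim (space W) \<le> edim (space V))"

definition dim_vector :: "('i \<Rightarrow> 'a) \<Rightarrow> 'a lmod \<Rightarrow> 'i \<Rightarrow> enat" where
  "dim_vector e V i = edim (act V (e i) ` space V)"

definition Rep :: "(complex, 'a) module \<Rightarrow> ('i \<Rightarrow> 'a) \<Rightarrow> ('i \<Rightarrow> enat) \<Rightarrow> 'a lmod set" where
  "Rep A e d = {V. is_module A V \<and> dim_vector e V = d}"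

definition ann :: "'a set \<Rightarrow> 'a lmod \<Rightarrow> 'a set" where
  "ann S V = {p \<in> S. \<forall>v\<in>space V. act V p v = 0}"

definition center :: "(complex, 'a) module \<Rightarrow> (complex, 'a) module" where
  "center A = A\<lparr>carrier := {z \<in> carrier A. \<forall>a\<in>carrier A. z \<otimes>\<^bsub>A\<^esub> a = a \<otimes>\<^bsub>A\<^esub> z}\<rparr>"

definition krull_dim :: "('a, 'm) ring_scheme \<Rightarrow> enat" where
  "krull_dim R = (SUP n \<in> {n. \<exists>P. (\<forall>i\<le>n. primeideal (P i) R) \<and> (\<forall>i<n. P i \<subset> P (Suc i))}. enat n)"


section \<open>Path-like sets and almost large modules\<close>

definition is_basis :: "(complex, 'a) module \<Rightarrow> 'a set \<Rightarrow> bool" where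
  "is_basis A B \<longleftrightarrow> B \<subseteq> carrier A \<and>
     (\<forall>a\<in>carrier A. \<exists>!c. finite {p. c p \<noteq> 0} \<and> {p. c p \<noteq> 0} \<subseteq> B \<and>
        a = finsum A (\<lambda>p. c p \<odot>\<^bsub>A\<^esub> p) {p. c p \<noteq> 0})"

definition idempotent :: "(complex, 'a) module \<Rightarrow> 'a \<Rightarrow> bool" where
  "idempotent A e \<longleftrightarrow> e \<in> carrier A \<and> e \<otimes>\<^bsub>A\<^esub> e = e"

definition orthogonal_idempotents :: "(complex, 'a) module \<Rightarrow> 'a \<Rightarrow> 'a \<Rightarrow> bool" where
  "orthogonal_idempotents A e f \<longleftrightarrow> e \<otimes>\<^bsub>A\<^esub> f = \<zero>\<^bsub>A\<^esub> \<and> f \<otimes>\<^bsub>A\<^esub> e = \<zero>\<^bsub>A\<^esub>"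

definition primitive_idempotent :: "(complex, 'a) module \<Rightarrow> 'a \<Rightarrow> bool" where
  "primitive_idempotent A e \<longleftrightarrow> idempotent A e \<and> e \<noteq> \<zero>\<^bsub>A\<^esub> \<and>
     \<not> (\<exists>f g. idempotent A f \<and> idempotent A g \<and> f \<noteq> \<zero>\<^bsub>A\<^esub> \<and> g \<noteq> \<zero>\<^bsub>A\<^esub> \<and>
          orthogonal_idempotents A f g \<and> e = f \<oplus>\<^bsub>A\<^esub> g)"

definition left_ideal_of :: "(complex, 'a) module \<Rightarrow> 'a \<Rightarrow> 'a set" where
  "left_ideal_of A e = {a \<otimes>\<^bsub>A\<^esub> e |a. a \<in> carrier A}"

definition left_ideal_iso :: "(complex, 'a) module \<Rightarrow> 'a \<Rightarrow> 'a \<Rightarrow> bool" where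
  "left_ideal_iso A e f \<longleftrightarrow>
     (\<exists>\<phi>. bij_betw \<phi> (left_ideal_of A e) (left_ideal_of A f) \<and>
          (\<forall>x\<in>left_ideal_of A e. \<forall>y\<in>left_ideal_of A e. \<phi> (x \<oplus>\<^bsub>A\<^esub> y) = \<phi> x \<oplus>\<^bsub>A\<^esub> \<phi> y) \<and>
          (\<forall>a\<in>carrier A. \<forall>x\<in>left_ideal_of A e. \<phi> (a \<otimes>\<^bsub>A\<^esub> x) = a \<otimes>\<^bsub>A\<^esub> \<phi> x))"

definition basic_set :: "(complex, 'a) module \<Rightarrow> 'a set \<Rightarrow> bool" where
  "basic_set A E \<longleftrightarrow> finite E \<and> (\<forall>e\<in>E. primitive_idempotent A e) \<and>
     (\<forall>e\<in>E. \<forall>f\<in>E. e \<noteq> f \<longrightarrow> orthogonal_idempotents A e f) \<and>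
     finsum A (\<lambda>e. e) E = \<one>\<^bsub>A\<^esub> \<and>
     (\<forall>e. primitive_idempotent A e \<longrightarrow> (\<exists>!f. f \<in> E \<and> left_ideal_iso A e f))"

definition path_like :: "(complex, 'a) module \<Rightarrow> 'a set \<Rightarrow> bool" where
  "path_like A \<P> \<longleftrightarrow> is_basis A (\<P> - {\<zero>\<^bsub>A\<^esub>}) \<and> \<P> \<subseteq> carrier A \<and> (\<exists>E\<subseteq>\<P>. basic_set A E) \<and>
     (\<forall>a\<in>\<P>. \<forall>b\<in>\<P>. a \<otimes>\<^bsub>A\<^esub> b \<in> \<P>)"

text \<open>
  There is a chain \<open>{0} = P\<^sub>0 \<subset> P\<^sub>1 \<subset> \<dots> \<subset> P\<^sub>n = P\<close> of
  \<open>\<P>\<close>-annihilators of modules with dimension vector \<open>d\<close> (apart from \<open>P\<^sub>0\<close>), maximal in the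
  sense that no further such annihilator can be inserted.
\<close>

definition has_codim ::
    "(complex, 'a) module \<Rightarrow> ('i \<Rightarrow> 'a) \<Rightarrow> ('i \<Rightarrow> enat) \<Rightarrow> 'a set \<Rightarrow> 'a set \<Rightarrow> nat \<Rightarrow> bool" where
  "has_codim A e d \<P> P n \<longleftrightarrow>
     (\<exists>C :: nat \<Rightarrow> 'a set. C 0 = {\<zero>\<^bsub>A\<^esub>} \<and> C n = P \<and>
        (\<forall>j<n. C j \<subset> C (Suc j) \<and> C (Suc j) \<in> ann \<P> ` Rep A e d \<and>
               \<not> (\<exists>N \<in> ann \<P> ` Rep A e d. C j \<subset> N \<and> N \<subset> C (Suc j))))"

definition almost_large :: "(complex, 'a) module \<Rightarrow> ('i \<Rightarrow> 'a) \<Rightarrow> 'a lmod \<Rightarrow> bool" where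
  "almost_large A e V \<longleftrightarrow>
     (\<exists>L \<P> n. large_module A L \<and> V \<in> Rep A e (dim_vector e L) \<and> \<not> simple_module A V \<and>
        path_like A \<P> \<and> 1 \<le> n \<and> enat n \<le> krull_dim (center A) \<and>
        has_codim A e (dim_vector e L) \<P> (ann \<P> V) n)"


section \<open>Quiver algebras\<close>

text \<open>
  A path is a pair of its start vertex and the list of its arrows in the order in which they are
  traversed; products of paths are read from right to left.
\<close>

type_synonym ('a, 'b) qpath = "'a \<times> 'b list"
type_synonym ('a, 'b) qpoly = "('a, 'b) qpath \<Rightarrow>\<^sub>0 complex"

definition qpaths :: "('a, 'b) pre_digraph \<Rightarrow> ('a, 'b) qpath set" where
  "qpaths G = {(u, es). \<exists>v. pre_digraph.awalk G u es v}"

definition path_mult ::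
    "('a, 'b) pre_digraph \<Rightarrow> ('a, 'b) qpath \<Rightarrow> ('a, 'b) qpath \<Rightarrow> ('a, 'b) qpoly" where
  "path_mult G p q =
     (if pre_digraph.awlast G (fst q) (snd q) = fst p
      then Poly_Mapping.single (fst q, snd q @ snd p) 1 else 0)"

definition path_algebra :: "('a, 'b) pre_digraph \<Rightarrow> (complex, ('a, 'b) qpoly) module" where
  "path_algebra G =
     \<lparr>carrier = {f. Poly_Mapping.keys f \<subseteq> qpaths G},
      mult = (\<lambda>f g. \<Sum>p\<in>Poly_Mapping.keys f. \<Sum>q\<in>Poly_Mapping.keys g.
        pm_scale (Poly_Mapping.lookup f p * Poly_Mapping.lookup g q) (path_mult G p q)),
      one = (\<Sum>v\<in>verts G. Poly_Mapping.single (v, []) 1),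
      zero = 0,
      add = (+),
      smult = pm_scale\<rparr>"

definition arr :: "('a, 'b) pre_digraph \<Rightarrow> 'b \<Rightarrow> ('a, 'b) qpoly" where
  "arr G a = Poly_Mapping.single (tail G a, [a]) 1"

definition vtx :: "'a \<Rightarrow> ('a, 'b) qpoly" where
  "vtx v = Poly_Mapping.single (v, []) 1"

definition quiver_algebra ::
    "('a, 'b) pre_digraph \<Rightarrow> ('a, 'b) qpoly set \<Rightarrow> (complex, ('a, 'b) qpoly set) module" where
  "quiver_algebra G S =
     (let P = path_algebra G; I = Idl\<^bsub>P\<^esub> S
      in ring.extend (P Quot I) (module.fields (\<lambda>c X. \<Union>f\<in>X. I +>\<^bsub>P\<^esub> pm_scale c f)))"

definition qclass ::
    "('a, 'b) pre_digraph \<Rightarrow> ('a, 'b) qpoly set \<Rightarrow> ('a, 'b) qpoly \<Rightarrow> ('a, 'b) qpoly set" where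
  "qclass G S f = (Idl\<^bsub>path_algebra G\<^esub> S) +>\<^bsub>path_algebra G\<^esub> f"

text \<open>
  The quiver obtained from \<open>G\<close> by adding an arrow \<open>a\<^sup>* = Inr a\<close> opposite to \<open>a\<close> for
  each \<open>a\<close> in \<open>S\<close>.
\<close>

definition add_inverse_arrows :: "('a, 'b) pre_digraph \<Rightarrow> 'b set \<Rightarrow> ('a, 'b + 'b) pre_digraph" where
  "add_inverse_arrows G S =
     \<lparr>verts = verts G, arcs = Inl ` arcs G \<union> Inr ` S,
      tail = case_sum (tail G) (head G), head = case_sum (head G) (tail G)\<rparr>"

definition inverse_relations :: "('a, 'b) pre_digraph \<Rightarrow> 'b set \<Rightarrow> ('a, 'b + 'b) qpoly set" where
  "inverse_relations G S =
     (let G' = add_inverse_arrows G S; P = path_algebra G'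
      in {arr G' (Inl a) \<otimes>\<^bsub>P\<^esub> arr G' (Inr a) - vtx (head G a) |a. a \<in> S} \<union>
         {arr G' (Inr a) \<otimes>\<^bsub>P\<^esub> arr G' (Inl a) - vtx (tail G a) |a. a \<in> S})"


section \<open>The conifold algebra\<close>

text \<open>The indices and vertices \<open>1\<close>, \<open>2\<close> are the two elements of the type \<^typ>\<open>2\<close>.\<close>

datatype conifold_arrow = Aarr 2 | Barr 2

definition conifold_quiver :: "(2, conifold_arrow) pre_digraph" where
  "conifold_quiver =
     \<lparr>verts = UNIV, arcs = UNIV,
      tail = case_conifold_arrow (\<lambda>_. 1) (\<lambda>_. 2), head = case_conifold_arrow (\<lambda>_. 2) (\<lambda>_. 1)\<rparr>"

text \<open>
  The relations are stated in any quiver \<open>G\<close> into which \<open>\<iota>\<close> embeds the arrows of the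
  conifold quiver, as they are also needed in the quivers with added inverse arrows.
\<close>

definition conifold_relations ::
    "(2, 'b) pre_digraph \<Rightarrow> (conifold_arrow \<Rightarrow> 'b) \<Rightarrow> (2, 'b) qpoly set" where
  "conifold_relations G \<iota> =
     (let P = path_algebra G; a = (\<lambda>i. arr G (\<iota> (Aarr i))); b = (\<lambda>i. arr G (\<iota> (Barr i)))
      in {a i \<otimes>\<^bsub>P\<^esub> b j \<otimes>\<^bsub>P\<^esub> a k - a k \<otimes>\<^bsub>P\<^esub> b j \<otimes>\<^bsub>P\<^esub> a i |i j k. True} \<union>
         {b i \<otimes>\<^bsub>P\<^esub> a j \<otimes>\<^bsub>P\<^esub> b k - b k \<otimes>\<^bsub>P\<^esub> a j \<otimes>\<^bsub>P\<^esub> b i |i j k. True})"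

type_synonym conifold_elem = "(2, conifold_arrow) qpoly set"

definition conifold_algebra :: "(complex, conifold_elem) module" where
  "conifold_algebra = quiver_algebra conifold_quiver (conifold_relations conifold_quiver id)"

definition cf_vtx :: "2 \<Rightarrow> conifold_elem" where
  "cf_vtx i = qclass conifold_quiver (conifold_relations conifold_quiver id) (vtx i)"

definition cf_arr :: "conifold_arrow \<Rightarrow> conifold_elem" where
  "cf_arr a = qclass conifold_quiver (conifold_relations conifold_quiver id) (arr conifold_quiver a)"

definition vertex_simple :: "2 \<Rightarrow> conifold_elem lmod \<Rightarrow> bool" where
  "vertex_simple i S \<longleftrightarrow> is_module conifold_algebra S \<and>
     dim_vector cf_vtx S = (\<lambda>j. if j = i then 1 else 0) \<and>
     (\<forall>a. \<forall>v\<in>space S. act S (cf_arr a) v = 0)"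

definition large_modules :: "conifold_elem lmod set" where
  "large_modules = {V. large_module conifold_algebra V}"

definition almost_large_modules_with_socle :: "2 \<Rightarrow> conifold_elem lmod set" where
  "almost_large_modules_with_socle i =
     {V. almost_large conifold_algebra cf_vtx V \<and>
         (\<exists>S. vertex_simple i S \<and> module_iso conifold_algebra (socle conifold_algebra V) S)}"

text \<open>
  \<open>a\<^sub>1, a\<^sub>2, b\<^sub>1, b\<^sub>2\<close> act on \<open>V\<close>, with respect to a basis of \<open>V\<close> consisting of a vector at
  each vertex, by the scalars \<open>x, y, z, w\<close>, the components of \<open>q\<close>.
\<close>

definition acts_by :: "conifold_elem lmod \<Rightarrow> complex ^ 4 \<Rightarrow> bool" where
  "acts_by V q \<longleftrightarrow>
     dim_vector cf_vtx V = (\<lambda>_. 1) \<and>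
     (\<exists>v\<^sub>1 \<in> act V (cf_vtx 1) ` space V - {0}. \<exists>v\<^sub>2 \<in> act V (cf_vtx 2) ` space V - {0}.
        act V (cf_arr (Aarr 1)) v\<^sub>1 = pm_scale (q $ 1) v\<^sub>2 \<and>
        act V (cf_arr (Aarr 2)) v\<^sub>1 = pm_scale (q $ 2) v\<^sub>2 \<and>
        act V (cf_arr (Barr 1)) v\<^sub>2 = pm_scale (q $ 3) v\<^sub>1 \<and>
        act V (cf_arr (Barr 2)) v\<^sub>2 = pm_scale (q $ 4) v\<^sub>1)"

definition supp_arrows :: "conifold_elem lmod \<Rightarrow> conifold_arrow set" where
  "supp_arrows V = {a. \<exists>v\<in>space V. act V (cf_arr a) v \<noteq> 0}"


section \<open>Polynomials, the ring \<open>R\<close> and its maximal spectrum\<close>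

type_synonym 'i cpoly = "('i \<Rightarrow>\<^sub>0 nat) \<Rightarrow>\<^sub>0 complex"

definition insertion ::
    "(complex \<Rightarrow> 'b::comm_ring_1) \<Rightarrow> ('i \<Rightarrow> 'b) \<Rightarrow> 'i cpoly \<Rightarrow> 'b" where
  "insertion \<kappa> q f = (\<Sum>m\<in>Poly_Mapping.keys f.
     \<kappa> (Poly_Mapping.lookup f m) * (\<Prod>i\<in>Poly_Mapping.keys m. q i ^ Poly_Mapping.lookup m i))"

abbreviation eval_at :: "complex ^ 'n \<Rightarrow> 'n cpoly \<Rightarrow> complex" where
  "eval_at p \<equiv> insertion id (($) p)"

text \<open>
  The polynomial ring \<open>B = \<complex>[x, y, z, w]\<close> has the variables \<open>1, 2, 3, 4\<close> in this order.
  All subrings of \<open>Frac B\<close>, including \<open>B\<close> and \<open>R\<close>, are realized inside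
  the type \<open>frac_B\<close>.
\<close>

type_synonym frac_B = "4 cpoly fract"

definition frac_const :: "complex \<Rightarrow> frac_B" where
  "frac_const c = Fract (Poly_Mapping.single 0 c) 1"

definition frac_var :: "4 \<Rightarrow> frac_B" where
  "frac_var i = Fract (Poly_Mapping.single (Poly_Mapping.single i 1) 1) 1"

definition stuv :: "('b::comm_ring_1) ^ 4 \<Rightarrow> 'b ^ 4" where
  "stuv q = vector [q $ 1 * q $ 3, q $ 1 * q $ 4, q $ 2 * q $ 3, q $ 2 * q $ 4]"

definition eval_R :: "4 cpoly \<Rightarrow> frac_B" where
  "eval_R g = insertion frac_const (($) (stuv (\<chi> i. frac_var i))) g"

definition conifold_ring :: "(complex, frac_B) module" where
  "conifold_ring = \<lparr>carrier = range eval_R, mult = (*), one = 1, zero = 0, add = (+),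
     smult = (\<lambda>c f. frac_const c * f)\<rparr>"

definition Max_spec :: "('a, 'm) ring_scheme \<Rightarrow> 'a set set" where
  "Max_spec R = {I. maximalideal I R}"

text \<open>
  Through \<open>R \<cong> \<complex>[s, t, u, v]/(sv - tu)\<close> a point of the affine variety \<open>sv = tu\<close>
  is a maximal ideal of \<open>R\<close>, namely that of the functions vanishing at the point.
\<close>

definition conifold_variety :: "(complex ^ 4) set" where
  "conifold_variety = {p. p $ 1 * p $ 4 = p $ 2 * p $ 3}"

definition ideal_of_point :: "complex ^ 4 \<Rightarrow> frac_B set" where
  "ideal_of_point p = {eval_R g |g. eval_at p g = 0}"

definition vanishing_ideal :: "(complex ^ 'n) set \<Rightarrow> 'n cpoly set" where
  "vanishing_ideal X = {f. \<forall>p\<in>X. eval_at p f = 0}"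

definition gradient :: "'n cpoly \<Rightarrow> complex ^ 'n \<Rightarrow> complex ^ 'n" where
  "gradient f p = (\<chi> i. deriv (\<lambda>c. eval_at (\<chi> j. if j = i then c else p $ j) f) (p $ i))"

text \<open>
  Jacobian criterion for a variety \<open>X\<close> of dimension \<open>r\<close> in affine space.
\<close>

definition nonsingular_points :: "(complex ^ 'n) set \<Rightarrow> nat \<Rightarrow> (complex ^ 'n) set" where
  "nonsingular_points X r =
     {p \<in> X. vec.dim ((\<lambda>f. gradient f p) ` vanishing_ideal X) + r = CARD('n)}"

text \<open>The conifold \<open>sv = tu\<close>, a hypersurface in a space of dimension four, has dimension three.\<close>

definition smooth_locus :: "frac_B set set" where
  "smooth_locus =
     {m \<in> Max_spec conifold_ring. \<exists>p \<in> nonsingular_points conifold_variety 3. m = ideal_of_point p}"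


section \<open>The two resolutions\<close>

text \<open>A point of the projective line is the set of its homogeneous coordinate vectors.\<close>

definition proj_point :: "complex ^ 2 \<Rightarrow> (complex ^ 2) set" where
  "proj_point v = {c *s v |c. c \<noteq> 0}"

definition proj_line :: "(complex ^ 2) set set" where
  "proj_line = {proj_point v |v. v \<noteq> 0}"

type_synonym blowup_point = "(complex ^ 4) \<times> (complex ^ 2) set"

definition Y_plus :: "blowup_point set" where
  "Y_plus = {(p, l). p \<in> conifold_variety \<and> l \<in> proj_line \<and>
     (\<forall>h\<in>l. p $ 1 * h $ 2 = h $ 1 * p $ 2 \<and> h $ 1 * p $ 4 = h $ 2 * p $ 3)}"

definition Y_minus :: "blowup_point set" where
  "Y_minus = {(p, l). p \<in> conifold_variety \<and> l \<in> proj_line \<and>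
     (\<forall>h\<in>l. p $ 1 * h $ 2 = h $ 1 * p $ 3 \<and> h $ 1 * p $ 4 = h $ 2 * p $ 2)}"

definition blowdown :: "blowup_point \<Rightarrow> frac_B set" where
  "blowdown = (\<lambda>(p, l). ideal_of_point p)"

definition exceptional_locus :: "blowup_point set \<Rightarrow> blowup_point set" where
  "exceptional_locus Y = {P \<in> Y. blowdown P = ideal_of_point 0}"

definition point_plus :: "complex ^ 4 \<Rightarrow> blowup_point" where
  "point_plus q = (stuv q, proj_point (vector [q $ 3, q $ 4]))"

definition point_minus :: "complex ^ 4 \<Rightarrow> blowup_point" where
  "point_minus q = (stuv q, proj_point (vector [q $ 1, q $ 2]))"

text \<open>
  Polynomials in four affine variables \<open>Inl i\<close> that are homogeneous of degree \<open>d\<close> in the two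
  homogeneous coordinates \<open>Inr j\<close>.
\<close>

definition proj_homogeneous :: "nat \<Rightarrow> (4 + 2) cpoly \<Rightarrow> bool" where
  "proj_homogeneous d g \<longleftrightarrow>
     (\<forall>m\<in>Poly_Mapping.keys g. Poly_Mapping.lookup m (Inr 1) + Poly_Mapping.lookup m (Inr 2) = d)"

definition eval_biv :: "complex ^ 4 \<Rightarrow> complex ^ 2 \<Rightarrow> (4 + 2) cpoly \<Rightarrow> complex" where
  "eval_biv p h g = insertion id (case_sum (($) p) (($) h)) g"

definition zariski_open :: "blowup_point set \<Rightarrow> blowup_point set \<Rightarrow> bool" where
  "zariski_open Y U \<longleftrightarrow>
     (\<exists>G. (\<forall>g\<in>G. \<exists>d. proj_homogeneous d g) \<and>
          U = {(p, l) \<in> Y. \<exists>g\<in>G. \<forall>h\<in>l. eval_biv p h g \<noteq> 0})"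

text \<open>The ring of regular functions on a Zariski-open set \<open>U\<close>: locally fractions of polynomials.\<close>

definition regular_functions :: "blowup_point set \<Rightarrow> (blowup_point \<Rightarrow> complex) set" where
  "regular_functions U = {r \<in> extensional U. \<forall>(p, l)\<in>U. \<exists>d f g.
     proj_homogeneous d f \<and> proj_homogeneous d g \<and> (\<forall>h\<in>l. eval_biv p h g \<noteq> 0) \<and>
     (\<forall>(p', l')\<in>U. \<forall>h\<in>l'. eval_biv p' h g \<noteq> 0 \<longrightarrow>
        r (p', l') = eval_biv p' h f / eval_biv p' h g)}"

definition standard_chart :: "blowup_point set \<Rightarrow> 2 \<Rightarrow> blowup_point set" where
  "standard_chart Y k = {(p, l) \<in> Y. \<forall>h\<in>l. h $ k \<noteq> 0}"


section \<open>The impression and the induced coordinates\<close>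

definition mat_unit :: "2 \<Rightarrow> 2 \<Rightarrow> frac_B ^ 2 ^ 2" where
  "mat_unit i j = (\<chi> k l. if k = i \<and> l = j then 1 else 0)"

definition arrow_var :: "conifold_arrow \<Rightarrow> frac_B" where
  "arrow_var a = (case a of
      Aarr i \<Rightarrow> if i = 1 then frac_var 1 else frac_var 2
    | Barr i \<Rightarrow> if i = 1 then frac_var 3 else frac_var 4)"

definition tau_arrow :: "conifold_arrow \<Rightarrow> frac_B ^ 2 ^ 2" where
  "tau_arrow a = mat (arrow_var a) ** mat_unit (head conifold_quiver a) (tail conifold_quiver a)"

definition tau_star :: "conifold_arrow \<Rightarrow> frac_B ^ 2 ^ 2" where
  "tau_star a =
     mat (inverse (arrow_var a)) ** mat_unit (tail conifold_quiver a) (head conifold_quiver a)"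

definition path_matrix :: "('b \<Rightarrow> frac_B ^ 2 ^ 2) \<Rightarrow> (2, 'b) qpath \<Rightarrow> frac_B ^ 2 ^ 2" where
  "path_matrix T p = fold (\<lambda>a M. T a ** M) (snd p) (mat_unit (fst p) (fst p))"

text \<open>
  The matrix representation of a quiver algebra extending \<open>T\<close>; it takes the same value on all
  representatives of a residue class.
\<close>

definition tau_ext :: "('b \<Rightarrow> frac_B ^ 2 ^ 2) \<Rightarrow> (2, 'b) qpoly set \<Rightarrow> frac_B ^ 2 ^ 2" where
  "tau_ext T X =
     the_elem ((\<lambda>f. \<Sum>p\<in>Poly_Mapping.keys f.
       mat (frac_const (Poly_Mapping.lookup f p)) ** path_matrix T p) ` X)"

definition tau :: "conifold_elem \<Rightarrow> frac_B ^ 2 ^ 2" where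
  "tau = tau_ext tau_arrow"

definition psi :: "conifold_elem \<Rightarrow> frac_B" where
  "psi z = tau z $ 1 $ 1"

text \<open>
  \<open>A(U)\<close> depends only on the arrow set \<open>S = Q\<^sub>1(U)\<close>, and \<open>induced_coords S i\<close> is
  \<open>\<tau>\<close>-bar of \<open>e\<^sub>i A(U) e\<^sub>i\<close>.
\<close>

definition localized_quiver :: "conifold_arrow set \<Rightarrow> (2, conifold_arrow + conifold_arrow) pre_digraph"
  where "localized_quiver S = add_inverse_arrows conifold_quiver S"

definition localized_relations :: "conifold_arrow set \<Rightarrow> (2, conifold_arrow + conifold_arrow) qpoly set"
  where "localized_relations S =
     conifold_relations (localized_quiver S) Inl \<union> inverse_relations conifold_quiver S"

definition induced_coords :: "conifold_arrow set \<Rightarrow> 2 \<Rightarrow> frac_B set" where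
  "induced_coords S i =
     (let A = quiver_algebra (localized_quiver S) (localized_relations S);
          e = qclass (localized_quiver S) (localized_relations S) (vtx i)
      in {tau_ext (case_sum tau_arrow tau_star) (e \<otimes>\<^bsub>A\<^esub> X \<otimes>\<^bsub>A\<^esub> e) $ i $ i |X. X \<in> carrier A})"

definition has_value :: "frac_B \<Rightarrow> complex ^ 4 \<Rightarrow> complex \<Rightarrow> bool" where
  "has_value f q c \<longleftrightarrow>
     (\<exists>g h. f = Fract g h \<and> eval_at q h \<noteq> 0 \<and> c = eval_at q g / eval_at q h)"

text \<open>
  In the following, \<open>X\<close> is a set of modules and \<open>pt\<close> maps the scalars by which the arrows act
  on a module to its point in \<open>Y\<close>.  First the arrows of \<open>Q(U)\<close>.
\<close>

definition common_support ::
    "conifold_elem lmod set \<Rightarrow> (complex ^ 4 \<Rightarrow> blowup_point) \<Rightarrow> blowup_point set \<Rightarrow>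
     conifold_arrow set" where
  "common_support X pt U =
     {a \<in> arcs conifold_quiver. \<forall>V\<in>X. \<forall>q. acts_by V q \<and> pt q \<in> U \<longrightarrow> a \<in> supp_arrows V}"

text \<open>\<open>U\<close> consists of all points at which the arrows of \<open>Q(U)\<close> act by nonzero scalars.\<close>

definition arrow_locus ::
    "conifold_elem lmod set \<Rightarrow> (complex ^ 4 \<Rightarrow> blowup_point) \<Rightarrow> blowup_point set \<Rightarrow> bool" where
  "arrow_locus X pt U \<longleftrightarrow>
     U = {pt q |q. \<exists>V\<in>X. acts_by V q \<and> common_support X pt U \<subseteq> supp_arrows V}"

text \<open>
  The coordinates given by the impression agree with those of \<open>Y\<close>: evaluation at the points of
  \<open>U\<close> embeds the induced coordinate ring of \<open>U\<close> into the ring of regular functions on \<open>U\<close>,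
  and is onto if \<open>U\<close> is cut out by the arrows of \<open>Q(U)\<close>, as is the case for the
  standard charts of \<open>Y\<close>.  Surjectivity cannot hold for every \<open>U\<close>: only arrows are inverted in
  \<open>A(U)\<close>, so that for instance \<open>1/(s - 1)\<close> is not obtained where it is regular.
  The sets \<open>U\<close> need not be affine.
\<close>

definition impression_coords_agree ::
    "conifold_elem lmod set \<Rightarrow> (complex ^ 4 \<Rightarrow> blowup_point) \<Rightarrow> blowup_point set \<Rightarrow> bool" where
  "impression_coords_agree X pt Y \<longleftrightarrow>
     (\<forall>k. zariski_open Y (standard_chart Y k) \<and> arrow_locus X pt (standard_chart Y k)) \<and>
     (\<forall>U i. zariski_open Y U \<and> U \<noteq> {} \<longrightarrow>
        (let \<O> = induced_coords (common_support X pt U) i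
         in \<exists>\<Phi>. inj_on \<Phi> \<O> \<and> \<Phi> ` \<O> \<subseteq> regular_functions U \<and>
              (\<forall>f\<in>\<O>. \<forall>V\<in>X. \<forall>q. acts_by V q \<and> pt q \<in> U \<longrightarrow> has_value f q (\<Phi> f (pt q))) \<and>
              (arrow_locus X pt U \<longrightarrow> \<Phi> ` \<O> = regular_functions U)))"

end

(*
  The impression identifies A with the algebra of 2x2 matrices over C[x,y,z,w] whose entries are
  homogeneous of prescribed weights for the torus action (mu x, mu y, z/mu, w/mu); the center becomes
  the ring R of polynomials of weight zero. By Dixmier's lemma the center acts on a simple module by
  scalars, which leaves at most one dimension at each vertex. A module of dimension vector (1,1) is
  a point q = (x,y,z,w) up to the torus. It is simple, equivalently large, iff (x,y) and (z,w) are
  both nonzero, and it has socle S_2 (resp. S_1) iff only (z,w) (resp. only (x,y)) vanishes. In these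
  cases it is almost large, because the nonzero paths killing such a module are those that use
  an arrow acting by zero: a chain of annihilators is a chain of sets of arrows, and the center has
  Krull dimension at least three. Thus the large modules together with the almost large ones of
  a fixed socle are the torus quotient of {(x,y) /= 0} or {(z,w) /= 0}, which is Y^- or Y^+.

  The induced coordinate ring of U consists of the fractions F/m of weight zero whose denominator is
  a monomial in the variables of the inverted arrows. Conversely, a regular function on U is, by
  unique factorization, a single reduced fraction F/G with G without zeros over U. If U is cut out
  by arrows it contains the image of the open torus, so that G is a monomial.
*)
theory Submission
  imports Defs "HOL-Computational_Algebra.Polynomial_Factorial"
    "HOL-Computational_Algebra.Field_as_Ring"
    "HOL-Computational_Algebra.Fundamental_Theorem_Algebra"
begin

text \<open>The demanding half of almost largeness is not the chain of annihilators but
  \<open>path_like\<close>: a basic set must match every primitive idempotent of an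
  infinite-dimensional algebra. Such an idempotent turns out to be a 2x2 matrix of trace one and
  determinant zero, so one diagonal entry survives at the origin. Splitting the matrix into a column
  times a row needs a gcd of polynomials, and the two factors lie in the algebra because that gcd is
  shown to have weight zero. This is why gcds and torus eigenvectors appear so early. Weights are
  detected by the single substitution with parameter 2: it suffices since 2 is not a root of unity,
  and being a ring homomorphism it respects divisibility. As \<open>almost_large\<close> asks for
  some path-like set, exhibiting the paths is enough. Simple modules are not assumed
  finite-dimensional: scalars come from a counting argument, as \<open>cvec\<close> has countable
  dimension while the complex numbers are uncountable. Fractions in lowest terms return at the end,
  where they make the local expressions of a regular function agree on one global fraction.\<close>

abbreviation "lk \<equiv> Poly_Mapping.lookup"
abbreviation "ks \<equiv> Poly_Mapping.keys"
abbreviation "sg \<equiv> Poly_Mapping.single"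

section \<open>Path algebras and their quotients\<close>

lemma pm_scale_single: "pm_scale c (sg p d) = sg p (c * d)"
  by (rule poly_mapping_eqI) (simp add: lookup_pm_scale lookup_single when_def)

lemma poly_mapping_expand: "f = (\<Sum>p\<in>ks f. sg p (lk f p))"
  by (rule poly_mapping_eqI) (simp add: lookup_sum lookup_single when_def in_keys_iff)

lemma poly_mapping_linear_induct [case_names zero add single]:
  fixes f :: "'a \<Rightarrow>\<^sub>0 'b::comm_monoid_add"
  assumes "P 0" "\<And>f g. P f \<Longrightarrow> P g \<Longrightarrow> P (f + g)" "\<And>p c. P (sg p c)"
  shows "P f"
proof -
  have "P (\<Sum>p\<in>A. sg p (lk f p))" if "finite A" for A
    using that by induction (auto intro: assms)
  from this[OF finite_keys[of f]] show ?thesis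
    using poly_mapping_expand[of f] by simp
qed

lemma poly_mapping_linear_induct_on [consumes 1, case_names zero add single]:
  fixes f :: "'a \<Rightarrow>\<^sub>0 'b::comm_monoid_add"
  assumes "ks f \<subseteq> K" "P 0"
    and "\<And>f g. ks f \<subseteq> K \<Longrightarrow> ks g \<subseteq> K \<Longrightarrow> P f \<Longrightarrow> P g \<Longrightarrow> P (f + g)"
    and "\<And>p c. p \<in> K \<Longrightarrow> P (sg p c)"
  shows "P f"
proof -
  have "ks (\<Sum>p\<in>A. sg p (lk f p)) \<subseteq> K \<and> P (\<Sum>p\<in>A. sg p (lk f p))" if "finite A" "A \<subseteq> K" for A
    using that
  proof induction
    case (insert p A)
    have "ks (sg p (lk f p)) \<subseteq> K" using insert by (auto simp: in_keys_iff lookup_single when_def split: if_splits)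
    with insert keys_add[of "sg p (lk f p)" "\<Sum>p\<in>A. sg p (lk f p)"] show ?case
      by (auto intro!: assms(3,4))
  qed (auto intro: assms(2))
  from this[OF finite_keys[of f] assms(1)] show ?thesis
    using poly_mapping_expand[of f] by simp
qed

lemma keys_add_subset: "ks f \<subseteq> K \<Longrightarrow> ks g \<subseteq> K \<Longrightarrow> ks (f + g) \<subseteq> K"
  by (rule order_trans[OF keys_add]) simp

text \<open>Closed form of \<open>awlast\<close>, meaningful for arbitrary pairs and not only for
  walks, so that products of paths can be computed before membership in \<open>qpaths\<close> is
  known.\<close>

definition path_end :: "('a, 'b) pre_digraph \<Rightarrow> ('a, 'b) qpath \<Rightarrow> 'a" where
  "path_end G p = (if snd p = [] then fst p else head G (last (snd p)))"

lemma awlast_eq_path_end: "pre_digraph.awlast G u es = path_end G (u, es)"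
  by (induction es arbitrary: u)
    (auto simp: path_end_def pre_digraph.awalk_verts.simps pre_digraph.awalk_verts_non_Nil)

lemma path_mult_eq:
  "path_mult G p q = (if path_end G q = fst p then sg (fst q, snd q @ snd p) 1 else 0)"
  by (simp add: path_mult_def awlast_eq_path_end)

definition pa_mult :: "('a, 'b) pre_digraph \<Rightarrow> ('a, 'b) qpoly \<Rightarrow> ('a, 'b) qpoly \<Rightarrow> ('a, 'b) qpoly" where
  "pa_mult G f g = (\<Sum>p\<in>ks f. \<Sum>q\<in>ks g. pm_scale (lk f p * lk g q) (path_mult G p q))"

lemma path_algebra_simps:
  "carrier (path_algebra G) = {f. ks f \<subseteq> qpaths G}"
  "f \<otimes>\<^bsub>path_algebra G\<^esub> g = pa_mult G f g"
  "f \<oplus>\<^bsub>path_algebra G\<^esub> g = f + g"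
  "\<zero>\<^bsub>path_algebra G\<^esub> = 0"
  "\<one>\<^bsub>path_algebra G\<^esub> = (\<Sum>v\<in>verts G. sg (v, []) 1)"
  "c \<odot>\<^bsub>path_algebra G\<^esub> f = pm_scale c f"
  by (simp_all add: path_algebra_def pa_mult_def)

text \<open>Sums over different supports become comparable once both factors are summed over a
  common finite superset; the added terms have coefficient zero. Both additivity lemmas rest on
  this.\<close>

lemma pa_mult_superset:
  assumes "finite S" "finite T" "ks f \<subseteq> S" "ks g \<subseteq> T"
  shows "pa_mult G f g = (\<Sum>p\<in>S. \<Sum>q\<in>T. pm_scale (lk f p * lk g q) (path_mult G p q))"
proof -
  have "pa_mult G f g = (\<Sum>p\<in>ks f. \<Sum>q\<in>T. pm_scale (lk f p * lk g q) (path_mult G p q))"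
    unfolding pa_mult_def using assms
    by (intro sum.cong refl sum.mono_neutral_left) (auto simp: in_keys_iff)
  also have "\<dots> = (\<Sum>p\<in>S. \<Sum>q\<in>T. pm_scale (lk f p * lk g q) (path_mult G p q))"
    using assms by (intro sum.mono_neutral_left) (auto simp: in_keys_iff)
  finally show ?thesis .
qed

lemma pa_mult_add_left: "pa_mult G (f + f') g = pa_mult G f g + pa_mult G f' g"
proof -
  let ?S = "ks f \<union> ks f' \<union> ks (f + f')"
  have "finite ?S" by simp
  note s = pa_mult_superset[OF this finite_keys[of g] _ order_refl]
  show ?thesis by (subst s, blast, subst s, blast, subst s, blast)
      (simp add: lookup_add algebra_simps pm.scale_left_distrib sum.distrib)
qed

lemma pa_mult_add_right: "pa_mult G f (g + g') = pa_mult G f g + pa_mult G f g'"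
proof -
  let ?S = "ks g \<union> ks g' \<union> ks (g + g')"
  have "finite ?S" by simp
  note s = pa_mult_superset[OF finite_keys[of f] this order_refl]
  show ?thesis by (subst s, blast, subst s, blast, subst s, blast)
      (simp add: lookup_add algebra_simps pm.scale_left_distrib sum.distrib)
qed

lemma pa_mult_zero [simp]: "pa_mult G 0 g = 0" "pa_mult G f 0 = 0"
  by (simp_all add: pa_mult_def)

lemma pa_mult_single: "pa_mult G (sg p c) (sg q d) = pm_scale (c * d) (path_mult G p q)"
  by (subst pa_mult_superset[of "{p}" "{q}"]) auto

lemma pa_mult_single_eq:
  "pa_mult G (sg p c) (sg q d) =
    (if path_end G q = fst p then sg (fst q, snd q @ snd p) (c * d) else 0)"
  by (simp add: pa_mult_single path_mult_eq pm_scale_single)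

lemma path_end_append:
  "path_end G q = fst p \<Longrightarrow> path_end G (fst q, snd q @ snd p) = path_end G p"
  by (auto simp: path_end_def)

text \<open>By trilinearity only three single paths have to be compared, and a concatenation ends
  where its last factor ends. This holds for all formal pairs.\<close>

lemma pa_mult_assoc: "pa_mult G (pa_mult G f g) h = pa_mult G f (pa_mult G g h)"
proof (induction f rule: poly_mapping_linear_induct)
  case (single p c)
  show ?case
  proof (induction g rule: poly_mapping_linear_induct)
    case (single q d)
    show ?case
    proof (induction h rule: poly_mapping_linear_induct)
      case (single r e)
      show ?case
        by (auto simp: pa_mult_single_eq path_end_append mult_ac)
    qed (simp_all add: pa_mult_add_right)
  qed (simp_all add: pa_mult_add_right pa_mult_add_left)
qed (simp_all add: pa_mult_add_left)

lemma pa_mult_scale_left: "pa_mult G (pm_scale c f) g = pm_scale c (pa_mult G f g)"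
proof (induction f rule: poly_mapping_linear_induct)
  case (single p d)
  show ?case
    by (induction g rule: poly_mapping_linear_induct)
      (auto simp: pa_mult_single_eq pm_scale_single pa_mult_add_right pm.scale_right_distrib mult_ac)
qed (simp_all add: pa_mult_add_left pm.scale_right_distrib)

context fin_digraph begin

lemma qpaths_iff: "p \<in> qpaths G \<longleftrightarrow> (\<exists>v. awalk (fst p) (snd p) v)"
  by (cases p) (simp add: qpaths_def)

lemma awalk_path_end: "awalk (fst p) (snd p) v \<Longrightarrow> v = path_end G p"
  using awlast_of_awalk[of "fst p" "snd p" v] by (simp add: awlast_eq_path_end)

lemma qpaths_append:
  assumes "p \<in> qpaths G" "q \<in> qpaths G" "path_end G q = fst p"
  shows "(fst q, snd q @ snd p) \<in> qpaths G"
proof -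
  obtain u v where w: "awalk (fst q) (snd q) u" "awalk (fst p) (snd p) v"
    using assms by (auto simp: qpaths_iff)
  then have "u = fst p" using awalk_path_end assms(3) by metis
  with w show ?thesis by (auto simp: qpaths_iff)
qed
lemma qpaths_verts: "p \<in> qpaths G \<Longrightarrow> fst p \<in> verts G" "p \<in> qpaths G \<Longrightarrow> path_end G p \<in> verts G"
  by (auto simp: qpaths_iff dest: awalk_hd_in_verts) (metis awalk_path_end awalk_last_in_verts qpaths_iff)

lemma vtx_in_qpaths: "(v, []) \<in> qpaths G \<longleftrightarrow> v \<in> verts G"
  by (auto simp: qpaths_iff awalk_Nil_iff)

lemma pa_mult_closed:
  assumes "ks f \<subseteq> qpaths G" "ks g \<subseteq> qpaths G" shows "ks (pa_mult G f g) \<subseteq> qpaths G"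
  using assms(1)
proof (induction f rule: poly_mapping_linear_induct_on)
  case (add f g) then show ?case unfolding pa_mult_add_left by (intro keys_add_subset)
next
  case (single p c)
  note p = this
  show ?case using assms(2)
  proof (induction g rule: poly_mapping_linear_induct_on)
    case (add f g) then show ?case unfolding pa_mult_add_right by (intro keys_add_subset)
  qed (use p in \<open>auto simp: pa_mult_single_eq intro: qpaths_append\<close>)
qed simp

lemma pa_mult_sum_left: "pa_mult G (sum F A) g = (\<Sum>a\<in>A. pa_mult G (F a) g)"
  by (induction A rule: infinite_finite_induct) (simp_all add: pa_mult_add_left)

lemma pa_mult_sum_right: "pa_mult G f (sum F A) = (\<Sum>a\<in>A. pa_mult G f (F a))"
  by (induction A rule: infinite_finite_induct) (simp_all add: pa_mult_add_right)

lemma pa_one_left: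
  assumes "ks f \<subseteq> qpaths G" shows "pa_mult G (\<Sum>v\<in>verts G. sg (v, []) 1) f = f"
  using assms
proof (induction f rule: poly_mapping_linear_induct_on)
  case (single p c)
  have "pa_mult G (\<Sum>v\<in>verts G. sg (v, []) 1) (sg p c) =
    (\<Sum>v\<in>verts G. if v = path_end G p then sg p c else 0)"
    unfolding pa_mult_sum_left by (intro sum.cong refl) (auto simp: pa_mult_single_eq)
  then show ?case using qpaths_verts[OF single] by simp
qed (simp_all add: pa_mult_add_right)

lemma pa_one_right:
  assumes "ks f \<subseteq> qpaths G" shows "pa_mult G f (\<Sum>v\<in>verts G. sg (v, []) 1) = f"
  using assms
proof (induction f rule: poly_mapping_linear_induct_on)
  case (single p c)
  have "pa_mult G (sg p c) (\<Sum>v\<in>verts G. sg (v, []) 1) =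
    (\<Sum>v\<in>verts G. if v = fst p then sg p c else 0)"
    unfolding pa_mult_sum_right
    by (intro sum.cong refl) (auto simp: pa_mult_single_eq path_end_def)
  then show ?case using qpaths_verts[OF single] by simp
qed (simp_all add: pa_mult_add_left)

lemma ks_one: "ks (\<Sum>v\<in>verts G. sg (v, []) (1::complex)) \<subseteq> qpaths G"
proof
  fix p :: "('a, 'b) qpath" assume "p \<in> ks (\<Sum>v\<in>verts G. sg (v, []) (1::complex))"
  then have "(\<Sum>v\<in>verts G. lk (sg (v, []) (1::complex)) p) \<noteq> 0"
    by (simp add: in_keys_iff lookup_sum)
  then obtain v where "v \<in> verts G" "lk (sg (v, []) (1::complex)) p \<noteq> 0"
    by (meson sum.neutral)
  then show "p \<in> qpaths G"
    by (auto simp: lookup_single when_def vtx_in_qpaths split: if_splits)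
qed

lemma ring_path_algebra: "ring (path_algebra G)"
proof (rule ringI)
  show "abelian_group (path_algebra G)"
  proof (rule abelian_groupI)
    fix f assume "f \<in> carrier (path_algebra G)"
    then show "\<exists>g\<in>carrier (path_algebra G). g \<oplus>\<^bsub>path_algebra G\<^esub> f = \<zero>\<^bsub>path_algebra G\<^esub>"
      by (intro bexI[of _ "- f"]) (auto simp: path_algebra_simps)
  next
    fix f g assume "f \<in> carrier (path_algebra G)" "g \<in> carrier (path_algebra G)"
    then show "f \<oplus>\<^bsub>path_algebra G\<^esub> g \<in> carrier (path_algebra G)"
      using keys_add[of f g] unfolding path_algebra_simps by blast
  qed (simp_all add: path_algebra_simps algebra_simps)
  show "Group.monoid (path_algebra G)"
    by (rule monoidI)
      (simp_all add: path_algebra_simps pa_mult_assoc pa_one_left pa_one_right pa_mult_closed ks_one)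
qed (simp_all add: path_algebra_simps pa_mult_add_left pa_mult_add_right)

end

section \<open>Quotients of path algebras by relations\<close>

lemma ring_cong_ops:
  assumes "ring R" "carrier R' = carrier R" "mult R' = mult R" "one R' = one R"
    "ring.zero R' = ring.zero R" "ring.add R' = ring.add R"
  shows "ring R'"
proof -
  interpret ring R by fact
  show ?thesis
  proof (rule ringI)
    show "abelian_group R'"
      by (rule abelian_groupI, unfold assms(2-)) (simp_all add: a_ac add.l_inv_ex[simplified])
    show "Group.monoid R'"
      by (rule monoidI, unfold assms(2-)) (simp_all add: m_assoc)
  qed (simp_all add: assms(2-) l_distr r_distr)
qed

text \<open>Abstract over quiver and relations, since it is instantiated both for
  \<open>conifold_quiver\<close> and for every quiver with added inverse arrows.\<close>

locale quiver_relations = fin_digraph G for G :: "('a, 'b) pre_digraph" +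
  fixes S :: "('a, 'b) qpoly set"
  assumes rel_carrier: "S \<subseteq> carrier (path_algebra G)"
begin

abbreviation "P \<equiv> path_algebra G"
abbreviation "I \<equiv> Idl\<^bsub>P\<^esub> S"
abbreviation "QA \<equiv> quiver_algebra G S"

sublocale P: ring P by (rule ring_path_algebra)
interpretation I: ideal I P by (rule P.genideal_ideal[OF rel_carrier])

lemma QA_simps:
  "carrier QA = carrier (P Quot I)" "mult QA = mult (P Quot I)" "one QA = one (P Quot I)"
  "ring.zero QA = ring.zero (P Quot I)" "ring.add QA = ring.add (P Quot I)"
  "c \<odot>\<^bsub>QA\<^esub> X = (\<Union>f\<in>X. I +>\<^bsub>P\<^esub> pm_scale c f)"
  by (simp_all add: quiver_algebra_def Let_def ring.defs module.defs)

text \<open>\<open>ring.extend\<close> only adds a scalar multiplication to the quotient ring, but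
  the record type changes, so the ring axioms are transported operation by operation.\<close>

lemma ring_QA: "ring QA"
  by (rule ring_cong_ops[OF I.quotient_is_ring]) (simp_all add: QA_simps)

lemma qclass_eq: "qclass G S f = I +>\<^bsub>P\<^esub> f"
  by (simp add: qclass_def)

lemma carrier_QA: "carrier QA = qclass G S ` carrier P"
  by (auto simp: QA_simps FactRing_def A_RCOSETS_def' qclass_eq)

lemma zero_P: "\<zero>\<^bsub>P\<^esub> = 0" by (simp add: path_algebra_simps)

lemma minus_P: "f \<in> carrier P \<Longrightarrow> \<ominus>\<^bsub>P\<^esub> f = - f"
  by (rule P.minus_equality) (auto simp: path_algebra_simps)

lemma qclass_eq_iff:
  assumes "f \<in> carrier P" "g \<in> carrier P"
  shows "qclass G S f = qclass G S g \<longleftrightarrow> f - g \<in> I"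
proof -
  have "f - g = f \<ominus>\<^bsub>P\<^esub> g"
    using assms by (simp add: a_minus_def minus_P path_algebra_simps)
  moreover have "I +>\<^bsub>P\<^esub> f = I +>\<^bsub>P\<^esub> g \<longleftrightarrow> f \<ominus>\<^bsub>P\<^esub> g \<in> I"
    using I.a_repr_independence' I.a_rcos_module assms P.minus_closed
    by (metis I.a_rcos_self P.quotient_eq_iff_same_a_r_cos I.is_ideal)
  ultimately show ?thesis by (simp add: qclass_eq)
qed

lemma pm_scale_closed: assumes "f \<in> carrier P" shows "pm_scale c f \<in> carrier P"
proof -
  have "ks (pm_scale c f) \<subseteq> ks f" by (auto simp: in_keys_iff lookup_pm_scale)
  then show ?thesis using assms unfolding path_algebra_simps by blast
qed

lemma I_closed:
  "0 \<in> I" "f \<in> I \<Longrightarrow> g \<in> I \<Longrightarrow> f + g \<in> I"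
  "f \<in> I \<Longrightarrow> x \<in> carrier P \<Longrightarrow> pa_mult G x f \<in> I"
  "f \<in> I \<Longrightarrow> x \<in> carrier P \<Longrightarrow> pa_mult G f x \<in> I"
  using I.zero_closed I.a_closed[of f g] I.I_l_closed[of f x] I.I_r_closed[of f x]
  unfolding path_algebra_simps by blast+

lemma S_subset_I: "S \<subseteq> I" by (rule P.genideal_self[OF rel_carrier])

text \<open>\<open>Idl\<close> is an ideal of the ring and knows nothing of scalars; scaling by c is
  multiplication by the ring element c times one.\<close>

lemma scale_in_I: assumes "f \<in> I" shows "pm_scale c f \<in> I"
proof -
  have f: "f \<in> carrier P" by (rule subsetD[OF I.a_subset assms])
  have one: "pm_scale c \<one>\<^bsub>P\<^esub> \<in> carrier P"
    by (rule pm_scale_closed[OF P.one_closed])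
  have "pm_scale c f = pm_scale c \<one>\<^bsub>P\<^esub> \<otimes>\<^bsub>P\<^esub> f"
    using P.l_one[OF f] unfolding path_algebra_simps pa_mult_scale_left by (rule arg_cong[OF sym])
  then show ?thesis using I.I_l_closed[OF assms one] by simp
qed


lemma qclass_self: "f \<in> carrier P \<Longrightarrow> f \<in> qclass G S f"
  unfolding qclass_eq by (rule I.a_rcos_self)

lemma qclass_repr:
  assumes "f \<in> carrier P" "f' \<in> qclass G S f"
  shows "f' \<in> carrier P" "f' - f \<in> I"
proof -
  show f': "f' \<in> carrier P"
    by (rule I.a_elemrcos_carrier[OF assms(1) assms(2)[unfolded qclass_eq]])
  obtain h where h: "h \<in> I" "f' = h + f"
    using assms(2) unfolding qclass_eq a_r_coset_def' path_algebra_simps by blast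
  then show "f' - f \<in> I" by (metis add_diff_cancel_right')
qed

lemma qclass_ops:
  assumes "f \<in> carrier P" "g \<in> carrier P"
  shows "qclass G S f \<otimes>\<^bsub>QA\<^esub> qclass G S g = qclass G S (pa_mult G f g)"
    "qclass G S f \<oplus>\<^bsub>QA\<^esub> qclass G S g = qclass G S (f + g)"
    "\<one>\<^bsub>QA\<^esub> = qclass G S (\<Sum>v\<in>verts G. sg (v, []) 1)"
    "\<zero>\<^bsub>QA\<^esub> = qclass G S 0"
    "c \<odot>\<^bsub>QA\<^esub> qclass G S f = qclass G S (pm_scale c f)"
proof -
  show "qclass G S f \<otimes>\<^bsub>QA\<^esub> qclass G S g = qclass G S (pa_mult G f g)"
    using I.rcoset_mult_add[OF assms]
    unfolding QA_simps FactRing_def qclass_eq path_algebra_simps by simp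
  show "qclass G S f \<oplus>\<^bsub>QA\<^esub> qclass G S g = qclass G S (f + g)"
    using I.a_rcos_sum[OF assms]
    unfolding QA_simps FactRing_def qclass_eq path_algebra_simps by simp
  show "\<one>\<^bsub>QA\<^esub> = qclass G S (\<Sum>v\<in>verts G. sg (v, []) 1)"
    unfolding QA_simps FactRing_def qclass_eq path_algebra_simps by simp
  show "\<zero>\<^bsub>QA\<^esub> = qclass G S 0"
    using P.a_coset_add_zero[OF I.a_subset]
    unfolding QA_simps qclass_eq FactRing_def zero_P by simp
  \<comment> \<open>The scalar action on classes is a union over representatives; all of them give
    the same class, so the union is that class.\<close>
  have "qclass G S (pm_scale c f') = qclass G S (pm_scale c f)" if "f' \<in> qclass G S f" for f'
  proof -
    have f': "f' \<in> carrier P" and "f' - f \<in> I" using qclass_repr[OF assms(1) that] by auto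
    then have "pm_scale c f' - pm_scale c f \<in> I"
      using scale_in_I[of "f' - f" c] unfolding pm.scale_right_diff_distrib by blast
    then show ?thesis using qclass_eq_iff f' assms pm_scale_closed by blast
  qed
  moreover have "f \<in> qclass G S f" by (rule qclass_self[OF assms(1)])
  ultimately show "c \<odot>\<^bsub>QA\<^esub> qclass G S f = qclass G S (pm_scale c f)"
    unfolding QA_simps qclass_eq[symmetric] by blast
qed

end


section \<open>Polynomials in four variables\<close>

text \<open>A predicate on functions between types, so that evaluations, substitutions and the
  embedding into fractions can be composed freely.\<close>

definition is_hom :: "('a::comm_ring_1 \<Rightarrow> 'b::comm_ring_1) \<Rightarrow> bool" where
  "is_hom h \<longleftrightarrow> h 1 = 1 \<and> (\<forall>x y. h (x + y) = h x + h y) \<and> (\<forall>x y. h (x * y) = h x * h y)"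

lemma is_homD:
  assumes "is_hom h"
  shows "h 1 = 1" "h (x + y) = h x + h y" "h (x * y) = h x * h y"
    "h 0 = 0" "h (- x) = - h x" "h (x - y) = h x - h y"
proof -
  show *: "h 1 = 1" "\<And>x y. h (x + y) = h x + h y" "h (x * y) = h x * h y"
    using assms by (auto simp: is_hom_def)
  show **: "h 0 = 0" using *(2)[of 0 0] by simp
  have ***: "h (- x) = - h x" for x using *(2)[of x "- x"] ** by (simp add: eq_neg_iff_add_eq_0 add.commute)
  then show "h (- x) = - h x" .
  show "h (x - y) = h x - h y" using *(2)[of x "- y"] *** by simp
qed

lemma is_hom_sum: "is_hom h \<Longrightarrow> h (sum f A) = (\<Sum>a\<in>A. h (f a))"
  by (induction A rule: infinite_finite_induct) (auto simp: is_homD)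

lemma is_hom_prod: "is_hom h \<Longrightarrow> h (prod f A) = (\<Prod>a\<in>A. h (f a))"
  by (induction A rule: infinite_finite_induct) (auto simp: is_homD)

lemma is_hom_power: "is_hom h \<Longrightarrow> h (x ^ n) = h x ^ n"
  by (induction n) (auto simp: is_homD)

lemma is_hom_prod_list: "is_hom h \<Longrightarrow> h (prod_list xs) = prod_list (map h xs)"
  by (induction xs) (auto simp: is_homD)

lemma is_hom_comp: "is_hom g \<Longrightarrow> is_hom h \<Longrightarrow> is_hom (\<lambda>x. g (h x))"
  by (simp add: is_hom_def)

lemma is_hom_id [simp]: "is_hom id" "is_hom (\<lambda>x. x)" by (simp_all add: is_hom_def)

definition const :: "complex \<Rightarrow> 'i cpoly" where "const c = sg 0 c"

definition var :: "'i \<Rightarrow> 'i cpoly" where "var i = sg (sg i 1) 1"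

lemma is_hom_const [simp]: "is_hom const"
  by (simp add: is_hom_def const_def single_add mult_single)

text \<open>The product runs over all variables instead of the support, which makes it
  multiplicative without case distinctions.\<close>

definition monval :: "('i \<Rightarrow> 'b::comm_ring_1) \<Rightarrow> ('i::finite \<Rightarrow>\<^sub>0 nat) \<Rightarrow> 'b" where
  "monval q m = (\<Prod>i\<in>UNIV. q i ^ lk m i)"

lemma monval_keys: "(\<Prod>i\<in>ks m. q i ^ lk m i) = monval q m"
  unfolding monval_def by (intro prod.mono_neutral_left) (auto simp: in_keys_iff)

lemma monval_add: "monval q (m + n) = monval q m * monval q n"
  by (simp add: monval_def lookup_add power_add prod.distrib)

lemma monval_0 [simp]: "monval q 0 = 1" by (simp add: monval_def)

lemma monval_single [simp]: "monval q (sg i n) = q i ^ n"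
proof -
  have "monval q (sg i n) = (\<Prod>j\<in>UNIV. if j = i then q i ^ n else 1)"
    unfolding monval_def by (intro prod.cong) (auto simp: lookup_single when_def)
  then show ?thesis by simp
qed

lemma insertion_monval: "insertion \<kappa> q f = (\<Sum>m\<in>ks f. \<kappa> (lk f m) * monval q m)"
  by (simp add: insertion_def monval_keys)

context
  fixes \<kappa> :: "complex \<Rightarrow> 'b::comm_ring_1" and q :: "'i::finite \<Rightarrow> 'b"
  assumes \<kappa>: "is_hom \<kappa>"
begin

lemma insertion_superset:
  assumes "finite S" "ks f \<subseteq> S"
  shows "insertion \<kappa> q f = (\<Sum>m\<in>S. \<kappa> (lk f m) * monval q m)"
  unfolding insertion_monval using assms
  by (intro sum.mono_neutral_left) (auto simp: in_keys_iff is_homD[OF \<kappa>])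

lemma insertion_add: "insertion \<kappa> q (f + g) = insertion \<kappa> q f + insertion \<kappa> q g"
proof -
  let ?S = "ks f \<union> ks g \<union> ks (f + g)"
  have S: "finite ?S" by simp
  note s = insertion_superset[OF S]
  show ?thesis
    by (subst s, blast, subst s, blast, subst s, blast)
      (simp add: lookup_add is_homD[OF \<kappa>] algebra_simps sum.distrib)
qed

lemma insertion_single: "insertion \<kappa> q (sg m c) = \<kappa> c * monval q m"
  by (subst insertion_superset[of "{m}"]) auto

lemma insertion_zero: "insertion \<kappa> q 0 = 0"
  by (simp add: insertion_monval)

lemma insertion_mult: "insertion \<kappa> q (f * g) = insertion \<kappa> q f * insertion \<kappa> q g"
proof (induction f rule: poly_mapping_linear_induct)
  case (single m c)
  show ?case
    by (induction g rule: poly_mapping_linear_induct)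
      (auto simp: insertion_zero insertion_add insertion_single mult_single monval_add is_homD[OF \<kappa>]
        algebra_simps)
qed (simp_all add: insertion_zero insertion_add algebra_simps)

lemma is_hom_insertion: "is_hom (insertion \<kappa> q)"
  using insertion_single[of 0 1]
  by (simp add: is_hom_def insertion_add insertion_mult is_homD[OF \<kappa>])

lemma insertion_const: "insertion \<kappa> q (const c) = \<kappa> c"
  by (simp add: const_def insertion_single)

lemma insertion_var: "insertion \<kappa> q (var i) = q i"
  by (simp add: var_def insertion_single is_homD[OF \<kappa>])

lemma hom_insertion:
  assumes "is_hom h" shows "h (insertion \<kappa> q f) = insertion (\<lambda>c. h (\<kappa> c)) (\<lambda>i. h (q i)) f"
  by (simp add: insertion_monval is_hom_sum[OF assms] is_homD[OF assms] monval_def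
      is_hom_prod[OF assms] is_hom_power[OF assms])

end

lemma monval_var: "monval var m = sg m 1"
proof (induction m rule: poly_mapping_linear_induct)
  case (single i n)
  have "var i ^ n = sg (sg i n) 1"
    by (induction n) (simp_all add: var_def mult_single flip: single_add)
  then show ?case by simp
qed (simp_all add: monval_add mult_single)

lemma insertion_const_var: "insertion const var f = (f :: 'i::finite cpoly)"
  by (simp add: insertion_monval monval_var const_def mult_single flip: poly_mapping_expand)

lemma hom_eq_insertion:
  fixes f :: "'i::finite cpoly"
  assumes "is_hom h" shows "h f = insertion (\<lambda>c. h (const c)) (\<lambda>i. h (var i)) f"
  using hom_insertion[OF is_hom_const assms, of var f] by (simp add: insertion_const_var)

text \<open>Uniqueness in the universal property: constants and variables generate the polynomial
  ring.\<close>

lemma hom_cpoly_eqI: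
  fixes f :: "'i::finite cpoly"
  assumes "is_hom g" "is_hom h" "\<And>c. g (const c) = h (const c)" "\<And>i. g (var i) = h (var i)"
  shows "g f = h f"
  using hom_eq_insertion[OF assms(1), of f] hom_eq_insertion[OF assms(2), of f] assms(3,4) by simp

lemma insertion_insertion:
  fixes f :: "'i::finite cpoly" and p :: "'i \<Rightarrow> 'j::finite cpoly"
  assumes "is_hom \<kappa>" "is_hom \<kappa>'"
  shows "insertion \<kappa> q (insertion const p f) = insertion \<kappa> (\<lambda>i. insertion \<kappa> q (p i)) f"
  using hom_insertion[OF is_hom_const is_hom_insertion[OF assms(1), of q], of p f]
  by (simp add: insertion_const[OF assms(1)])

lemmas eval_simps = insertion_add[OF is_hom_id(1)] insertion_mult[OF is_hom_id(1)]
  is_homD[OF is_hom_insertion[OF is_hom_id(1)]] insertion_const[OF is_hom_id(1)]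
  insertion_var[OF is_hom_id(1)] insertion_single[OF is_hom_id(1)]

lemma is_hom_eval: "is_hom (insertion id (q :: 'i::finite \<Rightarrow> complex))"
  by (rule is_hom_insertion) simp

subsection \<open>Comparison with iterated univariate polynomials\<close>

definition ev :: "('a::comm_ring_1 \<Rightarrow> 'b::comm_ring_1) \<Rightarrow> 'b \<Rightarrow> 'a poly \<Rightarrow> 'b" where
  "ev h a p = poly (map_poly h p) a"

lemma ev_pCons: "is_hom h \<Longrightarrow> ev h a (pCons c p) = h c + a * ev h a p"
  by (simp add: ev_def map_poly_pCons is_homD)

lemma ev_0: "ev h a 0 = 0" by (simp add: ev_def)

lemma ev_add: "is_hom h \<Longrightarrow> ev h a (p + q) = ev h a p + ev h a q"
  by (induction p q rule: poly_induct2) (simp_all add: ev_0 ev_pCons is_homD algebra_simps)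

lemma ev_smult: "is_hom h \<Longrightarrow> ev h a (Polynomial.smult c p) = h c * ev h a p"
  by (induction p) (simp_all add: ev_0 ev_pCons is_homD algebra_simps)

lemma ev_mult: "is_hom h \<Longrightarrow> ev h a (p * q) = ev h a p * ev h a q"
  by (induction p) (simp_all add: ev_0 ev_pCons ev_add ev_smult is_homD algebra_simps)

lemma is_hom_ev: "is_hom h \<Longrightarrow> is_hom (ev h a)"
  by (simp add: is_hom_def ev_add ev_mult) (simp add: one_pCons ev_pCons ev_0 is_hom_def)

lemma is_hom_pCons0: "is_hom h \<Longrightarrow> is_hom (\<lambda>c. [:h c:])"
  by (auto simp: is_hom_def one_pCons)

type_synonym poly4 = "complex poly poly poly poly"

text \<open>The first variable sits innermost, the fourth outermost; \<open>ev4\<close> substitutes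
  in the same order.\<close>

definition var4 :: "4 \<Rightarrow> poly4" where
  "var4 i = (if i = 1 then [:[:[:[:0, 1:]:]:]:] else if i = 2 then [:[:[:0, 1:]:]:]
     else if i = 3 then [:[:0, 1:]:] else [:0, 1:])"

definition to_poly4 :: "4 cpoly \<Rightarrow> poly4" where
  "to_poly4 = insertion (\<lambda>c. [:[:[:[:c:]:]:]:]) var4"

definition ev4 :: "(complex \<Rightarrow> 'b::comm_ring_1) \<Rightarrow> (4 \<Rightarrow> 'b) \<Rightarrow> poly4 \<Rightarrow> 'b" where
  "ev4 \<kappa> q = ev (ev (ev (ev \<kappa> (q 1)) (q 2)) (q 3)) (q 4)"

lemma is_hom_ev4: "is_hom \<kappa> \<Longrightarrow> is_hom (ev4 \<kappa> q)"
  by (simp add: ev4_def is_hom_ev)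

lemma is_hom_to_poly4: "is_hom to_poly4"
  unfolding to_poly4_def by (intro is_hom_insertion is_hom_pCons0 is_hom_id)

lemma ev4_to_poly4:
  assumes "is_hom \<kappa>" shows "ev4 \<kappa> q (to_poly4 f) = insertion \<kappa> q f"
proof -
  note h = assms is_hom_ev[OF assms] is_hom_ev[OF is_hom_ev[OF assms]]
    is_hom_ev[OF is_hom_ev[OF is_hom_ev[OF assms]]]
  have "q i = ev4 \<kappa> q (var4 i)" for i
    using exhaust_4[of i] by (auto simp: ev4_def var4_def ev_pCons h ev_0 is_homD[OF h(1)]
      is_homD[OF h(2)] is_homD[OF h(3)] is_homD[OF h(4)])
  moreover have "ev4 \<kappa> q [:[:[:[:c:]:]:]:] = \<kappa> c" for c
    by (simp add: ev4_def ev_pCons h ev_0)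
  moreover have "is_hom (\<lambda>c::complex. [:[:[:[:c:]:]:]:])" by (intro is_hom_pCons0 is_hom_id)
  ultimately show ?thesis
    unfolding to_poly4_def by (subst hom_insertion[OF _ is_hom_ev4[OF assms]]) (simp_all flip: \<open>\<And>i. q i = _\<close>)
qed

abbreviation "of_poly4 \<equiv> ev4 const var :: poly4 \<Rightarrow> 4 cpoly"

text \<open>This retraction lets a factorization found in \<open>poly4\<close> be pushed back to
  \<open>4 cpoly\<close>: \<open>of_poly4\<close> is a ring homomorphism that undoes
  \<open>to_poly4\<close>.\<close>

lemma of_to_poly4 [simp]: "of_poly4 (to_poly4 f) = f"
  by (simp add: ev4_to_poly4 insertion_const_var)

lemma is_hom_of_poly4: "is_hom of_poly4" by (rule is_hom_ev4) simp

lemma to_poly4_eq_0_iff: "to_poly4 f = 0 \<longleftrightarrow> f = 0"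
  using of_to_poly4[of f] is_homD(4)[OF is_hom_of_poly4] is_homD(4)[OF is_hom_to_poly4] by metis

text \<open>Greatest common divisors are computed in the isomorphic factorial ring of iterated polynomials.\<close>

lemma cpoly_coprime_decomposition:
  fixes f g :: "4 cpoly"
  assumes "g \<noteq> 0"
  obtains d f' g' where "f = d * f'" "g = d * g'"
    and "\<And>h k. f' * h = g' * k \<Longrightarrow> g' dvd h"
    and "\<And>e. e dvd f \<Longrightarrow> e dvd g \<Longrightarrow> e dvd d"
proof -
  let ?F = "to_poly4 f" and ?G = "to_poly4 g"
  define D where "D = gcd ?F ?G"
  have G0: "?G \<noteq> 0" using assms by (simp add: to_poly4_eq_0_iff)
  then have D0: "D \<noteq> 0" by (simp add: D_def)
  obtain F' where F': "?F = D * F'" unfolding D_def by (meson gcd_dvd1 dvdE)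
  obtain G' where G': "?G = D * G'" unfolding D_def by (meson gcd_dvd2 dvdE)
  have cop: "coprime F' G'"
  proof -
    have "F' = ?F div gcd ?F ?G" "G' = ?G div gcd ?F ?G"
      using F' G' D0 by (metis D_def nonzero_mult_div_cancel_left)+
    then show ?thesis using div_gcd_coprime G0 by metis
  qed
  note ho = is_homD[OF is_hom_of_poly4] and ht = is_homD[OF is_hom_to_poly4]
  show ?thesis
  proof (rule that)
    show f: "f = of_poly4 D * of_poly4 F'" using arg_cong[OF F', of of_poly4] by (simp add: ho)
    show g: "g = of_poly4 D * of_poly4 G'" using arg_cong[OF G', of of_poly4] by (simp add: ho)
    fix h k assume *: "of_poly4 F' * h = of_poly4 G' * k"
    have "f * h = g * k" unfolding f g using * by (simp add: mult.assoc)
    then have "D * (F' * to_poly4 h) = D * (G' * to_poly4 k)"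
      using F' G' by (metis ht(3) mult.assoc)
    then have "F' * to_poly4 h = G' * to_poly4 k" using D0 by simp
    then have "G' dvd to_poly4 h"
      using cop by (metis coprime_commute coprime_dvd_mult_right_iff dvd_triv_left)
    then obtain r where "to_poly4 h = G' * r" by (auto elim: dvdE)
    from arg_cong[OF this, of of_poly4] show "of_poly4 G' dvd h" by (simp add: ho)
  next
    fix e assume "e dvd f" "e dvd g"
    then have "to_poly4 e dvd ?F" "to_poly4 e dvd ?G" by (metis dvd_def ht(3))+
    then have "to_poly4 e dvd D" unfolding D_def by (rule gcd_greatest)
    then obtain r where "D = to_poly4 e * r" by (auto elim: dvdE)
    from arg_cong[OF this, of of_poly4] show "e dvd of_poly4 D" by (simp add: ho)
  qed
qed

section \<open>Points where polynomials do not vanish\<close>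

lemma exists_nonroot:
  fixes p :: "'a::idom poly" assumes "p \<noteq> 0" "infinite S" shows "\<exists>a\<in>S. poly p a \<noteq> 0"
proof (rule ccontr)
  assume "\<not> ?thesis"
  then have "S \<subseteq> {a. poly p a = 0}" by auto
  with poly_roots_finite[OF assms(1)] assms(2) show False using finite_subset by blast
qed

lemma exists_nonroot_const:
  fixes p :: "'a::{idom,ring_char_0} poly" assumes "p \<noteq> 0" "infinite (UNIV::'c set)" "inj (i :: 'c \<Rightarrow> 'a)"
  shows "\<exists>c. poly p (i c) \<noteq> 0"
  using exists_nonroot[OF assms(1), of "range i"] assms(2,3) by (auto simp: finite_image_iff)

lemma vector_4:
  "(vector [a, b, c, d] :: 'a::zero ^ 4) $ 1 = a" "(vector [a, b, c, d] :: 'a ^ 4) $ 2 = b"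
  "(vector [a, b, c, d] :: 'a ^ 4) $ 3 = c" "(vector [a, b, c, d] :: 'a ^ 4) $ 4 = d"
  by (simp_all add: vector_def)

text \<open>One variable is specialized at a time, outermost first: a nonzero polynomial over a
  domain has finitely many roots, while there are infinitely many constants to substitute.\<close>

lemma cpoly_nonroot:
  fixes f :: "4 cpoly" assumes "f \<noteq> 0" shows "\<exists>q. eval_at q f \<noteq> 0"
proof -
  have inj: "inj (\<lambda>c::complex. [:[:[:c:]:]:])" "inj (\<lambda>c::complex. [:[:c:]:])" "inj (\<lambda>c::complex. [:c:])"
    by (auto intro: injI)
  have inf: "infinite (UNIV::complex set)" by (rule infinite_UNIV_char_0)
  have "to_poly4 f \<noteq> 0" using assms by (simp add: to_poly4_eq_0_iff)
  then obtain a4 where 4: "poly (to_poly4 f) [:[:[:a4:]:]:] \<noteq> 0"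
    using exists_nonroot_const[OF _ inf inj(1)] by blast
  then obtain a3 where 3: "poly (poly (to_poly4 f) [:[:[:a4:]:]:]) [:[:a3:]:] \<noteq> 0"
    using exists_nonroot_const[OF _ inf inj(2)] by blast
  then obtain a2 where 2: "poly (poly (poly (to_poly4 f) [:[:[:a4:]:]:]) [:[:a3:]:]) [:a2:] \<noteq> 0"
    using exists_nonroot_const[OF _ inf inj(3)] by blast
  then obtain a1 where 1:
    "poly (poly (poly (poly (to_poly4 f) [:[:[:a4:]:]:]) [:[:a3:]:]) [:a2:]) a1 \<noteq> 0"
    using exists_nonroot[OF _ inf] by blast
  define q :: "complex ^ 4" where "q = vector [a1, a2, a3, a4]"
  let ?h = "\<lambda>g. poly (poly (poly (poly (g :: poly4) [:[:[:a4:]:]:]) [:[:a3:]:]) [:a2:]) a1"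
  have h: "is_hom ?h" by (simp add: is_hom_def)
  have "?h (to_poly4 f) = eval_at q f"
  proof (rule hom_cpoly_eqI[OF is_hom_comp[OF h is_hom_to_poly4] is_hom_eval])
    show "?h (to_poly4 (var i)) = eval_at q (var i)" for i
      using exhaust_4[of i]
      by (auto simp: to_poly4_def insertion_var is_hom_pCons0 eval_simps var4_def q_def vector_4)
  qed (simp add: to_poly4_def insertion_const is_hom_pCons0 eval_simps)
  with 1 show ?thesis by auto
qed

text \<open>Apply \<open>cpoly_nonroot\<close> to the product of f with all four variables.\<close>

lemma cpoly_torus_nonroot:
  fixes f :: "4 cpoly" assumes "f \<noteq> 0" shows "\<exists>q. (\<forall>i. q $ i \<noteq> 0) \<and> eval_at q f \<noteq> 0"
proof -
  have v: "var i \<noteq> (0 :: 4 cpoly)" for i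
    by (metis var_def lookup_single_eq lookup_zero zero_neq_one)
  then have "f * (\<Prod>i\<in>UNIV. var i) \<noteq> 0" using assms by simp
  then obtain q where q: "eval_at q (f * (\<Prod>i\<in>UNIV. var i)) \<noteq> 0" using cpoly_nonroot by blast
  moreover have "eval_at q (f * (\<Prod>i\<in>UNIV. var i)) = eval_at q f * (\<Prod>i\<in>UNIV. q $ i)"
    by (simp add: eval_simps is_hom_prod[OF is_hom_eval])
  ultimately have "eval_at q f * (\<Prod>i\<in>UNIV. q $ i) \<noteq> 0" by simp
  then have "eval_at q f \<noteq> 0" "\<forall>i. q $ i \<noteq> 0" by (simp_all add: prod_zero_iff)
  then show ?thesis by blast
qed

text \<open>Identities need checking only on the torus, where coordinates may be inverted.\<close>

lemma cpoly_eqI: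
  fixes f g :: "4 cpoly"
  assumes "\<And>q. (\<forall>i. q $ i \<noteq> 0) \<Longrightarrow> eval_at q f = eval_at q g" shows "f = g"
  using cpoly_torus_nonroot[of "f - g"] assms by (auto simp: eval_simps)

text \<open>After division by the highest power of the variable the cofactor has no root at all,
  hence is constant by the fundamental theorem of algebra; so p is a monomial.\<close>

lemma poly_no_nonzero_root:
  fixes p :: "complex poly"
  assumes "\<And>x. x \<noteq> 0 \<Longrightarrow> poly p x \<noteq> 0" "coeff p a \<noteq> 0" "coeff p b \<noteq> 0" shows "a = b"
proof -
  have "p \<noteq> 0" using assms(2) by auto
  from order_decomp[OF this, of 0] obtain r where
    r: "p = [:- 0, 1:] ^ Polynomial.order 0 p * r" "\<not> [:- 0, 1:] dvd r" by blast
  have nr: "poly r x \<noteq> 0" for x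
  proof (cases "x = 0")
    case True then show ?thesis using r(2) by (simp add: poly_eq_0_iff_dvd)
  next
    case False then show ?thesis using assms(1)[of x] r(1) by (metis mult_zero_right poly_mult)
  qed
  then have "constant (poly r)" using fundamental_theorem_of_algebra by blast
  then have "degree r = 0" by (simp add: constant_degree)
  then obtain c where c: "r = [:c:]" by (meson degree_eq_zeroE)
  have "p = Polynomial.monom c (Polynomial.order 0 p)"
    by (subst r(1)) (simp add: c monom_altdef)
  then have "\<And>k. coeff p k \<noteq> 0 \<Longrightarrow> k = Polynomial.order 0 p" by (metis coeff_monom)
  then show ?thesis using assms(2,3) by metis
qed

definition part :: "('i \<Rightarrow>\<^sub>0 nat) set \<Rightarrow> 'i cpoly \<Rightarrow> 'i cpoly" where
  "part M f = (\<Sum>m\<in>ks f \<inter> M. sg m (lk f m))"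

lemma lookup_part: "lk (part M f) m = (if m \<in> M then lk f m else 0)"
  unfolding part_def lookup_sum lookup_single when_def
  by (simp add: sum.If_cases Int_def in_keys_iff)

lemma eval_part: "insertion id q (part M f) = (\<Sum>m\<in>ks f \<inter> M. lk f m * monval q (m :: 'i::finite \<Rightarrow>\<^sub>0 nat))"
  unfolding part_def by (simp add: is_hom_sum[OF is_hom_eval] eval_simps)

text \<open>If two monomials differed in the exponent of some variable, then f, viewed along that
  variable at a suitable torus point, would be a univariate polynomial with two nonzero coefficients
  and so would have a nonzero root.\<close>

lemma torus_unit_monomial:
  fixes f :: "4 cpoly"
  assumes nz: "\<And>q. (\<forall>i. q $ i \<noteq> 0) \<Longrightarrow> eval_at q f \<noteq> 0"
  shows "\<exists>m c. c \<noteq> 0 \<and> f = sg m c"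
proof -
  have same: "lk m i = lk n i" if mn: "m \<in> ks f" "n \<in> ks f" for m n i
  proof -
    define M where "M a = {k :: 4 \<Rightarrow>\<^sub>0 nat. lk k i = a}" for a
    have "part (M (lk m i)) f \<noteq> 0" "part (M (lk n i)) f \<noteq> 0"
      using mn by (auto simp: poly_mapping_eq_iff fun_eq_iff lookup_part M_def in_keys_iff)
    \<comment> \<open>Nonvanishing of the product yields one torus point at which both components
      survive, so specialization loses neither coefficient.\<close>
    then have "part (M (lk m i)) f * part (M (lk n i)) f \<noteq> 0" by simp
    then obtain q where q: "\<forall>i. q $ i \<noteq> 0"
      "eval_at q (part (M (lk m i)) f * part (M (lk n i)) f) \<noteq> 0"
      using cpoly_torus_nonroot by blast
    \<comment> \<open>This is f along the curve that multiplies the i-th coordinate of q by x; its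
      coefficients are the values of the components.\<close>
    define p where "p = (\<Sum>k\<in>ks f. Polynomial.monom (lk f k * monval (($) q) k) (lk k i))"
    have cp: "coeff p a = eval_at q (part (M a) f)" for a
    proof -
      have "coeff p a = (\<Sum>k\<in>ks f. if lk k i = a then lk f k * monval (($) q) k else 0)"
        by (simp add: p_def coeff_sum)
      also have "\<dots> = eval_at q (part (M a) f)"
        by (simp add: eval_part sum.If_cases Int_def M_def)
      finally show ?thesis .
    qed
    have "poly p x \<noteq> 0" if "x \<noteq> 0" for x
    proof -
      let ?q = "\<chi> j. if j = i then x * q $ i else q $ j"
      have mv: "monval (($) ?q) k = monval (($) q) k * x ^ lk k i" for k
      proof -
        have "monval (($) ?q) k = (\<Prod>j\<in>UNIV. q $ j ^ lk k j * (if j = i then x ^ lk k i else 1))"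
          unfolding monval_def by (intro prod.cong) (auto simp: power_mult_distrib)
        then show ?thesis by (simp add: prod.distrib monval_def)
      qed
      have "poly p x = eval_at ?q f"
        by (simp only: p_def poly_sum poly_monom insertion_monval mv id_apply mult.assoc)
      also have "\<dots> \<noteq> 0" using q(1) that by (intro nz) auto
      finally show ?thesis .
    qed
    moreover have "coeff p (lk m i) \<noteq> 0" "coeff p (lk n i) \<noteq> 0"
      using q(2) by (simp_all add: cp eval_simps)
    ultimately show ?thesis by (rule poly_no_nonzero_root)
  qed
  have "f \<noteq> 0" using nz[of "\<chi> i. 1"] by (auto simp: eval_simps)
  then obtain m where m: "m \<in> ks f" by (metis ex_in_conv keys_eq_empty)
  then have "ks f = {m}" using same by (auto intro: poly_mapping_eqI)
  then have "f = sg m (lk f m)" using poly_mapping_expand[of f] by simp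
  with m show ?thesis by (metis in_keys_iff)
qed

lemma monval_0_power: "monval (($) 0) m = (if m = 0 then 1 else 0 :: complex)" for m :: "'i::finite \<Rightarrow>\<^sub>0 nat"
proof (cases "m = 0")
  case False
  then obtain i where "lk m i \<noteq> 0" by (metis poly_mapping_eqI lookup_zero)
  then show ?thesis using False by (auto simp: monval_def intro!: prod_zero)
qed simp

text \<open>A unit vanishes nowhere: on the torus this makes it a monomial, at the origin it makes
  the monomial constant.\<close>

lemma cpoly_unit_const:
  fixes u v :: "4 cpoly" assumes "u * v = 1" shows "\<exists>c. c \<noteq> 0 \<and> u = const c"
proof -
  have nz: "eval_at q u \<noteq> 0" for q using arg_cong[OF assms, of "eval_at q"] by (auto simp: eval_simps)
  then obtain m c where mc: "c \<noteq> 0" "u = sg m c" using torus_unit_monomial by blast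
  have "monval (($) 0) m \<noteq> (0::complex)" using nz[of 0] mc by (simp add: eval_simps)
  then have "m = 0" using monval_0_power[of m] by (auto split: if_splits)
  with mc show ?thesis by (auto simp: const_def)
qed

subsection \<open>The grading\<close>

text \<open>The torus acts on \<open>x, y\<close> with weight \<open>1\<close> and on \<open>z, w\<close> with weight \<open>-1\<close>.\<close>

definition wt :: "(4 \<Rightarrow>\<^sub>0 nat) \<Rightarrow> int" where
  "wt m = int (lk m 1) + int (lk m 2) - int (lk m 3) - int (lk m 4)"

definition homog :: "int \<Rightarrow> 4 cpoly \<Rightarrow> bool" where
  "homog k f \<longleftrightarrow> (\<forall>m\<in>ks f. wt m = k)"

lemma wt_add [simp]: "wt (m + n) = wt m + wt n" by (simp add: wt_def lookup_add)
lemma wt_0 [simp]: "wt 0 = 0" by (simp add: wt_def)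

lemma homog_0 [simp]: "homog k 0" by (simp add: homog_def)

lemma homog_add: "homog k f \<Longrightarrow> homog k g \<Longrightarrow> homog k (f + g)"
  using keys_add[of f g] by (auto simp: homog_def)

lemma homog_mult: "homog k f \<Longrightarrow> homog l g \<Longrightarrow> homog (k + l) (f * g)"
  using keys_mult[of f g] by (auto simp: homog_def)

lemma homog_singleI: "wt m = k \<Longrightarrow> homog k (sg m c)" by (simp add: homog_def)

lemma homog_const [simp]: "homog 0 (const c)" by (simp add: homog_def const_def)

text \<open>Effect on the four arrow scalars of rescaling the basis vectors at the two vertices;
  only the ratio of the two factors enters, see \<open>torus_vecI\<close>.\<close>

definition torus_vec :: "complex \<Rightarrow> complex ^ 4 \<Rightarrow> complex ^ 4" where
  "torus_vec \<mu> q = vector [\<mu> * q $ 1, \<mu> * q $ 2, q $ 3 / \<mu>, q $ 4 / \<mu>]"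

lemma torus_vec_nth [simp]:
  "torus_vec \<mu> q $ 1 = \<mu> * q $ 1" "torus_vec \<mu> q $ 2 = \<mu> * q $ 2"
  "torus_vec \<mu> q $ 3 = q $ 3 / \<mu>" "torus_vec \<mu> q $ 4 = q $ 4 / \<mu>"
  by (simp_all add: torus_vec_def vector_4)

lemma prod_4: "prod f (UNIV::4 set) = f 1 * f 2 * f 3 * f 4"
  unfolding UNIV_4 by (simp add: ac_simps)

lemma monval_torus:
  assumes "\<mu> \<noteq> 0"
  shows "monval (($) (torus_vec \<mu> q)) m = \<mu> powi wt m * monval (($) q) m"
proof -
  have "\<mu> powi wt m = \<mu> ^ lk m 1 * \<mu> ^ lk m 2 / (\<mu> ^ lk m 3 * \<mu> ^ lk m 4)"
    using assms by (simp add: wt_def power_int_diff power_int_add)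
  then show ?thesis
    by (simp add: monval_def prod_4 power_mult_distrib power_divide)
qed

lemma eval_torus_homog:
  assumes "\<mu> \<noteq> 0" "homog k f" shows "eval_at (torus_vec \<mu> q) f = \<mu> powi k * eval_at q f"
  unfolding insertion_monval sum_distrib_left using assms
  by (intro sum.cong) (auto simp: monval_torus homog_def)

text \<open>The substitution dual to \<open>torus_vec\<close>, see \<open>eval_scaling\<close>. It
  is diagonal on monomials, with eigenvalue given by the weight.\<close>

definition scaling :: "complex \<Rightarrow> 4 cpoly \<Rightarrow> 4 cpoly" where
  "scaling \<mu> = insertion const (\<lambda>i. const (if i = 1 \<or> i = 2 then \<mu> else inverse \<mu>) * var i)"

lemma is_hom_scaling: "is_hom (scaling \<mu>)"
  unfolding scaling_def by (rule is_hom_insertion) simp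

lemma eval_scaling: "eval_at q (scaling \<mu> f) = eval_at (torus_vec \<mu> q) f"
proof -
  have "insertion id (($) q) (const (if i = 1 \<or> i = 2 then \<mu> else inverse \<mu>) * var i) = torus_vec \<mu> q $ i" for i
    using exhaust_4[of i] by (auto simp: eval_simps divide_inverse)
  then show ?thesis
    unfolding scaling_def insertion_insertion[OF is_hom_id(1) is_hom_id(1)] by simp
qed

lemma lookup_scaling: assumes "\<mu> \<noteq> 0" shows "lk (scaling \<mu> f) m = \<mu> powi wt m * lk f m"
proof -
  let ?g = "\<Sum>m\<in>ks f. sg m (\<mu> powi wt m * lk f m)"
  have "scaling \<mu> f = ?g"
    by (rule cpoly_eqI)
      (simp add: eval_scaling is_hom_sum[OF is_hom_eval] eval_simps insertion_monval[of _ _ f]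
        monval_torus[OF assms] mult_ac)
  then show ?thesis
    by (simp add: lookup_sum lookup_single when_def in_keys_iff)
qed

lemma powi_2_inj: "(2::complex) powi k = 2 powi l \<Longrightarrow> k = l"
proof -
  assume "(2::complex) powi k = 2 powi l"
  then have "norm ((2::complex) powi k) = norm ((2::complex) powi l)" by simp
  then have "(2::real) powi k = 2 powi l" by (simp add: norm_power_int)
  then show "k = l" by (metis linorder_neqE_linordered_idom one_less_numeral_iff order_less_irrefl power_int_strict_increasing semiring_norm(76))
qed

text \<open>One substitution suffices because the integer powers of 2 are distinct. In this form
  homogeneity passes to factors, as \<open>scaling\<close> is multiplicative.\<close>

lemma homog_iff_scaling: "homog k f \<longleftrightarrow> scaling 2 f = const (2 powi k) * f"
proof -
  have c: "lk (const a * f) m = a * lk f m" for a m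
    unfolding const_def using mult_map_scale_conv_mult[of a f] lookup_pm_scale[of a f m]
    by (simp add: pm_scale_def)
  show ?thesis
  proof
    assume "homog k f"
    then show "scaling 2 f = const (2 powi k) * f"
      by (intro poly_mapping_eqI) (auto simp: homog_def lookup_scaling c in_keys_iff)
  next
    assume *: "scaling 2 f = const (2 powi k) * f"
    show "homog k f" unfolding homog_def
    proof
      fix m assume "m \<in> ks f"
      moreover have "2 powi wt m * lk f m = 2 powi k * lk f m"
        using arg_cong[OF *, of "\<lambda>g. lk g m"] by (simp add: lookup_scaling c)
      ultimately show "wt m = k" using powi_2_inj by (simp add: in_keys_iff)
    qed
  qed
qed

lemma scaling_inverse: "\<mu> \<noteq> 0 \<Longrightarrow> scaling \<mu> (scaling (inverse \<mu>) f) = f"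
  by (rule poly_mapping_eqI) (simp add: lookup_scaling power_int_inverse)

lemma cpoly_eval_0: "eval_at 0 (f :: 4 cpoly) = lk f 0"
proof -
  have "monval (($) 0) m = (if m = 0 then 1 else 0 :: complex)" for m :: "4 \<Rightarrow>\<^sub>0 nat"
    using monval_0_power[of m] by auto
  then show ?thesis
    by (simp add: insertion_monval in_keys_iff if_distrib[of "(*) _"] cong: if_cong)
qed

text \<open>A greatest common divisor of homogeneous polynomials that does not vanish at the origin is fixed
  by the torus up to a scalar, which is \<open>1\<close> by evaluation at the origin.\<close>

lemma gcd_homog:
  fixes p q d :: "4 cpoly"
  assumes "homog k p" "homog l q" "d dvd p" "d dvd q"
    and gcd: "\<And>e. e dvd p \<Longrightarrow> e dvd q \<Longrightarrow> e dvd d" and d0: "eval_at 0 d \<noteq> 0"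
  shows "homog 0 d"
proof -
  have dv: "scaling \<mu> d dvd d" if "\<mu> \<noteq> 0" for \<mu>
  proof -
    \<comment> \<open>A homogeneous multiple of d is an eigenvector of the substitution, hence also
      a multiple of the scaled d. So the scaled d is a common divisor.\<close>
    have "scaling \<mu> d dvd f" if f: "homog k f" "d dvd f" for k f
    proof -
      have "scaling \<mu> f = const (\<mu> powi k) * f"
      proof (rule cpoly_eqI)
        fix q show "eval_at q (scaling \<mu> f) = eval_at q (const (\<mu> powi k) * f)"
          using f \<open>\<mu> \<noteq> 0\<close> by (simp add: eval_scaling eval_torus_homog eval_simps)
      qed
      then have "f = const (\<mu> powi - k) * scaling \<mu> f"
        using \<open>\<mu> \<noteq> 0\<close>
        by (simp add: mult.assoc[symmetric] is_homD(3)[OF is_hom_const, symmetric] power_int_minus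
            is_homD(1)[OF is_hom_const])
      moreover have "scaling \<mu> d dvd scaling \<mu> f"
        using f(2) by (auto simp: dvd_def is_homD[OF is_hom_scaling])
      ultimately show ?thesis by (metis dvd_mult)
    qed
    then show ?thesis using assms by (intro gcd) blast+
  qed
  \<comment> \<open>Divisibility for the parameters 2 and 1/2 compares d with its scaling in both
    directions, so the quotient w is a unit and thus constant.\<close>
  obtain w where w: "d = scaling 2 d * w" using dv[of 2] by (auto elim: dvdE)
  obtain w' where w': "d = scaling (inverse 2) d * w'" using dv[of "inverse 2"] by (auto elim: dvdE)
  have "scaling 2 d = scaling 2 (scaling (inverse 2) d) * scaling 2 w'"
    using arg_cong[OF w', of "scaling 2"] by (simp only: is_homD[OF is_hom_scaling])
  then have "scaling 2 d = d * scaling 2 w'" by (metis scaling_inverse zero_neq_numeral)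
  with w have "d * 1 = d * (scaling 2 w' * w)" by (simp add: mult.assoc)
  moreover have "d \<noteq> 0" using d0 by (auto simp: eval_simps)
  ultimately have "w * scaling 2 w' = 1" by (metis mult.commute mult_cancel_left)
  then obtain c where c: "w = const c" using cpoly_unit_const by blast
  have "lk d 0 = lk d 0 * c"
    using arg_cong[OF w, of "eval_at 0"] by (simp add: c eval_simps cpoly_eval_0 lookup_scaling)
  then have "c = 1" using d0 by (simp add: cpoly_eval_0)
  then have "scaling 2 d = const (2 powi 0) * d"
    using w c by (simp add: is_homD(1)[OF is_hom_const])
  then show ?thesis by (simp only: homog_iff_scaling)
qed


section \<open>Evaluation of paths\<close>

text \<open>Entry, from vertex i to vertex j, of the matrix assigned to f when the arrows take the
  scalar values t. The target ring is left open: it is used over polynomials and over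
  \<open>frac_B\<close>, with arrows and with their inverses.\<close>

definition entry ::
  "('a, 'b) pre_digraph \<Rightarrow> (complex \<Rightarrow> 'c::comm_ring_1) \<Rightarrow> ('b \<Rightarrow> 'c) \<Rightarrow> ('a, 'b) qpoly \<Rightarrow> 'a \<Rightarrow> 'a \<Rightarrow> 'c"
  where "entry G \<kappa> t f j i =
    (\<Sum>p\<in>ks f. if fst p = i \<and> path_end G p = j then \<kappa> (lk f p) * prod_list (map t (snd p)) else 0)"

context
  fixes \<kappa> :: "complex \<Rightarrow> 'c::comm_ring_1" and t :: "'b \<Rightarrow> 'c" and G :: "('a, 'b) pre_digraph"
  assumes \<kappa>: "is_hom \<kappa>"
begin

lemma entry_superset:
  assumes "finite A" "ks f \<subseteq> A"
  shows "entry G \<kappa> t f j i =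
    (\<Sum>p\<in>A. if fst p = i \<and> path_end G p = j then \<kappa> (lk f p) * prod_list (map t (snd p)) else 0)"
  unfolding entry_def using assms
  by (intro sum.mono_neutral_left) (auto simp: in_keys_iff is_homD[OF \<kappa>])

lemma entry_zero: "entry G \<kappa> t 0 j i = 0" by (simp add: entry_def)

lemma entry_add: "entry G \<kappa> t (f + g) j i = entry G \<kappa> t f j i + entry G \<kappa> t g j i"
proof -
  let ?A = "ks f \<union> ks g \<union> ks (f + g)"
  have A: "finite ?A" by simp
  note s = entry_superset[OF A]
  show ?thesis
    by (subst s, blast, subst s, blast, subst s, blast)
      (auto simp: lookup_add is_homD[OF \<kappa>] algebra_simps sum.distrib[symmetric] intro!: sum.cong)
qed

lemma entry_single: "entry G \<kappa> t (sg p c) j i =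
    (if fst p = i \<and> path_end G p = j then \<kappa> c * prod_list (map t (snd p)) else 0)"
  by (subst entry_superset[of "{p}"]) auto

lemma entry_scale: "entry G \<kappa> t (pm_scale c f) j i = \<kappa> c * entry G \<kappa> t f j i"
  by (induction f rule: poly_mapping_linear_induct)
    (auto simp: entry_zero entry_add pm.scale_right_distrib entry_single pm_scale_single
      is_homD[OF \<kappa>] algebra_simps)

lemma entry_diff: "entry G \<kappa> t (f - g) j i = entry G \<kappa> t f j i - entry G \<kappa> t g j i"
  using entry_add[of "f - g" g] by simp

lemma hom_entry: "is_hom h \<Longrightarrow> h (entry G \<kappa> t f j i) = entry G (\<lambda>c. h (\<kappa> c)) (\<lambda>a. h (t a)) f j i"
  unfolding entry_def
  by (subst is_hom_sum, assumption)
    (auto intro!: sum.cong simp: is_homD is_hom_prod_list comp_def)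

end

lemma (in fin_digraph) entry_mult:
  assumes \<kappa>: "is_hom \<kappa>" and "f \<in> carrier (path_algebra G)" "g \<in> carrier (path_algebra G)"
  shows "entry G \<kappa> t (pa_mult G f g) j i = (\<Sum>k\<in>verts G. entry G \<kappa> t f j k * entry G \<kappa> t g k i)"
proof -
  note s = entry_zero[OF \<kappa>] entry_add[OF \<kappa>] entry_single[OF \<kappa>]
  have f: "ks f \<subseteq> qpaths G" and g: "ks g \<subseteq> qpaths G" using assms by (simp_all add: path_algebra_simps)
  show ?thesis
    using f
  proof (induction f rule: poly_mapping_linear_induct_on)
    case zero
    then show ?case by (simp add: s)
  next
    case (add f f')
    then show ?case by (simp add: s pa_mult_add_left sum.distrib distrib_right)
  next
    case (single p c)
    note p = this
    show ?case using g
    proof (induction g rule: poly_mapping_linear_induct_on)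
      case zero
      then show ?case by (simp add: s)
    next
      case (add g g')
      then show ?case by (simp add: s pa_mult_add_right sum.distrib distrib_left)
    next
      case (single q d)
      have "(\<Sum>k\<in>verts G. entry G \<kappa> t (sg p c) j k * entry G \<kappa> t (sg q d) k i) =
        (\<Sum>k\<in>verts G. if k = fst p then (if path_end G p = j \<and> fst q = i \<and> path_end G q = fst p
          then \<kappa> c * prod_list (map t (snd p)) * (\<kappa> d * prod_list (map t (snd q))) else 0) else 0)"
        by (intro sum.cong refl) (auto simp: s)
      also have "\<dots> = entry G \<kappa> t (pa_mult G (sg p c) (sg q d)) j i"
        using qpaths_verts[OF p]
        by (auto simp: s pa_mult_single_eq path_end_append is_homD[OF \<kappa>] algebra_simps)
      finally show ?case by simp
    qed
  qed
qed

context quiver_relations begin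

text \<open>Elements all of whose entries vanish form a two-sided ideal by
  \<open>entry_mult\<close>, and it contains the relations. All entries are taken together, since a
  product mixes them.\<close>

lemma entry_vanish:
  assumes \<kappa>: "is_hom \<kappa>" and S: "\<And>s i j. s \<in> S \<Longrightarrow> entry G \<kappa> t s j i = 0" and f: "f \<in> I"
  shows "entry G \<kappa> t f j i = 0"
proof -
  let ?J = "{f \<in> carrier P. \<forall>i j. entry G \<kappa> t f j i = 0}"
  have "ideal ?J P"
  proof (rule idealI)
    show "ring P" by (rule P.ring_axioms)
    show "subgroup ?J (add_monoid P)"
    proof (rule P.add.subgroupI)
      have "0 \<in> ?J" using P.zero_closed unfolding zero_P by (simp add: entry_zero[OF \<kappa>])
      then show "?J \<noteq> {}" by blast
    next
      fix a assume a: "a \<in> ?J"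
      then have "\<ominus>\<^bsub>P\<^esub> a = 0 - a" using minus_P[of a] by simp
      moreover have "\<ominus>\<^bsub>P\<^esub> a \<in> carrier P" using a P.a_inv_closed by blast
      ultimately show "\<ominus>\<^bsub>P\<^esub> a \<in> ?J"
        using a by (auto simp: entry_diff[OF \<kappa>] entry_zero[OF \<kappa>] simp del: diff_0)
    next
      fix a b assume "a \<in> ?J" "b \<in> ?J"
      moreover from this have "a \<oplus>\<^bsub>P\<^esub> b \<in> carrier P" by blast
      ultimately show "a \<oplus>\<^bsub>P\<^esub> b \<in> ?J"
        by (auto simp: path_algebra_simps(3) entry_add[OF \<kappa>])
    qed auto
  next
    fix a x assume a: "a \<in> ?J" "x \<in> carrier P"
    then have c: "x \<otimes>\<^bsub>P\<^esub> a \<in> carrier P" "a \<otimes>\<^bsub>P\<^esub> x \<in> carrier P" by (blast intro: P.m_closed)+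
    have "entry G \<kappa> t (x \<otimes>\<^bsub>P\<^esub> a) j i = 0" "entry G \<kappa> t (a \<otimes>\<^bsub>P\<^esub> x) j i = 0" for i j
      using a by (simp_all only: path_algebra_simps(2) mem_Collect_eq entry_mult[OF \<kappa>] mult_zero_left
          mult_zero_right sum.neutral_const)
    with c show "x \<otimes>\<^bsub>P\<^esub> a \<in> ?J" "a \<otimes>\<^bsub>P\<^esub> x \<in> ?J" by blast+
  qed
  then have "I \<subseteq> ?J" using S rel_carrier by (intro P.genideal_minimal) auto
  with f show ?thesis by blast
qed

lemma entry_qclass:
  assumes \<kappa>: "is_hom \<kappa>" and S: "\<And>s i j. s \<in> S \<Longrightarrow> entry G \<kappa> t s j i = 0"
    and "f \<in> carrier P" "f' \<in> qclass G S f"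
  shows "entry G \<kappa> t f' j i = entry G \<kappa> t f j i"
  using entry_vanish[OF \<kappa> S qclass_repr(2)[OF assms(3,4)], of j i] by (simp add: entry_diff[OF \<kappa>])

end

subsection \<open>The matrix representation of a quiver with two vertices\<close>

definition mat_entry :: "2 \<Rightarrow> 2 \<Rightarrow> frac_B \<Rightarrow> frac_B ^ 2 ^ 2" where
  "mat_entry i j c = (\<chi> k l. if k = i \<and> l = j then c else 0)"

lemma mat_mult_unit: "mat c ** mat_unit i j = mat_entry i j c"
  by (auto simp: vec_eq_iff matrix_matrix_mult_def mat_def mat_unit_def mat_entry_def sum_2 forall_2)

lemma mat_entry_mult: "mat_entry i j c ** mat_entry j k d = mat_entry i k (c * d)"
  using exhaust_2[of j]
  by (auto simp: vec_eq_iff matrix_matrix_mult_def mat_entry_def sum_2)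

lemma mat_unit_entry: "mat_unit i j = mat_entry i j 1"
  by (simp add: mat_unit_def mat_entry_def)

lemma mat_mult_entry: "mat c ** mat_entry i j d = mat_entry i j (c * d)"
  by (simp add: mat_mult_unit[symmetric] matrix_mul_assoc[symmetric])
    (auto simp: vec_eq_iff matrix_matrix_mult_def mat_def mat_unit_def mat_entry_def sum_2 forall_2)

lemma (in fin_digraph) path_matrix_eq:
  fixes t :: "'b \<Rightarrow> frac_B"
  assumes "\<And>a. a \<in> arcs G' \<Longrightarrow> T a = mat (t a) ** mat_unit (head G' a) (tail G' a)"
    "pre_digraph.awalk G' u es v" "fin_digraph G'"
  shows "path_matrix T (u, es) = mat_entry v u (prod_list (map t es))"
  using assms(2)
\<comment> \<open>Reverse induction, as \<open>fold\<close> multiplies by the last arrow from the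
  left.\<close>
proof (induction es arbitrary: v rule: rev_induct)
  interpret G': fin_digraph G' by (rule assms(3))
  case Nil
  then show ?case by (simp add: path_matrix_def mat_unit_entry G'.awalk_Nil_iff)
next
  interpret G': fin_digraph G' by (rule assms(3))
  case (snoc a es)
  then have a: "G'.awalk u es (tail G' a)" "a \<in> arcs G'" "v = head G' a"
    by (auto simp: G'.awalk_Cons_iff G'.awalk_Nil_iff)
  then show ?case
    using snoc.IH[OF a(1)] assms(1)[OF a(2)]
    by (simp add: path_matrix_def mat_mult_unit mat_entry_mult mult.commute)
qed

text \<open>Couples the matrices T of the definitions with the scalar values t, in which the
  relations are easier to verify.\<close>

locale two_vertex_relations = quiver_relations G S
  for G :: "(2, 'b) pre_digraph" and S +
  fixes T :: "'b \<Rightarrow> frac_B ^ 2 ^ 2" and t :: "'b \<Rightarrow> frac_B"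
  assumes T: "\<And>a. a \<in> arcs G \<Longrightarrow> T a = mat (t a) ** mat_unit (head G a) (tail G a)"
    and hom: "is_hom frac_const"
    and S: "\<And>s i j. s \<in> S \<Longrightarrow> entry G frac_const t s j i = 0"
begin

lemma path_sum_eq:
  assumes "f \<in> carrier P"
  shows "(\<Sum>p\<in>ks f. mat (frac_const (lk f p)) ** path_matrix T p) $ j $ i = entry G frac_const t f j i"
proof -
  have "(mat (frac_const (lk f p)) ** path_matrix T p) $ j $ i =
    (if fst p = i \<and> path_end G p = j then frac_const (lk f p) * prod_list (map t (snd p)) else 0)"
    if "p \<in> ks f" for p
  proof -
    have "p \<in> qpaths G" using that assms by (auto simp: path_algebra_simps)
    then have "awalk (fst p) (snd p) (path_end G p)" by (metis awalk_path_end qpaths_iff)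
    from path_matrix_eq[OF T this fin_digraph_axioms]
    show ?thesis by (auto simp: mat_mult_entry) (auto simp: mat_entry_def)
  qed
  then show ?thesis by (simp add: entry_def sum_component)
qed

text \<open>\<open>the_elem\<close> is meaningful because the matrix sum is constant on a residue
  class, by \<open>entry_qclass\<close>.\<close>

lemma tau_ext_qclass:
  assumes f: "f \<in> carrier P"
  shows "tau_ext T (qclass G S f) $ j $ i = entry G frac_const t f j i"
proof -
  let ?F = "\<lambda>f. \<Sum>p\<in>ks f. mat (frac_const (lk f p)) ** path_matrix T p"
  have "?F f' = ?F f" if "f' \<in> qclass G S f" for f'
    using path_sum_eq[OF f] path_sum_eq[OF qclass_repr(1)[OF f that]] entry_qclass[OF hom S f that]
    by (simp add: vec_eq_iff)
  then have "?F ` qclass G S f = {?F f}" using qclass_self[OF f] by blast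
  then show ?thesis using path_sum_eq[OF f] by (simp add: tau_ext_def)
qed

end

definition frac :: "4 cpoly \<Rightarrow> frac_B" where "frac f = Fract f 1"

lemma is_hom_frac: "is_hom frac"
  by (simp add: is_hom_def frac_def One_fract_def)

lemma frac_const_eq: "frac_const c = frac (const c)" by (simp add: frac_const_def frac_def const_def)
lemma frac_var_eq: "frac_var i = frac (var i)" by (simp add: frac_var_def frac_def var_def)

lemma is_hom_frac_const: "is_hom frac_const"
  using is_hom_comp[OF is_hom_frac is_hom_const] by (simp add: frac_const_eq[abs_def])

lemma inj_frac: "frac f = frac g \<longleftrightarrow> f = g" by (simp add: frac_def eq_fract)

section \<open>The conifold algebra as a matrix algebra\<close>

abbreviation "cq \<equiv> conifold_quiver"
abbreviation "cr \<equiv> conifold_relations conifold_quiver id"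
abbreviation "CA \<equiv> conifold_algebra"

lemma two_distinct [simp]: "(1::2) \<noteq> 2" "(2::2) \<noteq> 1" by simp_all

lemma cq_simps [simp]:
  "verts cq = UNIV" "arcs cq = UNIV" "tail cq (Aarr i) = 1" "head cq (Aarr i) = 2"
  "tail cq (Barr i) = 2" "head cq (Barr i) = 1"
  by (simp_all add: conifold_quiver_def)

lemma finite_conifold_arrow: "finite (UNIV :: conifold_arrow set)"
proof -
  have "(UNIV :: conifold_arrow set) = range Aarr \<union> range Barr" by (auto simp: image_iff) (metis conifold_arrow.exhaust)
  then show ?thesis by (metis finite_UnI finite_imageI finite_class.finite_UNIV)
qed

text \<open>The two families merge into one: a and c, leaving the same vertex, may be exchanged
  around any b that continues them. Lists are in traversal order, so the product a b c is the list
  starting with c.\<close>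

lemma conifold_relations_eq:
  assumes "\<And>i. tail G (\<iota> (Aarr i)) = 1" "\<And>i. head G (\<iota> (Aarr i)) = 2"
    "\<And>i. tail G (\<iota> (Barr i)) = 2" "\<And>i. head G (\<iota> (Barr i)) = 1"
  shows "conifold_relations G \<iota> =
    {sg (tail G (\<iota> c), [\<iota> c, \<iota> b, \<iota> a]) 1 - sg (tail G (\<iota> a), [\<iota> a, \<iota> b, \<iota> c]) 1 |a b c.
      tail cq a = tail cq c \<and> tail cq b = head cq a}"
proof -
  have 1: "conifold_relations G \<iota> =
    {sg (1, [\<iota> (Aarr k), \<iota> (Barr j), \<iota> (Aarr i)]) 1 - sg (1, [\<iota> (Aarr i), \<iota> (Barr j), \<iota> (Aarr k)]) 1 |i j k. True} \<union>
    {sg (2, [\<iota> (Barr k), \<iota> (Aarr j), \<iota> (Barr i)]) 1 - sg (2, [\<iota> (Barr i), \<iota> (Aarr j), \<iota> (Barr k)]) 1 |i j k. True}"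
    unfolding conifold_relations_def Let_def path_algebra_simps arr_def
    by (simp add: pa_mult_single_eq path_end_def assms)
  show ?thesis
  proof (intro equalityI subsetI)
    fix f :: "(2, _) qpoly" assume "f \<in> conifold_relations G \<iota>"
    then show "f \<in> {sg (tail G (\<iota> c), [\<iota> c, \<iota> b, \<iota> a]) 1 - sg (tail G (\<iota> a), [\<iota> a, \<iota> b, \<iota> c]) 1 |a b c.
      tail cq a = tail cq c \<and> tail cq b = head cq a}"
      unfolding 1 Un_iff mem_Collect_eq
    proof (elim disjE exE conjE)
      fix i j k assume "f = sg (1, [\<iota> (Aarr k), \<iota> (Barr j), \<iota> (Aarr i)]) 1 - sg (1, [\<iota> (Aarr i), \<iota> (Barr j), \<iota> (Aarr k)]) 1"
      then show "\<exists>a b c. f = sg (tail G (\<iota> c), [\<iota> c, \<iota> b, \<iota> a]) 1 - sg (tail G (\<iota> a), [\<iota> a, \<iota> b, \<iota> c]) 1 \<and>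
        tail cq a = tail cq c \<and> tail cq b = head cq a"
        by (intro exI[of _ "Aarr i"] exI[of _ "Barr j"] exI[of _ "Aarr k"]) (simp add: assms)
    next
      fix i j k assume "f = sg (2, [\<iota> (Barr k), \<iota> (Aarr j), \<iota> (Barr i)]) 1 - sg (2, [\<iota> (Barr i), \<iota> (Aarr j), \<iota> (Barr k)]) 1"
      then show "\<exists>a b c. f = sg (tail G (\<iota> c), [\<iota> c, \<iota> b, \<iota> a]) 1 - sg (tail G (\<iota> a), [\<iota> a, \<iota> b, \<iota> c]) 1 \<and>
        tail cq a = tail cq c \<and> tail cq b = head cq a"
        by (intro exI[of _ "Barr i"] exI[of _ "Aarr j"] exI[of _ "Barr k"]) (simp add: assms)
    qed
  next
    fix f :: "(2, _) qpoly" assume "f \<in> {sg (tail G (\<iota> c), [\<iota> c, \<iota> b, \<iota> a]) 1 - sg (tail G (\<iota> a), [\<iota> a, \<iota> b, \<iota> c]) 1 |a b c.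
      tail cq a = tail cq c \<and> tail cq b = head cq a}"
    then obtain a b c where f: "f = sg (tail G (\<iota> c), [\<iota> c, \<iota> b, \<iota> a]) 1 - sg (tail G (\<iota> a), [\<iota> a, \<iota> b, \<iota> c]) 1"
      and t: "tail cq a = tail cq c" "tail cq b = head cq a" by blast
    show "f \<in> conifold_relations G \<iota>"
      unfolding 1 f using t by (cases a; cases b; cases c) (simp_all add: assms, blast+)
  qed
qed

lemma fin_digraph_cq: "fin_digraph cq"
  by unfold_locales (simp_all add: finite_conifold_arrow)

global_interpretation cf: quiver_relations cq cr
proof -
  interpret fin_digraph cq by (rule fin_digraph_cq)
  show "quiver_relations cq cr"
  proof
    show "cr \<subseteq> carrier (path_algebra cq)"
    proof
      fix f assume "f \<in> cr"
      then obtain a b c where f: "f = sg (tail cq c, [c, b, a]) 1 - sg (tail cq a, [a, b, c]) 1"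
        and t: "tail cq a = tail cq c" "tail cq b = head cq a"
        by (subst (asm) conifold_relations_eq) auto
      have "(tail cq c, [c, b, a]) \<in> qpaths cq" "(tail cq a, [a, b, c]) \<in> qpaths cq"
        using t by (cases a; cases b; cases c; auto simp: qpaths_iff awalk_Cons_iff awalk_Nil_iff)+
      moreover have "ks f \<subseteq> {(tail cq c, [c, b, a]), (tail cq a, [a, b, c])}"
        unfolding f by (auto simp: in_keys_iff lookup_minus lookup_single when_def split: if_splits)
      ultimately show "f \<in> carrier (path_algebra cq)" by (auto simp: path_algebra_simps)
    qed
  qed
qed

lemma CA_eq: "CA = quiver_algebra cq cr" by (simp add: conifold_algebra_def)

definition aidx :: "conifold_arrow \<Rightarrow> 4" where
  "aidx a = (case a of Aarr i \<Rightarrow> if i = 1 then 1 else 2 | Barr i \<Rightarrow> if i = 1 then 3 else 4)"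

lemma aidx_simps [simp]: "aidx (Aarr 1) = 1" "aidx (Aarr 2) = 2" "aidx (Barr 1) = 3" "aidx (Barr 2) = 4"
  by (simp_all add: aidx_def)

lemma arrow_exhaust: "a = Aarr 1 \<or> a = Aarr 2 \<or> a = Barr 1 \<or> a = Barr 2"
  by (cases a) (use exhaust_2 in auto)

lemma inj_aidx: "aidx a = aidx b \<longleftrightarrow> a = b"
  using arrow_exhaust[of a] arrow_exhaust[of b] by auto

lemma aidx_surj: "\<exists>a. aidx a = k"
  using exhaust_4[of k] aidx_simps by metis

abbreviation arrow_poly :: "conifold_arrow \<Rightarrow> 4 cpoly" where "arrow_poly a \<equiv> var (aidx a)"

lemma arrow_var_eq: "arrow_var a = frac (arrow_poly a)"
  by (simp add: arrow_var_def aidx_def frac_var_eq split: conifold_arrow.split)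

lemma entry_cr:
  assumes "is_hom \<kappa>" "s \<in> cr" shows "entry cq \<kappa> t s j i = 0"
proof -
  obtain a b c where f: "s = sg (tail cq c, [c, b, a]) 1 - sg (tail cq a, [a, b, c]) 1"
    and t: "tail cq a = tail cq c" "tail cq b = head cq a"
    using assms(2) by (subst (asm) conifold_relations_eq) auto
  have "head cq a = head cq c" using t by (cases a; cases c) auto
  then show ?thesis
    by (simp add: f entry_diff[OF assms(1)] entry_single[OF assms(1)] path_end_def t mult_ac)
qed

global_interpretation cft: two_vertex_relations cq cr tau_arrow arrow_var
  by unfold_locales (simp_all add: tau_arrow_def is_hom_frac_const entry_cr)

abbreviation "pent \<equiv> entry cq const arrow_poly"

text \<open>This is \<open>tau\<close> before passing to fractions, see \<open>tau_eq_mt\<close>. By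
  \<open>mt_qclass\<close> every representative gives the same polynomials.\<close>

definition mt :: "conifold_elem \<Rightarrow> 2 \<Rightarrow> 2 \<Rightarrow> 4 cpoly" where
  "mt X = pent (SOME f. f \<in> X)"

lemma mt_qclass: assumes "f \<in> carrier cf.P" shows "mt (qclass cq cr f) j i = pent f j i"
proof -
  have "(SOME g. g \<in> qclass cq cr f) \<in> qclass cq cr f"
    using cf.qclass_self[OF assms] by (rule someI)
  from cf.entry_qclass[OF is_hom_const entry_cr[OF is_hom_const] assms this] show ?thesis
    by (simp add: mt_def)
qed

lemma CA_carrierE:
  assumes "X \<in> carrier CA" obtains f where "f \<in> carrier cf.P" "X = qclass cq cr f"
  using assms by (auto simp: CA_eq cf.carrier_QA)

lemma ring_CA: "ring CA" using cf.ring_QA by (simp add: CA_eq)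

global_interpretation CA: ring CA by (rule ring_CA)

lemma mt_mult:
  assumes "X \<in> carrier CA" "Y \<in> carrier CA"
  shows "mt (X \<otimes>\<^bsub>CA\<^esub> Y) j i = mt X j 1 * mt Y 1 i + mt X j 2 * mt Y 2 i"
proof -
  obtain f g where f: "f \<in> carrier cf.P" "X = qclass cq cr f" and g: "g \<in> carrier cf.P" "Y = qclass cq cr g"
    using assms by (meson CA_carrierE)
  have "pa_mult cq f g \<in> carrier cf.P"
    using cf.pa_mult_closed f(1) g(1) by (simp add: path_algebra_simps)
  then show ?thesis
    using f g by (simp add: CA_eq cf.qclass_ops mt_qclass cf.entry_mult[OF is_hom_const] sum_2)
qed

lemma mt_add:
  assumes "X \<in> carrier CA" "Y \<in> carrier CA"
  shows "mt (X \<oplus>\<^bsub>CA\<^esub> Y) j i = mt X j i + mt Y j i"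
proof -
  obtain f g where f: "f \<in> carrier cf.P" "X = qclass cq cr f" and g: "g \<in> carrier cf.P" "Y = qclass cq cr g"
    using assms by (meson CA_carrierE)
  have "f + g \<in> carrier cf.P"
    using keys_add_subset f(1) g(1) by (simp add: path_algebra_simps)
  then show ?thesis
    using f g by (simp add: CA_eq cf.qclass_ops mt_qclass entry_add)
qed

lemma mt_scale:
  assumes "X \<in> carrier CA" shows "mt (c \<odot>\<^bsub>CA\<^esub> X) j i = const c * mt X j i"
    "c \<odot>\<^bsub>CA\<^esub> X \<in> carrier CA"
proof -
  obtain f where f: "f \<in> carrier cf.P" "X = qclass cq cr f" using assms by (meson CA_carrierE)
  then show "mt (c \<odot>\<^bsub>CA\<^esub> X) j i = const c * mt X j i"
    using cf.pm_scale_closed[OF f(1)] by (simp add: CA_eq cf.qclass_ops mt_qclass entry_scale)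
  show "c \<odot>\<^bsub>CA\<^esub> X \<in> carrier CA"
    using f cf.pm_scale_closed[OF f(1)] by (simp add: CA_eq cf.qclass_ops cf.carrier_QA)
qed

lemma vtx_carrier: "vtx i \<in> carrier cf.P"
  by (simp add: vtx_def path_algebra_simps cf.vtx_in_qpaths)

lemma arr_carrier: "arr cq a \<in> carrier cf.P"
  by (simp add: arr_def path_algebra_simps cf.qpaths_iff cf.awalk_Cons_iff cf.awalk_Nil_iff)

lemma vtx_CA: "cf_vtx i \<in> carrier CA"
  using vtx_carrier by (simp add: CA_eq cf.carrier_QA cf_vtx_def)

lemma arr_CA: "cf_arr a \<in> carrier CA"
  using arr_carrier by (simp add: CA_eq cf.carrier_QA cf_arr_def)

lemma mt_vtx: "mt (cf_vtx k) j i = (if i = k \<and> j = k then 1 else 0)"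
  using vtx_carrier[of k] is_homD(1)[OF is_hom_const]
  by (auto simp: cf_vtx_def mt_qclass) (auto simp: vtx_def entry_single path_end_def)

lemma mt_arr: "mt (cf_arr a) j i = (if i = tail cq a \<and> j = head cq a then arrow_poly a else 0)"
  using arr_carrier[of a] is_homD(1)[OF is_hom_const]
  by (auto simp: cf_arr_def mt_qclass) (auto simp: arr_def entry_single path_end_def)

lemma mt_one: "mt \<one>\<^bsub>CA\<^esub> j i = (if i = j then 1 else 0)"
proof -
  have "\<one>\<^bsub>CA\<^esub> = qclass cq cr (\<Sum>v\<in>UNIV. sg (v, []) 1)"
    using cf.qclass_ops(3)[OF vtx_carrier vtx_carrier] by (simp add: CA_eq)
  moreover have "(\<Sum>v\<in>(UNIV::2 set). sg (v, []) 1) \<in> carrier cf.P"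
    using cf.ks_one by (simp add: path_algebra_simps)
  ultimately show ?thesis
    using exhaust_2[of i] exhaust_2[of j] is_homD(1)[OF is_hom_const]
    by (auto simp: mt_qclass sum_2 entry_add entry_single path_end_def)
qed

lemma mt_zero: "mt \<zero>\<^bsub>CA\<^esub> j i = 0"
proof -
  have "\<zero>\<^bsub>CA\<^esub> = qclass cq cr 0"
    using cf.qclass_ops(4)[OF vtx_carrier vtx_carrier] by (simp add: CA_eq)
  moreover have "0 \<in> carrier cf.P" by (simp add: path_algebra_simps)
  ultimately show ?thesis by (simp add: mt_qclass entry_zero)
qed

lemma tau_eq_mt: assumes "X \<in> carrier CA" shows "tau X $ j $ i = frac (mt X j i)"
proof -
  obtain f where f: "f \<in> carrier cf.P" "X = qclass cq cr f" using assms by (meson CA_carrierE)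
  have "frac (pent f j i) = entry cq frac_const arrow_var f j i"
    unfolding hom_entry[OF is_hom_const is_hom_frac] frac_const_eq[abs_def] arrow_var_eq[abs_def] ..
  then show ?thesis using f cft.tau_ext_qclass[OF f(1)] by (simp add: tau_def mt_qclass)
qed

text \<open>A potential on the vertices: the weight of an arrow is the difference of the values at
  its ends, so path weights telescope.\<close>

definition wd :: "2 \<Rightarrow> int" where "wd i = (if i = 1 then 0 else 1)"

lemma wd_simps [simp]: "wd 1 = 0" "wd 2 = 1" by (simp_all add: wd_def)

definition path_mon :: "conifold_arrow list \<Rightarrow> (4 \<Rightarrow>\<^sub>0 nat)" where
  "path_mon es = (\<Sum>a\<leftarrow>es. sg (aidx a) 1)"

lemma path_mon_simps [simp]: "path_mon [] = 0" "path_mon (a # es) = sg (aidx a) 1 + path_mon es"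
  by (simp_all add: path_mon_def)

lemma prod_list_path: "prod_list (map arrow_poly es) = sg (path_mon es) 1"
  by (induction es) (simp_all add: var_def mult_single)

lemma lookup_path_mon: "lk (path_mon es) (aidx a) = count (mset es) a"
  by (induction es) (auto simp: lookup_add lookup_single when_def inj_aidx)

text \<open>\<open>aidx\<close> matches arrows with variables bijectively, so the commutative
  monomial of a path remembers exactly how often each arrow occurs.\<close>

lemma path_mon_eq_iff: "path_mon es = path_mon fs \<longleftrightarrow> mset es = mset fs"
proof
  assume "path_mon es = path_mon fs"
  then show "mset es = mset fs" by (metis lookup_path_mon multiset_eqI)
next
  assume *: "mset es = mset fs"
  show "path_mon es = path_mon fs"
  proof (rule poly_mapping_eqI)
    fix k obtain a where "aidx a = k" using aidx_surj by blast
    then show "lk (path_mon es) k = lk (path_mon fs) k" using * by (metis lookup_path_mon)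
  qed
qed

lemma wt_arrow: "wt (sg (aidx a) 1) = wd (head cq a) - wd (tail cq a)"
proof (cases a)
  case (Aarr i)
  then show ?thesis using exhaust_2[of i] by (auto simp: wt_def lookup_single)
next
  case (Barr i)
  then show ?thesis using exhaust_2[of i] by (auto simp: wt_def lookup_single)
qed

lemma wt_path: "cf.awalk u es v \<Longrightarrow> wt (path_mon es) = wd v - wd u"
  by (induction es arbitrary: u) (auto simp: cf.awalk_Nil_iff cf.awalk_Cons_iff wt_arrow[simplified])

lemma pent_single: "pent (sg p c) j i =
    (if fst p = i \<and> path_end cq p = j then sg (path_mon (snd p)) c else 0)"
  by (simp add: entry_single prod_list_path const_def mult_single)

lemma pent_homog: assumes "f \<in> carrier cf.P" shows "homog (wd j - wd i) (pent f j i)"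
proof -
  have "ks f \<subseteq> qpaths cq" using assms by (simp add: path_algebra_simps)
  then show ?thesis
  proof (induction f rule: poly_mapping_linear_induct_on)
    case (single p c)
    then have "cf.awalk (fst p) (snd p) (path_end cq p)"
      by (metis cf.awalk_path_end cf.qpaths_iff)
    from wt_path[OF this] show ?case by (auto simp: pent_single intro: homog_singleI)
  qed (auto simp: entry_zero entry_add homog_add)
qed

lemma mt_homog: "X \<in> carrier CA \<Longrightarrow> homog (wd j - wd i) (mt X j i)"
  by (erule CA_carrierE) (simp add: mt_qclass pent_homog)

subsection \<open>The matrix representation is faithful\<close>

text \<open>Arrows two steps apart may be exchanged, so a path is determined by its start and its arrows.\<close>

definition path_cong :: "2 \<Rightarrow> conifold_arrow list \<Rightarrow> conifold_arrow list \<Rightarrow> bool" where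
  "path_cong u es fs \<longleftrightarrow> sg (u, es) 1 - sg (u, fs) 1 \<in> cf.I"

lemma path_cong_refl: "path_cong u es es"
  using cf.I_closed(1) by (simp add: path_cong_def)

lemma path_cong_trans: "path_cong u es fs \<Longrightarrow> path_cong u fs gs \<Longrightarrow> path_cong u es gs"
  using cf.I_closed(2)[of "sg (u, es) 1 - sg (u, fs) 1" "sg (u, fs) 1 - sg (u, gs) 1"]
  by (simp add: path_cong_def)

lemma pa_mult_diff_left: "pa_mult G (f - g) h = pa_mult G f h - pa_mult G g h"
  using pa_mult_add_left[of G "f - g" g h] by simp

lemma pa_mult_diff_right: "pa_mult G h (f - g) = pa_mult G h f - pa_mult G h g"
  using pa_mult_add_right[of G h "f - g" g] by simp

lemma path_cong_Cons:
  assumes "path_cong (head cq c) es fs" "tail cq c = u" shows "path_cong u (c # es) (c # fs)"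
proof -
  have "pa_mult cq (sg (head cq c, es) 1 - sg (head cq c, fs) 1) (arr cq c) \<in> cf.I"
    by (rule cf.I_closed(4)[OF assms(1)[unfolded path_cong_def] arr_carrier])
  then show ?thesis
    by (simp add: path_cong_def pa_mult_diff_left pa_mult_single_eq arr_def path_end_def assms(2))
qed

lemma path_cong_append:
  assumes "path_cong u es fs" "cf.awalk v gs w" "path_end cq (u, es) = v" "path_end cq (u, fs) = v"
  shows "path_cong u (es @ gs) (fs @ gs)"
proof -
  have "sg (v, gs) 1 \<in> carrier cf.P"
    using assms(2) by (auto simp: path_algebra_simps cf.qpaths_iff)
  then have "pa_mult cq (sg (v, gs) 1) (sg (u, es) 1 - sg (u, fs) 1) \<in> cf.I"
    by (rule cf.I_closed(3)[OF assms(1)[unfolded path_cong_def]])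
  then show ?thesis
    by (simp add: path_cong_def pa_mult_diff_right pa_mult_single_eq assms(3,4))
qed

lemma cr_mem:
  assumes "tail cq a = tail cq c" "tail cq b = head cq a"
  shows "sg (tail cq c, [c, b, a]) 1 - sg (tail cq a, [a, b, c]) 1 \<in> cr"
proof -
  have eq: "cr = {sg (tail cq c, [c, b, a]) 1 - sg (tail cq a, [a, b, c]) 1 |a b c.
      tail cq a = tail cq c \<and> tail cq b = head cq a}"
    by (subst conifold_relations_eq) simp_all
  show ?thesis unfolding eq using assms by blast
qed

text \<open>A defining relation applied to the first three arrows, then multiplied by the rest
  r.\<close>

lemma path_cong_swap:
  assumes "cf.awalk u (d # e # c # r) v" shows "path_cong u (d # e # c # r) (c # e # d # r)"
proof -
  have t: "tail cq d = u" "tail cq e = head cq d" "tail cq c = head cq e" "cf.awalk (head cq c) r v"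
    using assms by (auto simp: cf.awalk_Cons_iff)
  have t': "tail cq c = u" "head cq d = head cq c" using t by (cases d; cases e; cases c; auto)+
  have "tail cq c = tail cq d" "tail cq e = head cq c" using t t' by simp_all
  then have "sg (tail cq d, [d, e, c]) 1 - sg (tail cq c, [c, e, d]) 1 \<in> cr"
    by (rule cr_mem)
  then have "path_cong u [d, e, c] [c, e, d]"
    using cf.S_subset_I t t' by (auto simp: path_cong_def)
  from path_cong_append[OF this t(4)] show ?thesis
    using t' by (simp add: path_end_def)
qed

text \<open>Vertices alternate, so the arrows leaving u occupy every second place. Unless c is
  already first, induction on the path after two arrows brings it to third place, and
  \<open>path_cong_swap\<close> moves it to the front.\<close>

lemma path_cong_front:
  "cf.awalk u es v \<Longrightarrow> c \<in> set es \<Longrightarrow> tail cq c = u \<Longrightarrow>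
    \<exists>es'. path_cong u es (c # es') \<and> mset es = mset (c # es') \<and> cf.awalk u (c # es') v"
proof (induction "length es" arbitrary: es u rule: less_induct)
  case less
  obtain d es1 where es: "es = d # es1" using less.prems(2) by (cases es) auto
  show ?case
  proof (cases "d = c")
    case True
    then show ?thesis using es less.prems path_cong_refl by blast
  next
    case False
    then obtain e es2 where es1: "es1 = e # es2" using less.prems(2) es by (cases es1) auto
    have t: "tail cq d = u" "tail cq e = head cq d" "cf.awalk (head cq e) es2 v"
      using less.prems(1) by (auto simp: es es1 cf.awalk_Cons_iff)
    have t': "head cq e = u" "e \<noteq> c"
      using t less.prems(3) by (cases d; cases e; cases c; auto)+
    then have "c \<in> set es2" using False less.prems(2) es es1 by auto
    then obtain r where r: "path_cong u es2 (c # r)" "mset es2 = mset (c # r)" "cf.awalk u (c # r) v"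
      using less.hyps[of es2 u] t t' less.prems(3) es es1 by auto
    have w: "cf.awalk u (d # e # c # r) v"
      using r(3) t t' by (simp add: cf.awalk_Cons_iff)
    have "path_cong u es (d # e # c # r)"
      unfolding es es1 using r(1) t t' by (intro path_cong_Cons) auto
    then have "path_cong u es (c # e # d # r)" using path_cong_swap[OF w] path_cong_trans by blast
    moreover have "cf.awalk u (c # e # d # r) v"
      using w by (cases d; cases e; cases c) (auto simp: cf.awalk_Cons_iff)
    moreover have "mset es = mset (c # e # d # r)" using r(2) es es1 by simp
    ultimately show ?thesis by blast
  qed
qed

text \<open>The first arrow of fs occurs in es and leaves u; it is brought to the front of es and
  cancelled.\<close>

lemma path_cong_mset:
  "cf.awalk u es v \<Longrightarrow> cf.awalk u fs w \<Longrightarrow> mset es = mset fs \<Longrightarrow> path_cong u es fs"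
proof (induction fs arbitrary: u es)
  case Nil
  then show ?case by (simp add: path_cong_refl)
next
  case (Cons c fs)
  have "tail cq c = u" using Cons.prems(2) by (simp add: cf.awalk_Cons_iff)
  moreover have "c \<in> set es" using Cons.prems(3) by (metis list.set_intros(1) set_mset_mset)
  ultimately obtain es' where es': "path_cong u es (c # es')" "mset es = mset (c # es')"
      "cf.awalk u (c # es') v"
    using path_cong_front Cons.prems(1) by blast
  have "path_cong (head cq c) es' fs"
    using Cons.IH[of "head cq c" es'] es' Cons.prems by (simp add: cf.awalk_Cons_iff)
  then have "path_cong u (c # es') (c # fs)" using path_cong_Cons \<open>tail cq c = u\<close> by blast
  then show ?case using es'(1) path_cong_trans by blast
qed

lemma lookup_pent:
  "lk (pent f j i) m = (\<Sum>p\<in>ks f. if fst p = i \<and> path_end cq p = j \<and> path_mon (snd p) = m then lk f p else 0)"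
  unfolding entry_def lookup_sum
  by (intro sum.cong) (auto simp: prod_list_path const_def mult_single lookup_single when_def)

text \<open>A path p in f cannot be alone with its endpoints and monomial, for its coefficient would
  survive in the entry. Subtracting a multiple of p minus a partner q, which lies in the ideal,
  removes p from the support and adds nothing.\<close>

lemma pent_zero_in_ideal:
  assumes "f \<in> carrier cf.P" "\<And>i j. pent f j i = 0" shows "f \<in> cf.I"
  using assms
proof (induction "card (ks f)" arbitrary: f rule: less_induct)
  case less
  show ?case
  proof (cases "f = 0")
    case True
    then show ?thesis using cf.I_closed(1) by simp
  next
    case False
    then obtain p where p: "p \<in> ks f" by (metis ex_in_conv keys_eq_empty)
    let ?c = "lk f p"
    have c: "?c \<noteq> 0" using p by (simp add: in_keys_iff)
    have "\<exists>q\<in>ks f. q \<noteq> p \<and> fst q = fst p \<and> path_end cq q = path_end cq p \<and> path_mon (snd q) = path_mon (snd p)"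
    proof (rule ccontr)
      assume *: "\<not> ?thesis"
      have "lk (pent f (path_end cq p) (fst p)) (path_mon (snd p)) = (\<Sum>q\<in>ks f. if q = p then lk f p else 0)"
        unfolding lookup_pent using * by (intro sum.cong refl) auto
      then show False using less.prems(2) c p by simp
    qed
    then obtain q where q: "q \<in> ks f" "q \<noteq> p" "fst q = fst p" "path_end cq q = path_end cq p"
      "path_mon (snd q) = path_mon (snd p)" by blast
    have pq: "p \<in> qpaths cq" "q \<in> qpaths cq" using p q less.prems(1) by (auto simp: path_algebra_simps)
    then have "path_cong (fst p) (snd p) (snd q)"
      using q by (auto simp: cf.qpaths_iff path_mon_eq_iff intro: path_cong_mset)
    then have "sg p 1 - sg q 1 \<in> cf.I" using q(3) by (metis path_cong_def prod.collapse)
    then have "pm_scale ?c (sg p 1 - sg q 1) \<in> cf.I" by (rule cf.scale_in_I)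
    moreover define g where "g = f - pm_scale ?c (sg p 1 - sg q 1)"
    moreover have "g \<in> cf.I"
    proof (rule less.hyps)
      have sub: "ks g \<subseteq> ks f - {p}"
        using q(1,2) p by (auto simp: g_def in_keys_iff lookup_minus lookup_pm_scale lookup_single when_def
            split: if_splits)
      then show "card (ks g) < card (ks f)" using p by (metis card_Diff1_less card_mono finite_Diff finite_keys le_less_trans)
      show "g \<in> carrier cf.P" using sub less.prems(1) by (auto simp: path_algebra_simps)
      show "pent g j i = 0" for i j
        by (simp add: g_def entry_diff entry_scale less.prems(2) entry_single pent_single q)
    qed
    ultimately show ?thesis
      using cf.I_closed(2)[of g "pm_scale ?c (sg p 1 - sg q 1)"] by simp
  qed
qed

text \<open>Faithfulness of the impression; together with \<open>mt_surj\<close> it identifies the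
  algebra with the matrices of graded polynomials.\<close>

lemma mt_inj:
  assumes "X \<in> carrier CA" "Y \<in> carrier CA" "\<And>i j. mt X j i = mt Y j i" shows "X = Y"
proof -
  obtain f g where f: "f \<in> carrier cf.P" "X = qclass cq cr f" and g: "g \<in> carrier cf.P" "Y = qclass cq cr g"
    using assms by (meson CA_carrierE)
  have "f - g \<in> carrier cf.P"
    using f(1) g(1) by (auto simp: path_algebra_simps in_keys_iff lookup_minus) (metis diff_zero in_keys_iff subsetD)
  moreover have "pent (f - g) j i = 0" for i j
    using assms(3)[of j i] f g by (simp add: mt_qclass entry_diff)
  ultimately have "f - g \<in> cf.I" by (rule pent_zero_in_ideal)
  then show ?thesis using cf.qclass_eq_iff f g by simp
qed

text \<open>The weight guarantees an arrow leaving i that divides m: otherwise m would involve only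
  arrows in the other direction, and its weight would have the wrong sign unless m is trivial. That
  arrow is peeled off.\<close>

lemma exists_path_mon:
  "wt m = wd j - wd i \<Longrightarrow> \<exists>es. cf.awalk i es j \<and> path_mon es = m"
proof (induction "\<Sum>k\<in>UNIV. lk m k" arbitrary: m i rule: less_induct)
  case less
  show ?case
  proof (cases "m = 0")
    case True
    then have "i = j" using less.prems exhaust_2[of i] exhaust_2[of j] by auto
    then show ?thesis using True by (intro exI[of _ "[]"]) (simp add: cf.awalk_Nil_iff)
  next
    case False
    then have nz: "lk m 1 + lk m 2 + lk m 3 + lk m 4 \<noteq> 0"
      using exhaust_4 by (metis add_is_0 lookup_zero poly_mapping_eqI)
    have "\<exists>a. tail cq a = i \<and> lk m (aidx a) \<noteq> 0"
    proof (cases "i = 1")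
      case True
      then have "lk m 1 \<noteq> 0 \<or> lk m 2 \<noteq> 0" using less.prems nz exhaust_2[of j] by (auto simp: wt_def)
      then show ?thesis using True by (metis aidx_simps(1,2) cq_simps(3))
    next
      case i: False
      then have "i = 2" using exhaust_2[of i] by auto
      then have "lk m 3 \<noteq> 0 \<or> lk m 4 \<noteq> 0" using less.prems nz exhaust_2[of j] by (auto simp: wt_def)
      then show ?thesis using \<open>i = 2\<close> by (metis aidx_simps(3,4) cq_simps(5))
    qed
    then obtain a where a: "tail cq a = i" "lk m (aidx a) \<noteq> 0" by blast
    define m' where "m' = m - sg (aidx a) 1"
    have m: "m = sg (aidx a) 1 + m'"
      using a(2) by (intro poly_mapping_eqI) (auto simp: m'_def lookup_add lookup_minus lookup_single when_def)
    have "(\<Sum>k\<in>UNIV. lk m k) = 1 + (\<Sum>k\<in>UNIV. lk m' k)"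
      by (subst m) (simp add: lookup_add sum.distrib lookup_single when_def)
    moreover have "wt m' = wd j - wd (head cq a)"
      using less.prems wt_arrow[of a] a(1) by (simp add: m)
    ultimately obtain es where "cf.awalk (head cq a) es j" "path_mon es = m'"
      using less.hyps[of m'] by auto
    then show ?thesis using a(1) m by (intro exI[of _ "a # es"]) (simp add: cf.awalk_Cons_iff)
  qed
qed

lemma exists_pent:
  assumes "homog (wd j - wd i) g"
  shows "\<exists>f\<in>carrier cf.P. \<forall>j' i'. pent f j' i' = (if j' = j \<and> i' = i then g else 0)"
proof -
  have "ks g \<subseteq> {m. wt m = wd j - wd i}" using assms by (auto simp: homog_def)
  then show ?thesis
  proof (induction g rule: poly_mapping_linear_induct_on)
    case zero
    then show ?case by (intro bexI[of _ 0]) (auto simp: entry_zero path_algebra_simps)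
  next
    case (add f g)
    then obtain f' g' where "f' \<in> carrier cf.P" "g' \<in> carrier cf.P"
      "\<forall>j' i'. pent f' j' i' = (if j' = j \<and> i' = i then f else 0)"
      "\<forall>j' i'. pent g' j' i' = (if j' = j \<and> i' = i then g else 0)" by blast
    then show ?case using keys_add_subset
      by (intro bexI[of _ "f' + g'"]) (simp_all add: entry_add path_algebra_simps)
  next
    case (single m c)
    then obtain es where es: "cf.awalk i es j" "path_mon es = m" using exists_path_mon by blast
    then show ?case
      using cf.awalk_path_end[of "(i, es)" j]
      by (intro bexI[of _ "sg (i, es) c"]) (auto simp: pent_single path_algebra_simps cf.qpaths_iff)
  qed
qed

lemma mt_surj1:
  assumes "homog (wd j - wd i) g"
  shows "\<exists>X\<in>carrier CA. \<forall>j' i'. mt X j' i' = (if j' = j \<and> i' = i then g else 0)"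
proof -
  obtain f where f: "f \<in> carrier cf.P" "\<forall>j' i'. pent f j' i' = (if j' = j \<and> i' = i then g else 0)"
    using exists_pent[OF assms] by blast
  then show ?thesis
    by (intro bexI[of _ "qclass cq cr f"]) (auto simp: mt_qclass CA_eq cf.carrier_QA)
qed

lemma mt_surj:
  assumes "\<And>i j. homog (wd j - wd i) (M j i)"
  obtains X where "X \<in> carrier CA" "\<And>j i. mt X j i = M j i"
proof -
  obtain Y where Y: "\<And>j i. Y j i \<in> carrier CA"
    "\<And>j i j' i'. mt (Y j i) j' i' = (if j' = j \<and> i' = i then M j i else 0)"
    using mt_surj1[OF assms] by metis
  let ?X = "Y 1 1 \<oplus>\<^bsub>CA\<^esub> Y 1 2 \<oplus>\<^bsub>CA\<^esub> Y 2 1 \<oplus>\<^bsub>CA\<^esub> Y 2 2"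
  have "mt ?X j i = M j i" for j i
    using exhaust_2[of i] exhaust_2[of j] by (auto simp: mt_add Y)
  moreover have "?X \<in> carrier CA" using Y by simp
  ultimately show ?thesis using that by blast
qed


section \<open>The center\<close>

definition subst_stuv :: "4 cpoly \<Rightarrow> 4 cpoly" where
  "subst_stuv = insertion const (($) (stuv (\<chi> i. var i)))"

lemma is_hom_subst_stuv: "is_hom subst_stuv"
  unfolding subst_stuv_def by (rule is_hom_insertion) simp

lemma stuv_nth [simp]:
  "stuv q $ 1 = q $ 1 * q $ 3" "stuv q $ 2 = q $ 1 * q $ 4" "stuv q $ 3 = q $ 2 * q $ 3" "stuv q $ 4 = q $ 2 * q $ 4"
  by (simp_all add: stuv_def vector_4)

lemma eval_R_eq: "eval_R g = frac (subst_stuv g)"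
proof -
  have "stuv (\<chi> i. frac_var i) $ i = frac (stuv (\<chi> i. var i) $ i)" for i
    using exhaust_4[of i] by (auto simp: frac_var_eq is_homD[OF is_hom_frac])
  then have "($) (stuv (\<chi> i. frac_var i)) = (\<lambda>i. frac (stuv (\<chi> i. var i) $ i))" by (rule ext)
  then show ?thesis
    by (simp add: eval_R_def subst_stuv_def hom_insertion[OF is_hom_const is_hom_frac] frac_const_eq[abs_def])
qed

lemma eval_subst_stuv: "eval_at q (subst_stuv g) = eval_at (stuv q) g"
proof -
  have "eval_at q (stuv (\<chi> i. var i) $ i) = stuv q $ i" for i
    using exhaust_4[of i] by (auto simp: eval_simps)
  then show ?thesis
    unfolding subst_stuv_def insertion_insertion[OF is_hom_id(1) is_hom_id(1)] by simp
qed

lemma homog_var: "homog (if i = 1 \<or> i = 2 then 1 else - 1) (var i)"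
  using exhaust_4[of i] by (auto simp: var_def wt_def lookup_single intro!: homog_singleI)

lemma homog_subst_stuv: "homog 0 (subst_stuv g)"
proof (induction g rule: poly_mapping_linear_induct)
  case (single m c)
  have 1: "homog 0 (var 1 * var 3)" "homog 0 (var 1 * var 4)" "homog 0 (var 2 * var 3)" "homog 0 (var 2 * var 4)"
    using homog_mult[OF homog_var[of 1] homog_var[of 3]] homog_mult[OF homog_var[of 1] homog_var[of 4]]
      homog_mult[OF homog_var[of 2] homog_var[of 3]] homog_mult[OF homog_var[of 2] homog_var[of 4]]
    by simp_all
  have 2: "homog 0 (f * g)" if "homog 0 f" "homog 0 g" for f g
    using homog_mult[OF that] by simp
  have 3: "homog 0 (f ^ n)" if "homog 0 f" for f n
    by (induction n) (use that 2 homog_const[of 1] in \<open>auto simp: is_homD(1)[OF is_hom_const]\<close>)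
  show ?case
    by (simp add: subst_stuv_def insertion_single monval_def prod_4 1 2 3)
qed (simp_all add: is_homD[OF is_hom_subst_stuv] homog_add)

lemma total_degree_nonzero:
  fixes m :: "4 \<Rightarrow>\<^sub>0 nat" assumes "m \<noteq> 0" shows "lk m 1 + lk m 2 + lk m 3 + lk m 4 \<noteq> 0"
proof
  assume *: "lk m 1 + lk m 2 + lk m 3 + lk m 4 = 0"
  have "lk m k = 0" for k using * exhaust_4[of k] by auto
  then have "m = 0" by (intro poly_mapping_eqI) simp
  with assms show False ..
qed

text \<open>A monomial of weight zero has as many factors among x, y as among z, w; pairing them off
  writes it as a product of s, t, u, v.\<close>

lemma homog_0_subst_stuv: "homog 0 f \<Longrightarrow> \<exists>g. f = subst_stuv g"
proof -
  have mon: "wt m = 0 \<Longrightarrow> \<exists>g. sg m c = subst_stuv g" for m c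
  proof (induction "lk m 1 + lk m 2" arbitrary: m rule: less_induct)
    case less
    show ?case
    proof (cases "m = 0")
      case True
      then have "sg m c = subst_stuv (const c)"
        by (simp add: subst_stuv_def insertion_const) (simp add: const_def)
      then show ?thesis by blast
    next
      case False
      then have nz: "lk m 1 + lk m 2 + lk m 3 + lk m 4 \<noteq> 0"
        by (rule total_degree_nonzero)
      have *: ?thesis
        if k: "subst_stuv (var k) = var a * var b" "a = 1 \<or> a = 2" "b = 3 \<or> b = 4" "lk m a \<noteq> 0" "lk m b \<noteq> 0"
        for a b k
      proof -
        define m' where "m' = m - (sg a 1 + sg b 1)"
        have m: "m = sg a 1 + sg b 1 + m'"
          using k by (intro poly_mapping_eqI) (auto simp: m'_def lookup_add lookup_minus lookup_single when_def)
        have "lk m 1 + lk m 2 = lk m' 1 + lk m' 2 + 1" "wt m' = wt m"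
          by (subst m, use k(2,3) in \<open>auto simp: lookup_add lookup_single wt_def\<close>)+
        then obtain g where "sg m' c = subst_stuv g" using less by force
        moreover have "sg m c = var a * var b * sg m' c"
          by (subst m) (simp add: var_def mult_single)
        ultimately have "sg m c = subst_stuv (var k * g)"
          by (simp add: is_homD[OF is_hom_subst_stuv] k(1))
        then show ?thesis by blast
      qed
      have v: "subst_stuv (var 1) = var 1 * var 3" "subst_stuv (var 2) = var 1 * var 4"
        "subst_stuv (var 3) = var 2 * var 3" "subst_stuv (var 4) = var 2 * var 4"
        by (simp_all add: subst_stuv_def insertion_var)
      have "lk m 1 \<noteq> 0 \<or> lk m 2 \<noteq> 0" "lk m 3 \<noteq> 0 \<or> lk m 4 \<noteq> 0"
        using less.prems nz by (auto simp: wt_def)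
      then show ?thesis
        using *[OF v(1)] *[OF v(2)] *[OF v(3)] *[OF v(4)] by auto
    qed
  qed
  assume "homog 0 f"
  then have "ks f \<subseteq> {m. wt m = 0}" by (auto simp: homog_def)
  then show ?thesis
  proof (induction f rule: poly_mapping_linear_induct_on)
    case zero
    then show ?case using is_homD(4)[OF is_hom_subst_stuv] by metis
  next
    case (add f g)
    then show ?case using is_homD(2)[OF is_hom_subst_stuv] by metis
  qed (use mon in auto)
qed

text \<open>Commuting with \<open>cf_vtx 1\<close> kills the off-diagonal entries; commuting with
  one arrow equates the diagonal ones, as x is not a zero divisor.\<close>

lemma center_iff:
  "z \<in> carrier (center CA) \<longleftrightarrow> z \<in> carrier CA \<and> mt z 1 2 = 0 \<and> mt z 2 1 = 0 \<and> mt z 1 1 = mt z 2 2"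
  (is "?l \<longleftrightarrow> ?r")
proof
  assume ?l
  then have z: "z \<in> carrier CA" "\<And>a. a \<in> carrier CA \<Longrightarrow> z \<otimes>\<^bsub>CA\<^esub> a = a \<otimes>\<^bsub>CA\<^esub> z"
    by (auto simp: center_def)
  have "mt (z \<otimes>\<^bsub>CA\<^esub> cf_vtx 1) = mt (cf_vtx 1 \<otimes>\<^bsub>CA\<^esub> z)" using z(2) vtx_CA by simp
  from fun_cong[OF fun_cong[OF this, of 1], of 2] fun_cong[OF fun_cong[OF this, of 2], of 1]
  have 1: "mt z 1 2 = 0" "mt z 2 1 = 0" using z(1) vtx_CA by (simp_all add: mt_mult mt_vtx)
  have "mt (z \<otimes>\<^bsub>CA\<^esub> cf_arr (Aarr 1)) = mt (cf_arr (Aarr 1) \<otimes>\<^bsub>CA\<^esub> z)" using z(2) arr_CA by simp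
  from fun_cong[OF fun_cong[OF this, of 2], of 1]
  have "mt z 2 2 * var 1 = var 1 * mt z 1 1" using z(1) arr_CA by (simp add: mt_mult mt_arr)
  moreover have "var 1 \<noteq> (0 :: 4 cpoly)" by (metis var_def lookup_single_eq lookup_zero zero_neq_one)
  ultimately show ?r using 1 z by (simp add: mult.commute)
next
  assume r: ?r
  have "z \<otimes>\<^bsub>CA\<^esub> a = a \<otimes>\<^bsub>CA\<^esub> z" if a: "a \<in> carrier CA" for a
  proof (rule mt_inj)
    show "mt (z \<otimes>\<^bsub>CA\<^esub> a) j i = mt (a \<otimes>\<^bsub>CA\<^esub> z) j i" for i j
      using r a exhaust_2[of i] exhaust_2[of j] by (auto simp: mt_mult)
  qed (use r a in auto)
  then show ?l using r by (simp add: center_def)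
qed

lemma exists_center:
  assumes "homog 0 f" shows "\<exists>z\<in>carrier (center CA). mt z 1 1 = f"
proof -
  obtain X where "X \<in> carrier CA" "\<And>j i. mt X j i = (if i = j then f else 0)"
    by (rule mt_surj[of "\<lambda>j i. if i = j then f else 0"]) (use assms in auto)
  then show ?thesis by (intro bexI[of _ X]) (auto simp: center_iff)
qed

lemma psi_eq: "z \<in> carrier CA \<Longrightarrow> psi z = frac (mt z 1 1)"
  by (simp add: psi_def tau_eq_mt)

lemma center_simps [simp]:
  "mult (center A) = mult A" "ring.add (center A) = ring.add A" "one (center A) = one A"
  "ring.zero (center A) = ring.zero A"
  by (simp_all add: center_def)

lemma conifold_ring_simps [simp]:
  "carrier conifold_ring = range eval_R" "mult conifold_ring = (*)" "one conifold_ring = 1"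
  "ring.add conifold_ring = (+)" "ring.zero conifold_ring = 0" "c \<odot>\<^bsub>conifold_ring\<^esub> f = frac_const c * f"
  by (simp_all add: conifold_ring_def)

lemma psi_ring_iso: "psi \<in> ring_iso (center CA) conifold_ring"
proof -
  have sub: "z \<in> carrier CA" if "z \<in> carrier (center CA)" for z using that by (simp add: center_iff)
  have im: "psi z \<in> range eval_R" if z: "z \<in> carrier (center CA)" for z
  proof -
    have "homog 0 (mt z 1 1)" using mt_homog[OF sub[OF z], of 1 1] by simp
    then show ?thesis using homog_0_subst_stuv by (force simp: psi_eq[OF sub[OF z]] eval_R_eq)
  qed
  have "psi \<in> ring_hom (center CA) conifold_ring"
    by (rule ring_hom_memI)
      (use im in \<open>auto simp: psi_eq mt_mult mt_add mt_one center_iff is_homD[OF is_hom_frac]\<close>)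
  moreover have "bij_betw psi (carrier (center CA)) (range eval_R)"
  proof (rule bij_betw_imageI)
    show "inj_on psi (carrier (center CA))"
    proof (rule inj_onI)
      fix z z' assume z: "z \<in> carrier (center CA)" "z' \<in> carrier (center CA)" "psi z = psi z'"
      then have "mt z 1 1 = mt z' 1 1" by (simp add: psi_eq sub inj_frac)
      then have "mt z j i = mt z' j i" for i j
        using z exhaust_2[of i] exhaust_2[of j] by (auto simp: center_iff)
      then show "z = z'" using mt_inj sub z by blast
    qed
    show "psi ` carrier (center CA) = range eval_R"
    proof (intro equalityI subsetI)
      fix r assume "r \<in> range eval_R"
      then obtain g where g: "r = frac (subst_stuv g)" by (auto simp: eval_R_eq)
      obtain z where "z \<in> carrier (center CA)" "mt z 1 1 = subst_stuv g"
        using exists_center[OF homog_subst_stuv] by blast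
      then show "r \<in> psi ` carrier (center CA)" using g psi_eq sub by force
    qed (use im in auto)
  qed
  ultimately show ?thesis by (simp add: ring_iso_def)
qed

lemma psi_scale:
  assumes "z \<in> carrier (center CA)" shows "psi (c \<odot>\<^bsub>CA\<^esub> z) = c \<odot>\<^bsub>conifold_ring\<^esub> psi z"
  using assms
  by (simp add: center_iff psi_eq mt_scale is_homD[OF is_hom_frac] frac_const_eq)

lemma cring_center: assumes "ring A" shows "cring (center A)"
proof -
  interpret ring A by fact
  have car: "z \<in> carrier (center A) \<longleftrightarrow> z \<in> carrier A \<and> (\<forall>a\<in>carrier A. z \<otimes>\<^bsub>A\<^esub> a = a \<otimes>\<^bsub>A\<^esub> z)" for z
    by (simp add: center_def)
  have sub: "z \<in> carrier A" if "z \<in> carrier (center A)" for z using that car by blast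
  have comm: "z \<otimes>\<^bsub>A\<^esub> a = a \<otimes>\<^bsub>A\<^esub> z" if "z \<in> carrier (center A)" "a \<in> carrier A" for z a
    using that car by blast
  have I: "z \<in> carrier (center A)"
    if "z \<in> carrier A" "\<And>a. a \<in> carrier A \<Longrightarrow> z \<otimes>\<^bsub>A\<^esub> a = a \<otimes>\<^bsub>A\<^esub> z" for z
    using that car by blast
  show ?thesis
  proof (rule cringI)
    show "abelian_group (center A)"
    proof (rule abelian_groupI)
      fix x assume x: "x \<in> carrier (center A)"
      then have "\<ominus>\<^bsub>A\<^esub> x \<in> carrier (center A)" by (auto simp: car l_minus r_minus)
      then show "\<exists>y\<in>carrier (center A). y \<oplus>\<^bsub>center A\<^esub> x = \<zero>\<^bsub>center A\<^esub>"
        using x by (intro bexI[of _ "\<ominus>\<^bsub>A\<^esub> x"]) (auto simp: car l_neg)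
    qed (auto simp: car l_distr r_distr a_assoc, auto simp: a_comm)
    show "comm_monoid (center A)"
    proof (rule comm_monoidI)
      fix x y assume xy: "x \<in> carrier (center A)" "y \<in> carrier (center A)"
      have "(x \<otimes>\<^bsub>A\<^esub> y) \<otimes>\<^bsub>A\<^esub> a = a \<otimes>\<^bsub>A\<^esub> (x \<otimes>\<^bsub>A\<^esub> y)" if a: "a \<in> carrier A" for a
        using xy a by (metis car m_assoc)
      then show "x \<otimes>\<^bsub>center A\<^esub> y \<in> carrier (center A)" using sub xy by (intro I) simp_all
      show "x \<otimes>\<^bsub>center A\<^esub> y = y \<otimes>\<^bsub>center A\<^esub> x" using comm sub xy by simp
    qed (auto simp: sub m_assoc intro: I)
  qed (simp add: sub l_distr)
qed

section \<open>Prime ideals of the center\<close>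

definition restrict_poly :: "4 set \<Rightarrow> 4 cpoly \<Rightarrow> 4 cpoly" where
  "restrict_poly K = insertion const (\<lambda>i. if i \<in> K then var i else 0)"

lemma is_hom_restrict_poly: "is_hom (restrict_poly K)"
  unfolding restrict_poly_def by (rule is_hom_insertion) simp

lemma restrict_poly_var: "restrict_poly K (var i) = (if i \<in> K then var i else 0)"
  by (simp add: restrict_poly_def insertion_var)

definition coord_ideal :: "4 set \<Rightarrow> conifold_elem set" where
  "coord_ideal K = {z \<in> carrier (center CA). restrict_poly K (mt z 1 1) = 0}"

text \<open>Pulled back from the kernel of a homomorphism into a domain, since central elements
  multiply through their common diagonal entry.\<close>

lemma primeideal_coord_ideal: "primeideal (coord_ideal K) (center CA)"
proof -
  interpret Z: cring "center CA" by (rule cring_center[OF ring_CA])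
  note h = is_homD[OF is_hom_restrict_poly]
  have sub: "z \<in> carrier CA" if "z \<in> carrier (center CA)" for z using that by (simp add: center_iff)
  have mult: "restrict_poly K (mt (x \<otimes>\<^bsub>center CA\<^esub> y) 1 1) =
    restrict_poly K (mt x 1 1) * restrict_poly K (mt y 1 1)"
    if "x \<in> carrier (center CA)" "y \<in> carrier (center CA)" for x y
    using that by (simp add: mt_mult center_iff h)
  have add: "restrict_poly K (mt (x \<oplus>\<^bsub>center CA\<^esub> y) 1 1) =
    restrict_poly K (mt x 1 1) + restrict_poly K (mt y 1 1)"
    if "x \<in> carrier (center CA)" "y \<in> carrier (center CA)" for x y
    using that by (simp add: mt_add center_iff h)
  show ?thesis
  proof (rule primeidealI)
    show "ideal (coord_ideal K) (center CA)"
    proof (rule idealI)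
      show "subgroup (coord_ideal K) (add_monoid (center CA))"
      proof (rule Z.add.subgroupI)
        have "\<zero>\<^bsub>center CA\<^esub> \<in> coord_ideal K"
          using Z.zero_closed by (simp add: coord_ideal_def mt_zero h)
        then show "coord_ideal K \<noteq> {}" by blast
        show "coord_ideal K \<subseteq> carrier (center CA)" by (auto simp: coord_ideal_def)
        fix a assume a: "a \<in> coord_ideal K"
        then have c: "a \<in> carrier (center CA)" "\<ominus>\<^bsub>center CA\<^esub> a \<in> carrier (center CA)"
          using Z.a_inv_closed by (auto simp: coord_ideal_def)
        have "restrict_poly K (mt (a \<oplus>\<^bsub>center CA\<^esub> \<ominus>\<^bsub>center CA\<^esub> a) 1 1) = 0"
          using Z.r_neg[OF c(1)] by (simp add: mt_zero h)
        then show "\<ominus>\<^bsub>center CA\<^esub> a \<in> coord_ideal K"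
          using a c unfolding add[OF c] by (simp add: coord_ideal_def)
        fix b assume b: "b \<in> coord_ideal K"
        then show "a \<oplus>\<^bsub>center CA\<^esub> b \<in> coord_ideal K"
          using a add Z.a_closed unfolding coord_ideal_def mem_Collect_eq by (metis add_0)
      qed
      fix a x assume a: "a \<in> coord_ideal K" and x: "x \<in> carrier (center CA)"
      show "x \<otimes>\<^bsub>center CA\<^esub> a \<in> coord_ideal K" "a \<otimes>\<^bsub>center CA\<^esub> x \<in> coord_ideal K"
        using a x mult Z.m_closed unfolding coord_ideal_def mem_Collect_eq by (metis mult_zero_left mult_zero_right)+
    qed (rule Z.ring_axioms)
    show "carrier (center CA) \<noteq> coord_ideal K"
    proof -
      have "\<one>\<^bsub>center CA\<^esub> \<notin> coord_ideal K" by (simp add: coord_ideal_def mt_one h)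
      then show ?thesis using Z.one_closed by metis
    qed
    fix a b assume "a \<in> carrier (center CA)" "b \<in> carrier (center CA)" "a \<otimes>\<^bsub>center CA\<^esub> b \<in> coord_ideal K"
    then show "a \<in> coord_ideal K \<or> b \<in> coord_ideal K"
      using mult[of a b] unfolding coord_ideal_def mem_Collect_eq by simp
  qed (rule Z.cring_axioms)
qed

text \<open>Strictness is witnessed by the central element with diagonal entry
  \<open>var i * var j\<close>, a weight-zero monomial that survives on K but not on the smaller
  set.\<close>

lemma coord_ideal_strict:
  assumes "K' \<subseteq> K" "i = 1 \<or> i = 2" "j = 3 \<or> j = 4" "i \<in> K" "j \<in> K" "i \<notin> K' \<or> j \<notin> K'"
  shows "coord_ideal K \<subset> coord_ideal K'"
proof -
  have comp: "restrict_poly K' (restrict_poly K f) = restrict_poly K' f" for f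
    by (rule hom_cpoly_eqI[OF is_hom_comp[OF is_hom_restrict_poly is_hom_restrict_poly] is_hom_restrict_poly])
      (use assms(1) in \<open>auto simp: restrict_poly_var restrict_poly_def insertion_const insertion_zero insertion_var\<close>)
  then have "coord_ideal K \<subseteq> coord_ideal K'"
    using is_homD(4)[OF is_hom_restrict_poly] unfolding coord_ideal_def by auto metis
  moreover have "homog 0 (var i * var j)"
    using homog_mult[OF homog_var[of i] homog_var[of j]] assms(2,3) by auto
  then obtain z where z: "z \<in> carrier (center CA)" "mt z 1 1 = var i * var j" using exists_center by blast
  moreover have "var k \<noteq> (0 :: 4 cpoly)" for k by (metis var_def lookup_single_eq lookup_zero zero_neq_one)
  ultimately have "z \<in> coord_ideal K'" "z \<notin> coord_ideal K"
    using assms(4-6) by (auto simp: coord_ideal_def is_homD[OF is_hom_restrict_poly] restrict_poly_var)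
  with \<open>coord_ideal K \<subseteq> coord_ideal K'\<close> show ?thesis by blast
qed

lemma krull_dim_center: "enat 3 \<le> krull_dim (center CA)"
proof -
  \<comment> \<open>Of s, t, u, v there remain all; then s and u; then s; then none: coordinate
    rings of dimensions three, two, one and zero.\<close>
  define P where "P n = coord_ideal (if n = 0 then UNIV else if n = 1 then {1, 2, 3}
    else if n = 2 then {1, 3} else {})" for n :: nat
  have "P n \<subset> P (Suc n)" if n: "n < 3" for n
  proof -
    have "n = 0 \<or> n = 1 \<or> n = 2" using n by linarith
    then show ?thesis
      using coord_ideal_strict[of "{1, 2, 3}" UNIV 1 4] coord_ideal_strict[of "{1, 3}" "{1, 2, 3}" 2 3]
        coord_ideal_strict[of "{}" "{1, 3}" 1 3]
      by (auto simp: P_def)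
  qed
  moreover have "primeideal (P n) (center CA)" for n by (simp add: P_def primeideal_coord_ideal)
  ultimately show ?thesis unfolding krull_dim_def by (intro SUP_upper) blast
qed

section \<open>Primitive idempotents\<close>

text \<open>Right multiplication by U carries Ae to Af, with right multiplication by V as its
  inverse.\<close>

lemma left_ideal_isoI:
  assumes "ring A" "U \<in> carrier A" "V \<in> carrier A"
    "U \<otimes>\<^bsub>A\<^esub> V = e" "V \<otimes>\<^bsub>A\<^esub> U = f" "idempotent A e" "idempotent A f"
  shows "left_ideal_iso A e f"
proof -
  interpret ring A by fact
  have e: "e \<in> carrier A" "e \<otimes>\<^bsub>A\<^esub> e = e" and f: "f \<in> carrier A" "f \<otimes>\<^bsub>A\<^esub> f = f"
    using assms by (auto simp: idempotent_def)
  have fixd: "x \<in> carrier A \<and> x \<otimes>\<^bsub>A\<^esub> g = x"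
    if "x \<in> left_ideal_of A g" "g \<in> carrier A" "g \<otimes>\<^bsub>A\<^esub> g = g" for x g
    using that by (auto simp: left_ideal_of_def m_assoc)
  have mem: "x \<otimes>\<^bsub>A\<^esub> W \<in> left_ideal_of A (W' \<otimes>\<^bsub>A\<^esub> W)"
    if "x \<in> carrier A" "x \<otimes>\<^bsub>A\<^esub> (W \<otimes>\<^bsub>A\<^esub> W') = x" "W \<in> carrier A" "W' \<in> carrier A" for x W W'
    unfolding left_ideal_of_def using that by (auto intro!: exI[of _ "x \<otimes>\<^bsub>A\<^esub> W"] simp flip: m_assoc)
  have "bij_betw (\<lambda>x. x \<otimes>\<^bsub>A\<^esub> U) (left_ideal_of A e) (left_ideal_of A f)"
  proof (rule bij_betw_byWitness[where f' = "\<lambda>x. x \<otimes>\<^bsub>A\<^esub> V"])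
    show "\<forall>a\<in>left_ideal_of A e. a \<otimes>\<^bsub>A\<^esub> U \<otimes>\<^bsub>A\<^esub> V = a"
      using fixd[OF _ e] assms by (auto simp: m_assoc)
    show "\<forall>a\<in>left_ideal_of A f. a \<otimes>\<^bsub>A\<^esub> V \<otimes>\<^bsub>A\<^esub> U = a"
      using fixd[OF _ f] assms by (auto simp: m_assoc)
    show "(\<lambda>x. x \<otimes>\<^bsub>A\<^esub> U) ` left_ideal_of A e \<subseteq> left_ideal_of A f"
      using fixd[OF _ e] mem[of _ U V] assms by auto
    show "(\<lambda>x. x \<otimes>\<^bsub>A\<^esub> V) ` left_ideal_of A f \<subseteq> left_ideal_of A e"
      using fixd[OF _ f] mem[of _ V U] assms by auto
  qed
  then show ?thesis
    unfolding left_ideal_iso_def using fixd[OF _ e] assms(2)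
    by (intro exI[of _ "\<lambda>x. x \<otimes>\<^bsub>A\<^esub> U"]) (auto simp: l_distr m_assoc)
qed

text \<open>A left-linear isomorphism is determined by the image U of e; V is the preimage of f, and
  injectivity gives the product in the other order.\<close>

lemma left_ideal_isoE:
  assumes "ring A" "left_ideal_iso A e f" "idempotent A e" "idempotent A f"
  obtains U V where "U \<in> carrier A" "V \<in> carrier A" "U \<otimes>\<^bsub>A\<^esub> V = e" "V \<otimes>\<^bsub>A\<^esub> U = f"
proof -
  interpret ring A by fact
  have e: "e \<in> carrier A" "e \<otimes>\<^bsub>A\<^esub> e = e" and f: "f \<in> carrier A" "f \<otimes>\<^bsub>A\<^esub> f = f"
    using assms by (auto simp: idempotent_def)
  have fixd: "x \<in> carrier A \<and> x \<otimes>\<^bsub>A\<^esub> g = x"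
    if "x \<in> left_ideal_of A g" "g \<in> carrier A" "g \<otimes>\<^bsub>A\<^esub> g = g" for x g
    using that by (auto simp: left_ideal_of_def m_assoc)
  obtain \<phi> where bij: "bij_betw \<phi> (left_ideal_of A e) (left_ideal_of A f)"
    and lin: "\<And>a x. a \<in> carrier A \<Longrightarrow> x \<in> left_ideal_of A e \<Longrightarrow> \<phi> (a \<otimes>\<^bsub>A\<^esub> x) = a \<otimes>\<^bsub>A\<^esub> \<phi> x"
    using assms(2) by (auto simp: left_ideal_iso_def)
  have ee: "e \<in> left_ideal_of A e" and ff: "f \<in> left_ideal_of A f"
    using e f by (force simp: left_ideal_of_def)+
  define U where "U = \<phi> e"
  have U: "U \<in> left_ideal_of A f" using bij ee by (auto simp: U_def bij_betw_def)
  obtain V where V: "V \<in> left_ideal_of A e" "\<phi> V = f"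
    using bij ff unfolding bij_betw_def by (metis imageE)
  have c: "U \<in> carrier A" "V \<in> carrier A" using fixd[OF U f] fixd[OF V(1) e] by auto
  have "V \<otimes>\<^bsub>A\<^esub> U = f" using lin[OF c(2) ee] V fixd[OF V(1) e] by (simp add: U_def)
  moreover have "U \<otimes>\<^bsub>A\<^esub> V \<in> left_ideal_of A e"
    using V(1) c(1) by (auto simp: left_ideal_of_def) (metis m_assoc e(1) m_closed)
  moreover have "\<phi> (U \<otimes>\<^bsub>A\<^esub> V) = \<phi> e" using lin[OF c(1) V(1)] V(2) fixd[OF U f] by (simp add: U_def)
  ultimately show ?thesis using that[OF c] bij ee by (auto simp: bij_betw_def inj_on_def)
qed

lemma idempotent_vtx: "idempotent CA (cf_vtx i)"
proof -
  have "cf_vtx i \<otimes>\<^bsub>CA\<^esub> cf_vtx i = cf_vtx i"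
    by (rule mt_inj) (use vtx_CA exhaust_2[of i] in \<open>auto simp: mt_mult mt_vtx\<close>)
  then show ?thesis by (simp add: idempotent_def vtx_CA)
qed

lemma mt_vtx_left: "X \<in> carrier CA \<Longrightarrow> mt (cf_vtx i \<otimes>\<^bsub>CA\<^esub> X) j k = (if j = i then mt X j k else 0)"
  using exhaust_2[of i] by (auto simp: mt_mult vtx_CA mt_vtx)

lemma mt_vtx_right: "X \<in> carrier CA \<Longrightarrow> mt (X \<otimes>\<^bsub>CA\<^esub> cf_vtx i) j k = (if k = i then mt X j k else 0)"
  using exhaust_2[of i] by (auto simp: mt_mult vtx_CA mt_vtx)

text \<open>A summand of \<open>cf_vtx i\<close> is supported in a single diagonal entry, which is
  an idempotent of a domain, hence 0 or 1.\<close>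

lemma primitive_vtx: "primitive_idempotent CA (cf_vtx i)"
  unfolding primitive_idempotent_def
proof (intro conjI notI)
  show "idempotent CA (cf_vtx i)" by (rule idempotent_vtx)
  show False if "cf_vtx i = \<zero>\<^bsub>CA\<^esub>" using arg_cong[OF that, of "\<lambda>X. mt X i i"] by (simp add: mt_vtx mt_zero)
  assume "\<exists>f g. idempotent CA f \<and> idempotent CA g \<and> f \<noteq> \<zero>\<^bsub>CA\<^esub> \<and> g \<noteq> \<zero>\<^bsub>CA\<^esub> \<and>
    orthogonal_idempotents CA f g \<and> cf_vtx i = f \<oplus>\<^bsub>CA\<^esub> g"
  then obtain f g where fg: "f \<in> carrier CA" "g \<in> carrier CA" "f \<otimes>\<^bsub>CA\<^esub> f = f" "g \<otimes>\<^bsub>CA\<^esub> g = g"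
    "f \<noteq> \<zero>\<^bsub>CA\<^esub>" "g \<noteq> \<zero>\<^bsub>CA\<^esub>" "f \<otimes>\<^bsub>CA\<^esub> g = \<zero>\<^bsub>CA\<^esub>" "g \<otimes>\<^bsub>CA\<^esub> f = \<zero>\<^bsub>CA\<^esub>" "cf_vtx i = f \<oplus>\<^bsub>CA\<^esub> g"
    by (auto simp: idempotent_def orthogonal_idempotents_def)
  have sp: "(\<forall>j k. mt h j k = (if j = i \<and> k = i then mt h i i else 0)) \<and> mt h i i * mt h i i = mt h i i"
    if "h \<in> carrier CA" "cf_vtx i \<otimes>\<^bsub>CA\<^esub> h = h" "h \<otimes>\<^bsub>CA\<^esub> cf_vtx i = h" "h \<otimes>\<^bsub>CA\<^esub> h = h" for h
  proof -
    have "mt (cf_vtx i \<otimes>\<^bsub>CA\<^esub> h) j k = mt h j k" "mt (h \<otimes>\<^bsub>CA\<^esub> cf_vtx i) j k = mt h j k"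
      "mt (h \<otimes>\<^bsub>CA\<^esub> h) j k = mt h j k" for j k by (simp_all only: that)
    then have 1: "mt h j k = (if j = i then mt h j k else 0)" "mt h j k = (if k = i then mt h j k else 0)"
      "mt h j 1 * mt h 1 k + mt h j 2 * mt h 2 k = mt h j k" for j k
      unfolding mt_vtx_left[OF that(1)] mt_vtx_right[OF that(1)] mt_mult[OF that(1) that(1)] by metis+
    have z: "mt h j k = 0" if "j \<noteq> i \<or> k \<noteq> i" for j k
      using 1(1)[of j k] 1(2)[of j k] that by (cases "j = i") simp_all
    have "mt h i i * mt h i i = mt h i i"
      using 1(3)[of i i] exhaust_2[of i] z[of 1 2] z[of 2 1] by auto
    moreover have "\<forall>j k. mt h j k = (if j = i \<and> k = i then mt h i i else 0)" using z by simp
    ultimately show ?thesis by blast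
  qed
  have f: "cf_vtx i \<otimes>\<^bsub>CA\<^esub> f = f" "f \<otimes>\<^bsub>CA\<^esub> cf_vtx i = f" and g: "cf_vtx i \<otimes>\<^bsub>CA\<^esub> g = g" "g \<otimes>\<^bsub>CA\<^esub> cf_vtx i = g"
    using fg(1-4,7,8) unfolding fg(9) by (simp_all add: CA.l_distr CA.r_distr)
  have "mt f i i + mt g i i = 1"
    using arg_cong[OF fg(9), of "\<lambda>X. mt X i i"] fg(1,2) by (simp add: mt_add mt_vtx)
  moreover have "mt h i i = 0 \<or> mt h i i = 1" if "mt h i i * mt h i i = mt h i i" for h
    using that by simp
  ultimately have "mt f i i = 0 \<or> mt g i i = 0"
    using sp[OF fg(1) f fg(3)] sp[OF fg(2) g fg(4)] by (metis add_cancel_right_right)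
  then show False
  proof
    assume "mt f i i = 0"
    then have "mt f j k = 0" for j k using conjunct1[OF sp[OF fg(1) f fg(3)]] by metis
    then have "f = \<zero>\<^bsub>CA\<^esub>" by (intro mt_inj[OF fg(1) CA.zero_closed]) (simp only: mt_zero)
    with fg(5) show False ..
  next
    assume "mt g i i = 0"
    then have "mt g j k = 0" for j k using conjunct1[OF sp[OF fg(2) g fg(4)]] by metis
    then have "g = \<zero>\<^bsub>CA\<^esub>" by (intro mt_inj[OF fg(2) CA.zero_closed]) (simp only: mt_zero)
    with fg(6) show False ..
  qed
qed

text \<open>Compare the eigenvalues of d and of the product under \<open>scaling 2\<close>, then
  cancel d.\<close>

lemma homog_factor:
  assumes "homog k d" "d \<noteq> 0" "homog (k + l) (d * f)" shows "homog l f"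
proof -
  have "const (2 powi k) * d * scaling 2 f = const (2 powi (k + l)) * (d * f)"
    using assms(1,3) unfolding homog_iff_scaling by (simp add: is_homD[OF is_hom_scaling])
  also have "\<dots> = const (2 powi k) * d * (const (2 powi l) * f)"
    by (simp add: power_int_add is_homD[OF is_hom_const] mult_ac)
  finally have *: "const (2 powi k) * d * scaling 2 f = const (2 powi k) * d * (const (2 powi l) * f)" .
  have "const (2 powi - k) * const (2 powi k) = (1 :: 4 cpoly)"
    by (simp add: is_homD(3)[OF is_hom_const, symmetric] power_int_minus is_homD(1)[OF is_hom_const])
  then have "const (2 powi k) * d \<noteq> 0" using assms(2) by auto
  with * show ?thesis unfolding homog_iff_scaling by simp
qed

lemma orthogonal_vtx: "i \<noteq> j \<Longrightarrow> cf_vtx i \<otimes>\<^bsub>CA\<^esub> cf_vtx j = \<zero>\<^bsub>CA\<^esub>"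
  by (rule mt_inj) (use vtx_CA exhaust_2[of i] exhaust_2[of j] in \<open>auto simp: mt_mult mt_vtx mt_zero\<close>)

lemma vtx_sum: "cf_vtx 1 \<oplus>\<^bsub>CA\<^esub> cf_vtx 2 = \<one>\<^bsub>CA\<^esub>"
proof (rule mt_inj)
  show "mt (cf_vtx 1 \<oplus>\<^bsub>CA\<^esub> cf_vtx 2) j i = mt \<one>\<^bsub>CA\<^esub> j i" for i j
    using exhaust_2[of i] exhaust_2[of j] vtx_CA by (auto simp: mt_add mt_vtx mt_one)
qed (use vtx_CA in auto)

lemma homog_eval_0: "homog k f \<Longrightarrow> k \<noteq> 0 \<Longrightarrow> eval_at 0 f = 0"
  unfolding cpoly_eval_0 homog_def by (metis in_keys_iff wt_0)


text \<open>The diagonal entry of a rank-one idempotent that does not vanish at the origin splits off a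
  homogeneous greatest common divisor of its row, which factors the idempotent through a vertex.\<close>

lemma rank_one_idempotent_iso:
  assumes e: "idempotent CA e" and ij: "{i, j} = (UNIV :: 2 set)" "i \<noteq> j"
    and tr: "mt e i i + mt e j j = 1" and det: "mt e i i * mt e j j = mt e i j * mt e j i"
    and p0: "eval_at 0 (mt e i i) \<noteq> 0"
  shows "left_ideal_iso CA e (cf_vtx i)"
proof -
  have eC: "e \<in> carrier CA" using e by (simp add: idempotent_def)
  define p q r s where "p = mt e i i" and "q = mt e i j" and "r = mt e j i" and "s = mt e j j"
  have h: "homog 0 p" "homog (wd i - wd j) q" "homog (wd j - wd i) r" "homog 0 s"
    using mt_homog[OF eC, of i i] mt_homog[OF eC, of i j] mt_homog[OF eC, of j i] mt_homog[OF eC, of j j]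
    by (simp_all add: p_def q_def r_def s_def)
  have "p \<noteq> 0" using p0 by (auto simp: p_def eval_simps)
  then obtain d f' g' where d: "q = d * f'" "p = d * g'"
    and cop: "\<And>h k. f' * h = g' * k \<Longrightarrow> g' dvd h"
    and gcd: "\<And>e. e dvd q \<Longrightarrow> e dvd p \<Longrightarrow> e dvd d"
    by (rule cpoly_coprime_decomposition[of p q]) blast
  have nz: "d \<noteq> 0" "g' \<noteq> 0" using \<open>p \<noteq> 0\<close> d by auto
  have "d * (f' * r) = q * r" "d * (g' * s) = p * s" by (simp_all add: d mult.assoc)
  then have "d * (f' * r) = d * (g' * s)"
    using det by (simp add: p_def q_def r_def s_def)
  then have fr: "f' * r = g' * s" using nz by simp
  then have "g' dvd r" by (rule cop)
  then obtain u where u: "r = g' * u" by (rule dvdE)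
  have s: "s = f' * u" using fr nz unfolding u by (simp add: mult.left_commute)
  have "eval_at 0 d \<noteq> 0" using p0 d(2) by (auto simp: eval_simps p_def)
  have hd: "homog 0 d"
  proof (rule gcd_homog[OF h(1,2)])
    show "d dvd p" "d dvd q" using d by simp_all
    show "e dvd d" if "e dvd p" "e dvd q" for e using gcd that by blast
  qed fact
  have hg: "homog 0 g'" using homog_factor[OF hd nz(1), of 0 g'] h(1) d by simp
  have hf: "homog (wd i - wd j) f'" using homog_factor[OF hd nz(1), of "wd i - wd j" f'] h(2) d by simp
  have hu: "homog (wd j - wd i) u" using homog_factor[OF hg nz(2), of "wd j - wd i" u] h(3) u by simp
  have cases: "k = i \<or> k = j" for k :: 2 using ij by auto
  \<comment> \<open>The column (d, u) and the row (g', f'): multiplied in one order they give the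
    rank-one matrix e, in the other order its trace, which is one.\<close>
  obtain U where U: "U \<in> carrier CA"
    "\<And>k l. mt U k l = (if l = i then if k = i then d else u else 0)"
  proof (rule mt_surj[of "\<lambda>k l. if l = i then if k = i then d else u else 0"])
    show "homog (wd k - wd l) (if l = i then if k = i then d else u else 0)" for k l
      using cases[of k] cases[of l] hd hu by auto
  qed blast
  obtain V where V: "V \<in> carrier CA"
    "\<And>k l. mt V k l = (if k = i then if l = i then g' else f' else 0)"
  proof (rule mt_surj[of "\<lambda>k l. if k = i then if l = i then g' else f' else 0"])
    show "homog (wd k - wd l) (if k = i then if l = i then g' else f' else 0)" for k l
      using cases[of k] cases[of l] hg hf by auto
  qed blast
  have sum: "mt (X \<otimes>\<^bsub>CA\<^esub> Y) k l = mt X k i * mt Y i l + mt X k j * mt Y j l"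
    if "X \<in> carrier CA" "Y \<in> carrier CA" for X Y k l
    using ij exhaust_2[of i] exhaust_2[of j] that by (auto simp: mt_mult)
  have "U \<otimes>\<^bsub>CA\<^esub> V = e"
  proof (rule mt_inj)
    show "mt (U \<otimes>\<^bsub>CA\<^esub> V) k l = mt e k l" for l k
      using cases[of k] cases[of l] ij(2) d u s U V
      by (auto simp: sum p_def q_def r_def s_def mult.commute)
  qed (use U V eC in auto)
  moreover have "V \<otimes>\<^bsub>CA\<^esub> U = cf_vtx i"
  proof (rule mt_inj)
    have "g' * d + f' * u = 1" using tr d s by (simp add: p_def s_def mult.commute)
    then show "mt (V \<otimes>\<^bsub>CA\<^esub> U) k l = mt (cf_vtx i) k l" for l k
      using cases[of k] cases[of l] ij(2) U V by (auto simp: sum mt_vtx)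
  qed (use U V vtx_CA in auto)
  ultimately show ?thesis using left_ideal_isoI[OF ring_CA U(1) V(1)] e idempotent_vtx by blast
qed

text \<open>By Cayley-Hamilton, e times its trace minus one is its determinant times the identity.
  If the trace were not one, e would be the scalar 0 or 1, and 1 splits into the two vertex
  idempotents. With trace one, some diagonal entry is nonzero at the origin, as
  \<open>rank_one_idempotent_iso\<close> requires.\<close>

lemma primitive_idempotent_iso_vtx:
  assumes prim: "primitive_idempotent CA e" shows "\<exists>i. left_ideal_iso CA e (cf_vtx i)"
proof -
  have e: "idempotent CA e" and eC: "e \<in> carrier CA" and ee: "e \<otimes>\<^bsub>CA\<^esub> e = e" and nz: "e \<noteq> \<zero>\<^bsub>CA\<^esub>"
    using prim by (auto simp: primitive_idempotent_def idempotent_def)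
  define p q r s where "p = mt e 1 1" and "q = mt e 1 2" and "r = mt e 2 1" and "s = mt e 2 2"
  have eq: "p * p + q * r = p" "p * q + q * s = q" "r * p + s * r = r" "r * q + s * s = s"
    using mt_mult[OF eC eC, of 1 1] mt_mult[OF eC eC, of 1 2] mt_mult[OF eC eC, of 2 1]
      mt_mult[OF eC eC, of 2 2]
    by (simp_all add: ee p_def q_def r_def s_def)
  define D T where "D = p * s - q * r" and "T = p + s - 1"
  have T: "p * T = D" "q * T = 0" "r * T = 0" "s * T = D"
    using eq by (simp_all add: D_def T_def algebra_simps)
  have T0: "T = 0"
  proof (rule ccontr)
    assume "T \<noteq> 0"
    then have q: "q = 0" "r = 0" using T by auto
    then have D: "p * T = p * s" "s * T = p * s" using T D_def by auto
    have "p * (p - 1) = 0" "s * (s - 1) = 0" using eq q by (simp_all add: algebra_simps)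
    then have ps: "p = 0 \<or> p = 1" "s = 0 \<or> s = 1" by auto
    have pst: "p = s" using D \<open>T \<noteq> 0\<close> by (metis mult_cancel_right)
    have "p = 1"
    proof (rule ccontr)
      assume "p \<noteq> 1"
      then have "p = 0" "s = 0" using ps pst by auto
      then have "mt e j i = 0" for j i
        using q exhaust_2[of i] exhaust_2[of j] by (auto simp: p_def q_def r_def s_def)
      then have "e = \<zero>\<^bsub>CA\<^esub>" by (intro mt_inj[OF eC CA.zero_closed]) (simp only: mt_zero)
      with nz show False ..
    qed
    have "e = \<one>\<^bsub>CA\<^esub>"
    proof (rule mt_inj[OF eC])
      show "mt e j i = mt \<one>\<^bsub>CA\<^esub> j i" for i j
        using \<open>p = 1\<close> pst q exhaust_2[of i] exhaust_2[of j]
        by (auto simp: mt_one p_def q_def r_def s_def)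
    qed simp
    then have "e = cf_vtx 1 \<oplus>\<^bsub>CA\<^esub> cf_vtx 2" by (simp add: vtx_sum)
    moreover have "orthogonal_idempotents CA (cf_vtx 1) (cf_vtx 2)"
      by (simp add: orthogonal_idempotents_def orthogonal_vtx)
    moreover have "cf_vtx 1 \<noteq> \<zero>\<^bsub>CA\<^esub>" "cf_vtx 2 \<noteq> \<zero>\<^bsub>CA\<^esub>"
      using primitive_vtx by (auto simp: primitive_idempotent_def)
    ultimately show False using prim idempotent_vtx unfolding primitive_idempotent_def by blast
  qed
  then have tr: "p + s = 1" by (simp add: T_def)
  have det: "p * s = q * r" using T T0 by (simp add: D_def)
  show ?thesis
  proof (cases "eval_at 0 p = 0")
    case False
    then show ?thesis
      using rank_one_idempotent_iso[OF e UNIV_2[symmetric]] tr det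
      by (auto simp: p_def q_def r_def s_def)
  next
    case True
    have "eval_at 0 p + eval_at 0 s = 1" using arg_cong[OF tr, of "eval_at 0"] by (simp add: eval_simps)
    then have "eval_at 0 s \<noteq> 0" using True by auto
    moreover have "{2, 1} = (UNIV :: 2 set)" using UNIV_2 by auto
    ultimately show ?thesis
      using rank_one_idempotent_iso[OF e, of 2 1] tr det
      by (auto simp: p_def q_def r_def s_def add.commute mult.commute)
  qed
qed

text \<open>Composing the two isomorphisms would factor \<open>cf_vtx 1\<close> through
  \<open>cf_vtx 2\<close> and write 1 as a product of two entries of nonzero weight, which vanish at
  the origin.\<close>

lemma not_left_ideal_iso_both:
  assumes e: "idempotent CA e" and "left_ideal_iso CA e (cf_vtx 1)" "left_ideal_iso CA e (cf_vtx 2)"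
  shows False
proof -
  obtain U1 V1 where 1: "U1 \<in> carrier CA" "V1 \<in> carrier CA" "U1 \<otimes>\<^bsub>CA\<^esub> V1 = e" "V1 \<otimes>\<^bsub>CA\<^esub> U1 = cf_vtx 1"
    using left_ideal_isoE[OF ring_CA assms(2) e idempotent_vtx] by blast
  obtain U2 V2 where 2: "U2 \<in> carrier CA" "V2 \<in> carrier CA" "U2 \<otimes>\<^bsub>CA\<^esub> V2 = e" "V2 \<otimes>\<^bsub>CA\<^esub> U2 = cf_vtx 2"
    using left_ideal_isoE[OF ring_CA assms(3) e idempotent_vtx] by blast
  note C = 1(1,2) 2(1,2)
  define x y where "x = cf_vtx 1 \<otimes>\<^bsub>CA\<^esub> V1 \<otimes>\<^bsub>CA\<^esub> U2" and "y = V2 \<otimes>\<^bsub>CA\<^esub> U1 \<otimes>\<^bsub>CA\<^esub> cf_vtx 1"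
  have xy: "x \<in> carrier CA" "y \<in> carrier CA" using C vtx_CA by (auto simp: x_def y_def)
  have idem: "cf_vtx i \<otimes>\<^bsub>CA\<^esub> cf_vtx i = cf_vtx i" for i using idempotent_vtx by (simp add: idempotent_def)
  have "V1 \<otimes>\<^bsub>CA\<^esub> e \<otimes>\<^bsub>CA\<^esub> e \<otimes>\<^bsub>CA\<^esub> U1 = V1 \<otimes>\<^bsub>CA\<^esub> U1 \<otimes>\<^bsub>CA\<^esub> (V1 \<otimes>\<^bsub>CA\<^esub> U1) \<otimes>\<^bsub>CA\<^esub> (V1 \<otimes>\<^bsub>CA\<^esub> U1)"
    using C by (simp add: CA.m_assoc flip: 1(3))
  then have V1: "V1 \<otimes>\<^bsub>CA\<^esub> e \<otimes>\<^bsub>CA\<^esub> e \<otimes>\<^bsub>CA\<^esub> U1 = cf_vtx 1" by (simp add: 1(4) idem)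
  have "x \<otimes>\<^bsub>CA\<^esub> cf_vtx 2 \<otimes>\<^bsub>CA\<^esub> y =
    cf_vtx 1 \<otimes>\<^bsub>CA\<^esub> (V1 \<otimes>\<^bsub>CA\<^esub> (U2 \<otimes>\<^bsub>CA\<^esub> V2) \<otimes>\<^bsub>CA\<^esub> (U2 \<otimes>\<^bsub>CA\<^esub> V2) \<otimes>\<^bsub>CA\<^esub> U1) \<otimes>\<^bsub>CA\<^esub> cf_vtx 1"
    using C vtx_CA by (simp add: x_def y_def CA.m_assoc flip: 2(4))
  then have *: "x \<otimes>\<^bsub>CA\<^esub> cf_vtx 2 \<otimes>\<^bsub>CA\<^esub> y = cf_vtx 1" by (simp add: 2(3) V1 idem)
  have "mt (x \<otimes>\<^bsub>CA\<^esub> cf_vtx 2 \<otimes>\<^bsub>CA\<^esub> y) 1 1 = mt x 1 2 * mt y 2 1"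
    using xy vtx_CA by (simp add: mt_mult mt_vtx)
  then have "mt x 1 2 * mt y 2 1 = 1" by (simp add: * mt_vtx)
  from arg_cong[OF this, of "eval_at 0"] show False
    using homog_eval_0[OF mt_homog[OF xy(1), of 1 2]] by (simp add: eval_simps)
qed

lemma basic_set_CA: "basic_set CA {cf_vtx 1, cf_vtx 2}"
proof -
  have ne: "cf_vtx 1 \<noteq> cf_vtx 2"
  proof
    assume "cf_vtx 1 = cf_vtx 2"
    from arg_cong[OF this, of "\<lambda>X. mt X 1 1"] show False by (simp add: mt_vtx)
  qed
  have "\<exists>!f. f \<in> {cf_vtx 1, cf_vtx 2} \<and> left_ideal_iso CA e f" if e: "primitive_idempotent CA e" for e
  proof -
    obtain i where i: "left_ideal_iso CA e (cf_vtx i)" using primitive_idempotent_iso_vtx[OF e] by blast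
    have "\<not> (left_ideal_iso CA e (cf_vtx 1) \<and> left_ideal_iso CA e (cf_vtx 2))"
      using not_left_ideal_iso_both e by (auto simp: primitive_idempotent_def)
    then show ?thesis using i exhaust_2[of i] by auto
  qed
  moreover have "finsum CA (\<lambda>e. e) {cf_vtx 1, cf_vtx 2} = \<one>\<^bsub>CA\<^esub>"
    using ne vtx_CA by (simp add: CA.finsum_insert vtx_sum)
  ultimately show ?thesis
    unfolding basic_set_def orthogonal_idempotents_def using primitive_vtx orthogonal_vtx by auto
qed

section \<open>The path-like set of paths\<close>

text \<open>The class of the paths from i to j with monomial m, singled out by its matrix. It is
  unique by faithfulness and exists for the weight \<open>wd j - wd i\<close>.\<close>

definition path_elem :: "2 \<Rightarrow> 2 \<Rightarrow> (4 \<Rightarrow>\<^sub>0 nat) \<Rightarrow> conifold_elem" where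
  "path_elem j i m = (SOME X. X \<in> carrier CA \<and>
     (\<forall>j' i'. mt X j' i' = (if j' = j \<and> i' = i then sg m 1 else 0)))"

lemma path_elem:
  assumes "wt m = wd j - wd i"
  shows "path_elem j i m \<in> carrier CA"
    "mt (path_elem j i m) j' i' = (if j' = j \<and> i' = i then sg m 1 else 0)"
proof -
  have "\<exists>X. X \<in> carrier CA \<and> (\<forall>j' i'. mt X j' i' = (if j' = j \<and> i' = i then sg m 1 else 0))"
    using mt_surj1[OF homog_singleI[OF assms], of 1] by blast
  from someI_ex[OF this] show "path_elem j i m \<in> carrier CA"
    "mt (path_elem j i m) j' i' = (if j' = j \<and> i' = i then sg m 1 else 0)"
    by (auto simp: path_elem_def)
qed

definition path_elems :: "conifold_elem set" where
  "path_elems = {path_elem j i m |j i m. wt m = wd j - wd i}"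

lemma path_elem_inj:
  assumes "wt m = wd j - wd i" "wt m' = wd j' - wd i'" "path_elem j i m = path_elem j' i' m'"
  shows "j = j' \<and> i = i' \<and> m = m'"
proof -
  have "mt (path_elem j' i' m') j i = sg m 1" using assms(3) path_elem(2)[OF assms(1), of j i] by simp
  then have *: "(if j = j' \<and> i = i' then sg m' 1 else 0) = sg m (1::complex)"
    using path_elem(2)[OF assms(2), of j i] by simp
  then have "lk (if j = j' \<and> i = i' then sg m' 1 else 0) m = (1::complex)" by simp
  then show ?thesis by (auto simp: lookup_single when_def split: if_splits)
qed

lemma path_elem_nonzero: "wt m = wd j - wd i \<Longrightarrow> path_elem j i m \<noteq> \<zero>\<^bsub>CA\<^esub>"
proof
  assume m: "wt m = wd j - wd i" and "path_elem j i m = \<zero>\<^bsub>CA\<^esub>"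
  then have "sg m 1 = (0 :: 4 cpoly)" using path_elem(2)[OF m, of j i] by (simp add: mt_zero)
  then show False by (metis lookup_single_eq lookup_zero zero_neq_one)
qed

lemma mt_finsum:
  assumes "finite F" "g \<in> F \<rightarrow> carrier CA"
  shows "mt (finsum CA g F) j i = (\<Sum>p\<in>F. mt (g p) j i)"
  using assms
proof (induction F)
  case (insert x F)
  then have "g x \<in> carrier CA" "g \<in> F \<rightarrow> carrier CA" "finsum CA g F \<in> carrier CA"
    by (auto intro: CA.finsum_closed)
  then show ?case using insert by (simp add: CA.finsum_insert mt_add)
qed (simp add: mt_zero)

lemma lookup_const_mult: "lk (const a * f) m = a * lk f m"
  unfolding const_def using mult_map_scale_conv_mult[of a f] lookup_pm_scale[of a f m]
  by (simp add: pm_scale_def)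

lemma lookup_mt_path_elem:
  assumes "p \<in> path_elems" "wt m = wd j - wd i"
  shows "lk (mt p j i) m = (if p = path_elem j i m then 1 else 0)"
proof -
  obtain j' i' m' where p: "p = path_elem j' i' m'" "wt m' = wd j' - wd i'"
    using assms(1) unfolding path_elems_def by blast
  have "p = path_elem j i m \<longleftrightarrow> j' = j \<and> i' = i \<and> m' = m"
    unfolding p(1) using path_elem_inj[OF p(2) assms(2)] by metis
  then show ?thesis
    by (simp only: p(1) path_elem(2)[OF p(2)]) (simp add: lookup_single when_def)
qed

text \<open>The coefficient at a path is the coefficient of its monomial in the corresponding matrix
  entry, which gives both existence and uniqueness.\<close>

lemma is_basis_path_elems: "is_basis CA path_elems"
  unfolding is_basis_def
proof (intro conjI ballI)
  show sub: "path_elems \<subseteq> carrier CA" by (auto simp: path_elems_def path_elem)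
  fix a assume a: "a \<in> carrier CA"
  let ?P = "\<lambda>c. finite {p. c p \<noteq> 0} \<and> {p. c p \<noteq> 0} \<subseteq> path_elems \<and>
      a = finsum CA (\<lambda>p. c p \<odot>\<^bsub>CA\<^esub> p) {p. c p \<noteq> 0}"
  have lookup: "lk (mt (finsum CA (\<lambda>p. c p \<odot>\<^bsub>CA\<^esub> p) {p. c p \<noteq> 0}) j i) m = c (path_elem j i m)"
    if "finite {p. c p \<noteq> 0}" "{p. c p \<noteq> 0} \<subseteq> path_elems" "wt m = wd j - wd i" for c j i m
  proof -
    let ?F = "{p. c p \<noteq> 0}"
    have F: "(\<lambda>p. c p \<odot>\<^bsub>CA\<^esub> p) \<in> ?F \<rightarrow> carrier CA" using that sub mt_scale(2) by blast
    have "lk (mt (finsum CA (\<lambda>p. c p \<odot>\<^bsub>CA\<^esub> p) ?F) j i) m = (\<Sum>p\<in>?F. c p * lk (mt p j i) m)"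
      unfolding mt_finsum[OF that(1) F] lookup_sum
      by (intro sum.cong refl) (use that sub mt_scale(1) in \<open>auto simp: lookup_const_mult subset_iff\<close>)
    also have "\<dots> = (\<Sum>p\<in>?F. if p = path_elem j i m then c p else 0)"
      by (intro sum.cong refl)
        (simp add: lookup_mt_path_elem[OF subsetD[OF that(2)] that(3)])
    also have "\<dots> = c (path_elem j i m)" using that(1) by simp
    finally show ?thesis .
  qed
  \<comment> \<open>The coefficient function inverts the parametrization by j, i, m;
    \<open>THE\<close> is justified by \<open>path_elem_inj\<close>.\<close>
  define c0 where "c0 p = (if \<exists>j i m. wt m = wd j - wd i \<and> p = path_elem j i m
    then THE c. \<forall>j i m. wt m = wd j - wd i \<longrightarrow> p = path_elem j i m \<longrightarrow> c = lk (mt a j i) m else 0)" for p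
  have c0: "c0 (path_elem j i m) = lk (mt a j i) m" if m: "wt m = wd j - wd i" for j i m
    unfolding c0_def using m by (auto intro!: the_equality dest: path_elem_inj)
  have supp: "{p. c0 p \<noteq> 0} \<subseteq> path_elems"
    by (auto simp: c0_def path_elems_def split: if_splits)
  have "{p. c0 p \<noteq> 0} \<subseteq> (\<Union>j\<in>UNIV. \<Union>i\<in>UNIV. path_elem j i ` ks (mt a j i))"
  proof
    fix p assume p: "p \<in> {p. c0 p \<noteq> 0}"
    then obtain j i m where m: "wt m = wd j - wd i" "p = path_elem j i m"
      using supp by (auto simp: path_elems_def)
    then show "p \<in> (\<Union>j\<in>UNIV. \<Union>i\<in>UNIV. path_elem j i ` ks (mt a j i))"
    proof -
      have "m \<in> ks (mt a j i)" using p c0[OF m(1)] m(2) by (simp add: in_keys_iff)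
      then show ?thesis using m(2) by blast
    qed
  qed
  then have fin: "finite {p. c0 p \<noteq> 0}" by (rule finite_subset) simp
  have eq: "a = finsum CA (\<lambda>p. c0 p \<odot>\<^bsub>CA\<^esub> p) {p. c0 p \<noteq> 0}" (is "a = ?s")
  proof (rule mt_inj[OF a])
    show s: "?s \<in> carrier CA"
      using supp sub mt_scale(2) by (intro CA.finsum_closed) blast
    fix i j show "mt a j i = mt ?s j i"
    proof (rule poly_mapping_eqI)
      fix m
      show "lk (mt a j i) m = lk (mt ?s j i) m"
      proof (cases "wt m = wd j - wd i")
        case True
        then show ?thesis using lookup[OF fin supp] c0 by simp
      next
        case False
        then have "m \<notin> ks (mt a j i)" "m \<notin> ks (mt ?s j i)"
          using mt_homog[OF a, of j i] mt_homog[OF s, of j i] unfolding homog_def by blast+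
        then show ?thesis unfolding in_keys_iff by simp
      qed
    qed
  qed
  show "\<exists>!c. ?P c"
  proof (rule ex1I)
    show "?P c0" using fin supp eq by blast
    fix c assume c: "?P c"
    show "c = c0"
    proof
      fix p show "c p = c0 p"
      proof (cases "p \<in> path_elems")
        case True
        then obtain j i m where m: "wt m = wd j - wd i" "p = path_elem j i m" by (auto simp: path_elems_def)
        have "c p = lk (mt a j i) m" using lookup[of c m j i] c m by metis
        then show ?thesis using c0 m by simp
      next
        case False
        then have "c p = 0" "c0 p = 0" using c supp by blast+
        then show ?thesis by simp
      qed
    qed
  qed
qed

lemma path_like_CA: "path_like CA (insert \<zero>\<^bsub>CA\<^esub> path_elems)"
  unfolding path_like_def
proof (intro conjI ballI)
  have "\<zero>\<^bsub>CA\<^esub> \<notin> path_elems" using path_elem_nonzero by (auto simp: path_elems_def)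
  then show "is_basis CA (insert \<zero>\<^bsub>CA\<^esub> path_elems - {\<zero>\<^bsub>CA\<^esub>})" using is_basis_path_elems by simp
  show sub: "insert \<zero>\<^bsub>CA\<^esub> path_elems \<subseteq> carrier CA" by (auto simp: path_elems_def path_elem)
  have "cf_vtx i = path_elem i i 0" for i
    by (rule mt_inj) (auto simp: vtx_CA path_elem mt_vtx)
  moreover have "path_elem i i 0 \<in> path_elems" for i
  proof -
    have "wt 0 = wd i - wd i" by simp
    then show ?thesis unfolding path_elems_def by blast
  qed
  ultimately have "{cf_vtx 1, cf_vtx 2} \<subseteq> path_elems" by simp
  then show "\<exists>E\<subseteq>insert \<zero>\<^bsub>CA\<^esub> path_elems. basic_set CA E" using basic_set_CA by blast
  have pm: "path_elem j k m \<otimes>\<^bsub>CA\<^esub> path_elem l i n = (if k = l then path_elem j i (m + n) else \<zero>\<^bsub>CA\<^esub>)"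
    if w: "wt m = wd j - wd k" "wt n = wd l - wd i" for j k l i m n
  proof (rule mt_inj)
    have w': "wt (m + n) = wd j - wd i" if "k = l" using w that by simp
    then show "(if k = l then path_elem j i (m + n) else \<zero>\<^bsub>CA\<^esub>) \<in> carrier CA"
      by (simp add: path_elem)
    show "mt (path_elem j k m \<otimes>\<^bsub>CA\<^esub> path_elem l i n) j' i' =
      mt (if k = l then path_elem j i (m + n) else \<zero>\<^bsub>CA\<^esub>) j' i'" for i' j'
      using exhaust_2[of k] exhaust_2[of l] w w'
      by (auto simp: mt_mult path_elem mt_zero mult_single)
  qed (simp add: path_elem w)
  fix a b assume "a \<in> insert \<zero>\<^bsub>CA\<^esub> path_elems" "b \<in> insert \<zero>\<^bsub>CA\<^esub> path_elems"
  then show "a \<otimes>\<^bsub>CA\<^esub> b \<in> insert \<zero>\<^bsub>CA\<^esub> path_elems"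
  proof (elim insertE)
    assume "a \<in> path_elems" "b \<in> path_elems"
    then obtain j k m l i n where *: "a = path_elem j k m" "b = path_elem l i n"
      "wt m = wd j - wd k" "wt n = wd l - wd i" by (auto simp: path_elems_def)
    then have "k = l \<Longrightarrow> path_elem j i (m + n) \<in> path_elems" unfolding path_elems_def by force
    then show ?thesis unfolding *(1,2) pm[OF *(3,4)] by simp
  qed (use sub in \<open>auto simp: subset_iff\<close>)
qed


section \<open>Modules with a basis vector at each vertex\<close>

lemma is_moduleD:
  assumes "is_module A V"
  shows "pm.subspace (space V)"
    "a \<in> carrier A \<Longrightarrow> v \<in> space V \<Longrightarrow> act V a v \<in> space V"
    "a \<in> carrier A \<Longrightarrow> v \<in> space V \<Longrightarrow> w \<in> space V \<Longrightarrow> act V a (v + w) = act V a v + act V a w"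
    "a \<in> carrier A \<Longrightarrow> v \<in> space V \<Longrightarrow> act V a (pm_scale c v) = pm_scale c (act V a v)"
    "a \<in> carrier A \<Longrightarrow> b \<in> carrier A \<Longrightarrow> v \<in> space V \<Longrightarrow> act V (a \<oplus>\<^bsub>A\<^esub> b) v = act V a v + act V b v"
    "a \<in> carrier A \<Longrightarrow> v \<in> space V \<Longrightarrow> act V (c \<odot>\<^bsub>A\<^esub> a) v = pm_scale c (act V a v)"
    "a \<in> carrier A \<Longrightarrow> b \<in> carrier A \<Longrightarrow> v \<in> space V \<Longrightarrow> act V (a \<otimes>\<^bsub>A\<^esub> b) v = act V a (act V b v)"
    "v \<in> space V \<Longrightarrow> act V \<one>\<^bsub>A\<^esub> v = v"
  using assms unfolding is_module_def by blast+

lemma subspace_closed: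
  assumes "pm.subspace W"
  shows "0 \<in> W" "v \<in> W \<Longrightarrow> w \<in> W \<Longrightarrow> v + w \<in> W" "v \<in> W \<Longrightarrow> pm_scale c v \<in> W"
  using assms by (auto simp: pm.subspace_def)

lemma span_2: "x \<in> pm.span {v, w} \<longleftrightarrow> (\<exists>a b. x = pm_scale a v + pm_scale b w)"
proof -
  have "x \<in> pm.span {v, w} \<longleftrightarrow> (\<exists>a b. x - pm_scale a v = pm_scale b w)"
    by (auto simp: pm.span_insert[of v "{w}"] pm.span_singleton)
  also have "\<dots> \<longleftrightarrow> (\<exists>a b. x = pm_scale a v + pm_scale b w)"
    by (simp add: diff_eq_eq add.commute)
  finally show ?thesis .
qed

lemma span_1: "x \<in> pm.span {v} \<longleftrightarrow> (\<exists>a. x = pm_scale a v)"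
  by (auto simp: pm.span_singleton)

lemma edim_le:
  assumes "finite B" "W \<subseteq> pm.span B" shows "edim W \<le> enat (card B)"
  using assms pm.dim_le_card[OF assms(2,1)] by (auto simp: edim_def)

lemma edim_span_independent:
  assumes "finite B" "\<not> pm.dependent B" shows "edim (pm.span B) = enat (card B)"
  using assms pm.dim_span_eq_card_independent[OF assms(2)] by (auto simp: edim_def)

lemma edim_singleton: "v \<noteq> 0 \<Longrightarrow> edim (pm.span {v}) = 1"
  using edim_span_independent[of "{v}"] by (simp add: one_enat_def)

lemma edim_1E:
  assumes "edim W = 1" "pm.subspace W" obtains v where "v \<noteq> 0" "W = pm.span {v}"
proof -
  have "pm.dim W = 1" using assms(1) by (auto simp: edim_def one_enat_def split: if_splits)
  then obtain B where B: "B \<subseteq> W" "pm.independent B" "W \<subseteq> pm.span B" "card B = 1"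
    using pm.basis_exists[of W] by metis
  then obtain v where v: "B = {v}" by (auto simp: card_1_singleton_iff)
  have "v \<noteq> 0" using B(2) v pm.dependent_zero by auto
  moreover have "W = pm.span {v}" using B(1,3) v assms(2) by (metis pm.span_minimal subset_antisym)
  ultimately show ?thesis using that by blast
qed

context
  fixes V :: "conifold_elem lmod"
  assumes V: "is_module CA V"
begin

lemmas Vm = is_moduleD[OF V]

lemma act_zero: "v \<in> space V \<Longrightarrow> act V \<zero>\<^bsub>CA\<^esub> v = 0"
  using Vm(5)[OF CA.zero_closed CA.zero_closed, of v] by simp

lemma act_0: "X \<in> carrier CA \<Longrightarrow> act V X 0 = 0"
  using Vm(3)[of X 0 0] subspace_closed(1)[OF Vm(1)] by simp

lemma act_diff: "X \<in> carrier CA \<Longrightarrow> v \<in> space V \<Longrightarrow> w \<in> space V \<Longrightarrow> act V X (v - w) = act V X v - act V X w"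
  using Vm(3)[of X "v - w" w] pm.subspace_diff[OF Vm(1), of v w] by (simp add: eq_diff_eq)

abbreviation "vs i \<equiv> act V (cf_vtx i) ` space V"

lemma vs_iff: "v \<in> vs i \<longleftrightarrow> v \<in> space V \<and> act V (cf_vtx i) v = v"
proof -
  have "cf_vtx i \<otimes>\<^bsub>CA\<^esub> cf_vtx i = cf_vtx i" using idempotent_vtx by (simp add: idempotent_def)
  then have "act V (cf_vtx i) (act V (cf_vtx i) w) = act V (cf_vtx i) w" if "w \<in> space V" for w
    using Vm(7)[OF vtx_CA vtx_CA that, of i i] by simp
  then show ?thesis using Vm(2)[OF vtx_CA] by (auto simp: image_iff) metis
qed

lemma vs_other: "v \<in> vs i \<Longrightarrow> j \<noteq> i \<Longrightarrow> act V (cf_vtx j) v = 0"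
  using Vm(7)[OF vtx_CA vtx_CA, of v j i] orthogonal_vtx[of j i] act_zero by (simp add: vs_iff)

lemma vtx_decompose: "v \<in> space V \<Longrightarrow> v = act V (cf_vtx 1) v + act V (cf_vtx 2) v"
  using Vm(5)[OF vtx_CA vtx_CA, of v 1 2] Vm(8) by (simp add: vtx_sum)

lemma subspace_vs: "pm.subspace (vs i)"
proof -
  note s = subspace_closed[OF Vm(1)]
  have "0 \<in> vs i" unfolding vs_iff using s(1) act_0[OF vtx_CA] by blast
  moreover have "v + w \<in> vs i" if "v \<in> vs i" "w \<in> vs i" for v w
    using that s(2)[of v w] Vm(3)[OF vtx_CA, of v w i] unfolding vs_iff by simp
  moreover have "pm_scale c v \<in> vs i" if "v \<in> vs i" for c v
    using that s(3)[of v c] Vm(4)[OF vtx_CA, of v i c] unfolding vs_iff by simp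
  ultimately show ?thesis unfolding pm.subspace_def by blast
qed

lemma act_vs: "X \<in> carrier CA \<Longrightarrow> v \<in> space V \<Longrightarrow> cf_vtx i \<otimes>\<^bsub>CA\<^esub> X = X \<Longrightarrow> act V X v \<in> vs i"
  using Vm(7)[OF vtx_CA, of X v i] Vm(2) by (simp add: vs_iff)

lemma arr_vtx: "cf_vtx (head cq a) \<otimes>\<^bsub>CA\<^esub> cf_arr a = cf_arr a" "cf_arr a \<otimes>\<^bsub>CA\<^esub> cf_vtx (tail cq a) = cf_arr a"
  by (rule mt_inj; auto simp: vtx_CA arr_CA mt_vtx_left mt_vtx_right mt_arr)+

lemma act_arr_other: "v \<in> vs i \<Longrightarrow> i \<noteq> tail cq a \<Longrightarrow> act V (cf_arr a) v = 0"
  using Vm(7)[OF arr_CA vtx_CA, of v a "tail cq a"] vs_other[of v i "tail cq a"] act_0[OF arr_CA]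
  by (simp add: arr_vtx vs_iff)

end

text \<open>The basis hidden in \<open>acts_by\<close>, made explicit and indexed by vertices so
  that statements can be uniform in the vertex; see \<open>acts_by_frame\<close>.\<close>

definition frame :: "conifold_elem lmod \<Rightarrow> (2 \<Rightarrow> cvec) \<Rightarrow> complex ^ 4 \<Rightarrow> bool" where
  "frame V v q \<longleftrightarrow> is_module CA V \<and> (\<forall>i. v i \<noteq> 0 \<and> v i \<in> space V \<and> act V (cf_vtx i) (v i) = v i) \<and>
     space V = pm.span {v 1, v 2} \<and>
     (\<forall>a. act V (cf_arr a) (v (tail cq a)) = pm_scale (q $ aidx a) (v (head cq a)))"

lemma frameD:
  assumes "frame V v q"
  shows "is_module CA V" "v i \<noteq> 0" "v i \<in> space V" "act V (cf_vtx i) (v i) = v i"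
    "space V = pm.span {v 1, v 2}"
    "act V (cf_arr a) (v (tail cq a)) = pm_scale (q $ aidx a) (v (head cq a))"
    "v i \<in> act V (cf_vtx i) ` space V"
    "j \<noteq> i \<Longrightarrow> act V (cf_vtx j) (v i) = 0"
proof -
  show *: "is_module CA V" "v i \<noteq> 0" "v i \<in> space V" "act V (cf_vtx i) (v i) = v i"
    "space V = pm.span {v 1, v 2}"
    "act V (cf_arr a) (v (tail cq a)) = pm_scale (q $ aidx a) (v (head cq a))"
    using assms by (auto simp: frame_def)
  show **: "v i \<in> act V (cf_vtx i) ` space V" using vs_iff[OF *(1)] * by blast
  show "j \<noteq> i \<Longrightarrow> act V (cf_vtx j) (v i) = 0" using vs_other[OF *(1) **] by blast
qed

lemma frame_vtx_comb:
  assumes "frame V v q"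
  shows "act V (cf_vtx 1) (pm_scale a (v 1) + pm_scale b (v 2)) = pm_scale a (v 1)"
    "act V (cf_vtx 2) (pm_scale a (v 1) + pm_scale b (v 2)) = pm_scale b (v 2)"
  using is_moduleD(3,4)[OF frameD(1)[OF assms] vtx_CA] frameD(3,4,8)[OF assms]
    subspace_closed(3)[OF is_moduleD(1)[OF frameD(1)[OF assms]]]
  by simp_all

lemma frame_scale_eq: "frame V v q \<Longrightarrow> pm_scale a (v i) = pm_scale b (v i) \<longleftrightarrow> a = b"
  using frameD(2)[of V v q i] pm.scale_right_imp_eq by blast

lemma frame_comb_eq:
  assumes "frame V v q"
  shows "pm_scale a (v 1) + pm_scale b (v 2) = pm_scale a' (v 1) + pm_scale b' (v 2) \<longleftrightarrow> a = a' \<and> b = b'"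
  using frame_vtx_comb[OF assms, of a b] frame_vtx_comb[OF assms, of a' b'] frame_scale_eq[OF assms] by metis

lemma frame_vs: assumes "frame V v q" shows "act V (cf_vtx i) ` space V = pm.span {v i}"
proof
  show "act V (cf_vtx i) ` space V \<subseteq> pm.span {v i}"
    using exhaust_2[of i] frame_vtx_comb[OF assms] by (auto simp: frameD(5)[OF assms] span_2 span_1)
  show "pm.span {v i} \<subseteq> act V (cf_vtx i) ` space V"
    using frameD(7)[OF assms] subspace_vs[OF frameD(1)[OF assms]] by (intro pm.span_minimal) auto
qed

lemma frame_dim_vector: "frame V v q \<Longrightarrow> dim_vector cf_vtx V = (\<lambda>_. 1)"
  using frame_vs[of V v q] edim_singleton frameD(2)[of V v q] by (auto simp: dim_vector_def fun_eq_iff)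

lemma frame_independent:
  assumes "frame V v q" shows "v 1 \<noteq> v 2" "pm.independent {v 1, v 2}"
proof -
  show ne: "v 1 \<noteq> v 2"
    using frameD(4)[OF assms, of 1] frameD(8)[OF assms, of 1 2] frameD(2)[OF assms] by force
  have "v 1 \<notin> pm.span {v 2}"
    using frame_comb_eq[OF assms, of 1 0 0] by (auto simp: span_1)
  then show "pm.independent {v 1, v 2}"
    using frameD(2)[OF assms] ne by (simp add: pm.independent_insert pm.dependent_single)
qed

lemma frame_edim: "frame V v q \<Longrightarrow> edim (space V) = 2"
  using edim_span_independent[of "{v 1, v 2}"] frame_independent[of V v q] frameD(5)[of V v q]
  by (simp add: numeral_eq_enat)

lemma acts_by_frame:
  assumes "is_module CA V" shows "acts_by V q \<longleftrightarrow> (\<exists>v. frame V v q)"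
proof
  assume "acts_by V q"
  then obtain v1 v2 where dim: "dim_vector cf_vtx V = (\<lambda>_. 1)"
    and v: "v1 \<in> act V (cf_vtx 1) ` space V" "v1 \<noteq> 0" "v2 \<in> act V (cf_vtx 2) ` space V" "v2 \<noteq> 0"
    and a: "act V (cf_arr (Aarr 1)) v1 = pm_scale (q $ 1) v2" "act V (cf_arr (Aarr 2)) v1 = pm_scale (q $ 2) v2"
      "act V (cf_arr (Barr 1)) v2 = pm_scale (q $ 3) v1" "act V (cf_arr (Barr 2)) v2 = pm_scale (q $ 4) v1"
    unfolding acts_by_def by blast
  define v where "v i = (if i = 1 then v1 else v2)" for i :: 2
  have vi: "v i \<noteq> 0" "v i \<in> act V (cf_vtx i) ` space V" for i
    using v exhaust_2[of i] by (auto simp: v_def)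
  have sp: "act V (cf_vtx i) ` space V = pm.span {v i}" for i
  proof -
    have "edim (act V (cf_vtx i) ` space V) = 1" using dim by (simp add: dim_vector_def fun_eq_iff)
    then obtain w where w: "w \<noteq> 0" "act V (cf_vtx i) ` space V = pm.span {w}"
      using edim_1E subspace_vs[OF assms] by metis
    obtain c where c: "v i = pm_scale c w" using vi(2)[of i] unfolding w(2) span_1 by blast
    then have "c \<noteq> 0" using vi(1)[of i] by auto
    then have "w = pm_scale (inverse c) (v i)" by (simp add: c)
    then have "w \<in> pm.span {v i}" by (auto simp: span_1)
    moreover have "v i \<in> pm.span {w}" using c by (auto simp: span_1)
    ultimately show ?thesis unfolding w(2)
      by (intro subset_antisym pm.span_minimal) (auto simp: pm.subspace_span)
  qed
  have "space V = pm.span {v 1, v 2}"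
  proof
    show "pm.span {v 1, v 2} \<subseteq> space V"
      using vi(2)[of 1] vi(2)[of 2] is_moduleD(1)[OF assms] vs_iff[OF assms] by (intro pm.span_minimal) auto
    show "space V \<subseteq> pm.span {v 1, v 2}"
    proof
      fix w assume w: "w \<in> space V"
      then have "act V (cf_vtx i) w \<in> pm.span {v i}" for i using sp by blast
      then obtain a b where "act V (cf_vtx 1) w = pm_scale a (v 1)" "act V (cf_vtx 2) w = pm_scale b (v 2)"
        unfolding span_1 by meson
      then show "w \<in> pm.span {v 1, v 2}" using vtx_decompose[OF assms w] unfolding span_2 by metis
    qed
  qed
  moreover have "act V (cf_arr a) (v (tail cq a)) = pm_scale (q $ aidx a) (v (head cq a))" for a
    using arrow_exhaust[of a] a by (auto simp: v_def)
  ultimately show "\<exists>v. frame V v q"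
    using vi vs_iff[OF assms] assms unfolding frame_def by (intro exI[of _ v]) blast
next
  assume "\<exists>v. frame V v q"
  then obtain v where v: "frame V v q" by blast
  show "acts_by V q"
    unfolding acts_by_def
    using frame_dim_vector[OF v] frameD(2,7)[OF v, of 1] frameD(2,7)[OF v, of 2]
      frameD(6)[OF v, of "Aarr 1"] frameD(6)[OF v, of "Aarr 2"] frameD(6)[OF v, of "Barr 1"]
      frameD(6)[OF v, of "Barr 2"]
    by (intro conjI bexI[of _ "v 1"] bexI[of _ "v 2"]) simp_all
qed

lemma qclass_CA: "f \<in> carrier cf.P \<Longrightarrow> qclass cq cr f \<in> carrier CA"
  by (auto simp: CA_eq cf.carrier_QA)

definition path_class :: "2 \<Rightarrow> conifold_arrow list \<Rightarrow> conifold_elem" where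
  "path_class u es = qclass cq cr (sg (u, es) 1)"

lemma frame_act_path:
  assumes F: "frame V v q"
  shows "cf.awalk u es w \<Longrightarrow> act V (path_class u es) (v i) =
    (if i = u then pm_scale (monval (($) q) (path_mon es)) (v w) else 0)"
proof (induction es arbitrary: u i)
  case Nil
  have "path_class u [] = cf_vtx u" by (simp add: path_class_def cf_vtx_def vtx_def)
  then show ?case using frameD(4,8)[OF F] Nil by (auto simp: cf.awalk_Nil_iff)
next
  case (Cons a es)
  have t: "tail cq a = u" "cf.awalk (head cq a) es w" using Cons.prems by (auto simp: cf.awalk_Cons_iff)
  have "sg (head cq a, es) 1 \<in> carrier cf.P" using t by (auto simp: path_algebra_simps cf.qpaths_iff)
  note c = this arr_carrier[of a]
  have "sg (u, a # es) 1 = pa_mult cq (sg (head cq a, es) 1) (arr cq a)"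
    using t by (simp add: arr_def pa_mult_single_eq path_end_def)
  then have "path_class u (a # es) = path_class (head cq a) es \<otimes>\<^bsub>CA\<^esub> cf_arr a"
    using cf.qclass_ops(1)[OF c] by (simp add: CA_eq cf_arr_def path_class_def)
  moreover have pc: "path_class (head cq a) es \<in> carrier CA"
    unfolding path_class_def by (rule qclass_CA[OF c(1)])
  ultimately have *: "act V (path_class u (a # es)) (v i) =
      act V (path_class (head cq a) es) (act V (cf_arr a) (v i))"
    using is_moduleD(7)[OF frameD(1)[OF F] pc arr_CA frameD(3)[OF F]] by simp
  show ?case
  proof (cases "i = u")
    case True
    then have "act V (cf_arr a) (v i) = pm_scale (q $ aidx a) (v (head cq a))" using frameD(6)[OF F, of a] t by simp
    then show ?thesis
      unfolding * using True Cons.IH[OF t(2), of "head cq a"]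
        is_moduleD(4)[OF frameD(1)[OF F] pc frameD(3)[OF F]]
      by (simp add: monval_add)
  next
    case False
    then have "act V (cf_arr a) (v i) = 0"
      using act_arr_other[OF frameD(1)[OF F] frameD(7)[OF F]] t by simp
    then show ?thesis unfolding * using False act_0[OF frameD(1)[OF F] pc] by simp
  qed
qed

text \<open>A framed module is the matrix representation \<open>mt\<close> evaluated at q.
  Submodules, annihilators and isomorphisms are all read off from q through this formula.\<close>

lemma frame_act:
  assumes F: "frame V v q" and X: "X \<in> carrier CA"
  shows "act V X (v i) = pm_scale (eval_at q (mt X 1 i)) (v 1) + pm_scale (eval_at q (mt X 2 i)) (v 2)"
proof -
  note V = frameD(1)[OF F]
  obtain f where f: "f \<in> carrier cf.P" "X = qclass cq cr f" using X by (meson CA_carrierE)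
  have "ks f \<subseteq> qpaths cq" using f(1) by (simp add: path_algebra_simps)
  define R where "R f \<longleftrightarrow> act V (qclass cq cr f) (v i) =
    pm_scale (eval_at q (pent f 1 i)) (v 1) + pm_scale (eval_at q (pent f 2 i)) (v 2)" for f
  from \<open>ks f \<subseteq> qpaths cq\<close> have "R f"
  proof (induction f rule: poly_mapping_linear_induct_on)
    case zero
    have "qclass cq cr 0 = \<zero>\<^bsub>CA\<^esub>"
      using cf.qclass_ops(4)[OF vtx_carrier vtx_carrier] by (simp add: CA_eq)
    then show ?case unfolding R_def using act_zero[OF V frameD(3)[OF F]] by (simp add: entry_zero eval_simps)
  next
    case (add f g)
    then have c: "f \<in> carrier cf.P" "g \<in> carrier cf.P" by (simp_all add: path_algebra_simps)
    have "qclass cq cr (f + g) = qclass cq cr f \<oplus>\<^bsub>CA\<^esub> qclass cq cr g"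
      using cf.qclass_ops(2)[OF c] by (simp add: CA_eq)
    then show ?case
      using add.IH[unfolded R_def] unfolding R_def using is_moduleD(5)[OF V qclass_CA[OF c(1)] qclass_CA[OF c(2)] frameD(3)[OF F]]
      by (simp add: entry_add eval_simps pm.scale_left_distrib)
  next
    case (single p c)
    have p: "sg p 1 \<in> carrier cf.P" using single by (simp add: path_algebra_simps)
    obtain w where w: "cf.awalk (fst p) (snd p) w" using single by (auto simp: cf.qpaths_iff)
    have "qclass cq cr (sg p c) = c \<odot>\<^bsub>CA\<^esub> qclass cq cr (sg p 1)"
      using cf.qclass_ops(5)[OF p p] by (simp add: CA_eq pm_scale_single)
    then have "act V (qclass cq cr (sg p c)) (v i) =
      pm_scale c (if i = fst p then pm_scale (monval (($) q) (path_mon (snd p))) (v w) else 0)"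
      using is_moduleD(6)[OF V qclass_CA[OF p] frameD(3)[OF F]] frame_act_path[OF F w, of i, unfolded path_class_def] by simp
    then show ?case
      unfolding R_def using exhaust_2[of w] cf.awalk_path_end[OF w] by (auto simp: pent_single eval_simps)
  qed
  then show ?thesis unfolding R_def using f by (simp add: mt_qclass)
qed

subsection \<open>Existence and isomorphism\<close>

text \<open>Coordinates 0 and 1 of \<open>cvec\<close> serve as the basis at the vertices 1 and 2.
  Since \<open>mt\<close> is multiplicative, every q is realized.\<close>

definition std_module :: "complex ^ 4 \<Rightarrow> conifold_elem lmod" where
  "std_module q = \<lparr>space = {w. ks w \<subseteq> {0, 1}},
     act = (\<lambda>X w. sg 0 (eval_at q (mt X 1 1) * lk w 0 + eval_at q (mt X 1 2) * lk w 1) +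
       sg 1 (eval_at q (mt X 2 1) * lk w 0 + eval_at q (mt X 2 2) * lk w 1))\<rparr>"

lemma frame_std_module: "frame (std_module q) (\<lambda>i. if i = 1 then sg 0 1 else sg 1 1) q"
proof -
  have "ks (pm_scale c w) \<subseteq> ks w" for c and w :: cvec by (auto simp: in_keys_iff lookup_pm_scale)
  then have sub: "pm.subspace {w :: cvec. ks w \<subseteq> {0, 1}}"
    unfolding pm.subspace_def mem_Collect_eq
    by (intro conjI ballI allI) (simp, rule keys_add_subset, blast+)
  have eq: "w = sg 0 (lk w 0) + sg 1 (lk w 1)" if "ks w \<subseteq> {0, 1}" for w :: cvec
    using that by (intro poly_mapping_eqI) (auto simp: lookup_add lookup_single when_def in_keys_iff subset_iff)
  have in01: "ks (sg 0 a + sg 1 b) \<subseteq> {0, 1 :: nat}" for a b :: complex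
    by (intro keys_add_subset) auto
  have "is_module CA (std_module q)"
    unfolding is_module_def std_module_def lmod.simps
    by (intro conjI ballI allI sub)
      (use in01 in \<open>auto intro!: poly_mapping_eqI simp: lookup_add lookup_pm_scale lookup_single when_def
        mt_add mt_scale mt_mult mt_one eval_simps algebra_simps in_keys_iff subset_iff\<close>)
  moreover have "space (std_module q) = pm.span {sg 0 1, sg 1 1}"
  proof
    show "space (std_module q) \<subseteq> pm.span {sg 0 1, sg 1 1}"
    proof
      fix w assume "w \<in> space (std_module q)"
      then have "ks w \<subseteq> {0, 1}" by (simp add: std_module_def)
      then have "w = pm_scale (lk w 0) (sg 0 1) + pm_scale (lk w 1) (sg 1 1)"
        using eq[of w] by (simp only: pm_scale_single mult_1_right)
      then show "w \<in> pm.span {sg 0 1, sg 1 1}" unfolding span_2 by blast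
    qed
    show "pm.span {sg 0 1, sg 1 1} \<subseteq> space (std_module q)"
      using sub by (intro pm.span_minimal) (auto simp: std_module_def)
  qed
  moreover have ne: "sg n 1 \<noteq> (0 :: cvec)" for n by (metis lookup_single_eq lookup_zero zero_neq_one)
  moreover have "(if i = 1 then sg 0 1 else sg 1 1) \<in> space (std_module q)" for i :: 2
    by (simp add: std_module_def del: single_one)
  moreover have "act (std_module q) (cf_vtx i) (if i = 1 then sg 0 1 else sg 1 1) =
      (if i = 1 then sg 0 1 else sg 1 1)" for i :: 2
    using exhaust_2[of i]
    by (auto simp: std_module_def mt_vtx eval_simps lookup_single when_def simp del: single_one)
  moreover have "act (std_module q) (cf_arr a) (if tail cq a = 1 then sg 0 1 else sg 1 1) =
      pm_scale (q $ aidx a) (if head cq a = 1 then sg 0 1 else sg 1 1)" for a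
    using arrow_exhaust[of a]
    by (auto simp: std_module_def mt_arr eval_simps lookup_single when_def pm_scale_single simp del: single_one)
  ultimately show ?thesis
    unfolding frame_def using ne by simp
qed

text \<open>Multiplying the basis vector at each vertex i by \<open>c i\<close> changes an arrow
  scalar by the ratio of the factors at its tail and its head.\<close>

lemma torus_vec_arrow:
  fixes q :: "complex ^ 4"
  assumes that: "\<And>i::2. c i \<noteq> (0::complex)"
  shows "torus_vec (c 1 / c 2) q $ aidx a * c (head cq a) = q $ aidx a * c (tail cq a)"
  using arrow_exhaust[of a] that[of 1] that[of 2] by auto

lemma torus_vecI:
  fixes q :: "complex ^ 4"
  assumes "\<And>i::2. c i \<noteq> (0::complex)" "\<And>a. q' $ aidx a * c (head cq a) = q $ aidx a * c (tail cq a)"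
  shows "q' = torus_vec (c 1 / c 2) q"
proof -
  have "q' $ k = torus_vec (c 1 / c 2) q $ k" for k
    using aidx_surj[of k] torus_vec_arrow[where c = c and q = q, OF assms(1)] assms by (metis mult_right_cancel)
  then show ?thesis by (simp add: vec_eq_iff)
qed

text \<open>The space at each vertex is a line, so two frames differ by one scalar per
  vertex.\<close>

lemma frame_unique:
  assumes F: "frame V v q" and F': "frame V v' q'"
  shows "\<exists>\<mu>. \<mu> \<noteq> 0 \<and> q' = torus_vec \<mu> q"
proof -
  have "\<exists>c. v' i = pm_scale c (v i)" for i
    using frameD(7)[OF F', of i] unfolding frame_vs[OF F] span_1 .
  then obtain c where c: "\<And>i. v' i = pm_scale (c i) (v i)" by metis
  have c0: "c i \<noteq> 0" for i using frameD(2)[OF F', of i] by (auto simp: c)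
  have "q' $ aidx a * c (head cq a) = q $ aidx a * c (tail cq a)" for a
  proof -
    have "pm_scale (q' $ aidx a * c (head cq a)) (v (head cq a)) = act V (cf_arr a) (v' (tail cq a))"
      using frameD(6)[OF F', of a] by (simp add: c)
    also have "\<dots> = pm_scale (q $ aidx a * c (tail cq a)) (v (head cq a))"
      using is_moduleD(4)[OF frameD(1)[OF F] arr_CA frameD(3)[OF F]] frameD(6)[OF F, of a]
      by (simp add: c mult.commute)
    finally show ?thesis using frame_scale_eq[OF F] by blast
  qed
  then have "q' = torus_vec (c 1 / c 2) q" by (rule torus_vecI[OF c0])
  then show ?thesis using c0 by (metis divide_eq_0_iff)
qed

lemma frame_rescale:
  assumes F: "frame V v q" and \<mu>: "\<mu> \<noteq> 0" shows "\<exists>v'. frame V v' (torus_vec \<mu> q)"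
proof -
  define c where "c i = (if i = 1 then \<mu> else 1)" for i :: 2
  define v' where "v' i = pm_scale (c i) (v i)" for i
  have c0: "c i \<noteq> 0" for i using \<mu> by (simp add: c_def)
  note V = frameD(1)[OF F]
  have sp: "pm_scale k (v i) \<in> space V" for k i
    by (rule subspace_closed(3)[OF is_moduleD(1)[OF V] frameD(3)[OF F]])
  have "pm.span {v 1, v 2} = pm.span {v' 1, v' 2}"
  proof
    have "v 1 \<in> pm.span {v' 1, v' 2}"
      unfolding span_2 v'_def by (intro exI[of _ "inverse (c 1)"] exI[of _ 0]) (simp add: c0)
    moreover have "v 2 \<in> pm.span {v' 1, v' 2}"
      unfolding span_2 v'_def by (intro exI[of _ 0] exI[of _ "inverse (c 2)"]) (simp add: c0)
    ultimately show "pm.span {v 1, v 2} \<subseteq> pm.span {v' 1, v' 2}"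
      by (intro pm.span_minimal) (auto simp: pm.subspace_span)
    show "pm.span {v' 1, v' 2} \<subseteq> pm.span {v 1, v 2}"
      by (intro pm.span_minimal) (auto simp: pm.subspace_span v'_def intro: pm.span_scale pm.span_base)
  qed
  moreover have "act V (cf_arr a) (v' (tail cq a)) = pm_scale (torus_vec \<mu> q $ aidx a) (v' (head cq a))" for a
    using is_moduleD(4)[OF V arr_CA frameD(3)[OF F]] frameD(6)[OF F, of a] torus_vec_arrow[where c = c and q = q and a = a, OF c0]
    by (simp add: v'_def c_def mult.commute)
  moreover have "act V (cf_vtx i) (v' i) = v' i" for i
    using is_moduleD(4)[OF V vtx_CA frameD(3)[OF F]] frameD(4)[OF F] by (simp add: v'_def)
  ultimately have "frame V v' (torus_vec \<mu> q)"
    unfolding frame_def using V frameD(2,5)[OF F] sp c0 by (simp add: v'_def)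
  then show ?thesis by blast
qed

text \<open>An isomorphism transports the frame. Conversely, matching two frames with the same q
  defines a linear bijection, which commutes with the action because \<open>frame_act\<close>
  involves only q.\<close>

lemma frame_module_iso:
  assumes F: "frame V v q"
  shows "module_iso CA V W \<longleftrightarrow> (\<exists>w. frame W w q)"
proof
  assume "module_iso CA V W"
  then obtain \<phi> where W: "is_module CA W" and bij: "bij_betw \<phi> (space V) (space W)"
    and add: "\<And>x y. x \<in> space V \<Longrightarrow> y \<in> space V \<Longrightarrow> \<phi> (x + y) = \<phi> x + \<phi> y"
    and scale: "\<And>c x. x \<in> space V \<Longrightarrow> \<phi> (pm_scale c x) = pm_scale c (\<phi> x)"
    and act: "\<And>X x. X \<in> carrier CA \<Longrightarrow> x \<in> space V \<Longrightarrow> \<phi> (act V X x) = act W X (\<phi> x)"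
    unfolding module_iso_def by blast
  note v = frameD[OF F] and sV = subspace_closed[OF is_moduleD(1)[OF frameD(1)[OF F]]]
  have 0: "\<phi> 0 = 0" using add[OF sV(1) sV(1)] by simp
  have "\<phi> (v i) \<noteq> 0" for i
    using v(2,3) sV(1) 0 bij by (metis bij_betw_def inj_onD)
  moreover have "\<phi> (v i) \<in> space W" "act W (cf_vtx i) (\<phi> (v i)) = \<phi> (v i)" for i
    using v(3,4)[of i] bij act[OF vtx_CA v(3), of i i] by (auto simp: bij_betw_def)
  moreover have "space W = pm.span {\<phi> (v 1), \<phi> (v 2)}"
  proof -
    have "\<phi> (pm_scale a (v 1) + pm_scale b (v 2)) = pm_scale a (\<phi> (v 1)) + pm_scale b (\<phi> (v 2))" for a b
      using add sV(3) scale v(3) by simp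
    moreover have "space W = \<phi> ` pm.span {v 1, v 2}" using bij v(5) by (simp add: bij_betw_def)
    ultimately have "y \<in> space W \<longleftrightarrow> y \<in> pm.span {\<phi> (v 1), \<phi> (v 2)}" for y
      unfolding span_2 by (metis (no_types, lifting) image_iff span_2)
    then show ?thesis by blast
  qed
  moreover have "act W (cf_arr a) (\<phi> (v (tail cq a))) = pm_scale (q $ aidx a) (\<phi> (v (head cq a)))" for a
    using act[OF arr_CA v(3)] v(6) scale[OF v(3)] by metis
  ultimately show "\<exists>w. frame W w q" unfolding frame_def using W by (intro exI[of _ "\<lambda>i. \<phi> (v i)"]) simp
next
  assume "\<exists>w. frame W w q"
  then obtain w where G: "frame W w q" by blast
  note v = frameD[OF F] and w = frameD[OF G]
  define cr where "cr i x = (THE c. act V (cf_vtx i) x = pm_scale c (v i))" for i x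
  define \<phi> where "\<phi> x = pm_scale (cr 1 x) (w 1) + pm_scale (cr 2 x) (w 2)" for x
  have cr: "cr 1 (pm_scale a (v 1) + pm_scale b (v 2)) = a" "cr 2 (pm_scale a (v 1) + pm_scale b (v 2)) = b" for a b
    unfolding cr_def frame_vtx_comb[OF F] frame_scale_eq[OF F] by simp_all
  have \<phi>: "\<phi> (pm_scale a (v 1) + pm_scale b (v 2)) = pm_scale a (w 1) + pm_scale b (w 2)" for a b
    by (simp add: \<phi>_def cr)
  have V: "x \<in> space V \<Longrightarrow> \<exists>a b. x = pm_scale a (v 1) + pm_scale b (v 2)" for x
    unfolding v(5) span_2 .
  have lin: "pm_scale a (v 1) + pm_scale b (v 2) + (pm_scale c (v 1) + pm_scale d (v 2)) =
      pm_scale (a + c) (v 1) + pm_scale (b + d) (v 2)"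
    "pm_scale k (pm_scale a (v 1) + pm_scale b (v 2)) = pm_scale (k * a) (v 1) + pm_scale (k * b) (v 2)"
    for a b c d k and v :: "2 \<Rightarrow> cvec"
    by (simp_all add: algebra_simps pm.scale_left_distrib pm.scale_right_distrib)
  have actc: "act U X (pm_scale a (u 1) + pm_scale b (u 2)) =
      pm_scale (a * eval_at q (mt X 1 1) + b * eval_at q (mt X 1 2)) (u 1) +
      pm_scale (a * eval_at q (mt X 2 1) + b * eval_at q (mt X 2 2)) (u 2)"
    if "frame U u q" "X \<in> carrier CA" for U u X a b
  proof -
    note U = is_moduleD[OF frameD(1)[OF that(1)]] and u = frameD(3)[OF that(1)]
    have "act U X (pm_scale a (u 1) + pm_scale b (u 2)) = pm_scale a (act U X (u 1)) + pm_scale b (act U X (u 2))"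
      using U(3,4)[OF that(2)] u subspace_closed(3)[OF U(1)] by simp
    then show ?thesis unfolding frame_act[OF that] by (simp add: lin)
  qed
  have "bij_betw \<phi> (space V) (space W)"
  proof (rule bij_betw_imageI)
    show "inj_on \<phi> (space V)"
    proof (rule inj_onI)
      fix x y assume "x \<in> space V" "y \<in> space V" "\<phi> x = \<phi> y"
      then show "x = y" using V[of x] V[of y] \<phi> frame_comb_eq[OF G] by metis
    qed
    show "\<phi> ` space V = space W"
    proof (intro equalityI subsetI)
      fix y assume "y \<in> \<phi> ` space V"
      then show "y \<in> space W" unfolding w(5) span_2 using V \<phi> by blast
    next
      fix y assume "y \<in> space W"
      then obtain a b where "y = \<phi> (pm_scale a (v 1) + pm_scale b (v 2))" unfolding w(5) span_2 \<phi> by blast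
      moreover have "pm_scale a (v 1) + pm_scale b (v 2) \<in> space V" unfolding v(5) span_2 by blast
      ultimately show "y \<in> \<phi> ` space V" by blast
    qed
  qed
  moreover have "\<phi> (x + y) = \<phi> x + \<phi> y" if xy: "x \<in> space V" "y \<in> space V" for x y
  proof -
    obtain a b c d where "x = pm_scale a (v 1) + pm_scale b (v 2)" "y = pm_scale c (v 1) + pm_scale d (v 2)"
      using V xy by meson
    then show ?thesis by (simp only: lin \<phi>)
  qed
  moreover have "\<phi> (pm_scale c x) = pm_scale c (\<phi> x)" if x: "x \<in> space V" for c x
    using V[OF x] by (auto simp: lin \<phi>)
  moreover have "\<phi> (act V X x) = act W X (\<phi> x)" if x: "x \<in> space V" and X: "X \<in> carrier CA" for X x
    using V[OF x] by (auto simp: \<phi> actc[OF F X] actc[OF G X])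
  ultimately show "module_iso CA V W" unfolding module_iso_def using v(1) w(1) by blast
qed

text \<open>Common pattern of all the parameterizations: isoclasses are torus orbits of coordinate
  vectors, and f separates exactly the orbits in Q.\<close>

lemma parameterized_by_frames:
  fixes f :: "complex ^ 4 \<Rightarrow> 'x"
  assumes frames: "\<And>V. V \<in> \<V> \<Longrightarrow> \<exists>v q. frame V v q \<and> q \<in> Q"
    and torus: "\<And>q q'. q \<in> Q \<Longrightarrow> q' \<in> Q \<Longrightarrow> f q = f q' \<longleftrightarrow> (\<exists>\<mu>. \<mu> \<noteq> 0 \<and> q' = torus_vec \<mu> q)"

    and onto: "\<And>x. x \<in> X \<longleftrightarrow> (\<exists>q\<in>Q. x = f q)"
    and exist: "\<And>q. q \<in> Q \<Longrightarrow> \<exists>V v. V \<in> \<V> \<and> frame V v q"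
    and \<rho>: "\<And>V v q. V \<in> \<V> \<Longrightarrow> frame V v q \<Longrightarrow> q \<in> Q \<Longrightarrow> \<rho> V (f q)"
  shows "parameterized_by CA \<V> X \<rho>"
proof -
  \<comment> \<open>Any coordinate vector of a member will do: two of them lie in one orbit, on
    which f is constant.\<close>
  define F where "F C = f (SOME q. q \<in> Q \<and> (\<exists>V\<in>C. \<exists>v. frame V v q))" for C
  have cls: "iso_rel CA `` {V} = {W. \<exists>w. frame W w q}" if "frame V v q" for V v q
    using frame_module_iso[OF that] by (auto simp: iso_rel_def)
  have F: "F (iso_rel CA `` {V}) = f q" if V: "frame V v q" "q \<in> Q" for V v q
  proof -
    let ?P = "\<lambda>q'. q' \<in> Q \<and> (\<exists>W\<in>iso_rel CA `` {V}. \<exists>w. frame W w q')"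
    have "?P q" using V unfolding cls[OF V(1)] by blast
    then have *: "?P (SOME q'. ?P q')" by (rule someI)
    then obtain W w w' where "frame W w (SOME q'. ?P q')" "frame W w' q"
      unfolding cls[OF V(1)] by blast
    from frame_unique[OF this(2,1)] show ?thesis
      unfolding F_def using torus[OF V(2)] * by metis
  qed
  have "bij_betw F (\<V> // iso_rel CA) X"
  proof (rule bij_betw_imageI)
    show "inj_on F (\<V> // iso_rel CA)"
    proof (rule inj_onI)
      fix C D assume C: "C \<in> \<V> // iso_rel CA" and D: "D \<in> \<V> // iso_rel CA" and eq: "F C = F D"
      obtain V v q where V: "V \<in> \<V>" "C = iso_rel CA `` {V}" "frame V v q" "q \<in> Q"
        using C frames by (auto elim!: quotientE) metis
      obtain W w r where W: "W \<in> \<V>" "D = iso_rel CA `` {W}" "frame W w r" "r \<in> Q"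
        using D frames by (auto elim!: quotientE) metis
      have "f q = f r" using eq F[OF V(3,4)] F[OF W(3,4)] V(2) W(2) by simp
      then obtain \<mu> where "\<mu> \<noteq> 0" "r = torus_vec \<mu> q" using torus V W by blast
      then obtain v' where "frame V v' r" using frame_rescale[OF V(3)] by blast
      then show "C = D" using cls W V by metis
    qed
    show "F ` (\<V> // iso_rel CA) = X"
    proof (intro equalityI subsetI)
      fix x assume "x \<in> F ` (\<V> // iso_rel CA)"
      then obtain V where V: "V \<in> \<V>" "x = F (iso_rel CA `` {V})" by (auto elim!: quotientE)
      then show "x \<in> X" using frames[OF V(1)] F onto by metis
    next
      fix x assume "x \<in> X"
      then obtain q where q: "q \<in> Q" "x = f q" using onto by blast
      then obtain V v where V: "V \<in> \<V>" "frame V v q" using exist by blast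
      then show "x \<in> F ` (\<V> // iso_rel CA)" using F[OF V(2) q(1)] q(2) quotientI[OF V(1)] by force
    qed
  qed
  moreover have "\<rho> V (F (iso_rel CA `` {V}))" if "V \<in> \<V>" for V
    using frames[OF that] F \<rho>[OF that] by metis
  ultimately show ?thesis unfolding parameterized_by_def by blast
qed


section \<open>Simple modules\<close>

text \<open>Each vector has finite support, so B is a countable union of independent sets in
  finite-dimensional spaces.\<close>

lemma independent_countable:
  fixes B :: "cvec set" assumes "pm.independent B" shows "countable B"
proof -
  let ?B = "\<lambda>n. {b \<in> B. ks b \<subseteq> {..<n}}"
  have fin: "finite (?B n)" for n
  proof -
    have "b \<in> pm.span ((\<lambda>k. sg k 1) ` {..<n})" if "ks b \<subseteq> {..<n}" for b :: cvec
    proof -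
      have "b = (\<Sum>k\<in>ks b. pm_scale (lk b k) (sg k 1))"
        using poly_mapping_expand[of b] by (simp add: pm_scale_single)
      also have "\<dots> \<in> pm.span ((\<lambda>k. sg k 1) ` {..<n})"
        using that by (intro pm.span_sum pm.span_scale pm.span_base) auto
      finally show ?thesis .
    qed
    then have "?B n \<subseteq> pm.span ((\<lambda>k. sg k 1) ` {..<n})" by blast
    moreover have "pm.independent (?B n)" by (rule pm.independent_mono[OF assms]) blast
    ultimately show ?thesis using pm.independent_span_bound[of "(\<lambda>k. sg k 1) ` {..<n}" "?B n"] by simp
  qed
  have "B \<subseteq> (\<Union>n. ?B n)"
  proof
    fix b assume b: "b \<in> B"
    obtain n where "\<forall>k\<in>ks b. k < n" using finite_nat_set_iff_bounded[of "ks b"] by auto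
    then show "b \<in> (\<Union>n. ?B n)" using b by blast
  qed
  moreover have "countable (\<Union>n. ?B n)"
    by (intro countable_UN countableI_type countable_finite fin)
  ultimately show ?thesis using countable_subset by blast
qed

section \<open>Operators without eigenvectors\<close>

definition pev :: "(cvec \<Rightarrow> cvec) \<Rightarrow> complex poly \<Rightarrow> cvec \<Rightarrow> cvec" where
  "pev T p v = fold_coeffs (\<lambda>c u. pm_scale c v + T u) p 0"

context
  fixes W :: "cvec set" and T :: "cvec \<Rightarrow> cvec"
  assumes W: "pm.subspace W" and Tc: "\<And>v. v \<in> W \<Longrightarrow> T v \<in> W"
    and Ta: "\<And>v w. v \<in> W \<Longrightarrow> w \<in> W \<Longrightarrow> T (v + w) = T v + T w"
    and Ts: "\<And>c v. v \<in> W \<Longrightarrow> T (pm_scale c v) = pm_scale c (T v)"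
begin

lemma T0: "T 0 = 0" using Ta[of 0 0] subspace_closed(1)[OF W] by simp

lemma pev_0: "pev T 0 v = 0" by (simp add: pev_def)

lemma pev_pCons: "pev T (pCons c p) v = pm_scale c v + T (pev T p v)"
  by (cases "c = 0 \<and> p = 0") (auto simp: pev_def T0)

lemma pev_closed: "v \<in> W \<Longrightarrow> pev T p v \<in> W"
  by (induction p) (auto simp: pev_0 pev_pCons intro!: subspace_closed[OF W] Tc)

lemma pev_add: "v \<in> W \<Longrightarrow> pev T (p + q) v = pev T p v + pev T q v"
  by (induction p q rule: poly_induct2)
    (simp_all add: pev_0 pev_pCons pm.scale_left_distrib Ta pev_closed)

lemma pev_smult: "v \<in> W \<Longrightarrow> pev T (Polynomial.smult c p) v = pm_scale c (pev T p v)"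
  by (induction p) (simp_all add: pev_0 pev_pCons pm.scale_right_distrib Ts pev_closed)

lemma pev_mult: "v \<in> W \<Longrightarrow> pev T (p * q) v = pev T p (pev T q v)"
  by (induction p) (simp_all add: pev_0 pev_pCons pev_add pev_smult)

lemma pev_add_right: "v \<in> W \<Longrightarrow> w \<in> W \<Longrightarrow> pev T p (v + w) = pev T p v + pev T p w"
  by (induction p) (simp_all add: pev_0 pev_pCons pm.scale_right_distrib Ta pev_closed)

lemma pev_scale_right: "v \<in> W \<Longrightarrow> pev T p (pm_scale c v) = pm_scale c (pev T p v)"
  by (induction p) (simp_all add: pev_0 pev_pCons pm.scale_right_distrib Ts pev_closed mult.commute)

lemma pev_zero_right: "pev T p 0 = 0"
  by (induction p) (simp_all add: pev_0 pev_pCons T0)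

lemma pev_sum_right:
  assumes "finite S" "\<And>s. s \<in> S \<Longrightarrow> F s \<in> W"
  shows "pev T p (\<Sum>s\<in>S. F s) = (\<Sum>s\<in>S. pev T p (F s))"
  using assms
proof (induction S)
  case (insert s S)
  then have "sum F S \<in> W" by (intro pm.subspace_sum[OF W]) auto
  then show ?case using insert by (simp add: pev_add_right)
qed (simp add: pev_zero_right)

lemma pev_sum_left: "v \<in> W \<Longrightarrow> pev T (\<Sum>s\<in>S. P s) v = (\<Sum>s\<in>S. pev T (P s) v)"
  by (induction S rule: infinite_finite_induct) (simp_all add: pev_0 pev_add)

lemma pev_linear: "v \<in> W \<Longrightarrow> pev T [:- c, 1:] v = T v - pm_scale c v"
  by (simp add: pev_pCons pev_0 T0 pm.scale_minus_left)

text \<open>Over the complex numbers p splits into linear factors, and each T - c is injective when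
  T has no eigenvector.\<close>

lemma pev_injective:
  assumes ne: "\<And>c v. v \<in> W \<Longrightarrow> T v = pm_scale c v \<Longrightarrow> v = 0"
  shows "p \<noteq> 0 \<Longrightarrow> v \<in> W \<Longrightarrow> pev T p v = 0 \<Longrightarrow> v = 0"
proof (induction "degree p" arbitrary: p rule: less_induct)
  case less
  show ?case
  proof (cases "degree p = 0")
    case True
    then obtain c where "p = [:c:]" by (meson degree_eq_zeroE)
    then show ?thesis using less.prems by (simp add: pev_pCons pev_0 T0)
  next
    case False
    then have "\<not> constant (poly p)" by (simp add: constant_degree)
    then obtain r where "poly p r = 0" using fundamental_theorem_of_algebra by blast
    then obtain p' where p': "p = [:- r, 1:] * p'" by (metis dvdE poly_eq_0_iff_dvd)
    then have "p' \<noteq> 0" using less.prems by auto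
    then have "degree p' < degree p" unfolding p' by (subst degree_mult_eq) auto
    moreover have "pev T p' v = 0"
      using less.prems(3) ne[of "pev T p' v" r] pev_closed[OF less.prems(2)]
      unfolding p' pev_mult[OF less.prems(2)] by (simp add: pev_linear)
    ultimately show ?thesis using less.hyps \<open>p' \<noteq> 0\<close> less.prems(2) by blast
  qed
qed

text \<open>Dixmier's argument: the vectors \<open>(T - c)\<^sup>-\<^sup>1 v\<close> would be uncountably many independent vectors.\<close>

lemma resolvent_contradiction:
  assumes ne: "\<And>c v. v \<in> W \<Longrightarrow> T v = pm_scale c v \<Longrightarrow> v = 0"
    and v: "v \<in> W" "v \<noteq> 0" and onto: "\<And>c. \<exists>w\<in>W. T w - pm_scale c w = v"
  shows False
proof -
  obtain w where w: "\<And>c. w c \<in> W" "\<And>c. T (w c) - pm_scale c (w c) = v" using onto by metis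
  have inj: "inj w"
  proof (rule injI)
    fix c d assume "w c = w d"
    then have "T (w c) = v + pm_scale c (w c)" "T (w c) = v + pm_scale d (w c)"
      using w(2)[of c] w(2)[of d] by (simp_all add: diff_eq_eq)
    then have "pm_scale (c - d) (w c) = 0" by (auto simp: pm.scale_left_diff_distrib)
    moreover have "w c \<noteq> 0" using w(2)[of c] v(2) T0 by auto
    ultimately show "c = d" by simp
  qed
  have "pm.independent (range w)"
  proof
    assume "pm.dependent (range w)"
    then obtain S u where S: "finite S" "S \<subseteq> range w" "(\<Sum>x\<in>S. pm_scale (u x) x) = 0" "\<exists>x\<in>S. u x \<noteq> 0"
      by (auto simp: pm.dependent_explicit)
    define C where "C = w -` S"
    have C: "finite C" "S = w ` C" using S(1,2) inj by (auto simp: C_def intro: finite_vimageI)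
    define \<alpha> where "\<alpha> c = u (w c)" for c
    have 0: "(\<Sum>c\<in>C. pm_scale (\<alpha> c) (w c)) = 0"
      using S(3) sum.reindex[of w C "\<lambda>x. pm_scale (u x) x"] inj_on_subset[OF inj, of C]
      by (simp add: C(2) \<alpha>_def)
    obtain c0 where c0: "c0 \<in> C" "\<alpha> c0 \<noteq> 0" using S(4) C(2) by (auto simp: \<alpha>_def)
    \<comment> \<open>Applying the product of all T - c to the dependence relation clears the
      resolvents and leaves a polynomial in T applied to v.\<close>
    define pl where "pl A = (\<Prod>c\<in>A. [:- c, 1:])" for A :: "complex set"
    define g where "g = (\<Sum>c\<in>C. Polynomial.smult (\<alpha> c) (pl (C - {c})))"
    have pl: "pl C = pl (C - {c}) * [:- c, 1:]" if "c \<in> C" for c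
      unfolding pl_def using prod.remove[OF C(1) that, of "\<lambda>c. [:- c, 1:]"] by (simp add: mult.commute)
    have "0 = pev T (pl C) (\<Sum>c\<in>C. pm_scale (\<alpha> c) (w c))" by (simp add: 0 pev_zero_right)
    also have "\<dots> = (\<Sum>c\<in>C. pm_scale (\<alpha> c) (pev T (pl C) (w c)))"
      using C(1) w(1) subspace_closed(3)[OF W] by (simp add: pev_sum_right pev_scale_right)
    also have "\<dots> = (\<Sum>c\<in>C. pm_scale (\<alpha> c) (pev T (pl (C - {c})) v))"
    proof (intro sum.cong refl)
      fix c assume "c \<in> C"
      show "pm_scale (\<alpha> c) (pev T (pl C) (w c)) = pm_scale (\<alpha> c) (pev T (pl (C - {c})) v)"
        unfolding pl[OF \<open>c \<in> C\<close>] pev_mult[OF w(1)] pev_linear[OF w(1)] w(2) ..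
    qed
    also have "\<dots> = pev T g v" by (simp add: g_def pev_sum_left[OF v(1)] pev_smult[OF v(1)])
    finally have "pev T g v = 0" by simp
    \<comment> \<open>Injectivity forces g to vanish, but at \<open>c0\<close> only the summand
      belonging to \<open>c0\<close> survives, with nonzero value.\<close>
    then have "g = 0" using pev_injective[of g v] ne v by blast
    moreover have "poly g c0 = (\<Sum>c\<in>C. if c = c0 then \<alpha> c0 * poly (pl (C - {c0})) c0 else 0)"
      unfolding g_def poly_sum
    proof (intro sum.cong refl)
      fix c assume "c \<in> C"
      show "poly (Polynomial.smult (\<alpha> c) (pl (C - {c}))) c0 =
        (if c = c0 then \<alpha> c0 * poly (pl (C - {c0})) c0 else 0)"
      proof (cases "c = c0")
        case False
        then have "poly (pl (C - {c})) c0 = 0"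
          unfolding pl_def poly_prod using C(1) c0(1) by (intro prod_zero) auto
        then show ?thesis using False by simp
      qed simp
    qed
    ultimately have "\<alpha> c0 * poly (pl (C - {c0})) c0 = 0" using C(1) c0(1) by simp
    moreover have "poly (pl (C - {c0})) c0 \<noteq> 0"
      unfolding pl_def poly_prod using C(1) by (auto simp: prod_zero_iff)
    ultimately show False using c0(2) by simp
  qed
  then have "countable (range w)" by (rule independent_countable)
  then have "countable (UNIV :: complex set)" using inj by (metis countable_image_inj_eq)
  then have "countable (range complex_of_real)" by (rule countable_subset[rotated]) simp
  then have "countable (UNIV :: real set)" using countable_image_inj_eq[of complex_of_real UNIV] inj_of_real by blast
  then show False using uncountable_UNIV_real by blast
qed

end

lemma center_act_commute:
  assumes "is_module CA V" "z \<in> carrier (center CA)" "X \<in> carrier CA" "v \<in> space V"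
  shows "act V z (act V X v) = act V X (act V z v)"
proof -
  have "z \<in> carrier CA" "z \<otimes>\<^bsub>CA\<^esub> X = X \<otimes>\<^bsub>CA\<^esub> z" using assms(2,3) by (auto simp: center_def)
  then show ?thesis using is_moduleD(7)[OF assms(1)] assms(3,4) by metis
qed

text \<open>Kernel and image of z - c are submodules because z is central. If z were not scalar,
  simplicity would make every z - c bijective, which \<open>resolvent_contradiction\<close>
  excludes.\<close>

lemma simple_center_scalar:
  assumes S: "simple_module CA V" and z: "z \<in> carrier (center CA)"
  shows "\<exists>c. \<forall>v\<in>space V. act V z v = pm_scale c v"
proof (rule ccontr)
  assume no: "\<not> ?thesis"
  have V: "is_module CA V" and ne: "space V \<noteq> {0}"
    and simp: "\<And>W. submodule CA V W \<Longrightarrow> W = {0} \<or> W = space V"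
    using S by (auto simp: simple_module_def)
  note Vm = is_moduleD[OF V] and sV = subspace_closed[OF Vm(1)]
  have zC: "z \<in> carrier CA" using z by (simp add: center_def)
  let ?T = "act V z"
  have eig: "v = 0" if v: "v \<in> space V" "?T v = pm_scale c v" for c v
  proof -
    let ?K = "{v \<in> space V. ?T v = pm_scale c v}"
    have "submodule CA V ?K"
      unfolding submodule_def pm.subspace_def
      using sV act_0[OF V zC] center_act_commute[OF V z]
      by (auto simp: Vm zC pm.scale_right_distrib mult.commute)
    moreover have "?K \<noteq> space V" using no by blast
    ultimately have "?K = {0}" using simp by blast
    then show ?thesis using v by blast
  qed
  obtain v0 where v0: "v0 \<in> space V" "v0 \<noteq> 0" using ne sV(1) by blast
  have onto: "\<exists>w\<in>space V. ?T w - pm_scale c w = v0" for c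
  proof -
    let ?I = "(\<lambda>w. ?T w - pm_scale c w) ` space V"
    have "submodule CA V ?I"
      unfolding submodule_def pm.subspace_def
    proof (intro conjI ballI allI)
      show "0 \<in> ?I" using sV(1) act_0[OF V zC] by (intro image_eqI[of _ _ 0]) auto
      show "?I \<subseteq> space V" using Vm(2)[OF zC] sV(3) pm.subspace_diff[OF Vm(1)] by blast
      fix x assume "x \<in> ?I"
      then obtain v where v: "v \<in> space V" "x = ?T v - pm_scale c v" by blast
      show "pm_scale k x \<in> ?I" for k
        using v sV(3) by (intro image_eqI[of _ _ "pm_scale k v"])
          (auto simp: Vm(4)[OF zC] pm.scale_right_diff_distrib mult.commute)
      show "x + y \<in> ?I" if y: "y \<in> ?I" for y
      proof -
        obtain w where w: "w \<in> space V" "y = ?T w - pm_scale c w" using y by blast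
        show ?thesis using v w sV(2)
          by (intro image_eqI[of _ _ "v + w"]) (auto simp: Vm(3)[OF zC] pm.scale_right_distrib)
      qed
      show "act V X x \<in> ?I" if X: "X \<in> carrier CA" for X
        using v X Vm(2)[OF X v(1)] Vm(2)[OF zC v(1)] sV(3)
        by (intro image_eqI[of _ _ "act V X v"])
          (auto simp: act_diff[OF V X] Vm(4)[OF X] center_act_commute[OF V z X])
    qed
    moreover have "?I \<noteq> {0}"
    proof
      assume I: "?I = {0}"
      have "?T v0 - pm_scale c v0 \<in> ?I" using v0(1) by blast
      then have "?T v0 - pm_scale c v0 = 0" unfolding I by blast
      then show False using eig[OF v0(1), of c] v0(2) by simp
    qed
    ultimately have "?I = space V" using simp by blast
    then have "v0 \<in> ?I" using v0(1) by simp
    then obtain w where "w \<in> space V" "v0 = ?T w - pm_scale c w" by (rule imageE)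
    then show ?thesis by (intro bexI[of _ w]) simp_all
  qed
  show False
    by (rule resolvent_contradiction[OF Vm(1) Vm(2)[OF zC] Vm(3)[OF zC] Vm(4)[OF zC] eig v0 onto])
qed

text \<open>The module is generated by v, and elements cut down to vertex i on both sides act like
  central ones, hence by scalars.\<close>

lemma simple_vs:
  assumes S: "simple_module CA V" and v: "v \<in> act V (cf_vtx i) ` space V" "v \<noteq> 0"
  shows "act V (cf_vtx i) ` space V = pm.span {v}"
proof
  have V: "is_module CA V" using S by (simp add: simple_module_def)
  note Vm = is_moduleD[OF V] and sV = subspace_closed[OF Vm(1)]
  have vV: "v \<in> space V" "act V (cf_vtx i) v = v" using v vs_iff[OF V] by auto
  show "pm.span {v} \<subseteq> act V (cf_vtx i) ` space V"
    using subspace_vs[OF V] v(1) by (intro pm.span_minimal) auto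
  let ?W = "(\<lambda>X. act V X v) ` carrier CA"
  have "submodule CA V ?W"
    unfolding submodule_def pm.subspace_def
  proof (intro conjI ballI allI)
    show "0 \<in> ?W" using act_zero[OF V vV(1)] CA.zero_closed by force
    show "?W \<subseteq> space V" using Vm(2) vV by blast
    fix x assume "x \<in> ?W"
    then obtain X where X: "X \<in> carrier CA" "x = act V X v" by blast
    show "pm_scale c x \<in> ?W" for c
      using X mt_scale(2)[OF X(1)] Vm(6)[OF X(1) vV(1)] by (intro image_eqI[of _ _ "c \<odot>\<^bsub>CA\<^esub> X"]) simp_all
    show "x + y \<in> ?W" if y: "y \<in> ?W" for y
    proof -
      obtain Y where Y: "Y \<in> carrier CA" "y = act V Y v" using y by blast
      then show ?thesis
        using X Vm(5)[OF X(1) Y(1) vV(1)] by (intro image_eqI[of _ _ "X \<oplus>\<^bsub>CA\<^esub> Y"]) simp_all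
    qed
    show "act V Y x \<in> ?W" if "Y \<in> carrier CA" for Y
      using that X Vm(7)[OF that X(1) vV(1)] by (intro image_eqI[of _ _ "Y \<otimes>\<^bsub>CA\<^esub> X"]) simp_all
  qed
  moreover have "v \<in> ?W" using Vm(8)[OF vV(1)] by (intro image_eqI[of _ _ "\<one>\<^bsub>CA\<^esub>"]) simp_all
  ultimately have W: "?W = space V" using S v(2) unfolding simple_module_def by blast
  show "act V (cf_vtx i) ` space V \<subseteq> pm.span {v}"
  proof
    fix w assume w: "w \<in> act V (cf_vtx i) ` space V"
    then have w': "w \<in> space V" "act V (cf_vtx i) w = w" using vs_iff[OF V] by auto
    have "w \<in> ?W" using w'(1) W by simp
    then obtain X where X: "X \<in> carrier CA" "w = act V X v" by (elim imageE)
    have "homog 0 (mt X i i)" using mt_homog[OF X(1), of i i] by simp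
    \<comment> \<open>The diagonal entry has weight zero and so extends to a central element, which
      agrees with X between the idempotents at i.\<close>
    then obtain z where z: "z \<in> carrier (center CA)" "mt z 1 1 = mt X i i" using exists_center by blast
    then have zC: "z \<in> carrier CA" and mz: "mt z j k = (if j = k then mt X i i else 0)" for j k
      using exhaust_2[of j] exhaust_2[of k] by (auto simp: center_iff)
    have "cf_vtx i \<otimes>\<^bsub>CA\<^esub> X \<otimes>\<^bsub>CA\<^esub> cf_vtx i = cf_vtx i \<otimes>\<^bsub>CA\<^esub> z"
      by (rule mt_inj) (use X zC vtx_CA in \<open>auto simp: mt_vtx_left mt_vtx_right mz\<close>)
    then have "act V (cf_vtx i) (act V X (act V (cf_vtx i) v)) = act V (cf_vtx i) (act V z v)"
      using Vm(7)[OF vtx_CA zC vV(1), of i] Vm(7)[OF vtx_CA X(1) vV(1), of i]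
        Vm(7)[of "cf_vtx i \<otimes>\<^bsub>CA\<^esub> X" "cf_vtx i" v] vV X(1) vtx_CA by simp
    then have "w = act V (cf_vtx i) (act V z v)" using vV(2) X(2) w'(2) by simp
    moreover obtain c where "act V z v = pm_scale c v" using simple_center_scalar[OF S z(1)] vV(1) by blast
    ultimately have "w = pm_scale c v" using Vm(4)[OF vtx_CA vV(1), of i c] vV(2) by simp
    then show "w \<in> pm.span {v}" by (auto simp: span_1)
  qed
qed

lemma dim_vector_frame:
  assumes V: "is_module CA V" and dim: "dim_vector cf_vtx V = (\<lambda>_. 1)" shows "\<exists>v q. frame V v q"
proof -
  have "\<exists>w. w \<noteq> 0 \<and> act V (cf_vtx i) ` space V = pm.span {w}" for i
  proof -
    have "edim (act V (cf_vtx i) ` space V) = 1" using dim by (simp add: dim_vector_def fun_eq_iff)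
    then show ?thesis using edim_1E subspace_vs[OF V] by metis
  qed
  then obtain v where v: "\<And>i. v i \<noteq> 0" "\<And>i. act V (cf_vtx i) ` space V = pm.span {v i}" by metis
  have vi: "v i \<in> act V (cf_vtx i) ` space V" for i unfolding v(2) by (simp add: pm.span_base)
  have "\<exists>c. act V (cf_arr a) (v (tail cq a)) = pm_scale c (v (head cq a))" for a
  proof -
    have "act V (cf_arr a) (v (tail cq a)) \<in> act V (cf_vtx (head cq a)) ` space V"
      using act_vs[OF V arr_CA _ arr_vtx(1)[OF V]] vi vs_iff[OF V] by blast
    then show ?thesis unfolding v(2) span_1 .
  qed
  then obtain c where c: "\<And>a. act V (cf_arr a) (v (tail cq a)) = pm_scale (c a) (v (head cq a))" by metis
  define q :: "complex ^ 4" where "q = vector [c (Aarr 1), c (Aarr 2), c (Barr 1), c (Barr 2)]"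
  have "acts_by V q"
    unfolding acts_by_def
    using dim vi[of 1] vi[of 2] v(1)[of 1] v(1)[of 2] c[of "Aarr 1"] c[of "Aarr 2"] c[of "Barr 1"] c[of "Barr 2"]
    by (intro conjI bexI[of _ "v 1"] bexI[of _ "v 2"]) (simp_all add: q_def vector_4)
  then show ?thesis using acts_by_frame[OF V] by blast
qed

text \<open>By \<open>simple_vs\<close> each vertex space is zero or a line, and total dimension two
  forces both to be lines.\<close>

lemma simple_edim_le: assumes S: "simple_module CA V" shows "edim (space V) \<le> 2"
  and "edim (space V) = 2 \<Longrightarrow> \<exists>v q. frame V v q"
proof -
  have V: "is_module CA V" using S by (simp add: simple_module_def)
  note Vm = is_moduleD[OF V]
  have "\<exists>w. act V (cf_vtx i) ` space V = pm.span {w}" for i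
  proof (cases "act V (cf_vtx i) ` space V = {0}")
    case True
    then show ?thesis by (intro exI[of _ 0]) auto
  next
    case False
    then obtain w where "w \<in> act V (cf_vtx i) ` space V" "w \<noteq> 0"
      using subspace_closed(1)[OF subspace_vs[OF V, of i]] by blast
    then show ?thesis using simple_vs[OF S] by blast
  qed
  then obtain v where v: "\<And>i. act V (cf_vtx i) ` space V = pm.span {v i}" by metis
  have sub: "space V \<subseteq> pm.span {v 1, v 2}"
  proof
    fix w assume w: "w \<in> space V"
    then have "act V (cf_vtx i) w \<in> pm.span {v i}" for i using v by blast
    then obtain a b where "act V (cf_vtx 1) w = pm_scale a (v 1)" "act V (cf_vtx 2) w = pm_scale b (v 2)"
      unfolding span_1 by meson
    then show "w \<in> pm.span {v 1, v 2}" using vtx_decompose[OF V w] unfolding span_2 by metis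
  qed
  have "edim (space V) \<le> enat (card {v 1, v 2})" by (rule edim_le[OF _ sub]) simp
  also have "\<dots> \<le> enat 2" by (simp add: card_insert_if)
  finally show "edim (space V) \<le> 2" by (simp add: numeral_eq_enat)
  show "\<exists>v q. frame V v q" if 2: "edim (space V) = 2"
  proof (rule dim_vector_frame[OF V])
    have "v i \<noteq> 0" for i
    proof
      assume "v i = 0"
      then have "space V \<subseteq> pm.span {v (if i = 1 then 2 else 1)}"
        using sub exhaust_2[of i] by (auto simp: pm.span_insert_0 insert_commute)
      then have "edim (space V) \<le> enat (card {v (if i = 1 then 2 else 1)})" by (intro edim_le) auto
      then show False using 2 by (simp add: numeral_eq_enat)
    qed
    then show "dim_vector cf_vtx V = (\<lambda>_. 1)" using v edim_singleton by (simp add: dim_vector_def fun_eq_iff)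
  qed
qed

section \<open>Submodules of framed modules\<close>

lemma monval_eq_0_iff: "monval (($) q) m = (0::complex) \<longleftrightarrow> (\<exists>k\<in>ks m. q $ k = 0)"
  by (auto simp: monval_def in_keys_iff)

text \<open>The obstruction to the line at vertex i being a submodule; see
  \<open>submodule_span_vertex\<close>.\<close>

definition out :: "complex ^ 4 \<Rightarrow> 2 \<Rightarrow> bool" where
  "out q i \<longleftrightarrow> (\<exists>a. tail cq a = i \<and> q $ aidx a \<noteq> 0)"

lemma out_simps: "out q 1 \<longleftrightarrow> q $ 1 \<noteq> 0 \<or> q $ 2 \<noteq> 0" "out q 2 \<longleftrightarrow> q $ 3 \<noteq> 0 \<or> q $ 4 \<noteq> 0"
  unfolding out_def by (metis aidx_simps arrow_exhaust cq_simps(3,5) two_distinct)+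

text \<open>By weight, every monomial leading from i to the other vertex contains an arrow leaving
  i.\<close>

lemma not_out_eval:
  assumes "\<not> out q i" "j \<noteq> i" "X \<in> carrier CA" shows "eval_at q (mt X j i) = 0"
  unfolding insertion_monval
proof (intro sum.neutral ballI)
  fix m assume "m \<in> ks (mt X j i)"
  then have wt: "wt m = wd j - wd i" using mt_homog[OF assms(3), of j i] by (auto simp: homog_def)
  have "\<exists>k\<in>ks m. q $ k = 0"
  proof (cases "i = 1")
    case True
    then have "j = 2" using assms(2) exhaust_2[of j] by auto
    then have "lk m 1 \<noteq> 0 \<or> lk m 2 \<noteq> 0" using wt True by (auto simp: wt_def)
    then show ?thesis using assms(1) True by (auto simp: out_simps in_keys_iff)
  next
    case False
    then have i: "i = 2" using exhaust_2[of i] by auto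
    then have "j = 1" using assms(2) exhaust_2[of j] by auto
    then have "lk m 3 \<noteq> 0 \<or> lk m 4 \<noteq> 0" using wt i by (auto simp: wt_def)
    then show ?thesis using assms(1) i by (auto simp: out_simps in_keys_iff)
  qed
  then have "monval (($) q) m = 0" using monval_eq_0_iff by blast
  then show "id (lk (mt X j i) m) * monval (($) q) m = 0" by simp
qed

lemma submodule_span_vertex:
  assumes F: "frame V v q" and "\<not> out q i" shows "submodule CA V (pm.span {v i})"
  unfolding submodule_def
proof (intro conjI ballI)
  note V = is_moduleD[OF frameD(1)[OF F]]
  show "pm.span {v i} \<subseteq> space V" using frameD(3)[OF F, of i] V(1) by (intro pm.span_minimal) auto
  fix X w assume X: "X \<in> carrier CA" and "w \<in> pm.span {v i}"
  then obtain c where c: "w = pm_scale c (v i)" by (auto simp: span_1)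
  have "act V X (v i) = pm_scale (eval_at q (mt X i i)) (v i)"
    using exhaust_2[of i] frame_act[OF F X, of i] not_out_eval[OF assms(2) _ X, of 1]
      not_out_eval[OF assms(2) _ X, of 2] by auto
  then show "act V X w \<in> pm.span {v i}"
    using V(4)[OF X frameD(3)[OF F]] by (auto simp: c span_1)
qed (rule pm.subspace_span)

text \<open>The vertex idempotents project a submodule to its vertex components, so it is spanned by
  some of the \<open>v i\<close>; an arrow with nonzero scalar pulls in the other vertex.\<close>

lemma submodule_frame:
  assumes F: "frame V v q" and W: "submodule CA V W"
  shows "W = {0} \<or> W = space V \<or> (\<exists>i. W = pm.span {v i} \<and> \<not> out q i)"
proof -
  note V = is_moduleD[OF frameD(1)[OF F]]
  have sub: "pm.subspace W" "W \<subseteq> space V" "\<And>X w. X \<in> carrier CA \<Longrightarrow> w \<in> W \<Longrightarrow> act V X w \<in> W"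
    using W by (auto simp: submodule_def)
  have comp: "(a \<noteq> 0 \<longrightarrow> v 1 \<in> W) \<and> (b \<noteq> 0 \<longrightarrow> v 2 \<in> W)"
    if w: "pm_scale a (v 1) + pm_scale b (v 2) \<in> W" for a b
  proof -
    have "pm_scale a (v 1) \<in> W" "pm_scale b (v 2) \<in> W"
      using sub(3)[OF vtx_CA w] frame_vtx_comb[OF F] by metis+
    then have "pm_scale (inverse a) (pm_scale a (v 1)) \<in> W" "pm_scale (inverse b) (pm_scale b (v 2)) \<in> W"
      using subspace_closed(3)[OF sub(1)] by blast+
    then show ?thesis by auto
  qed
  have el: "\<exists>a b. w = pm_scale a (v 1) + pm_scale b (v 2)" if "w \<in> W" for w
    using that sub(2) unfolding frameD(5)[OF F] span_2[symmetric] by blast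
  have span: "pm.span {v i} \<subseteq> W" if "v i \<in> W" for i using that sub(1) by (intro pm.span_minimal) auto
  have no: "\<not> out q i" if "v i \<in> W" "v j \<notin> W" "i \<noteq> j" for i j
  proof
    assume "out q i"
    then obtain a where a: "tail cq a = i" "q $ aidx a \<noteq> 0" by (auto simp: out_def)
    then have "head cq a = j" using that(3) exhaust_2[of i] exhaust_2[of j] by (cases a) auto
    then have "pm_scale (q $ aidx a) (v j) \<in> W" using sub(3)[OF arr_CA that(1), of a] frameD(6)[OF F, of a] a by simp
    then have "pm_scale (inverse (q $ aidx a)) (pm_scale (q $ aidx a) (v j)) \<in> W"
      by (rule subspace_closed(3)[OF sub(1)])
    then show False using a(2) that(2) by simp
  qed
  show ?thesis
  proof (cases "v 1 \<in> W"; cases "v 2 \<in> W")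
    assume "v 1 \<in> W" "v 2 \<in> W"
    then have "space V \<subseteq> W" unfolding frameD(5)[OF F] using sub(1) by (intro pm.span_minimal) auto
    then show ?thesis using sub(2) by blast
  next
    assume 1: "v 1 \<in> W" "v 2 \<notin> W"
    have "W \<subseteq> pm.span {v 1}"
    proof
      fix w assume w: "w \<in> W"
      then obtain a b where ab: "w = pm_scale a (v 1) + pm_scale b (v 2)" using el by blast
      then have "b = 0" using comp[of a b] w 1 by auto
      then show "w \<in> pm.span {v 1}" using ab by (auto simp: span_1)
    qed
    then show ?thesis using span[OF 1(1)] no[OF 1] by auto
  next
    assume 2: "v 1 \<notin> W" "v 2 \<in> W"
    have "W \<subseteq> pm.span {v 2}"
    proof
      fix w assume w: "w \<in> W"
      then obtain a b where ab: "w = pm_scale a (v 1) + pm_scale b (v 2)" using el by blast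
      then have "a = 0" using comp[of a b] w 2 by auto
      then show "w \<in> pm.span {v 2}" using ab by (auto simp: span_1)
    qed
    then show ?thesis using span[OF 2(2)] no[OF 2(2,1)] by auto
  next
    assume 0: "v 1 \<notin> W" "v 2 \<notin> W"
    have "w = 0" if w: "w \<in> W" for w
    proof -
      obtain a b where ab: "w = pm_scale a (v 1) + pm_scale b (v 2)" using el[OF w] by blast
      then have "a = 0" "b = 0" using comp[of a b] w 0 by auto
      then show ?thesis using ab by simp
    qed
    then show ?thesis using subspace_closed(1)[OF sub(1)] by blast
  qed
qed

lemma frame_span_proper:
  assumes "frame V v q" shows "pm.span {v i} \<noteq> space V" "pm.span {v i} \<noteq> {0}" "space V \<noteq> {0}"
proof -
  have "v j \<notin> pm.span {v i}" if "j \<noteq> i" for j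
  proof
    assume "v j \<in> pm.span {v i}"
    then obtain c where "v j = pm_scale c (v i)" by (auto simp: span_1)
    then have "act V (cf_vtx j) (v j) = pm_scale c (act V (cf_vtx j) (v i))"
      using is_moduleD(4)[OF frameD(1)[OF assms] vtx_CA frameD(3)[OF assms]] by simp
    then show False using frameD(4,8,2)[OF assms] that by simp
  qed
  moreover obtain j where "j \<noteq> i" using exhaust_2[of i] two_distinct by metis
  ultimately show "pm.span {v i} \<noteq> space V" using frameD(3)[OF assms] by blast
  show "pm.span {v i} \<noteq> {0}" using frameD(2)[OF assms] pm.span_base[of "v i" "{v i}"] by auto
  show "space V \<noteq> {0}" using frameD(2,3)[OF assms] by blast
qed

lemma simple_frame:
  assumes F: "frame V v q" shows "simple_module CA V \<longleftrightarrow> (\<forall>i. out q i)"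
proof
  assume "simple_module CA V"
  then show "\<forall>i. out q i"
    using submodule_span_vertex[OF F] frame_span_proper[OF F] unfolding simple_module_def by metis
next
  assume "\<forall>i. out q i"
  then show "simple_module CA V"
    using submodule_frame[OF F] frame_span_proper(3)[OF F] frameD(1)[OF F] unfolding simple_module_def by metis
qed

lemma out_ones: "out (\<chi> i. 1) i"
  using exhaust_2[of i] by (auto simp: out_simps)

text \<open>Simple modules have dimension at most two, and the module with all scalars equal to 1
  shows that two is attained.\<close>

lemma large_iff: "large_module CA V \<longleftrightarrow> (\<exists>v q. frame V v q \<and> (\<forall>i. out q i))"
proof
  assume "\<exists>v q. frame V v q \<and> (\<forall>i. out q i)"
  then obtain v q where F: "frame V v q" "\<forall>i. out q i" by blast
  then show "large_module CA V"
    unfolding large_module_def using simple_frame[OF F(1)] simple_edim_le(1) frame_edim[OF F(1)] by simp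
next
  assume L: "large_module CA V"
  let ?q = "(\<chi> i. 1) :: complex ^ 4"
  have out: "\<forall>i. out ?q i" by (simp add: out_ones)
  have "simple_module CA (std_module ?q)" "edim (space (std_module ?q)) = 2"
    using simple_frame[OF frame_std_module] frame_edim[OF frame_std_module] out by blast+
  then have "2 \<le> edim (space V)" and S: "simple_module CA V" using L unfolding large_module_def by metis+
  then have "edim (space V) = 2" using simple_edim_le(1)[OF S] by (intro order_antisym)
  then obtain v q where "frame V v q" using simple_edim_le(2)[OF S] by blast
  then show "\<exists>v q. frame V v q \<and> (\<forall>i. out q i)" using simple_frame \<open>simple_module CA V\<close> by blast
qed

section \<open>Almost large modules\<close>

lemma submodule_module: "is_module A V \<Longrightarrow> submodule A V W \<Longrightarrow> is_module A (V\<lparr>space := W\<rparr>)"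
  unfolding is_module_def submodule_def by (auto simp: subset_iff)

lemma submodule_update: "submodule A (V\<lparr>space := W\<rparr>) W' \<longleftrightarrow> pm.subspace W' \<and> W' \<subseteq> W \<and>
    (\<forall>a\<in>carrier A. \<forall>v\<in>W'. act V a v \<in> W')"
  by (simp add: submodule_def)

lemma simple_span_vertex:
  assumes F: "frame V v q" and "\<not> out q i" shows "simple_module CA (V\<lparr>space := pm.span {v i}\<rparr>)"
  unfolding simple_module_def
proof (intro conjI allI impI)
  show "is_module CA (V\<lparr>space := pm.span {v i}\<rparr>)"
    by (rule submodule_module[OF frameD(1)[OF F] submodule_span_vertex[OF assms]])
  show "space (V\<lparr>space := pm.span {v i}\<rparr>) \<noteq> {0}" using frame_span_proper(2)[OF F] by simp
  fix W assume "submodule CA (V\<lparr>space := pm.span {v i}\<rparr>) W"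
  then have W: "pm.subspace W" "W \<subseteq> pm.span {v i}" by (auto simp: submodule_update)
  show "W = {0} \<or> W = space (V\<lparr>space := pm.span {v i}\<rparr>)"
  proof (cases "W = {0}")
    case False
    then obtain w where w: "w \<in> W" "w \<noteq> 0" using subspace_closed(1)[OF W(1)] by blast
    then obtain c where c: "w = pm_scale c (v i)" using subsetD[OF W(2) w(1)] by (auto simp: span_1)
    then have "c \<noteq> 0" using w by auto
    have "pm_scale (inverse c) w \<in> W" by (rule subspace_closed(3)[OF W(1) w(1)])
    then have "v i \<in> W" using c \<open>c \<noteq> 0\<close> by simp
    then have "pm.span {v i} \<subseteq> W" using W(1) by (intro pm.span_minimal) auto
    then show ?thesis using W(2) by auto
  qed simp
qed

lemma semisimple_span_vertex:
  assumes F: "frame V v q" and no: "\<not> out q i" shows "semisimple_module CA (V\<lparr>space := pm.span {v i}\<rparr>)"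
  unfolding semisimple_module_def
proof
  let ?V = "V\<lparr>space := pm.span {v i}\<rparr>"
  have s: "simple_module CA ?V" by (rule simple_span_vertex[OF assms])
  then show "is_module CA ?V" by (simp add: simple_module_def)
  have "submodule CA ?V (pm.span {v i})"
    using submodule_span_vertex[OF assms] by (auto simp: submodule_def)
  then have "pm.span {v i} \<subseteq> \<Union>{W. submodule CA ?V W \<and> simple_module CA (?V\<lparr>space := W\<rparr>)}"
    using s by (intro Union_upper) simp
  moreover have "\<Union>{W. submodule CA ?V W \<and> simple_module CA (?V\<lparr>space := W\<rparr>)} \<subseteq> pm.span {v i}"
    by (auto simp: submodule_update)
  ultimately have "\<Union>{W. submodule CA ?V W \<and> simple_module CA (?V\<lparr>space := W\<rparr>)} = pm.span {v i}" by blast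
  then show "space ?V = pm.span (\<Union>{W. submodule CA ?V W \<and> simple_module CA (?V\<lparr>space := W\<rparr>)})"
    by (simp add: pm.span_span)
qed

text \<open>The line at i is the only proper nonzero submodule, so all simple submodules together
  span just that line.\<close>

lemma socle_one:
  assumes F: "frame V v q" and no: "\<not> out q i" and out: "\<And>j. j \<noteq> i \<Longrightarrow> out q j"
  shows "socle CA V = V\<lparr>space := pm.span {v i}\<rparr>"
proof -
  have "(GREATEST W. submodule CA V W \<and> semisimple_module CA (V\<lparr>space := W\<rparr>)) = pm.span {v i}"
  proof (rule Greatest_equality)
    show "submodule CA V (pm.span {v i}) \<and> semisimple_module CA (V\<lparr>space := pm.span {v i}\<rparr>)"
      using submodule_span_vertex[OF F no] semisimple_span_vertex[OF F no] by blast
    fix W assume W: "submodule CA V W \<and> semisimple_module CA (V\<lparr>space := W\<rparr>)"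
    have sub: "W' = {0} \<or> W' = space V \<or> W' = pm.span {v i}" if "submodule CA V W'" for W'
      using submodule_frame[OF F that] out by metis
    have "W \<noteq> space V"
    proof
      assume "W = space V"
      moreover have upd: "V\<lparr>space := space V\<rparr> = V" by simp
      ultimately have "semisimple_module CA V" using W by simp
      then have "space V = pm.span (\<Union>{W. submodule CA V W \<and> simple_module CA (V\<lparr>space := W\<rparr>)})"
        by (simp add: semisimple_module_def)
      moreover have "W' \<subseteq> pm.span {v i}" if W': "submodule CA V W'" "simple_module CA (V\<lparr>space := W'\<rparr>)" for W'
      proof -
        have "W' \<noteq> space V" using W'(2) simple_frame[OF F] no upd by auto
        then show ?thesis using sub[OF W'(1)] pm.span_zero by blast
      qed
      then have "pm.span (\<Union>{W. submodule CA V W \<and> simple_module CA (V\<lparr>space := W\<rparr>)}) \<subseteq> pm.span {v i}"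
        by (intro pm.span_minimal) (auto simp: pm.subspace_span)
      ultimately have "space V \<subseteq> pm.span {v i}" by simp
      moreover have "pm.span {v i} \<subseteq> space V" using submodule_span_vertex[OF F no] by (simp add: submodule_def)
      ultimately show False using frame_span_proper(1)[OF F, of i] by blast
    qed
    then show "W \<le> pm.span {v i}" using sub[of W] W pm.span_zero by blast
  qed
  then show ?thesis by (simp add: socle_def)
qed

text \<open>With all arrows acting by zero both vertex lines are simple submodules, and they span
  the module.\<close>

lemma socle_all:
  assumes F: "frame V v q" and no: "\<And>i. \<not> out q i" shows "socle CA V = V"
proof -
  let ?U = "\<Union>{W. submodule CA V W \<and> simple_module CA (V\<lparr>space := W\<rparr>)}"
  have U: "v i \<in> ?U" for i
    using submodule_span_vertex[OF F no] simple_span_vertex[OF F no] pm.span_base[of "v i" "{v i}"] by blast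
  then have "space V \<subseteq> pm.span ?U"
    unfolding frameD(5)[OF F] by (intro pm.span_mono insert_subsetI U empty_subsetI)
  moreover have "pm.span ?U \<subseteq> space V"
    using is_moduleD(1)[OF frameD(1)[OF F]] by (intro pm.span_minimal) (auto simp: submodule_def)
  ultimately have "semisimple_module CA V" using frameD(1)[OF F] by (simp add: semisimple_module_def)
  moreover have "submodule CA V (space V)"
    using is_moduleD(1,2)[OF frameD(1)[OF F]] by (simp add: submodule_def)
  ultimately have "(GREATEST W. submodule CA V W \<and> semisimple_module CA (V\<lparr>space := W\<rparr>)) = space V"
    by (intro Greatest_equality) (auto simp: submodule_def)
  then show ?thesis by (simp add: socle_def)
qed

lemma edim_0: assumes "edim W = 0" "w \<in> W" shows "w = 0"
proof (rule ccontr)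
  assume "w \<noteq> 0"
  obtain B where B: "finite B" "W \<subseteq> pm.span B" "pm.dim W = 0"
    using assms(1) by (auto simp: edim_def zero_enat_def split: if_splits)
  obtain B' where B': "B' \<subseteq> W" "pm.independent B'" "W \<subseteq> pm.span B'" "card B' = 0"
    using pm.basis_exists[of W] B(3) by metis
  have "finite B'" using pm.independent_span_bound[OF B(1) B'(2)] B'(1) B(2) by blast
  then have "W \<subseteq> {0}" using B'(3,4) by simp
  with assms(2) \<open>w \<noteq> 0\<close> show False by blast
qed

text \<open>If no arrow acts nontrivially out of i, then \<open>v i\<close> lies in the socle,
  whereas the vertex simple at k has nothing at vertices other than k.\<close>

lemma socle_vertex_simple_iff:
  assumes F: "frame V v q" and ns: "\<not> simple_module CA V"
  shows "(\<exists>S. vertex_simple k S \<and> module_iso CA (socle CA V) S) \<longleftrightarrow> \<not> out q k \<and> (\<forall>j. j \<noteq> k \<longrightarrow> out q j)"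
proof
  assume "\<exists>S. vertex_simple k S \<and> module_iso CA (socle CA V) S"
  then obtain S where S: "vertex_simple k S" "module_iso CA (socle CA V) S" by blast
  have key: "i = k" if no: "\<not> out q i" for i
  proof (rule ccontr)
    assume "i \<noteq> k"
    have act: "act (socle CA V) = act V" by (simp add: socle_def)
    have m: "v i \<in> space (socle CA V)"
    proof (cases "\<exists>j. j \<noteq> i \<and> \<not> out q j")
      case True
      then obtain j0 where "j0 \<noteq> i" "\<not> out q j0" by blast
      then have "\<not> out q j" for j using no exhaust_2[of j] exhaust_2[of i] exhaust_2[of j0] by auto
      then show ?thesis using socle_all[OF F] frameD(3)[OF F] by simp
    next
      case False
      then have "socle CA V = V\<lparr>space := pm.span {v i}\<rparr>" by (intro socle_one[OF F no]) blast
      then show ?thesis using pm.span_base[of "v i" "{v i}"] by simp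
    qed
    obtain \<phi> where \<phi>: "bij_betw \<phi> (space (socle CA V)) (space S)"
      "\<And>x y. x \<in> space (socle CA V) \<Longrightarrow> y \<in> space (socle CA V) \<Longrightarrow> \<phi> (x + y) = \<phi> x + \<phi> y"
      "\<And>X x. X \<in> carrier CA \<Longrightarrow> x \<in> space (socle CA V) \<Longrightarrow> \<phi> (act (socle CA V) X x) = act S X (\<phi> x)"
      and sc: "is_module CA (socle CA V)"
      using S(2) unfolding module_iso_def by blast
    have "act S (cf_vtx i) (\<phi> (v i)) = \<phi> (v i)"
      using \<phi>(3)[OF vtx_CA m, of i] frameD(4)[OF F, of i] act by simp
    moreover have "\<phi> (v i) \<in> space S" by (rule bspec[OF bij_betwE[OF \<phi>(1)] m])
    ultimately have "\<phi> (v i) \<in> act S (cf_vtx i) ` space S" by (intro image_eqI[of _ _ "\<phi> (v i)"]) simp_all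
    moreover have "edim (act S (cf_vtx i) ` space S) = 0"
      using S(1) \<open>i \<noteq> k\<close> by (simp add: vertex_simple_def dim_vector_def fun_eq_iff)
    ultimately have "\<phi> (v i) = 0" using edim_0 by blast
    have z: "0 \<in> space (socle CA V)" by (rule subspace_closed(1)[OF is_moduleD(1)[OF sc]])
    have "\<phi> (v i) = \<phi> 0" using \<phi>(2)[OF z z] \<open>\<phi> (v i) = 0\<close> by simp
    then have "v i = 0" by (rule inj_onD[OF bij_betw_imp_inj_on[OF \<phi>(1)] _ m z])
    then show False using frameD(2)[OF F] by blast
  qed
  moreover obtain i where "\<not> out q i" using ns simple_frame[OF F] by blast
  ultimately show "\<not> out q k \<and> (\<forall>j. j \<noteq> k \<longrightarrow> out q j)" by blast
next
  assume k: "\<not> out q k \<and> (\<forall>j. j \<noteq> k \<longrightarrow> out q j)"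
  let ?S = "V\<lparr>space := pm.span {v k}\<rparr>"
  note V = is_moduleD[OF frameD(1)[OF F]]
  have S: "is_module CA ?S" using simple_span_vertex[OF F] k by (simp add: simple_module_def)
  have "socle CA V = ?S" using socle_one[OF F] k by blast
  moreover have "module_iso CA ?S ?S"
    unfolding module_iso_def using S by (intro conjI exI[of _ id]) auto
  moreover have "vertex_simple k ?S"
    unfolding vertex_simple_def
  proof (intro conjI allI ballI S)
    have e: "act V (cf_vtx j) (pm_scale c (v k)) = (if j = k then pm_scale c (v k) else 0)" for j c
      using V(4)[OF vtx_CA frameD(3)[OF F]] frameD(4,8)[OF F] by auto
    have "act V (cf_vtx j) ` pm.span {v k} = (if j = k then pm.span {v k} else {0})" for j
    proof -
      have "act V (cf_vtx j) ` pm.span {v k} = range (\<lambda>c. act V (cf_vtx j) (pm_scale c (v k)))"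
        by (auto simp: span_1 image_iff)
      also have "\<dots> = (if j = k then pm.span {v k} else {0})"        unfolding e by (cases "j = k") (auto simp: set_eq_iff span_1 image_iff)
      finally show ?thesis .
    qed
    moreover have "edim {0} = 0" using edim_span_independent[of "{}"] by (simp add: zero_enat_def pm.independent_empty)
    ultimately show "dim_vector cf_vtx ?S = (\<lambda>j. if j = k then 1 else 0)"
      using edim_singleton[OF frameD(2)[OF F]] by (simp add: dim_vector_def fun_eq_iff)
    fix a w assume "w \<in> space ?S"
    then obtain c where c: "w = pm_scale c (v k)" by (auto simp: span_1)
    have "act V (cf_arr a) (v k) = 0"
    proof (cases "tail cq a = k")
      case True
      then have "q $ aidx a = 0" using k by (auto simp: out_def)
      then show ?thesis using frameD(6)[OF F, of a] True by simp
    next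
      case False
      then show ?thesis using act_arr_other[OF frameD(1)[OF F] frameD(7)[OF F, of k], of a] by simp
    qed
    then show "act ?S (cf_arr a) w = 0" using V(4)[OF arr_CA frameD(3)[OF F]] c by simp
  qed
  ultimately show "\<exists>S. vertex_simple k S \<and> module_iso CA (socle CA V) S" by metis
qed

subsection \<open>Chains of annihilators\<close>

abbreviation "paths \<equiv> insert \<zero>\<^bsub>CA\<^esub> path_elems"

text \<open>K stands for the set of arrows with nonzero scalar; the exact link with annihilators is
  \<open>ann_frame\<close>.\<close>

definition path_ann :: "4 set \<Rightarrow> conifold_elem set" where
  "path_ann K = insert \<zero>\<^bsub>CA\<^esub> {path_elem j i m |j i m. wt m = wd j - wd i \<and> \<not> ks m \<subseteq> K}"

text \<open>A path acts by the value of its monomial at q, which vanishes as soon as one of its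
  arrows acts by zero, and only then.\<close>

lemma ann_frame: assumes F: "frame V v q" shows "ann paths V = path_ann {k. q $ k \<noteq> 0}"
proof -
  note V = is_moduleD[OF frameD(1)[OF F]]
  have kill: "(\<forall>w\<in>space V. act V (path_elem j i m) w = 0) \<longleftrightarrow> \<not> ks m \<subseteq> {k. q $ k \<noteq> 0}"
    if m: "wt m = wd j - wd i" for j i m
  proof -
    note p = path_elem[OF m]
    have a: "act V (path_elem j i m) (v i') = (if i' = i then pm_scale (monval (($) q) m) (v j) else 0)" for i'
      using frame_act[OF F p(1), of i'] exhaust_2[of j] by (auto simp: p(2) eval_simps)
    have "(\<forall>w\<in>space V. act V (path_elem j i m) w = 0) \<longleftrightarrow> (\<forall>i'. act V (path_elem j i m) (v i') = 0)"
    proof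
      assume "\<forall>w\<in>space V. act V (path_elem j i m) w = 0"
      then show "\<forall>i'. act V (path_elem j i m) (v i') = 0" using frameD(3)[OF F] by blast
    next
      assume *: "\<forall>i'. act V (path_elem j i m) (v i') = 0"
      show "\<forall>w\<in>space V. act V (path_elem j i m) w = 0"
      proof
        fix w assume "w \<in> space V"
        then obtain a b where w: "w = pm_scale a (v 1) + pm_scale b (v 2)" unfolding frameD(5)[OF F] span_2 by blast
        show "act V (path_elem j i m) w = 0"
          using V(3,4)[OF p(1)] subspace_closed(3)[OF V(1)] frameD(3)[OF F] * by (simp add: w)
      qed
    qed
    also have "\<dots> \<longleftrightarrow> monval (($) q) m = 0" unfolding a using frameD(2)[OF F] by auto
    also have "\<dots> \<longleftrightarrow> \<not> ks m \<subseteq> {k. q $ k \<noteq> 0}" unfolding monval_eq_0_iff by blast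
    finally show ?thesis .
  qed
  show ?thesis
  proof (intro equalityI subsetI)
    fix p assume "p \<in> ann paths V"
    then have p: "p = \<zero>\<^bsub>CA\<^esub> \<or> p \<in> path_elems" "\<forall>w\<in>space V. act V p w = 0" by (auto simp: ann_def)
    show "p \<in> path_ann {k. q $ k \<noteq> 0}"
    proof (cases "p = \<zero>\<^bsub>CA\<^esub>")
      case False
      then obtain j i m where "p = path_elem j i m" "wt m = wd j - wd i"
        using p(1) unfolding path_elems_def by blast
      then show ?thesis using kill p(2) unfolding path_ann_def by blast
    qed (simp add: path_ann_def)
  next
    fix p assume "p \<in> path_ann {k. q $ k \<noteq> 0}"
    then consider "p = \<zero>\<^bsub>CA\<^esub>" | j i m where "p = path_elem j i m" "wt m = wd j - wd i" "\<not> ks m \<subseteq> {k. q $ k \<noteq> 0}"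
      unfolding path_ann_def by blast
    then show "p \<in> ann paths V"
    proof cases
      case 1
      then show ?thesis using act_zero[OF frameD(1)[OF F]] by (simp add: ann_def)
    next
      case 2
      then have "p \<in> path_elems" unfolding path_elems_def by blast
      then show ?thesis using 2 kill unfolding ann_def by blast
    qed
  qed
qed

lemma path_ann_mono: "K' \<subseteq> K \<Longrightarrow> path_ann K \<subseteq> path_ann K'"
  unfolding path_ann_def by blast

text \<open>The arrows themselves, as paths of length one, recover K from
  \<open>path_ann K\<close>.\<close>

lemma path_ann_mono_iff: "path_ann K \<subseteq> path_ann K' \<longleftrightarrow> K' \<subseteq> K"
proof
  assume sub: "path_ann K \<subseteq> path_ann K'"
  show "K' \<subseteq> K"
  proof (rule subsetI, rule ccontr)
    fix k assume k: "k \<in> K'" "k \<notin> K"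
    obtain a where a: "aidx a = k" using aidx_surj by blast
    have w: "wt (sg k 1) = wd (head cq a) - wd (tail cq a)" using wt_arrow[of a] a by simp
    moreover have "\<not> ks (sg k (1::nat)) \<subseteq> K" using k(2) by simp
    ultimately have "path_elem (head cq a) (tail cq a) (sg k 1) \<in> path_ann K"
      unfolding path_ann_def by blast
    then have "path_elem (head cq a) (tail cq a) (sg k 1) \<in> path_ann K'" using sub by blast
    then obtain j i m where m: "wt m = wd j - wd i" "\<not> ks m \<subseteq> K'"
      "path_elem (head cq a) (tail cq a) (sg k 1) = path_elem j i m"
      using path_elem_nonzero[OF w] unfolding path_ann_def by blast
    then have "m = sg k 1" using path_elem_inj[OF w m(1)] by blast
    then show False using m(2) k(1) by simp
  qed
qed (rule path_ann_mono)

lemma path_ann_UNIV: "path_ann UNIV = {\<zero>\<^bsub>CA\<^esub>}"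
  by (simp add: path_ann_def)

lemma ann_Rep: "ann paths ` Rep CA cf_vtx (\<lambda>_. 1) = range path_ann"
proof (intro equalityI subsetI)
  fix N assume "N \<in> ann paths ` Rep CA cf_vtx (\<lambda>_. 1)"
  then obtain V where V: "is_module CA V" "dim_vector cf_vtx V = (\<lambda>_. 1)" "N = ann paths V" by (auto simp: Rep_def)
  then obtain v q where "frame V v q" using dim_vector_frame by blast
  then show "N \<in> range path_ann" using ann_frame V(3) by blast
next
  fix N assume "N \<in> range path_ann"
  then obtain K where K: "N = path_ann K" by blast
  define q :: "complex ^ 4" where "q = (\<chi> k. if k \<in> K then 1 else 0)"
  have "{k. q $ k \<noteq> 0} = K" by (auto simp: q_def)
  then have "N = ann paths (std_module q)" using ann_frame[OF frame_std_module[of q]] K by simp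
  moreover have "std_module q \<in> Rep CA cf_vtx (\<lambda>_. 1)"
    using frameD(1)[OF frame_std_module] frame_dim_vector[OF frame_std_module] by (simp add: Rep_def)
  ultimately show "N \<in> ann paths ` Rep CA cf_vtx (\<lambda>_. 1)" by blast
qed

text \<open>Annihilators are ordered like sets of arrows, with inclusion reversed, so dropping one
  arrow at a time gives a chain that cannot be refined.\<close>

lemma has_codim_path_ann: "has_codim CA cf_vtx (\<lambda>_. 1) paths (path_ann K) (card (- K))"
proof -
  define n where "n = card (- K)"
  obtain f where f: "bij_betw f {0..<n} (- K)"
    unfolding n_def using ex_bij_betw_nat_finite[of "- K"] by auto
  \<comment> \<open>Start from all arrows, whose annihilator is zero, and drop those outside K one
    by one.\<close>
  define L where "L j = - (f ` {0..<j})" for j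
  have step: "L (Suc j) = L j - {f j}" "f j \<in> L j" if "j < n" for j
  proof -
    show "L (Suc j) = L j - {f j}" unfolding L_def by (auto simp: less_Suc_eq)
    have "f j \<noteq> f i" if "i < j" for i
      using f \<open>j < n\<close> that by (auto simp: bij_betw_def inj_on_def) (metis atLeastLessThan_iff le0 less_trans order_less_irrefl)
    then show "f j \<in> L j" unfolding L_def by fastforce
  qed
  have "L n = K" using f by (auto simp: L_def bij_betw_def)
  moreover have "L 0 = UNIV" by (simp add: L_def)
  moreover have "path_ann (L j) \<subset> path_ann (L (Suc j)) \<and> path_ann (L (Suc j)) \<in> range path_ann \<and>
      \<not> (\<exists>N\<in>range path_ann. path_ann (L j) \<subset> N \<and> N \<subset> path_ann (L (Suc j)))" if "j < n" for j
  proof (intro conjI notI)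
    show "path_ann (L j) \<subset> path_ann (L (Suc j))"
      using step[OF that] unfolding less_le_not_le path_ann_mono_iff by blast
    assume "\<exists>N\<in>range path_ann. path_ann (L j) \<subset> N \<and> N \<subset> path_ann (L (Suc j))"
    then obtain M where "path_ann (L j) \<subset> path_ann M" "path_ann M \<subset> path_ann (L (Suc j))" by blast
    then have "M \<subseteq> L j" "\<not> L j \<subseteq> M" "L (Suc j) \<subseteq> M" "\<not> M \<subseteq> L (Suc j)"
      unfolding less_le_not_le path_ann_mono_iff by blast+
    then show False using step[OF that] by blast
  qed simp
  ultimately show ?thesis
    unfolding has_codim_def ann_Rep n_def[symmetric]
    by (intro exI[of _ "\<lambda>j. path_ann (L j)"]) (simp add: path_ann_UNIV)
qed

lemma dim_vector_large: "large_module CA L \<Longrightarrow> dim_vector cf_vtx L = (\<lambda>_. 1)"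
  using large_iff frame_dim_vector by blast

lemma almost_large_with_socle_iff:
  "V \<in> almost_large_modules_with_socle k \<longleftrightarrow>
    (\<exists>v q. frame V v q \<and> \<not> out q k \<and> (\<forall>j. j \<noteq> k \<longrightarrow> out q j))"
proof
  assume "V \<in> almost_large_modules_with_socle k"
  then have al: "almost_large CA cf_vtx V" and so: "\<exists>S. vertex_simple k S \<and> module_iso CA (socle CA V) S"
    by (auto simp: almost_large_modules_with_socle_def)
  then have V: "is_module CA V" "dim_vector cf_vtx V = (\<lambda>_. 1)" "\<not> simple_module CA V"
    using dim_vector_large unfolding almost_large_def Rep_def by auto
  then obtain v q where F: "frame V v q" using dim_vector_frame by blast
  then show "\<exists>v q. frame V v q \<and> \<not> out q k \<and> (\<forall>j. j \<noteq> k \<longrightarrow> out q j)"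
    using socle_vertex_simple_iff[OF F V(3)] so by blast
next
  assume "\<exists>v q. frame V v q \<and> \<not> out q k \<and> (\<forall>j. j \<noteq> k \<longrightarrow> out q j)"
  then obtain v q where F: "frame V v q" and k: "\<not> out q k" "\<And>j. j \<noteq> k \<Longrightarrow> out q j" by blast
  have ns: "\<not> simple_module CA V" using simple_frame[OF F] k by blast
  let ?q = "(\<chi> i. 1) :: complex ^ 4"
  have L: "large_module CA (std_module ?q)"
    unfolding large_iff using frame_std_module[of ?q] out_ones by blast
  let ?K = "{k. q $ k \<noteq> 0}"
  obtain j where "j \<noteq> k" using exhaust_2[of k] two_distinct by metis
  \<comment> \<open>Some arrow leaving the other vertex survives and those leaving k die, so the
    codimension lies between one and three.\<close>
  then obtain a where a: "aidx a \<in> ?K" using k(2) by (auto simp: out_def)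
  obtain b where b: "tail cq b = k" using exhaust_2[of k] cq_simps(3,5) by metis
  then have bK: "aidx b \<in> - ?K" using k(1) by (auto simp: out_def)
  have c1: "1 \<le> card (- ?K)" using bK by (metis One_nat_def Suc_leI card_gt_0_iff empty_iff finite)
  have "card (- ?K) < card (UNIV :: 4 set)" using a by (intro psubset_card_mono) auto
  then have "enat (card (- ?K)) \<le> enat 3" by simp
  then have c2: "enat (card (- ?K)) \<le> krull_dim (center CA)" using krull_dim_center by (rule order_trans)
  have "almost_large CA cf_vtx V"
    unfolding almost_large_def
  proof (intro exI conjI)
    show "large_module CA (std_module ?q)" by (rule L)
    show "V \<in> Rep CA cf_vtx (dim_vector cf_vtx (std_module ?q))"
      using frameD(1)[OF F] frame_dim_vector[OF F] dim_vector_large[OF L] by (simp add: Rep_def)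
    show "path_like CA paths" by (rule path_like_CA)
    show "has_codim CA cf_vtx (dim_vector cf_vtx (std_module ?q)) paths (ann paths V) (card (- ?K))"
      unfolding dim_vector_large[OF L] ann_frame[OF F] by (rule has_codim_path_ann)
  qed (use ns c1 c2 in auto)
  then show "V \<in> almost_large_modules_with_socle k"
    using socle_vertex_simple_iff[OF F ns] k by (auto simp: almost_large_modules_with_socle_def)
qed


section \<open>Points of the conifold\<close>

lemma torus_vec_eq_iff:
  "q' = torus_vec \<mu> q \<longleftrightarrow> q' $ 1 = \<mu> * q $ 1 \<and> q' $ 2 = \<mu> * q $ 2 \<and> q' $ 3 = q $ 3 / \<mu> \<and> q' $ 4 = q $ 4 / \<mu>"
  by (simp add: vec_eq_iff forall_4)

lemma stuv_eq_iff:
  "stuv q = p \<longleftrightarrow> p $ 1 = q $ 1 * q $ 3 \<and> p $ 2 = q $ 1 * q $ 4 \<and> p $ 3 = q $ 2 * q $ 3 \<and> p $ 4 = q $ 2 * q $ 4"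
  by (auto simp: vec_eq_iff forall_4)

lemma stuv_torus: "\<mu> \<noteq> 0 \<Longrightarrow> stuv (torus_vec \<mu> q) = stuv q"
  by (simp add: stuv_eq_iff)

lemma out_torus: "\<mu> \<noteq> 0 \<Longrightarrow> out (torus_vec \<mu> q) i \<longleftrightarrow> out q i"
  using exhaust_2[of i] by (auto simp: out_simps)

lemma stuv_variety: "stuv q \<in> conifold_variety"
  by (simp add: conifold_variety_def)

text \<open>A nonzero 2x2 matrix of determinant zero with rows (s, t) and (u, v) is a nonzero column
  (x, y) times a nonzero row (z, w).\<close>

lemma variety_stuv:
  assumes "p \<in> conifold_variety" "p \<noteq> 0" obtains q where "p = stuv q" "\<forall>i. out q i"
proof -
  note R = that
  have v: "p $ 1 * p $ 4 = p $ 2 * p $ 3" using assms(1) by (simp add: conifold_variety_def)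
  have ne: "p $ 1 \<noteq> 0 \<or> p $ 2 \<noteq> 0 \<or> p $ 3 \<noteq> 0 \<or> p $ 4 \<noteq> 0"
    using assms(2) by (auto simp: vec_eq_iff forall_4)
  have ex: thesis if c: "stuv q = p" "out q 1" "out q 2" for q
  proof (rule R)
    show "p = stuv q" using c(1) by simp
    show "\<forall>i. out q i" using c(2,3) exhaust_2 by metis
  qed
  show thesis
  proof (cases "p $ 1 = 0 \<and> p $ 2 = 0")
    case False
    show thesis
    proof (cases "p $ 1 = 0")
      case True
      then have "p $ 2 \<noteq> 0" "p $ 3 = 0" using False v by auto
      then show thesis using True
        by (intro ex[of "vector [p $ 2, p $ 4, 0, 1]"]) (auto simp: stuv_eq_iff out_simps vector_4)
    next
      case False
      then show thesis using v
        by (intro ex[of "vector [1, p $ 3 / p $ 1, p $ 1, p $ 2]"])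
          (auto simp: stuv_eq_iff out_simps vector_4 field_simps)
    qed
  next
    case True
    then show thesis using ne
      by (intro ex[of "vector [0, 1, p $ 3, p $ 4]"]) (auto simp: stuv_eq_iff out_simps vector_4)
  qed
qed

lemma variety_exists_stuv: assumes "p \<in> conifold_variety" shows "\<exists>q. p = stuv q"
proof (cases "p = 0")
  case True
  then have "stuv 0 = p" by (simp add: stuv_eq_iff)
  then show ?thesis by metis
next
  case False
  with variety_stuv[OF assms] show ?thesis by metis
qed

lemma torus_of_stuv:
  assumes "stuv q = stuv q'" "\<mu> \<noteq> 0" "q' $ 1 = \<mu> * q $ 1" "q' $ 2 = \<mu> * q $ 2" "out q 1"
  shows "q' = torus_vec \<mu> q"
  using assms unfolding torus_vec_eq_iff stuv_eq_iff out_simps by (auto simp: field_simps)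

lemma stuv_eq_torus:
  assumes "\<forall>i. out q i" "\<forall>i. out q' i"
  shows "stuv q = stuv q' \<longleftrightarrow> (\<exists>\<mu>. \<mu> \<noteq> 0 \<and> q' = torus_vec \<mu> q)"
proof
  assume eq: "stuv q = stuv q'"
  then have e: "q $ 1 * q $ 3 = q' $ 1 * q' $ 3" "q $ 1 * q $ 4 = q' $ 1 * q' $ 4"
    "q $ 2 * q $ 3 = q' $ 2 * q' $ 3" "q $ 2 * q $ 4 = q' $ 2 * q' $ 4"
    by (simp_all add: stuv_eq_iff)
  have o1: "q $ 1 \<noteq> 0 \<or> q $ 2 \<noteq> 0" "q $ 3 \<noteq> 0 \<or> q $ 4 \<noteq> 0" "q' $ 1 \<noteq> 0 \<or> q' $ 2 \<noteq> 0"
    using assms out_simps[of q] out_simps[of q'] by auto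
  \<comment> \<open>The torus parameter is read off from a coordinate among z, w that is nonzero on
    both sides.\<close>
  have "\<exists>\<mu>. \<mu> \<noteq> 0 \<and> q' $ 1 = \<mu> * q $ 1 \<and> q' $ 2 = \<mu> * q $ 2"
  proof (cases "q $ 3 = 0")
    case True
    then have "q $ 4 \<noteq> 0" "q' $ 4 \<noteq> 0" using o1 e by auto
    then show ?thesis using e by (intro exI[of _ "q $ 4 / q' $ 4"]) (auto simp: field_simps)
  next
    case False
    then have "q' $ 3 \<noteq> 0" using o1 e by auto
    then show ?thesis using e False by (intro exI[of _ "q $ 3 / q' $ 3"]) (auto simp: field_simps)
  qed
  then show "\<exists>\<mu>. \<mu> \<noteq> 0 \<and> q' = torus_vec \<mu> q" using torus_of_stuv[OF eq] assms by blast
qed (auto simp: stuv_torus)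

lemma is_hom_eval_R: "is_hom eval_R"
  using is_hom_comp[OF is_hom_frac is_hom_subst_stuv] by (simp add: eval_R_eq[abs_def])

text \<open>Every point of the cone has the form \<open>stuv q\<close>, so values there depend only
  on the class in R.\<close>

lemma eval_R_eval:
  assumes "p \<in> conifold_variety" "eval_R g = eval_R g'" shows "eval_at p g = eval_at p g'"
proof -
  obtain q where "p = stuv q" using variety_exists_stuv[OF assms(1)] by blast
  then show ?thesis using assms(2) by (metis eval_R_eq eval_subst_stuv inj_frac)
qed

lemma eval_R_in_ideal:
  assumes "p \<in> conifold_variety" shows "eval_R g \<in> ideal_of_point p \<longleftrightarrow> eval_at p g = 0"
proof
  assume "eval_R g \<in> ideal_of_point p"
  then obtain g' where "eval_R g = eval_R g'" "eval_at p g' = 0" unfolding ideal_of_point_def by blast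
  then show "eval_at p g = 0" using eval_R_eval[OF assms, of g g'] by simp
qed (auto simp: ideal_of_point_def)

text \<open>The functions \<open>var k - const (p $ k)\<close> recover the coordinates of p from its
  ideal.\<close>

lemma ideal_of_point_inj:
  assumes "p \<in> conifold_variety" "p' \<in> conifold_variety" "ideal_of_point p = ideal_of_point p'" shows "p = p'"
proof -
  have "p $ k = p' $ k" for k
  proof -
    have "eval_R (var k - const (p $ k)) \<in> ideal_of_point p"
      using eval_R_in_ideal[OF assms(1)] by (simp add: eval_simps)
    then show ?thesis using eval_R_in_ideal[OF assms(2)] unfolding assms(3) by (simp add: eval_simps)
  qed
  then show ?thesis by (simp add: vec_eq_iff)
qed

lemma ring_conifold_ring: "ring conifold_ring"
proof -
  note h = is_homD[OF is_hom_eval_R]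
  have closed: "1 \<in> range eval_R" "0 \<in> range eval_R" "\<And>x y. x \<in> range eval_R \<Longrightarrow> y \<in> range eval_R \<Longrightarrow> x + y \<in> range eval_R"
    "\<And>x y. x \<in> range eval_R \<Longrightarrow> y \<in> range eval_R \<Longrightarrow> x * y \<in> range eval_R" "\<And>x. x \<in> range eval_R \<Longrightarrow> - x \<in> range eval_R"
  proof -
    show "1 \<in> range eval_R" by (rule image_eqI[of _ _ 1]) (simp_all add: h)
    show "0 \<in> range eval_R" by (rule image_eqI[of _ _ 0]) (simp_all add: h)
    fix x assume "x \<in> range eval_R"
    then obtain g where g: "x = eval_R g" by blast
    show "- x \<in> range eval_R" by (rule image_eqI[of _ _ "- g"]) (simp_all add: h g)
    fix y assume "y \<in> range eval_R"
    then obtain k where k: "y = eval_R k" by blast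
    show "x + y \<in> range eval_R" by (rule image_eqI[of _ _ "g + k"]) (simp_all add: h g k)
    show "x * y \<in> range eval_R" by (rule image_eqI[of _ _ "g * k"]) (simp_all add: h g k)
  qed
  show ?thesis
  proof (rule ringI)
    show "abelian_group conifold_ring"
    proof (rule abelian_groupI)
      fix x assume "x \<in> carrier conifold_ring"
      then show "\<exists>y\<in>carrier conifold_ring. y \<oplus>\<^bsub>conifold_ring\<^esub> x = \<zero>\<^bsub>conifold_ring\<^esub>"
        using closed(5) by (intro bexI[of _ "- x"]) simp_all
    qed (use closed in \<open>simp_all add: add_ac\<close>)
    show "Group.monoid conifold_ring"
      by (rule monoidI) (use closed in \<open>simp_all add: mult_ac\<close>)
  qed (simp_all add: algebra_simps)
qed

lemma cring_conifold_ring: "cring conifold_ring"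
proof -
  interpret ring conifold_ring by (rule ring_conifold_ring)
  show ?thesis by unfold_locales (simp add: mult.commute)
qed

lemma maximalideal_point:
  assumes p: "p \<in> conifold_variety" shows "maximalideal (ideal_of_point p) conifold_ring"
proof -
  interpret R: cring conifold_ring by (rule cring_conifold_ring)
  note h = is_homD[OF is_hom_eval_R] and mem = eval_R_in_ideal[OF p]
  have I: "ideal (ideal_of_point p) conifold_ring"
  proof (rule idealI)
    show "ring conifold_ring" by (rule ring_conifold_ring)
    show "subgroup (ideal_of_point p) (add_monoid conifold_ring)"
    proof (rule R.add.subgroupI)
      show "ideal_of_point p \<subseteq> carrier conifold_ring" by (auto simp: ideal_of_point_def)
      show "ideal_of_point p \<noteq> {}" using mem[of 0] by (auto simp: eval_simps)
    next
      fix a assume "a \<in> ideal_of_point p"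
      then obtain g where g: "a = eval_R g" "eval_at p g = 0" by (auto simp: ideal_of_point_def)
      have "\<ominus>\<^bsub>conifold_ring\<^esub> eval_R g = eval_R (- g)"
      proof (rule R.minus_equality)
        show "eval_R (- g) \<oplus>\<^bsub>conifold_ring\<^esub> eval_R g = \<zero>\<^bsub>conifold_ring\<^esub>" by (simp add: h)
      qed (unfold conifold_ring_simps, (rule rangeI)+)
      then show "\<ominus>\<^bsub>conifold_ring\<^esub> a \<in> ideal_of_point p" using g mem[of "- g"] by (simp add: eval_simps)
      fix b assume "b \<in> ideal_of_point p"
      then obtain k where k: "b = eval_R k" "eval_at p k = 0" by (auto simp: ideal_of_point_def)
      have "a \<oplus>\<^bsub>conifold_ring\<^esub> b = eval_R (g + k)" by (simp add: g k h)
      then show "a \<oplus>\<^bsub>conifold_ring\<^esub> b \<in> ideal_of_point p" using mem[of "g + k"] g k by (simp add: eval_simps)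
    qed
    fix a x assume "a \<in> ideal_of_point p" "x \<in> carrier conifold_ring"
    then obtain g k where "a = eval_R g" "eval_at p g = 0" "x = eval_R k" by (auto simp: ideal_of_point_def)
    then show "x \<otimes>\<^bsub>conifold_ring\<^esub> a \<in> ideal_of_point p" "a \<otimes>\<^bsub>conifold_ring\<^esub> x \<in> ideal_of_point p"
      using mem[of "k * g"] mem[of "g * k"] by (simp_all add: h eval_simps)
  qed
  show ?thesis
  proof (rule maximalidealI[OF I])
    show "carrier conifold_ring \<noteq> ideal_of_point p"
    proof
      assume "carrier conifold_ring = ideal_of_point p"
      then have "eval_R 1 \<in> ideal_of_point p" by auto
      then show False using mem[of 1] by (simp add: eval_simps)
    qed
    fix J assume J: "ideal J conifold_ring" and IJ: "ideal_of_point p \<subseteq> J" "J \<subseteq> carrier conifold_ring"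
    show "J = ideal_of_point p \<or> J = carrier conifold_ring"
    proof (cases "J = ideal_of_point p")
      case False
      interpret J: ideal J conifold_ring by (rule J)
      obtain r where r: "r \<in> J" "r \<notin> ideal_of_point p" using False IJ(1) by blast
      then obtain g where "r = eval_R g" using IJ(2) by auto
      then have g: "eval_R g \<in> J" "eval_at p g \<noteq> 0" using r mem by auto
      \<comment> \<open>The constant c differs from g by an element of the ideal of p, so J contains
        a nonzero constant.\<close>
      define c where "c = eval_at p g"
      have "eval_R (const c - g) \<in> J"
        using mem[of "const c - g"] IJ by (auto simp: eval_simps c_def)
      then have "eval_R (const c - g) \<oplus>\<^bsub>conifold_ring\<^esub> eval_R g \<in> J" using g(1) by (rule J.a_closed)
      then have "eval_R (const c) \<in> J" by (simp add: h)
      then have "eval_R (const (inverse c)) \<otimes>\<^bsub>conifold_ring\<^esub> eval_R (const c) \<in> J" by (intro J.I_l_closed) auto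
      moreover have "const (inverse c) * const c = (1 :: 4 cpoly)"
        using g(2) by (simp add: is_homD(3)[OF is_hom_const, symmetric] is_homD(1)[OF is_hom_const] c_def)
      ultimately have "\<one>\<^bsub>conifold_ring\<^esub> \<in> J" by (simp add: h(3)[symmetric] h(1))
      then show ?thesis using J.one_imp_carrier by blast
    qed simp
  qed
qed

section \<open>The smooth locus\<close>

lemma cpoly_induct [case_names const var add mult]:
  fixes f :: "'i::finite cpoly"
  assumes "\<And>c. P (const c)" "\<And>i. P (var i)" "\<And>f g. P f \<Longrightarrow> P g \<Longrightarrow> P (f + g)" "\<And>f g. P f \<Longrightarrow> P g \<Longrightarrow> P (f * g)"
  shows "P f"
proof (induction f rule: poly_mapping_linear_induct)
  case zero
  have "const 0 = (0 :: 'i cpoly)" by (simp add: const_def)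
  then show ?case using assms(1)[of 0] by simp
next
  case (add f g)
  then show ?case by (rule assms(3))
next
  case (single m c)
  have 1: "P 1" using assms(1)[of 1] by (simp add: is_homD(1)[OF is_hom_const])
  have pow: "P (var i ^ n)" for i n by (induction n) (use 1 assms in auto)
  have pr: "P (\<Prod>i\<in>A. var i ^ lk m i)" if "finite A" for A
    using that by induction (use 1 pow assms(4) in auto)
  have "P (monval var m)" unfolding monval_def by (rule pr) simp
  then have "P (const c * monval var m)" by (rule assms(4)[OF assms(1)])
  then show ?case unfolding monval_var by (simp add: const_def mult_single)
qed

text \<open>One vector G must serve all directions d at once; induction along sums and products
  builds it by the product rule.\<close>

lemma eval_directional_derivative:
  fixes f :: "4 cpoly"
  shows "\<exists>G. \<forall>d. ((\<lambda>c. eval_at (p + c *s d) f) has_field_derivative (\<Sum>i\<in>UNIV. G i * d $ i)) (at 0)"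
proof (induction f rule: cpoly_induct)
  case (const c)
  show ?case by (intro exI[of _ "\<lambda>_. 0"]) (simp add: eval_simps insertion_const[OF is_hom_id(2)])
next
  case (var i)
  show ?case
    by (intro exI[of _ "\<lambda>j. if j = i then 1 else 0"] allI)
      (auto simp: eval_simps insertion_var[OF is_hom_id(2)] if_distrib[of "\<lambda>x. x * _"] cong: if_cong
        intro!: derivative_eq_intros)
next
  case (add f g)
  then obtain F G where
    "\<forall>d. ((\<lambda>c. eval_at (p + c *s d) f) has_field_derivative (\<Sum>i\<in>UNIV. F i * d $ i)) (at 0)"
    "\<forall>d. ((\<lambda>c. eval_at (p + c *s d) g) has_field_derivative (\<Sum>i\<in>UNIV. G i * d $ i)) (at 0)" by blast
  then show ?case unfolding eval_simps
    by (intro exI[of _ "\<lambda>i. F i + G i"] allI)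
      (auto simp: distrib_right sum.distrib intro!: DERIV_add)
next
  case (mult f g)
  then obtain F G where
    F: "\<forall>d. ((\<lambda>c. eval_at (p + c *s d) f) has_field_derivative (\<Sum>i\<in>UNIV. F i * d $ i)) (at 0)" and
    G: "\<forall>d. ((\<lambda>c. eval_at (p + c *s d) g) has_field_derivative (\<Sum>i\<in>UNIV. G i * d $ i)) (at 0)" by blast
  show ?case unfolding eval_simps
  proof (intro exI[of _ "\<lambda>i. F i * eval_at p g + G i * eval_at p f"] allI)
    fix d
    show "((\<lambda>c. eval_at (p + c *s d) f * eval_at (p + c *s d) g) has_field_derivative
      (\<Sum>i\<in>UNIV. (F i * eval_at p g + G i * eval_at p f) * d $ i)) (at 0)"
      using DERIV_mult[OF spec[OF F, of d] spec[OF G, of d]]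
      by (simp add: sum.distrib sum_distrib_left sum_distrib_right algebra_simps)
  qed
qed

lemma gradient_directional:
  fixes f :: "4 cpoly"
  shows "((\<lambda>c. eval_at (p + c *s d) f) has_field_derivative (\<Sum>i\<in>UNIV. gradient f p $ i * d $ i)) (at 0)"
proof -
  obtain G where G: "\<And>d. ((\<lambda>c. eval_at (p + c *s d) f) has_field_derivative (\<Sum>i\<in>UNIV. G i * d $ i)) (at 0)"
    using eval_directional_derivative by blast
  have "gradient f p $ i = G i" for i
  proof -
    have eq: "(\<chi> j. if j = i then c else p $ j) = p + (c - p $ i) *s axis i 1" for c
      by (simp add: vec_eq_iff axis_def)
    have "((\<lambda>c. eval_at (p + c *s axis i 1) f) has_field_derivative G i) (at (p $ i - p $ i))"
      using G[of "axis i 1"] by (simp add: axis_def if_distrib[of "(*) _"] cong: if_cong)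
    then have "((\<lambda>c. eval_at (p + (c - p $ i) *s axis i 1) f) has_field_derivative G i) (at (p $ i))"
      using DERIV_shift[of "\<lambda>c. eval_at (p + c *s axis i 1) f" "G i" "p $ i" "- (p $ i)"] by simp
    then show ?thesis by (simp add: gradient_def eq DERIV_imp_deriv)
  qed
  then show ?thesis using G by simp
qed

text \<open>Along a line contained in the variety f is constantly zero.\<close>

lemma gradient_tangent:
  assumes "f \<in> vanishing_ideal conifold_variety" "\<And>c. p + c *s d \<in> conifold_variety"
  shows "(\<Sum>i\<in>UNIV. gradient f p $ i * d $ i) = 0"
proof -
  have "(\<lambda>c. eval_at (p + c *s d) f) = (\<lambda>c. 0)" using assms by (auto simp: vanishing_ideal_def)
  then have "((\<lambda>c. 0) has_field_derivative (\<Sum>i\<in>UNIV. gradient f p $ i * d $ i)) (at 0)"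
    using gradient_directional[of p d f] by simp
  then show ?thesis using DERIV_unique DERIV_const by blast
qed

text \<open>At the origin all coordinate axes lie in the cone, which kills every gradient. Elsewhere
  the lines in the cone through p leave only the multiples of one normal vector.\<close>

lemma nonsingular_iff: "p \<in> nonsingular_points conifold_variety 3 \<longleftrightarrow> p \<in> conifold_variety \<and> p \<noteq> 0"
proof -
  let ?D = "(\<lambda>f. gradient f p) ` vanishing_ideal conifold_variety"
  have 0: "vec.dim ?D = 0" if "p = 0"
  proof -
    have "gradient f p = 0" if f: "f \<in> vanishing_ideal conifold_variety" for f
    proof -
      have "gradient f p $ i = 0" for i
        using gradient_tangent[OF f, of p "axis i 1"] exhaust_4[of i] \<open>p = 0\<close>
        by (auto simp: conifold_variety_def axis_def if_distrib[of "(*) _"] cong: if_cong)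
      then show ?thesis by (simp add: vec_eq_iff)
    qed
    then have "?D \<subseteq> vec.span {}" by auto
    then show ?thesis using vec.dim_unique[of "{}" ?D 0] by (simp add: vec.independent_empty)
  qed
  have 1: "vec.dim ?D = 1" if p: "p \<in> conifold_variety" "p \<noteq> 0"
  proof -
    obtain q where q: "p = stuv q" "\<forall>i. out q i" by (rule variety_stuv[OF p])
    then have o: "q $ 1 \<noteq> 0 \<or> q $ 2 \<noteq> 0" "q $ 3 \<noteq> 0 \<or> q $ 4 \<noteq> 0" using out_simps[of q] by auto
    \<comment> \<open>The gradient of sv - tu at p.\<close>
    define n :: "complex ^ 4" where "n = vector [p $ 4, - p $ 3, - p $ 2, p $ 1]"
    have n0: "n \<noteq> 0" using p(2) by (auto simp: n_def vec_eq_iff forall_4 vector_4)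
    have "gradient f p \<in> vec.span {n}" if f: "f \<in> vanishing_ideal conifold_variety" for f
    proof -
      define g where "g = gradient f p"
      \<comment> \<open>Varying one coordinate of q at a time moves \<open>stuv q\<close> along a
        line inside the cone; these are the four directions.\<close>
      have e: "g $ 1 * q $ 3 + g $ 2 * q $ 4 = 0" "g $ 3 * q $ 3 + g $ 4 * q $ 4 = 0"
        "g $ 1 * q $ 1 + g $ 3 * q $ 2 = 0" "g $ 2 * q $ 1 + g $ 4 * q $ 2 = 0"
        using gradient_tangent[OF f, of p "vector [q $ 3, q $ 4, 0, 0]"]
          gradient_tangent[OF f, of p "vector [0, 0, q $ 3, q $ 4]"]
          gradient_tangent[OF f, of p "vector [q $ 1, 0, q $ 2, 0]"]
          gradient_tangent[OF f, of p "vector [0, q $ 1, 0, q $ 2]"]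
        by (simp_all add: g_def sum_4 vector_4 conifold_variety_def q(1) algebra_simps)
      have "\<exists>c. g = c *s n"
      proof (cases "q $ 1 = 0")
        case True
        then have y: "q $ 2 \<noteq> 0" "g $ 3 = 0" "g $ 4 = 0" using o e by auto
        show ?thesis
        proof (cases "q $ 3 = 0")
          case True
          then show ?thesis using y e o \<open>q $ 1 = 0\<close>
            by (intro exI[of _ "g $ 1 / (q $ 2 * q $ 4)"])
              (auto simp: vec_eq_iff forall_4 n_def vector_4 q(1) field_simps)
        next
          case False
          have "g $ 1 = - g $ 2 * q $ 4 / q $ 3" using e(1) False by (simp add: field_simps eq_neg_iff_add_eq_0)
          then show ?thesis using y False \<open>q $ 1 = 0\<close>
            by (intro exI[of _ "- g $ 2 / (q $ 2 * q $ 3)"])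
              (simp add: vec_eq_iff forall_4 n_def vector_4 q(1))
        qed
      next
        case x: False
        have g1: "g $ 1 = - g $ 3 * q $ 2 / q $ 1" "g $ 2 = - g $ 4 * q $ 2 / q $ 1"
          using e(3,4) x by (simp_all add: field_simps eq_neg_iff_add_eq_0)
        show ?thesis
        proof (cases "q $ 3 = 0")
          case True
          then have "g $ 4 = 0" "q $ 4 \<noteq> 0" using e(2) o by auto
          then show ?thesis using x g1 True
            by (intro exI[of _ "- g $ 3 / (q $ 1 * q $ 4)"])
              (simp add: vec_eq_iff forall_4 n_def vector_4 q(1))
        next
          case False
          then have "g $ 3 = - g $ 4 * q $ 4 / q $ 3" using e(2) by (simp add: field_simps eq_neg_iff_add_eq_0)
          then show ?thesis using x g1 False
            by (intro exI[of _ "g $ 4 / (q $ 1 * q $ 3)"])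
              (simp add: vec_eq_iff forall_4 n_def vector_4 q(1) mult_ac)
        qed
      qed
      then show ?thesis by (auto simp: g_def vec.span_singleton)
    qed
    then have sub: "?D \<subseteq> vec.span {n}" by blast
    let ?f = "var 1 * var 4 - var 2 * var 3 :: 4 cpoly"
    have "?f \<in> vanishing_ideal conifold_variety"
      by (simp add: vanishing_ideal_def conifold_variety_def eval_simps)
    moreover have "gradient ?f p = n"
    proof -
      have "gradient ?f p $ i = n $ i" for i
        unfolding gradient_def vec_lambda_beta
        by (rule DERIV_imp_deriv)
          (use exhaust_4[of i] in \<open>auto simp: eval_simps n_def vector_4 intro!: derivative_eq_intros\<close>)
      then show ?thesis by (simp add: vec_eq_iff)
    qed
    ultimately have "{n} \<subseteq> ?D" by blast
    moreover have "vec.independent {n}" using n0 by (simp add: vec.dependent_single)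
    ultimately show ?thesis using vec.dim_unique[of "{n}" ?D 1] sub by simp
  qed
  show ?thesis
  proof (cases "p = 0")
    case True
    show ?thesis unfolding nonsingular_points_def mem_Collect_eq 0[OF True] using True by simp
  next
    case False
    then show ?thesis unfolding nonsingular_points_def mem_Collect_eq using 1 by auto
  qed
qed

lemma smooth_locus_iff: "m \<in> smooth_locus \<longleftrightarrow> (\<exists>q. (\<forall>i. out q i) \<and> m = ideal_of_point (stuv q))"
proof
  assume "m \<in> smooth_locus"
  then obtain p where "p \<in> conifold_variety" "p \<noteq> 0" "m = ideal_of_point p"
    by (auto simp: smooth_locus_def nonsingular_iff)
  then show "\<exists>q. (\<forall>i. out q i) \<and> m = ideal_of_point (stuv q)" using variety_stuv by metis
next
  assume "\<exists>q. (\<forall>i. out q i) \<and> m = ideal_of_point (stuv q)"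
  then obtain q where q: "\<forall>i. out q i" "m = ideal_of_point (stuv q)" by blast
  then have "q $ 1 \<noteq> 0 \<or> q $ 2 \<noteq> 0" "q $ 3 \<noteq> 0 \<or> q $ 4 \<noteq> 0" using out_simps[of q] by auto
  then have "stuv q \<noteq> 0" by (auto simp: stuv_eq_iff)
  then have "stuv q \<in> nonsingular_points conifold_variety 3" by (simp add: nonsingular_iff stuv_variety)
  moreover have "m \<in> Max_spec conifold_ring"
    unfolding Max_spec_def q(2) using maximalideal_point[OF stuv_variety] by simp
  ultimately show "m \<in> smooth_locus"
    unfolding smooth_locus_def mem_Collect_eq using q(2) by (intro conjI bexI[of _ "stuv q"])
qed

text \<open>A central element acts by the value of its diagonal entry at q, and that entry is a
  polynomial in s, t, u, v.\<close>

lemma psi_ann: assumes F: "frame V v q"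
  shows "psi ` ann (carrier (center CA)) V = ideal_of_point (stuv q)"
proof -
  note V = is_moduleD[OF frameD(1)[OF F]]
  have kill: "z \<in> ann (carrier (center CA)) V \<longleftrightarrow> eval_at q (mt z 1 1) = 0" if z: "z \<in> carrier (center CA)" for z
  proof -
    have zC: "z \<in> carrier CA" and m: "mt z 1 2 = 0" "mt z 2 1 = 0" "mt z 2 2 = mt z 1 1"
      using z by (auto simp: center_iff)
    have a: "act V z (v i) = pm_scale (eval_at q (mt z 1 1)) (v i)" for i
      using frame_act[OF F zC, of i] exhaust_2[of i] by (auto simp: m eval_simps)
    show ?thesis
    proof
      assume "z \<in> ann (carrier (center CA)) V"
      then have "act V z (v 1) = 0" using frameD(3)[OF F] by (simp add: ann_def)
      then show "eval_at q (mt z 1 1) = 0" using a[of 1] frameD(2)[OF F] by simp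
    next
      assume 0: "eval_at q (mt z 1 1) = 0"
      have "act V z w = 0" if w: "w \<in> space V" for w
      proof -
        obtain c d where "w = pm_scale c (v 1) + pm_scale d (v 2)" using w unfolding frameD(5)[OF F] span_2 by blast
        then show ?thesis
          using V(3,4)[OF zC] subspace_closed(3)[OF V(1)] frameD(3)[OF F] a 0 by simp
      qed
      then show "z \<in> ann (carrier (center CA)) V" using z by (simp add: ann_def)
    qed
  qed
  show ?thesis
  proof (intro equalityI subsetI)
    fix r assume "r \<in> psi ` ann (carrier (center CA)) V"
    then obtain z where z: "z \<in> ann (carrier (center CA)) V" "r = psi z" by blast
    then have zc: "z \<in> carrier (center CA)" by (simp add: ann_def)
    then have zC: "z \<in> carrier CA" by (simp add: center_iff)
    have "homog 0 (mt z 1 1)" using mt_homog[OF zC, of 1 1] by simp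
    then obtain g where g: "mt z 1 1 = subst_stuv g" using homog_0_subst_stuv by blast
    then have "r = eval_R g" using z(2) zC by (simp add: psi_eq eval_R_eq)
    moreover have "eval_at (stuv q) g = 0" using kill[OF zc] z(1) g by (simp add: eval_subst_stuv)
    ultimately show "r \<in> ideal_of_point (stuv q)" unfolding ideal_of_point_def by blast
  next
    fix r assume "r \<in> ideal_of_point (stuv q)"
    then obtain g where g: "r = eval_R g" "eval_at (stuv q) g = 0" by (auto simp: ideal_of_point_def)
    obtain z where z: "z \<in> carrier (center CA)" "mt z 1 1 = subst_stuv g"
      using exists_center[OF homog_subst_stuv] by blast
    then have "z \<in> ann (carrier (center CA)) V" using kill[OF z(1)] g(2) by (simp add: eval_subst_stuv)
    moreover have "psi z = r" using z g by (simp add: center_iff psi_eq eval_R_eq)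
    ultimately show "r \<in> psi ` ann (carrier (center CA)) V" by blast
  qed
qed

section \<open>The parameterizations\<close>

lemma large_modules_iff: "V \<in> large_modules \<longleftrightarrow> (\<exists>v q. frame V v q \<and> (\<forall>i. out q i))"
  by (simp add: large_modules_def large_iff)

lemma parameterized_large:
  "parameterized_by CA large_modules smooth_locus (\<lambda>V m. m = psi ` ann (carrier (center CA)) V)"
proof (rule parameterized_by_frames[where Q = "{q. \<forall>i. out q i}" and f = "\<lambda>q. ideal_of_point (stuv q)"])
  show "ideal_of_point (stuv q) = ideal_of_point (stuv q') \<longleftrightarrow> (\<exists>\<mu>. \<mu> \<noteq> 0 \<and> q' = torus_vec \<mu> q)"
    if "q \<in> {q. \<forall>i. out q i}" "q' \<in> {q. \<forall>i. out q i}" for q q'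
    using that stuv_eq_torus[of q q'] ideal_of_point_inj[OF stuv_variety stuv_variety, of q q'] by auto
qed (use frame_std_module psi_ann in \<open>auto simp: large_modules_iff smooth_locus_iff\<close>, blast)

text \<open>Adding the large modules leaves a single open condition, on the arrows leaving j: the
  semistable locus of the torus quotient.\<close>

lemma large_or_almost_large_iff:
  assumes "k \<noteq> j"
  shows "V \<in> large_modules \<union> almost_large_modules_with_socle k \<longleftrightarrow> (\<exists>v q. frame V v q \<and> out q j)"
proof -
  have *: "(\<forall>i. i \<noteq> k \<longrightarrow> out q i) \<longleftrightarrow> out q j" for q
    using assms exhaust_2[of k] exhaust_2[of j] by (metis exhaust_2)
  have **: "(\<forall>i. out q i) \<longleftrightarrow> out q j \<and> out q k" for q
    using assms exhaust_2[of k] exhaust_2[of j] by (metis exhaust_2)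
  show ?thesis unfolding Un_iff large_modules_iff almost_large_with_socle_iff * ** by blast
qed

section \<open>Points of the two resolutions in torus coordinates\<close>

lemma proj_point_eq_iff:
  "proj_point (vector [a, b]) = proj_point (vector [c, d]) \<longleftrightarrow> (\<exists>\<mu>. \<mu> \<noteq> 0 \<and> c = \<mu> * a \<and> d = \<mu> * b)"
proof
  assume "proj_point (vector [a, b]) = proj_point (vector [c, d])"
  moreover have "vector [c, d] \<in> proj_point (vector [c, d])"
    unfolding proj_point_def by (auto intro!: exI[of _ 1])
  ultimately obtain \<mu> where "\<mu> \<noteq> 0" "vector [c, d] = (\<mu> *s vector [a, b] :: complex ^ 2)"
    unfolding proj_point_def by auto
  then show "\<exists>\<mu>. \<mu> \<noteq> 0 \<and> c = \<mu> * a \<and> d = \<mu> * b"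
    by (auto simp: vec_eq_iff forall_2 vector_2)
next
  assume "\<exists>\<mu>. \<mu> \<noteq> 0 \<and> c = \<mu> * a \<and> d = \<mu> * b"
  then obtain \<mu> where \<mu>: "\<mu> \<noteq> 0" "c = \<mu> * a" "d = \<mu> * b" by blast
  then have v: "vector [c, d] = (\<mu> *s vector [a, b] :: complex ^ 2)" by (simp add: vec_eq_iff forall_2 vector_2)
  have 1: "k *s vector [a, b] = (k / \<mu>) *s (vector [c, d] :: complex ^ 2)" for k
    using \<mu>(1) by (simp add: v vector_smult_assoc)
  have 2: "k *s vector [c, d] = (k * \<mu>) *s (vector [a, b] :: complex ^ 2)" for k
    by (simp add: v vector_smult_assoc)
  show "proj_point (vector [a, b]) = proj_point (vector [c, d])"
  proof (intro equalityI subsetI)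
    fix h assume "h \<in> proj_point (vector [a, b])"
    then obtain k where "k \<noteq> 0" "h = k *s vector [a, b]" unfolding proj_point_def by blast
    then have "k / \<mu> \<noteq> 0" "h = (k / \<mu>) *s vector [c, d]" using \<mu>(1) 1[of k] by simp_all
    then show "h \<in> proj_point (vector [c, d])" unfolding proj_point_def by blast
  next
    fix h assume "h \<in> proj_point (vector [c, d])"
    then obtain k where "k \<noteq> 0" "h = k *s vector [c, d]" unfolding proj_point_def by blast
    then have "k * \<mu> \<noteq> 0" "h = (k * \<mu>) *s vector [a, b]" using \<mu>(1) 2[of k] by simp_all
    then show "h \<in> proj_point (vector [a, b])" unfolding proj_point_def by blast
  qed
qed

lemma proj_lineE:
  assumes "l \<in> proj_line" obtains a b where "l = proj_point (vector [a, b])" "a \<noteq> 0 \<or> b \<noteq> 0"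
proof -
  obtain v where v: "l = proj_point v" "v \<noteq> 0" using assms by (auto simp: proj_line_def)
  have "v = vector [v $ 1, v $ 2]" by (simp add: vec_eq_iff forall_2 vector_2)
  moreover have "v $ 1 \<noteq> 0 \<or> v $ 2 \<noteq> 0" using v(2) by (auto simp: vec_eq_iff forall_2)
  ultimately show ?thesis using that v(1) by metis
qed

lemma proj_lineI: "a \<noteq> 0 \<or> b \<noteq> 0 \<Longrightarrow> proj_point (vector [a, b]) \<in> proj_line"
  unfolding proj_line_def by (auto simp: vec_eq_iff forall_2 vector_2 intro!: exI[of _ "vector [a, b]"])

lemma ball_proj_point:
  "(\<forall>h\<in>proj_point (vector [a, b]). P h) \<longleftrightarrow> (\<forall>c. c \<noteq> 0 \<longrightarrow> P (vector [c * a, c * b]))"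
proof -
  have "c *s vector [a, b] = (vector [c * a, c * b] :: complex ^ 2)" for c
    by (simp add: vec_eq_iff forall_2 vector_2)
  then show ?thesis unfolding proj_point_def by auto
qed

lemma Y_minus_iff: "P \<in> Y_minus \<longleftrightarrow> (\<exists>q. out q 1 \<and> P = point_minus q)"
proof
  assume "P \<in> Y_minus"
  then obtain p l where P: "P = (p, l)" "p \<in> conifold_variety" "l \<in> proj_line"
    "\<forall>h\<in>l. p $ 1 * h $ 2 = h $ 1 * p $ 3 \<and> h $ 1 * p $ 4 = h $ 2 * p $ 2" by (auto simp: Y_minus_def)
  obtain a b where l: "l = proj_point (vector [a, b])" "a \<noteq> 0 \<or> b \<noteq> 0" using proj_lineE[OF P(3)] by blast
  have e: "p $ 1 * b = a * p $ 3" "a * p $ 4 = b * p $ 2"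
    using P(4) unfolding l(1) ball_proj_point by (auto simp: vector_2 dest: spec[of _ 1])
  show "\<exists>q. out q 1 \<and> P = point_minus q"
  \<comment> \<open>The remaining coordinates z and w are recovered from s, t, u, v on division by
    the homogeneous coordinate that is nonzero.\<close>
  proof (cases "a = 0")
    case True
    then show ?thesis using l e P(1)
      by (intro exI[of _ "vector [a, b, p $ 3 / b, p $ 4 / b]"])
        (auto simp: out_simps point_minus_def vector_4 vec_eq_iff forall_4)
  next
    case False
    then show ?thesis using l e P(1)
      by (intro exI[of _ "vector [a, b, p $ 1 / a, p $ 2 / a]"])
        (auto simp: out_simps point_minus_def vector_4 vec_eq_iff forall_4 field_simps)
  qed
next
  assume "\<exists>q. out q 1 \<and> P = point_minus q"
  then obtain q where "out q 1" "P = point_minus q" by blast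
  then show "P \<in> Y_minus"
    unfolding Y_minus_def point_minus_def out_simps
    by (auto simp: stuv_variety ball_proj_point vector_2 intro: proj_lineI)
qed

text \<open>The homogeneous coordinates fix the torus parameter, and \<open>stuv\<close> then
  determines z and w.\<close>

lemma point_minus_eq_iff:
  assumes "out q 1" shows "point_minus q = point_minus q' \<longleftrightarrow> (\<exists>\<mu>. \<mu> \<noteq> 0 \<and> q' = torus_vec \<mu> q)"
proof
  assume "point_minus q = point_minus q'"
  then have s: "stuv q = stuv q'" and "\<exists>\<mu>. \<mu> \<noteq> 0 \<and> q' $ 1 = \<mu> * q $ 1 \<and> q' $ 2 = \<mu> * q $ 2"
    by (auto simp: point_minus_def proj_point_eq_iff)
  then show "\<exists>\<mu>. \<mu> \<noteq> 0 \<and> q' = torus_vec \<mu> q" using torus_of_stuv[OF s _ _ _ assms] by blast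
next
  assume "\<exists>\<mu>. \<mu> \<noteq> 0 \<and> q' = torus_vec \<mu> q"
  then show "point_minus q = point_minus q'" by (auto simp: point_minus_def stuv_torus proj_point_eq_iff)
qed

text \<open>The reflection exchanging \<open>(x, y)\<close> and \<open>(z, w)\<close> carries \<open>Y\<^sup>+\<close> to \<open>Y\<^sup>-\<close>.\<close>

definition swap_arrows :: "complex ^ 4 \<Rightarrow> complex ^ 4" where
  "swap_arrows q = vector [q $ 3, q $ 4, q $ 1, q $ 2]"

definition swap_point :: "(complex ^ 4) \<times> 'l \<Rightarrow> (complex ^ 4) \<times> 'l" where
  "swap_point = (\<lambda>(p, l). (vector [p $ 1, p $ 3, p $ 2, p $ 4], l))"

lemma swap_arrows_nth [simp]:
  "swap_arrows q $ 1 = q $ 3" "swap_arrows q $ 2 = q $ 4" "swap_arrows q $ 3 = q $ 1" "swap_arrows q $ 4 = q $ 2"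
  by (simp_all add: swap_arrows_def vector_4)

lemma swap_arrows_swap [simp]: "swap_arrows (swap_arrows q) = q"
  by (simp add: vec_eq_iff forall_4)

lemma swap_point_swap [simp]: "swap_point (swap_point P) = P"
  by (cases P) (simp add: swap_point_def vec_eq_iff forall_4 vector_4)

lemma out_swap [simp]: "out (swap_arrows q) 1 \<longleftrightarrow> out q 2" "out (swap_arrows q) 2 \<longleftrightarrow> out q 1"
  by (simp_all add: out_simps)

lemma point_plus_swap: "point_plus q = swap_point (point_minus (swap_arrows q))"
  by (simp add: point_plus_def point_minus_def swap_point_def vec_eq_iff forall_4 vector_4)

lemma Y_plus_swap: "P \<in> Y_plus \<longleftrightarrow> swap_point P \<in> Y_minus"
  by (cases P) (auto simp: Y_plus_def Y_minus_def swap_point_def conifold_variety_def vector_4 mult.commute)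

lemma torus_swap: "\<mu> \<noteq> 0 \<Longrightarrow> swap_arrows (torus_vec \<mu> q) = torus_vec (inverse \<mu>) (swap_arrows q)"
  by (simp add: vec_eq_iff forall_4 divide_inverse mult.commute)

lemma Y_plus_iff: "P \<in> Y_plus \<longleftrightarrow> (\<exists>q. out q 2 \<and> P = point_plus q)"
  unfolding Y_plus_swap Y_minus_iff point_plus_swap by (metis out_swap(1) swap_arrows_swap swap_point_swap)

lemma point_plus_eq_iff:
  assumes "out q 2" shows "point_plus q = point_plus q' \<longleftrightarrow> (\<exists>\<mu>. \<mu> \<noteq> 0 \<and> q' = torus_vec \<mu> q)"
proof -
  have "point_plus q = point_plus q' \<longleftrightarrow> (\<exists>\<mu>. \<mu> \<noteq> 0 \<and> swap_arrows q' = torus_vec \<mu> (swap_arrows q))"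
    using point_minus_eq_iff[of "swap_arrows q" "swap_arrows q'"] assms
    unfolding point_plus_swap by (metis out_swap(1) swap_point_swap)
  also have "\<dots> \<longleftrightarrow> (\<exists>\<mu>. \<mu> \<noteq> 0 \<and> q' = torus_vec \<mu> q)"
    using torus_swap by (metis inverse_inverse_eq nonzero_imp_inverse_nonzero swap_arrows_swap)
  finally show ?thesis .
qed

lemma frame_acts_by: "frame V v q \<Longrightarrow> acts_by V q"
  using acts_by_frame frameD(1) by blast

lemma parameterized_Y_minus:
  "parameterized_by CA (large_modules \<union> almost_large_modules_with_socle 2) Y_minus
     (\<lambda>V P. \<exists>q. acts_by V q \<and> P = point_minus q)"
proof (rule parameterized_by_frames[where Q = "{q. out q 1}" and f = point_minus])
  note iff = large_or_almost_large_iff[OF two_distinct(2)]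
  show "\<exists>v q. frame V v q \<and> q \<in> {q. out q 1}" if "V \<in> large_modules \<union> almost_large_modules_with_socle 2" for V
    using that unfolding iff by blast
  show "\<exists>V v. V \<in> large_modules \<union> almost_large_modules_with_socle 2 \<and> frame V v q" if "q \<in> {q. out q 1}" for q
    using that frame_std_module[of q] unfolding iff by blast
  show "P \<in> Y_minus \<longleftrightarrow> (\<exists>q\<in>{q. out q 1}. P = point_minus q)" for P
    by (simp add: Y_minus_iff)
  show "\<exists>q'. acts_by V q' \<and> point_minus q = point_minus q'" if "frame V v q" for V v q
    using that frame_acts_by by blast
qed (simp add: point_minus_eq_iff)

lemma parameterized_Y_plus:
  "parameterized_by CA (large_modules \<union> almost_large_modules_with_socle 1) Y_plus
     (\<lambda>V P. \<exists>q. acts_by V q \<and> P = point_plus q)"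
proof (rule parameterized_by_frames[where Q = "{q. out q 2}" and f = point_plus])
  note iff = large_or_almost_large_iff[OF two_distinct(1)]
  show "\<exists>v q. frame V v q \<and> q \<in> {q. out q 2}" if "V \<in> large_modules \<union> almost_large_modules_with_socle 1" for V
    using that unfolding iff by blast
  show "\<exists>V v. V \<in> large_modules \<union> almost_large_modules_with_socle 1 \<and> frame V v q" if "q \<in> {q. out q 2}" for q
    using that frame_std_module[of q] unfolding iff by blast
  show "P \<in> Y_plus \<longleftrightarrow> (\<exists>q\<in>{q. out q 2}. P = point_plus q)" for P
    by (simp add: Y_plus_iff)
  show "\<exists>q'. acts_by V q' \<and> point_plus q = point_plus q'" if "frame V v q" for V v q
    using that frame_acts_by by blast
qed (simp add: point_plus_eq_iff)

lemma stuv_0_iff: "stuv q = 0 \<longleftrightarrow> \<not> (out q 1 \<and> out q 2)"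
  by (auto simp: stuv_eq_iff out_simps)

lemma blowdown_0_iff: "p \<in> conifold_variety \<Longrightarrow> blowdown (p, l) = ideal_of_point 0 \<longleftrightarrow> p = 0"
  using ideal_of_point_inj[of p 0] by (auto simp: blowdown_def conifold_variety_def)

lemma blowdown_point:
  "blowdown (point_minus q) = ideal_of_point 0 \<longleftrightarrow> \<not> (out q 1 \<and> out q 2)"
  "blowdown (point_plus q) = ideal_of_point 0 \<longleftrightarrow> \<not> (out q 1 \<and> out q 2)"
  by (simp_all add: point_minus_def point_plus_def blowdown_0_iff[OF stuv_variety] stuv_0_iff)

lemma almost_large_iff:
  assumes "k \<noteq> j"
  shows "V \<in> almost_large_modules_with_socle k \<longleftrightarrow> (\<exists>v q. frame V v q \<and> out q j \<and> \<not> out q k)"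
proof -
  have *: "(\<forall>i. i \<noteq> k \<longrightarrow> out q i) \<longleftrightarrow> out q j" for q
    using assms exhaust_2[of k] exhaust_2[of j] by (metis exhaust_2)
  show ?thesis unfolding almost_large_with_socle_iff * by blast
qed

lemma parameterized_exceptional_minus:
  "parameterized_by CA (almost_large_modules_with_socle 2) (exceptional_locus Y_minus)
     (\<lambda>V P. \<exists>q. acts_by V q \<and> P = (0, proj_point (vector [q $ 1, q $ 2])))"
proof (rule parameterized_by_frames[where Q = "{q. out q 1 \<and> \<not> out q 2}" and f = point_minus])
  note iff = almost_large_iff[OF two_distinct(2)]
  show "\<exists>v q. frame V v q \<and> q \<in> {q. out q 1 \<and> \<not> out q 2}" if "V \<in> almost_large_modules_with_socle 2" for V
    using that unfolding iff by blast
  show "\<exists>V v. V \<in> almost_large_modules_with_socle 2 \<and> frame V v q" if "q \<in> {q. out q 1 \<and> \<not> out q 2}" for q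
    using that frame_std_module[of q] unfolding iff by blast
  show "P \<in> exceptional_locus Y_minus \<longleftrightarrow> (\<exists>q\<in>{q. out q 1 \<and> \<not> out q 2}. P = point_minus q)" for P
    unfolding exceptional_locus_def mem_Collect_eq Y_minus_iff
    using blowdown_point(1) by auto
  show "\<exists>q'. acts_by V q' \<and> point_minus q = (0, proj_point (vector [q' $ 1, q' $ 2]))"
    if "frame V v q" "q \<in> {q. out q 1 \<and> \<not> out q 2}" for V v q
    using that frame_acts_by stuv_0_iff[of q] by (intro exI[of _ q]) (auto simp: point_minus_def)
qed (simp add: point_minus_eq_iff)

lemma parameterized_exceptional_plus:
  "parameterized_by CA (almost_large_modules_with_socle 1) (exceptional_locus Y_plus)
     (\<lambda>V P. \<exists>q. acts_by V q \<and> P = (0, proj_point (vector [q $ 3, q $ 4])))"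
proof (rule parameterized_by_frames[where Q = "{q. out q 2 \<and> \<not> out q 1}" and f = point_plus])
  note iff = almost_large_iff[OF two_distinct(1)]
  show "\<exists>v q. frame V v q \<and> q \<in> {q. out q 2 \<and> \<not> out q 1}" if "V \<in> almost_large_modules_with_socle 1" for V
    using that unfolding iff by blast
  show "\<exists>V v. V \<in> almost_large_modules_with_socle 1 \<and> frame V v q" if "q \<in> {q. out q 2 \<and> \<not> out q 1}" for q
    using that frame_std_module[of q] unfolding iff by blast
  show "P \<in> exceptional_locus Y_plus \<longleftrightarrow> (\<exists>q\<in>{q. out q 2 \<and> \<not> out q 1}. P = point_plus q)" for P
    unfolding exceptional_locus_def mem_Collect_eq Y_plus_iff
    using blowdown_point(2) by auto
  show "\<exists>q'. acts_by V q' \<and> point_plus q = (0, proj_point (vector [q' $ 3, q' $ 4]))"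
    if "frame V v q" "q \<in> {q. out q 2 \<and> \<not> out q 1}" for V v q
    using that frame_acts_by stuv_0_iff[of q] by (intro exI[of _ q]) (auto simp: point_plus_def)
qed (simp add: point_plus_eq_iff)


section \<open>The induced coordinate rings\<close>

text \<open>Explicit form of the induced coordinate rings, see \<open>induced_coords_eq\<close>:
  fractions of weight zero whose denominators are monomials in the inverted arrows.\<close>

definition loc_ring :: "conifold_arrow set \<Rightarrow> frac_B set" where
  "loc_ring S = {frac F / frac (sg m 1) |F m. homog (wt m) F \<and> ks m \<subseteq> aidx ` S}"

lemma sg_1_nonzero: "sg m 1 \<noteq> (0 :: 'i cpoly)"
  by (metis lookup_single_eq lookup_zero zero_neq_one)

lemma frac_eq_0_iff: "frac f = 0 \<longleftrightarrow> f = 0"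
  using inj_frac[of f 0] is_homD(4)[OF is_hom_frac] by simp

lemma frac_sg_mult: "frac (sg (m + n) 1) = frac (sg m 1) * frac (sg n 1)"
  by (simp add: is_homD(3)[OF is_hom_frac, symmetric] mult_single)

definition loc_var :: "conifold_arrow + conifold_arrow \<Rightarrow> frac_B" where
  "loc_var = case_sum arrow_var (\<lambda>a. inverse (arrow_var a))"

lemma loc_var_simps [simp]:
  "loc_var (Inl a) = frac (sg (sg (aidx a) 1) 1)" "loc_var (Inr a) = inverse (frac (sg (sg (aidx a) 1) 1))"
  by (simp_all add: loc_var_def arrow_var_eq var_def)

lemma localized_quiver_simps [simp]:
  "verts (localized_quiver S) = UNIV" "arcs (localized_quiver S) = Inl ` UNIV \<union> Inr ` S"
  "tail (localized_quiver S) (Inl a) = tail cq a" "head (localized_quiver S) (Inl a) = head cq a"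
  "tail (localized_quiver S) (Inr a) = head cq a" "head (localized_quiver S) (Inr a) = tail cq a"
  by (simp_all add: localized_quiver_def add_inverse_arrows_def)

lemma fin_digraph_localized: "fin_digraph (localized_quiver S)"
proof
  show "finite (arcs (localized_quiver S))"
    using finite_conifold_arrow finite_subset[of S UNIV] by simp
qed simp_all

text \<open>Shared shape of the conifold and the inverse relations: a difference of parallel paths
  of equal value. It yields both membership in the path algebra and vanishing under the
  representation.\<close>

lemma localized_relation_cases:
  assumes "s \<in> localized_relations S"
  shows "\<exists>p p'. s = sg p 1 - sg p' 1 \<and> p \<in> qpaths (localized_quiver S) \<and> p' \<in> qpaths (localized_quiver S) \<and>
    fst p = fst p' \<and> path_end (localized_quiver S) p = path_end (localized_quiver S) p' \<and>
    prod_list (map loc_var (snd p)) = prod_list (map loc_var (snd p'))"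
proof -
  let ?G = "localized_quiver S"
  interpret fin_digraph ?G by (rule fin_digraph_localized)
  have nz: "frac (sg (sg (aidx a) 1) 1) \<noteq> 0" for a by (simp add: frac_eq_0_iff sg_1_nonzero)
  consider (rel) "s \<in> conifold_relations ?G Inl" | (inv) "s \<in> inverse_relations cq S"
    using assms by (auto simp: localized_relations_def)
  then show ?thesis
  proof cases
    case rel
    then obtain a b c where s: "s = sg (tail ?G (Inl c), [Inl c, Inl b, Inl a]) 1 - sg (tail ?G (Inl a), [Inl a, Inl b, Inl c]) 1"
      and t: "tail cq a = tail cq c" "tail cq b = head cq a"
      by (subst (asm) conifold_relations_eq) auto
    have h: "head cq a = head cq c" "head cq b = tail cq c" using t by (cases a; cases b; cases c; simp)+
    show ?thesis
      by (rule exI[of _ "(tail ?G (Inl c), [Inl c, Inl b, Inl a])"], rule exI[of _ "(tail ?G (Inl a), [Inl a, Inl b, Inl c])"])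
        (use t h in \<open>simp add: s qpaths_iff awalk_Cons_iff awalk_Nil_iff path_end_def mult_ac\<close>)
  next
    case inv
    have L: "add_inverse_arrows cq S = ?G" by (simp add: localized_quiver_def)
    obtain a where a: "a \<in> S" "s = sg (head cq a, [Inr a, Inl a]) 1 - sg (head cq a, []) 1 \<or>
        s = sg (tail cq a, [Inl a, Inr a]) 1 - sg (tail cq a, []) 1"
      using inv unfolding inverse_relations_def Let_def L path_algebra_simps arr_def vtx_def
      by (auto simp: pa_mult_single_eq path_end_def)
    from a(2) show ?thesis
    proof
      assume s: "s = sg (head cq a, [Inr a, Inl a]) 1 - sg (head cq a, []) 1"
      show ?thesis
        by (rule exI[of _ "(head cq a, [Inr a, Inl a])"], rule exI[of _ "(head cq a, [])"])
          (use a(1) nz in \<open>simp add: s qpaths_iff awalk_Cons_iff awalk_Nil_iff path_end_def\<close>)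
    next
      assume s: "s = sg (tail cq a, [Inl a, Inr a]) 1 - sg (tail cq a, []) 1"
      show ?thesis
        by (rule exI[of _ "(tail cq a, [Inl a, Inr a])"], rule exI[of _ "(tail cq a, [])"])
          (use a(1) nz in \<open>simp add: s qpaths_iff awalk_Cons_iff awalk_Nil_iff path_end_def\<close>)
    qed
  qed
qed

lemma two_vertex_localized:
  "two_vertex_relations (localized_quiver S) (localized_relations S) (case_sum tau_arrow tau_star) loc_var"
proof -
  let ?G = "localized_quiver S"
  interpret fin_digraph ?G by (rule fin_digraph_localized)
  show ?thesis
  proof
    show "localized_relations S \<subseteq> carrier (path_algebra ?G)"
    proof
      fix s assume "s \<in> localized_relations S"
      then obtain p p' where s: "s = sg p 1 - sg p' 1" "p \<in> qpaths ?G" "p' \<in> qpaths ?G"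
        using localized_relation_cases by metis
      have "ks s \<subseteq> {p, p'}"
        unfolding s(1) by (auto simp: in_keys_iff lookup_minus lookup_single when_def split: if_splits)
      then show "s \<in> carrier (path_algebra ?G)" using s(2,3) by (auto simp: path_algebra_simps)
    qed
    show "(case a of Inl x \<Rightarrow> tau_arrow x | Inr x \<Rightarrow> tau_star x) = mat (loc_var a) ** mat_unit (head ?G a) (tail ?G a)"
      if "a \<in> arcs ?G" for a
      by (cases a) (simp_all add: tau_arrow_def tau_star_def arrow_var_eq var_def)
    show "is_hom frac_const" by (rule is_hom_frac_const)
    show "entry ?G frac_const loc_var s j i = 0" if rel: "s \<in> localized_relations S" for s i j
    proof -
      obtain p p' where s: "s = sg p 1 - sg p' 1" "fst p = fst p'" "path_end ?G p = path_end ?G p'"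
        "prod_list (map loc_var (snd p)) = prod_list (map loc_var (snd p'))"
        using localized_relation_cases[OF rel] by metis
      show ?thesis by (simp only: s entry_diff[OF is_hom_frac_const] entry_single[OF is_hom_frac_const]) simp
    qed
  qed
qed

text \<open>Multiplying by \<open>vtx i\<close> on both sides isolates the diagonal entry at i,
  which can be computed on representatives in the path algebra.\<close>

lemma induced_coords_entry:
  "induced_coords S i =
    (\<lambda>f. entry (localized_quiver S) frac_const loc_var f i i) ` carrier (path_algebra (localized_quiver S))"
proof -
  let ?G = "localized_quiver S" and ?S = "localized_relations S"
  interpret L: two_vertex_relations ?G ?S "case_sum tau_arrow tau_star" loc_var by (rule two_vertex_localized)
  have vtx: "vtx i \<in> carrier L.P" by (simp add: vtx_def path_algebra_simps L.vtx_in_qpaths)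
  have closed: "pa_mult ?G f g \<in> carrier L.P" if "f \<in> carrier L.P" "g \<in> carrier L.P" for f g
    using L.pa_mult_closed that by (simp add: path_algebra_simps)
  have ev: "entry ?G frac_const loc_var (vtx i) j k = (if k = i \<and> j = i then 1 else 0)" for j k
    by (auto simp: vtx_def entry_single[OF is_hom_frac_const] path_end_def is_homD(1)[OF is_hom_frac_const])
  have *: "tau_ext (case_sum tau_arrow tau_star)
      (qclass ?G ?S (vtx i) \<otimes>\<^bsub>L.QA\<^esub> qclass ?G ?S f \<otimes>\<^bsub>L.QA\<^esub> qclass ?G ?S (vtx i)) $ i $ i =
      entry ?G frac_const loc_var f i i" if f: "f \<in> carrier L.P" for f
  proof -
    note c1 = closed[OF vtx f] and c2 = closed[OF closed[OF vtx f] vtx]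
    show ?thesis
      unfolding L.qclass_ops(1)[OF vtx f] L.qclass_ops(1)[OF c1 vtx] L.tau_ext_qclass[OF c2]
        L.entry_mult[OF is_hom_frac_const c1 vtx] L.entry_mult[OF is_hom_frac_const vtx f] ev
      using exhaust_2[of i] by (auto simp: sum_2)
  qed
  have "induced_coords S i = (\<lambda>X. tau_ext (case_sum tau_arrow tau_star)
      (qclass ?G ?S (vtx i) \<otimes>\<^bsub>L.QA\<^esub> X \<otimes>\<^bsub>L.QA\<^esub> qclass ?G ?S (vtx i)) $ i $ i) ` carrier L.QA"
    unfolding induced_coords_def Let_def by blast
  also have "\<dots> = (\<lambda>f. tau_ext (case_sum tau_arrow tau_star)
      (qclass ?G ?S (vtx i) \<otimes>\<^bsub>L.QA\<^esub> qclass ?G ?S f \<otimes>\<^bsub>L.QA\<^esub> qclass ?G ?S (vtx i)) $ i $ i) ` carrier L.P"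
    unfolding L.carrier_QA image_image ..
  also have "\<dots> = (\<lambda>f. entry ?G frac_const loc_var f i i) ` carrier L.P"
    using * by (rule image_cong[OF refl])
  finally show ?thesis .
qed

lemma loc_ring_add: assumes "f \<in> loc_ring S" "g \<in> loc_ring S" shows "f + g \<in> loc_ring S"
proof -
  obtain F m where F: "f = frac F / frac (sg m 1)" "homog (wt m) F" "ks m \<subseteq> aidx ` S"
    using assms(1) unfolding loc_ring_def by blast
  obtain G n where G: "g = frac G / frac (sg n 1)" "homog (wt n) G" "ks n \<subseteq> aidx ` S"
    using assms(2) unfolding loc_ring_def by blast
  have "f + g = frac (F * sg n 1 + G * sg m 1) / frac (sg (m + n) 1)"
    by (simp add: F(1) G(1) frac_sg_mult is_homD[OF is_hom_frac] frac_eq_0_iff sg_1_nonzero field_simps)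
  moreover have "homog (wt (m + n)) (F * sg n 1 + G * sg m 1)"
    using homog_mult[OF F(2), of "wt n" "sg n 1"] homog_mult[OF G(2), of "wt m" "sg m 1"]
    by (intro homog_add) (simp_all add: homog_singleI add.commute)
  moreover have "ks (m + n) \<subseteq> aidx ` S" by (rule keys_add_subset[OF F(3) G(3)])
  ultimately show ?thesis unfolding loc_ring_def by blast
qed

text \<open>An ordinary arrow multiplies the numerator by its variable, an inverse arrow the
  denominator; weights telescope as in \<open>wt_path\<close>.\<close>

lemma localized_walk_value:
  "pre_digraph.awalk (localized_quiver S) u es v \<Longrightarrow> \<exists>m1 m2.
    prod_list (map loc_var es) = frac (sg m1 1) / frac (sg m2 1) \<and> ks m2 \<subseteq> aidx ` S \<and> wt m1 - wt m2 = wd v - wd u"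
proof (induction es arbitrary: u)
  interpret fin_digraph "localized_quiver S" by (rule fin_digraph_localized)
  case Nil
  have "frac (sg 0 1) = 1" using is_homD(1)[OF is_hom_frac] by simp
  then show ?case using Nil by (intro exI[of _ 0]) (simp add: awalk_Nil_iff)
next
  interpret fin_digraph "localized_quiver S" by (rule fin_digraph_localized)
  case (Cons a es)
  have w: "tail (localized_quiver S) a = u" "awalk (head (localized_quiver S) a) es v" "a \<in> arcs (localized_quiver S)"
    using Cons.prems by (auto simp: awalk_Cons_iff)
  obtain m1 m2 where m: "prod_list (map loc_var es) = frac (sg m1 1) / frac (sg m2 1)" "ks m2 \<subseteq> aidx ` S"
    "wt m1 - wt m2 = wd v - wd (head (localized_quiver S) a)" using Cons.IH[OF w(2)] by blast
  show ?case
  proof (cases a)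
    case (Inl b)
    then show ?thesis using m w wt_arrow[of b]
      by (intro exI[of _ "sg (aidx b) 1 + m1"] exI[of _ m2]) (simp add: frac_sg_mult)
  next
    case (Inr b)
    then have "ks (sg (aidx b) (1::nat)) \<subseteq> aidx ` S" using w(3) by auto
    then have "ks (sg (aidx b) 1 + m2) \<subseteq> aidx ` S" using m(2) by (rule keys_add_subset)
    then show ?thesis using m w wt_arrow[of b] Inr
      by (intro exI[of _ m1] exI[of _ "sg (aidx b) 1 + m2"]) (simp add: frac_sg_mult divide_inverse mult_ac)
  qed
qed

text \<open>As in \<open>exists_path_mon\<close> the weight forces a next step at i: an arrow
  leaving i that divides the numerator, or the inverse of an arrow into i that divides the
  denominator.\<close>

lemma exists_localized_walk:
  "ks m \<subseteq> aidx ` S \<Longrightarrow> wt n - wt m = wd j - wd i \<Longrightarrow>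
    \<exists>es. pre_digraph.awalk (localized_quiver S) i es j \<and>
      prod_list (map loc_var es) = frac (sg n 1) / frac (sg m 1)"
proof (induction "(\<Sum>k\<in>UNIV. lk n k) + (\<Sum>k\<in>UNIV. lk m k)" arbitrary: m n i rule: less_induct)
  interpret fin_digraph "localized_quiver S" by (rule fin_digraph_localized)
  case less
  have peel: "\<exists>l'. l = sg (aidx a) 1 + l' \<and> (\<Sum>k\<in>UNIV. lk l k) = 1 + (\<Sum>k\<in>UNIV. lk l' k)"
    if "lk l (aidx a) \<noteq> 0" for l :: "4 \<Rightarrow>\<^sub>0 nat" and a
  proof -
    have l: "l = sg (aidx a) 1 + (l - sg (aidx a) 1)"
      using that by (intro poly_mapping_eqI) (auto simp: lookup_add lookup_minus lookup_single when_def)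
    have "(\<Sum>k\<in>UNIV. lk l k) = 1 + (\<Sum>k\<in>UNIV. lk (l - sg (aidx a) 1) k)"
      by (subst l) (simp add: lookup_add sum.distrib lookup_single when_def)
    with l show ?thesis by blast
  qed
  show ?case
  proof (cases "n = 0 \<and> m = 0")
    case True
    then have "i = j" using less.prems exhaust_2[of i] exhaust_2[of j] by auto
    then show ?thesis using True
      by (intro exI[of _ "[]"]) (simp add: awalk_Nil_iff is_homD(1)[OF is_hom_frac])
  next
    case False
    then have nz: "lk n 1 + lk n 2 + lk n 3 + lk n 4 + (lk m 1 + lk m 2 + lk m 3 + lk m 4) \<noteq> 0"
      using total_degree_nonzero[of n] total_degree_nonzero[of m] by auto
    have "\<exists>a. (tail cq a = i \<and> lk n (aidx a) \<noteq> 0) \<or> (head cq a = i \<and> lk m (aidx a) \<noteq> 0)"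
    proof (cases "i = 1")
      case True
      then have "lk n 1 \<noteq> 0 \<or> lk n 2 \<noteq> 0 \<or> lk m 3 \<noteq> 0 \<or> lk m 4 \<noteq> 0"
        using less.prems(2) nz exhaust_2[of j] by (auto simp: wt_def)
      then show ?thesis using True by (metis aidx_simps cq_simps(3,6))
    next
      case False
      then have i: "i = 2" using exhaust_2[of i] by auto
      then have "lk n 3 \<noteq> 0 \<or> lk n 4 \<noteq> 0 \<or> lk m 1 \<noteq> 0 \<or> lk m 2 \<noteq> 0"
        using less.prems(2) nz exhaust_2[of j] by (auto simp: wt_def)
      then show ?thesis using i by (metis aidx_simps cq_simps(4,5))
    qed
    then obtain a where "(tail cq a = i \<and> lk n (aidx a) \<noteq> 0) \<or> (head cq a = i \<and> lk m (aidx a) \<noteq> 0)" by blast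
    then show ?thesis
    proof (elim disjE conjE)
      assume a: "tail cq a = i" "lk n (aidx a) \<noteq> 0"
      obtain n' where n': "n = sg (aidx a) 1 + n'" "(\<Sum>k\<in>UNIV. lk n k) = 1 + (\<Sum>k\<in>UNIV. lk n' k)"
        using peel[OF a(2)] by blast
      have "wt n' - wt m = wd j - wd (head cq a)" using less.prems(2) wt_arrow[of a] a(1) by (simp add: n'(1))
      then obtain es where es: "awalk (head cq a) es j" "prod_list (map loc_var es) = frac (sg n' 1) / frac (sg m 1)"
        using less.hyps[of n' m] n'(2) less.prems(1) by auto
      then show ?thesis using a(1)
        by (intro exI[of _ "Inl a # es"]) (simp add: awalk_Cons_iff n'(1) frac_sg_mult)
    next
      assume a: "head cq a = i" "lk m (aidx a) \<noteq> 0"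
      have "aidx a \<in> aidx ` S" using a(2) less.prems(1) by (metis in_keys_iff subsetD)
      then have aS: "a \<in> S" by (auto simp: inj_aidx)
      obtain m' where m': "m = sg (aidx a) 1 + m'" "(\<Sum>k\<in>UNIV. lk m k) = 1 + (\<Sum>k\<in>UNIV. lk m' k)"
        using peel[OF a(2)] by blast
      have "ks m' \<subseteq> ks m" unfolding m'(1) by (auto simp: in_keys_iff lookup_add)
      then have "ks m' \<subseteq> aidx ` S" using less.prems(1) by (rule subset_trans)
      moreover have "wt n - wt m' = wd j - wd (tail cq a)" using less.prems(2) wt_arrow[of a] a(1) by (simp add: m'(1))
      ultimately obtain es where es: "awalk (tail cq a) es j" "prod_list (map loc_var es) = frac (sg n 1) / frac (sg m' 1)"
        using less.hyps[of n m'] m'(2) by auto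
      then show ?thesis using a(1) aS
        by (intro exI[of _ "Inr a # es"]) (simp add: awalk_Cons_iff m'(1) frac_sg_mult divide_inverse mult_ac)
    qed
  qed
qed

lemma induced_coords_eq: "induced_coords S i = loc_ring S"
proof -
  let ?G = "localized_quiver S"
  interpret fin_digraph ?G by (rule fin_digraph_localized)
  note e = entry_zero[OF is_hom_frac_const] entry_add[OF is_hom_frac_const] entry_single[OF is_hom_frac_const]
  show ?thesis unfolding induced_coords_entry
  proof (intro equalityI subsetI)
    fix r assume "r \<in> (\<lambda>f. entry ?G frac_const loc_var f i i) ` carrier (path_algebra ?G)"
    then obtain f where f: "ks f \<subseteq> qpaths ?G" "r = entry ?G frac_const loc_var f i i" by (auto simp: path_algebra_simps)
    have zero: "0 \<in> loc_ring S"
      unfolding loc_ring_def by (intro CollectI exI[of _ 0]) (simp add: is_homD(4)[OF is_hom_frac])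
    from f(1) have "entry ?G frac_const loc_var f i i \<in> loc_ring S"
    proof (induction f rule: poly_mapping_linear_induct_on)
      case (single p c)
      show ?case
      proof (cases "fst p = i \<and> path_end ?G p = i")
        case True
        have "awalk (fst p) (snd p) (path_end ?G p)" using single by (metis awalk_path_end qpaths_iff)
        then have w: "awalk i (snd p) i" using True by simp
        obtain m1 m2 where m: "prod_list (map loc_var (snd p)) = frac (sg m1 1) / frac (sg m2 1)"
          "ks m2 \<subseteq> aidx ` S" "wt m1 = wt m2" using localized_walk_value[OF w] by auto
        have "entry ?G frac_const loc_var (sg p c) i i = frac (sg m1 c) / frac (sg m2 1)"
          using True m(1) by (simp add: e frac_const_eq is_homD(3)[OF is_hom_frac, symmetric] const_def mult_single)
        then show ?thesis unfolding loc_ring_def using m(2,3) homog_singleI[of m1 "wt m2" c] by auto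
      qed (use zero in \<open>auto simp: e\<close>)
    qed (use zero loc_ring_add in \<open>simp_all add: e\<close>)
    then show "r \<in> loc_ring S" using f(2) by simp
  next
    fix r assume "r \<in> loc_ring S"
    then obtain F m where r: "r = frac F / frac (sg m 1)" and F: "homog (wt m) F" and m: "ks m \<subseteq> aidx ` S"
      unfolding loc_ring_def by blast
    have "ks F \<subseteq> {n. wt n = wt m}" using F by (auto simp: homog_def)
    then have "\<exists>f\<in>carrier (path_algebra ?G). entry ?G frac_const loc_var f i i = frac F / frac (sg m 1)"
    proof (induction F rule: poly_mapping_linear_induct_on)
      case zero
      then show ?case by (intro bexI[of _ 0]) (simp_all add: e path_algebra_simps is_homD(4)[OF is_hom_frac])
    next
      case (add f g)
      then obtain f' g' where "f' \<in> carrier (path_algebra ?G)" "g' \<in> carrier (path_algebra ?G)"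
        "entry ?G frac_const loc_var f' i i = frac f / frac (sg m 1)"
        "entry ?G frac_const loc_var g' i i = frac g / frac (sg m 1)" by blast
      then show ?case using keys_add_subset
        by (intro bexI[of _ "f' + g'"]) (simp_all add: e path_algebra_simps is_homD(2)[OF is_hom_frac] add_divide_distrib)
    next
      case (single n c)
      then have "wt n - wt m = wd i - wd i" by simp
      then obtain es where es: "awalk i es i" "prod_list (map loc_var es) = frac (sg n 1) / frac (sg m 1)"
        using exists_localized_walk[OF m] by blast
      have "entry ?G frac_const loc_var (sg (i, es) c) i i = frac_const c * (frac (sg n 1) / frac (sg m 1))"
        using es awalk_path_end[of "(i, es)" i] by (simp add: e)
      also have "\<dots> = frac (sg n c) / frac (sg m 1)"
        by (simp add: frac_const_eq is_homD(3)[OF is_hom_frac, symmetric] const_def mult_single)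
      finally show ?case using es(1)
        by (intro bexI[of _ "sg (i, es) c"]) (auto simp: path_algebra_simps qpaths_iff)
    qed
    then show "r \<in> (\<lambda>f. entry ?G frac_const loc_var f i i) ` carrier (path_algebra ?G)"
      unfolding r by (metis image_eqI)
  qed
qed


section \<open>Regular functions on the resolutions\<close>

lemma frac_quotient: "M \<noteq> 0 \<Longrightarrow> frac F / frac M = Fract F M"
  by (simp add: frac_def)

lemma has_value_unique:
  assumes "has_value f q c" "has_value f q c'" shows "c = c'"
proof -
  obtain g h where gh: "f = Fract g h" "eval_at q h \<noteq> 0" "c = eval_at q g / eval_at q h"
    using assms(1) unfolding has_value_def by blast
  obtain g' h' where gh': "f = Fract g' h'" "eval_at q h' \<noteq> 0" "c' = eval_at q g' / eval_at q h'"
    using assms(2) unfolding has_value_def by blast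
  have "h \<noteq> 0" "h' \<noteq> 0" using gh(2) gh'(2) by (auto simp: is_homD(4)[OF is_hom_eval])
  then have "g * h' = g' * h" using gh(1) gh'(1) by (simp add: eq_fract)
  then have "eval_at q g * eval_at q h' = eval_at q g' * eval_at q h"
    by (metis is_homD(3)[OF is_hom_eval])
  then show ?thesis using gh(2,3) gh'(2,3) by (simp add: frac_eq_eq)
qed

lemma has_value_quotient:
  assumes "eval_at q M \<noteq> 0" shows "has_value (frac F / frac M) q (eval_at q F / eval_at q M)"
proof -
  have "M \<noteq> 0" using assms by (auto simp: is_homD(4)[OF is_hom_eval])
  then show ?thesis using assms unfolding has_value_def frac_quotient[OF \<open>M \<noteq> 0\<close>] by blast
qed

lemma supp_arrows_frame:
  assumes F: "frame V v q" shows "supp_arrows V = {a. q $ aidx a \<noteq> 0}"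
proof -
  note V = is_moduleD[OF frameD(1)[OF F]]
  have "(\<exists>w\<in>space V. act V (cf_arr a) w \<noteq> 0) \<longleftrightarrow> q $ aidx a \<noteq> 0" for a
  proof
    assume "q $ aidx a \<noteq> 0"
    then have "act V (cf_arr a) (v (tail cq a)) \<noteq> 0" using frameD(2,6)[OF F] by simp
    then show "\<exists>w\<in>space V. act V (cf_arr a) w \<noteq> 0" using frameD(3)[OF F] by blast
  next
    assume "\<exists>w\<in>space V. act V (cf_arr a) w \<noteq> 0"
    then obtain w where w: "w \<in> space V" "act V (cf_arr a) w \<noteq> 0" by blast
    obtain c d where wc: "w = pm_scale c (v 1) + pm_scale d (v 2)" using w(1) unfolding frameD(5)[OF F] span_2 by blast
    show "q $ aidx a \<noteq> 0"
    proof
      assume 0: "q $ aidx a = 0"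
      have "act V (cf_arr a) (v i) = 0" for i
        using frameD(6)[OF F, of a] act_arr_other[OF frameD(1)[OF F] frameD(7)[OF F], of i a] 0 by fastforce
      then have "act V (cf_arr a) w = 0"
        unfolding wc using V(3,4)[OF arr_CA] subspace_closed(3)[OF V(1)] frameD(3)[OF F] by simp
      with w(2) show False by simp
    qed
  qed
  then show ?thesis unfolding supp_arrows_def by blast
qed

lemma eval_biv_hom: "is_hom (eval_biv p h)"
  unfolding eval_biv_def[abs_def] by (rule is_hom_eval)

lemma eval_biv_single: "eval_biv p h (sg m c) = c * monval (case_sum (($) p) (($) h)) m"
  unfolding eval_biv_def using insertion_single[OF is_hom_id(1)] by simp

lemma monval_sum_type:
  fixes P :: "4 \<Rightarrow> complex" and h :: "2 \<Rightarrow> complex"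
  shows "monval (case_sum P h) m = (\<Prod>i\<in>UNIV. P i ^ lk m (Inl i)) * (h 1 ^ lk m (Inr 1) * h 2 ^ lk m (Inr 2))"
proof -
  have "monval (case_sum P h) m = (\<Prod>i\<in>Sum_Type.Plus UNIV UNIV. case_sum P h i ^ lk m i)"
    by (simp only: monval_def UNIV_Plus_UNIV)
  also have "\<dots> = (\<Prod>i\<in>UNIV. P i ^ lk m (Inl i)) * (\<Prod>i\<in>UNIV. h i ^ lk m (Inr i))"
    by (subst prod.Plus) (simp_all add: comp_def)
  finally show ?thesis by (simp add: UNIV_2)
qed

lemma eval_biv_scale:
  assumes "proj_homogeneous d g"
  shows "eval_biv p (vector [c * a, c * b]) g = c ^ d * eval_biv p (vector [a, b]) g"
  unfolding eval_biv_def insertion_monval sum_distrib_left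
proof (rule sum.cong[OF refl])
  fix m assume "m \<in> ks g"
  then have d: "d = lk m (Inr 1) + lk m (Inr 2)" using assms by (simp add: proj_homogeneous_def)
  show "id (lk g m) * monval (case_sum (($) p) (($) (vector [c * a, c * b] :: complex ^ 2))) m =
    c ^ d * (id (lk g m) * monval (case_sum (($) p) (($) (vector [a, b] :: complex ^ 2))) m)"
    unfolding monval_sum_type d by (simp add: vector_2 power_mult_distrib power_add mult_ac)
qed

lemma proj_homogeneous_sum: "(\<And>a. a \<in> A \<Longrightarrow> proj_homogeneous d (F a)) \<Longrightarrow> proj_homogeneous d (sum F A)"
proof (induction A rule: infinite_finite_induct)
  case (insert a A)
  then show ?case using keys_add[of "F a" "sum F A"] unfolding proj_homogeneous_def by fastforce
qed (simp_all add: proj_homogeneous_def)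

lemma proj_homogeneous_single:
  "lk m (Inr 1) + lk m (Inr 2) = d \<Longrightarrow> proj_homogeneous d (sg m c)"
  by (simp add: proj_homogeneous_def)

text \<open>
  The two resolutions are treated simultaneously: \<open>q $ hv k\<close> are the homogeneous coordinates of the
  point with coordinates \<open>q\<close>, \<open>q $ jv k\<close> the scalars of the arrows in the other direction, and
  \<open>ps\<close> locates the products of the two among \<open>s, t, u, v\<close>.
\<close>

locale resolution_side =
  fixes hv jv :: "2 \<Rightarrow> 4" and ps :: "2 \<Rightarrow> 2 \<Rightarrow> 4" and src :: 2 and eps :: int
    and X :: "conifold_elem lmod set" and pt :: "complex ^ 4 \<Rightarrow> blowup_point" and Y :: "blowup_point set"
  assumes vars: "UNIV = {hv 1, hv 2, jv 1, jv 2}" "distinct [hv 1, hv 2, jv 1, jv 2]"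
    and stuv_ps: "\<And>(q :: complex ^ 4) a b. stuv q $ ps a b = q $ hv a * q $ jv b"
    and pt: "\<And>q. pt q = (stuv q, proj_point (vector [q $ hv 1, q $ hv 2]))"
    and eps_wt: "\<And>m. eps * wt m = int (lk m (hv 1)) + int (lk m (hv 2)) - int (lk m (jv 1)) - int (lk m (jv 2))"
    and out_src: "\<And>q. out q src \<longleftrightarrow> q $ hv 1 \<noteq> 0 \<or> q $ hv 2 \<noteq> 0"
    and Y_iff: "\<And>P. P \<in> Y \<longleftrightarrow> (\<exists>q. out q src \<and> P = pt q)"
    and pt_eq: "\<And>q q'. out q src \<Longrightarrow> pt q = pt q' \<longleftrightarrow> (\<exists>\<mu>. \<mu> \<noteq> 0 \<and> q' = torus_vec \<mu> q)"
    and X_iff: "\<And>V. V \<in> X \<longleftrightarrow> (\<exists>v q. frame V v q \<and> out q src)"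
begin

text \<open>Functions on the resolution are moved to polynomials in x, y, z, w, where lowest terms
  are available.\<close>

definition pullback :: "(4 + 2) cpoly \<Rightarrow> 4 cpoly" where
  "pullback = insertion const (case_sum (\<lambda>k. stuv (\<chi> i. var i) $ k) (\<lambda>k. var (hv k)))"

lemma eval_pullback: "eval_at q (pullback g) = eval_biv (stuv q) (vector [q $ hv 1, q $ hv 2]) g"
proof -
  have "(\<lambda>i. eval_at q (case_sum (\<lambda>k. stuv (\<chi> i. var i) $ k) (\<lambda>k. var (hv k)) i)) =
    case_sum (($) (stuv q)) (($) (vector [q $ hv 1, q $ hv 2] :: complex ^ 2))"
  proof
    fix i :: "4 + 2"
    show "eval_at q (case_sum (\<lambda>k. stuv (\<chi> i. var i) $ k) (\<lambda>k. var (hv k)) i) =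
      case_sum (($) (stuv q)) (($) (vector [q $ hv 1, q $ hv 2] :: complex ^ 2)) i"
    proof (cases i)
      case (Inl k)
      then show ?thesis using exhaust_4[of k] by (auto simp: eval_simps)
    next
      case (Inr k)
      then show ?thesis using exhaust_2[of k] by (auto simp: eval_simps vector_2)
    qed
  qed
  then show ?thesis
    unfolding pullback_def eval_biv_def insertion_insertion[OF is_hom_id(1) is_hom_id(1)] by (rule arg_cong)
qed

lemma nonvanishing_pullback:
  assumes "proj_homogeneous d g"
  shows "(\<forall>h\<in>proj_point (vector [q $ hv 1, q $ hv 2]). eval_biv (stuv q) h g \<noteq> 0) \<longleftrightarrow> eval_at q (pullback g) \<noteq> 0"
proof -
  have "(\<forall>c. c \<noteq> 0 \<longrightarrow> c ^ d * e \<noteq> 0) \<longleftrightarrow> e \<noteq> 0" for e :: complex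
    by (auto dest: spec[of _ 1])
  then show ?thesis unfolding ball_proj_point eval_biv_scale[OF assms] eval_pullback .
qed

text \<open>The preimage of U in the semistable coordinate space, a union of torus orbits.\<close>

definition sat :: "blowup_point set \<Rightarrow> (complex ^ 4) set" where
  "sat U = {q. out q src \<and> pt q \<in> U}"

text \<open>The polynomial g is the pullback of a member of the defining family that is nonzero at
  some point of U.\<close>

lemma zariski_openE:
  assumes "zariski_open Y U" "U \<noteq> {}"
  obtains g where "g \<noteq> 0" "\<And>q. out q src \<Longrightarrow> eval_at q g \<noteq> 0 \<Longrightarrow> q \<in> sat U" "\<And>P. P \<in> U \<Longrightarrow> \<exists>q\<in>sat U. P = pt q"
proof -
  obtain G where G: "\<And>g. g \<in> G \<Longrightarrow> \<exists>d. proj_homogeneous d g"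
    and U: "U = {(p, l) \<in> Y. \<exists>g\<in>G. \<forall>h\<in>l. eval_biv p h g \<noteq> 0}" using assms(1) unfolding zariski_open_def by blast
  have mem: "pt q \<in> U \<longleftrightarrow> (\<exists>g\<in>G. eval_at q (pullback g) \<noteq> 0)" if o: "out q src" for q
  proof -
    have "pt q \<in> Y" using o Y_iff by blast
    then have "pt q \<in> U \<longleftrightarrow> (\<exists>g\<in>G. \<forall>h\<in>proj_point (vector [q $ hv 1, q $ hv 2]). eval_biv (stuv q) h g \<noteq> 0)"
      unfolding U pt by simp
    also have "\<dots> \<longleftrightarrow> (\<exists>g\<in>G. eval_at q (pullback g) \<noteq> 0)"
      using nonvanishing_pullback G by blast
    finally show ?thesis .
  qed
  have all: "\<exists>q\<in>sat U. P = pt q" if P: "P \<in> U" for P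
  proof -
    have "P \<in> Y" using P unfolding U by blast
    then obtain q where q: "out q src" "P = pt q" using iffD1[OF Y_iff] by blast
    have "q \<in> sat U" using q P by (simp add: sat_def)
    then show ?thesis using q(2) by (rule bexI[rotated])
  qed
  obtain P where "P \<in> U" using assms(2) by blast
  then obtain q where "q \<in> sat U" using all by blast
  then obtain g where g: "g \<in> G" "eval_at q (pullback g) \<noteq> 0" using mem unfolding sat_def by blast
  show thesis
  proof (rule that)
    show "pullback g \<noteq> 0" using g(2) by (auto simp: is_homD(4)[OF is_hom_eval])
    show "q' \<in> sat U" if "out q' src" "eval_at q' (pullback g) \<noteq> 0" for q'
      using that mem g(1) unfolding sat_def by blast
  qed (rule all)
qed

lemma out_torus_point: "\<forall>i. q $ i \<noteq> 0 \<Longrightarrow> out q src"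
  by (simp add: out_src)

text \<open>Multiplication by the polynomial from \<open>zariski_openE\<close> makes the identity
  trivial at torus points outside \<open>sat U\<close>, so \<open>cpoly_eqI\<close> applies.\<close>

lemma sat_dense:
  assumes U: "zariski_open Y U" "U \<noteq> {}" and eq: "\<And>q. q \<in> sat U \<Longrightarrow> eval_at q f = eval_at q f'"
  shows "f = f'"
proof -
  obtain g where g: "g \<noteq> 0" "\<And>q. out q src \<Longrightarrow> eval_at q g \<noteq> 0 \<Longrightarrow> q \<in> sat U"
    using zariski_openE[OF U] by metis
  have "g * f = g * f'"
  proof (rule cpoly_eqI)
    fix q :: "complex ^ 4" assume "\<forall>i. q $ i \<noteq> 0"
    then show "eval_at q (g * f) = eval_at q (g * f')"
      using g(2)[OF out_torus_point] eq by (cases "eval_at q g = 0") (simp_all add: is_homD(3)[OF is_hom_eval])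
  qed
  then show ?thesis using g(1) by simp
qed

lemma acts_by_X:
  assumes "V \<in> X" "acts_by V q" shows "\<exists>v. frame V v q \<and> out q src"
proof -
  obtain v0 q0 where F0: "frame V v0 q0" "out q0 src" using assms(1) X_iff by blast
  obtain v where F: "frame V v q" using assms(2) acts_by_frame[OF frameD(1)[OF F0(1)]] by blast
  obtain \<mu> where "\<mu> \<noteq> 0" "q = torus_vec \<mu> q0" using frame_unique[OF F0(1) F] by blast
  then show ?thesis using F F0(2) out_torus by blast
qed

lemma X_acts_by: assumes "out q src" shows "\<exists>V\<in>X. acts_by V q \<and> supp_arrows V = {a. q $ aidx a \<noteq> 0}"
  using X_iff assms frame_std_module frame_acts_by supp_arrows_frame by blast

lemma common_support_iff: "a \<in> common_support X pt U \<longleftrightarrow> (\<forall>q\<in>sat U. q $ aidx a \<noteq> 0)"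
proof
  assume a: "a \<in> common_support X pt U"
  show "\<forall>q\<in>sat U. q $ aidx a \<noteq> 0"
  proof
    fix q assume q: "q \<in> sat U"
    then obtain V where "V \<in> X" "acts_by V q" "supp_arrows V = {a. q $ aidx a \<noteq> 0}"
      using X_acts_by unfolding sat_def by blast
    then show "q $ aidx a \<noteq> 0" using a q unfolding common_support_def sat_def by blast
  qed
next
  assume a: "\<forall>q\<in>sat U. q $ aidx a \<noteq> 0"
  have "a \<in> supp_arrows V" if V: "V \<in> X" "acts_by V q" "pt q \<in> U" for V q
  proof -
    obtain v where "frame V v q" "out q src" using acts_by_X V(1,2) by blast
    then show ?thesis using supp_arrows_frame a V(3) unfolding sat_def by blast
  qed
  then show "a \<in> common_support X pt U" by (auto simp: common_support_def)
qed

lemma arrow_locus_iff: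
  "arrow_locus X pt U \<longleftrightarrow> U = {pt q |q. out q src \<and> (\<forall>a\<in>common_support X pt U. q $ aidx a \<noteq> 0)}"
proof -
  have "(\<exists>V\<in>X. acts_by V q \<and> S \<subseteq> supp_arrows V) \<longleftrightarrow> out q src \<and> (\<forall>a\<in>S. q $ aidx a \<noteq> 0)" for q S
  proof
    assume "\<exists>V\<in>X. acts_by V q \<and> S \<subseteq> supp_arrows V"
    then obtain V v where "S \<subseteq> supp_arrows V" "frame V v q" "out q src" using acts_by_X by blast
    then show "out q src \<and> (\<forall>a\<in>S. q $ aidx a \<noteq> 0)" using supp_arrows_frame by blast
  next
    assume "out q src \<and> (\<forall>a\<in>S. q $ aidx a \<noteq> 0)"
    then show "\<exists>V\<in>X. acts_by V q \<and> S \<subseteq> supp_arrows V" using X_acts_by by blast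
  qed
  then show ?thesis unfolding arrow_locus_def by simp
qed

subsection \<open>The standard charts\<close>

lemma standard_chart_iff: "P \<in> standard_chart Y k \<longleftrightarrow> (\<exists>q. out q src \<and> q $ hv k \<noteq> 0 \<and> P = pt q)"
proof -
  have *: "pt q \<in> standard_chart Y k \<longleftrightarrow> q $ hv k \<noteq> 0" if "out q src" for q
  proof -
    have "pt q \<in> Y" using that Y_iff by blast
    then have "pt q \<in> standard_chart Y k \<longleftrightarrow> (\<forall>h\<in>proj_point (vector [q $ hv 1, q $ hv 2]). h $ k \<noteq> 0)"
      unfolding standard_chart_def pt by simp
    also have "\<dots> \<longleftrightarrow> (\<forall>c. c \<noteq> 0 \<longrightarrow> c * q $ hv k \<noteq> 0)"
    proof -
      have "(vector [c * q $ hv 1, c * q $ hv 2] :: complex ^ 2) $ k = c * q $ hv k" for c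
        using exhaust_2[of k] by (elim disjE) (simp_all only: vector_2)
      then show ?thesis unfolding ball_proj_point by simp
    qed
    also have "\<dots> \<longleftrightarrow> q $ hv k \<noteq> 0" by (metis mult_eq_0_iff zero_neq_one)
    finally show ?thesis .
  qed
  show ?thesis
  proof
    assume P: "P \<in> standard_chart Y k"
    then have "P \<in> Y" unfolding standard_chart_def by blast
    then obtain q where q: "out q src" "P = pt q" using iffD1[OF Y_iff] by blast
    then show "\<exists>q. out q src \<and> q $ hv k \<noteq> 0 \<and> P = pt q" using *[OF q(1)] P by blast
  next
    assume "\<exists>q. out q src \<and> q $ hv k \<noteq> 0 \<and> P = pt q"
    then obtain q where q: "out q src" "q $ hv k \<noteq> 0" "P = pt q" by blast
    then show "P \<in> standard_chart Y k" using *[OF q(1)] by simp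
  qed
qed

lemma sat_standard_chart: "q \<in> sat (standard_chart Y k) \<longleftrightarrow> out q src \<and> q $ hv k \<noteq> 0"
proof -
  have "q $ hv k \<noteq> 0" if o: "out q src" and P: "pt q \<in> standard_chart Y k"
  proof -
    obtain q' where q': "out q' src" "q' $ hv k \<noteq> 0" "pt q' = pt q" using P standard_chart_iff by metis
    then obtain \<mu> where "\<mu> \<noteq> 0" "q = torus_vec \<mu> q'" using pt_eq by metis
    then show ?thesis using q'(2) exhaust_4[of "hv k"] by auto
  qed
  then show ?thesis unfolding sat_def using standard_chart_iff by blast
qed

lemma zariski_open_standard_chart: "zariski_open Y (standard_chart Y k)"
proof -
  let ?g = "sg (sg (Inr k) 1) 1 :: (4 + 2) cpoly"
  have "proj_homogeneous 1 ?g"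
    by (rule proj_homogeneous_single) (use exhaust_2[of k] in \<open>auto simp: lookup_single\<close>)
  moreover have "eval_biv p h ?g = h $ k" for p h
    by (simp add: eval_biv_single)
  ultimately show ?thesis
    unfolding zariski_open_def standard_chart_def by (intro exI[of _ "{?g}"] conjI) (blast, simp)
qed

lemma arrow_locus_standard_chart: "arrow_locus X pt (standard_chart Y k)"
proof -
  have cs: "a \<in> common_support X pt (standard_chart Y k) \<longleftrightarrow> aidx a = hv k" for a
  proof
    \<comment> \<open>At this point of the chart all arrows but one act by zero, so no other arrow
      is common to the chart.\<close>
    let ?q = "(\<chi> i. if i = hv k then 1 else 0) :: complex ^ 4"
    assume "a \<in> common_support X pt (standard_chart Y k)"
    moreover have "?q \<in> sat (standard_chart Y k)"
      unfolding sat_standard_chart out_src using exhaust_2[of k] by auto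
    ultimately have "?q $ aidx a \<noteq> 0" unfolding common_support_iff by blast
    then show "aidx a = hv k" by (simp split: if_splits)
  qed (simp add: common_support_iff sat_standard_chart)
  obtain a where "aidx a = hv k" using aidx_surj by blast
  then have "(\<forall>a\<in>common_support X pt (standard_chart Y k). q $ aidx a \<noteq> 0) \<longleftrightarrow> q $ hv k \<noteq> 0" for q :: "complex ^ 4"
    unfolding Ball_def cs by metis
  then show ?thesis unfolding arrow_locus_iff using standard_chart_iff[of _ k] by blast
qed

subsection \<open>Homogenization\<close>

text \<open>
  Multiplied by a power of the homogeneous coordinate \<open>q $ hv k\<close>, every monomial in \<open>x, y, z, w\<close>
  becomes one in \<open>s, t, u, v\<close> and the homogeneous coordinates.
\<close>

definition hmon :: "2 \<Rightarrow> nat \<Rightarrow> (4 \<Rightarrow>\<^sub>0 nat) \<Rightarrow> (4 + 2 \<Rightarrow>\<^sub>0 nat)" where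
  "hmon k N m = sg (Inl (ps k 1)) (lk m (jv 1)) + sg (Inl (ps k 2)) (lk m (jv 2)) +
     sg (Inr 1) (lk m (hv 1)) + sg (Inr 2) (lk m (hv 2)) + sg (Inr k) (N - (lk m (jv 1) + lk m (jv 2)))"

definition hpoly :: "2 \<Rightarrow> nat \<Rightarrow> 4 cpoly \<Rightarrow> (4 + 2) cpoly" where
  "hpoly k N F = (\<Sum>m\<in>ks F. sg (hmon k N m) (lk F m))"

lemma monval_vars:
  fixes q :: "complex ^ 4"
  shows "monval (($) q) m =
    q $ hv 1 ^ lk m (hv 1) * q $ hv 2 ^ lk m (hv 2) * q $ jv 1 ^ lk m (jv 1) * q $ jv 2 ^ lk m (jv 2)"
  unfolding monval_def vars(1) using vars(2) by (simp add: mult_ac)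

lemma eval_hmon:
  assumes "lk m (jv 1) + lk m (jv 2) \<le> N"
  shows "monval (case_sum (($) (stuv q)) (($) (vector [q $ hv 1, q $ hv 2] :: complex ^ 2))) (hmon k N m) =
    q $ hv k ^ N * monval (($) q) m"
proof -
  have N: "q $ hv k ^ N = q $ hv k ^ lk m (jv 1) * q $ hv k ^ lk m (jv 2) * q $ hv k ^ (N - (lk m (jv 1) + lk m (jv 2)))"
    using assms by (simp add: power_add[symmetric])
  have k: "(vector [q $ hv 1, q $ hv 2] :: complex ^ 2) $ k = q $ hv k"
    using exhaust_2[of k] by (elim disjE) (simp_all only: vector_2)
  show ?thesis
    unfolding hmon_def monval_add monval_single sum.case stuv_ps k N monval_vars
    by (simp add: vector_2 power_mult_distrib mult_ac)
qed

lemma eval_hpoly: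
  assumes "\<And>m. m \<in> ks F \<Longrightarrow> lk m (jv 1) + lk m (jv 2) \<le> N"
  shows "eval_at q (pullback (hpoly k N F)) = q $ hv k ^ N * eval_at q F"
proof -
  have "eval_at q F = (\<Sum>m\<in>ks F. lk F m * monval (($) q) m)" by (simp add: insertion_monval)
  then show ?thesis
    unfolding eval_pullback hpoly_def is_hom_sum[OF eval_biv_hom] eval_biv_single
    by (simp add: eval_hmon[OF assms] sum_distrib_left mult_ac)
qed

text \<open>The degree depends only on N and the weight, so numerator and denominator of a
  weight-zero fraction receive the same degree. The sign \<open>eps\<close> makes the homogeneous
  coordinates count positively.\<close>

lemma proj_homogeneous_hpoly:
  assumes "\<And>m. m \<in> ks F \<Longrightarrow> lk m (jv 1) + lk m (jv 2) \<le> N" "homog w F"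
  shows "proj_homogeneous (nat (int N + eps * w)) (hpoly k N F)"
  unfolding hpoly_def
proof (intro proj_homogeneous_sum proj_homogeneous_single)
  fix m assume m: "m \<in> ks F"
  then have "wt m = w" using assms(2) by (simp add: homog_def)
  then have "nat (int N + eps * w) = lk m (hv 1) + lk m (hv 2) + (N - (lk m (jv 1) + lk m (jv 2)))"
    using eps_wt[of m] assms(1)[OF m] by simp
  then show "lk (hmon k N m) (Inr 1) + lk (hmon k N m) (Inr 2) = nat (int N + eps * w)"
    using exhaust_2[of k] by (auto simp: hmon_def lookup_add lookup_single)
qed

subsection \<open>The induced coordinates as regular functions\<close>

text \<open>The value is taken at some representative q of the point; for the elements of
  \<open>loc_ring\<close> over an open U, \<open>coord_value\<close> shows that every representative
  gives the same one.\<close>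

definition restrict_coord :: "blowup_point set \<Rightarrow> frac_B \<Rightarrow> blowup_point \<Rightarrow> complex" where
  "restrict_coord U f = (\<lambda>P\<in>U. SOME c. \<exists>q. out q src \<and> pt q = P \<and> has_value f q c)"

context
  fixes U assumes U: "zariski_open Y U" "U \<noteq> {}"
begin

abbreviation "S \<equiv> common_support X pt U"

lemma monval_nonzero:
  assumes "ks m \<subseteq> aidx ` S" "q \<in> sat U" shows "monval (($) q) m \<noteq> 0"
proof -
  have "q $ k \<noteq> 0" if k: "k \<in> ks m" for k
  proof -
    obtain a where "a \<in> S" "k = aidx a" using assms(1) k by blast
    then show ?thesis using assms(2) common_support_iff by blast
  qed
  then show ?thesis using monval_eq_0_iff by blast
qed

lemma coord_value:
  assumes F: "homog (wt m) F" and m: "ks m \<subseteq> aidx ` S" and q: "q \<in> sat U"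
  shows "has_value (frac F / frac (sg m 1)) q (eval_at q F / monval (($) q) m)"
    "restrict_coord U (frac F / frac (sg m 1)) (pt q) = eval_at q F / monval (($) q) m"
proof -
  let ?f = "frac F / frac (sg m 1)"
  have M: "eval_at q (sg m 1) = monval (($) q) m" for q
    using insertion_single[OF is_hom_id(1), of "($) q" m 1] by simp
  have hv: "has_value ?f q' (eval_at q' F / monval (($) q') m)" if q': "q' \<in> sat U" for q'
    using has_value_quotient[of q' "sg m 1" F] monval_nonzero[OF m q'] unfolding M by simp
  from hv[OF q] show "has_value ?f q (eval_at q F / monval (($) q) m)" .
  have o: "out q src" "pt q \<in> U" using q unfolding sat_def by blast+
  have "(SOME c. \<exists>q'. out q' src \<and> pt q' = pt q \<and> has_value ?f q' c) = eval_at q F / monval (($) q) m"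
  proof (rule some_equality)
    show "\<exists>q'. out q' src \<and> pt q' = pt q \<and> has_value ?f q' (eval_at q F / monval (($) q) m)"
      using o hv[OF q] by blast
    fix c assume "\<exists>q'. out q' src \<and> pt q' = pt q \<and> has_value ?f q' c"
    then obtain q' where q': "out q' src" "pt q' = pt q" "has_value ?f q' c" by blast
    then have "q' \<in> sat U" using o(2) unfolding sat_def by simp
    then have c: "c = eval_at q' F / monval (($) q') m" using has_value_unique[OF q'(3)] hv by blast
    obtain \<mu> where "\<mu> \<noteq> 0" "q' = torus_vec \<mu> q" using pt_eq[OF o(1), of q'] q'(2) by auto
    then show "c = eval_at q F / monval (($) q) m"
      using c eval_torus_homog[OF _ F, of \<mu> q] monval_torus[of \<mu> q m] by simp
  qed
  then show "restrict_coord U ?f (pt q) = eval_at q F / monval (($) q) m"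
    unfolding restrict_coord_def using o(2) by simp
qed

lemma restrict_coord_regular:
  assumes F: "homog (wt m) F" and m: "ks m \<subseteq> aidx ` S"
  shows "restrict_coord U (frac F / frac (sg m 1)) \<in> regular_functions U"
proof -
  let ?r = "restrict_coord U (frac F / frac (sg m 1))"
  \<comment> \<open>N bounds the degree in the \<open>jv\<close> variables of every monomial in
    numerator and denominator, so both can be homogenized with the same power.\<close>
  define N where "N = (\<Sum>n\<in>insert m (ks F). lk n (jv 1) + lk n (jv 2))"
  have N: "lk n (jv 1) + lk n (jv 2) \<le> N" if "n \<in> insert m (ks F)" for n
    unfolding N_def using that by (intro member_le_sum) simp_all
  have "\<exists>d f g. proj_homogeneous d f \<and> proj_homogeneous d g \<and> (\<forall>h\<in>snd P. eval_biv (fst P) h g \<noteq> 0) \<and>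
     (\<forall>(p', l')\<in>U. \<forall>h\<in>l'. eval_biv p' h g \<noteq> 0 \<longrightarrow> ?r (p', l') = eval_biv p' h f / eval_biv p' h g)"
    if P: "P \<in> U" for P
  proof -
    obtain q where q: "q \<in> sat U" "P = pt q" using zariski_openE[OF U] P by metis
    \<comment> \<open>A homogeneous coordinate that is nonzero at the given point; its N-th power is
      the factor that cancels from the fraction.\<close>
    obtain k where k: "q $ hv k \<noteq> 0" using q(1) unfolding sat_def out_src by blast
    let ?d = "nat (int N + eps * wt m)" and ?f = "hpoly k N F" and ?g = "hpoly k N (sg m 1)"
    have hf: "proj_homogeneous ?d ?f" using N by (intro proj_homogeneous_hpoly F) simp
    have hg: "proj_homogeneous ?d ?g" using N by (intro proj_homogeneous_hpoly homog_singleI) simp_all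
    have ef: "eval_at q' (pullback ?f) = q' $ hv k ^ N * eval_at q' F" for q'
      using N by (intro eval_hpoly) simp
    have "eval_at q' (pullback ?g) = q' $ hv k ^ N * eval_at q' (sg m 1)" for q'
      using N by (intro eval_hpoly) simp
    then have eg: "eval_at q' (pullback ?g) = q' $ hv k ^ N * monval (($) q') m" for q'
      using insertion_single[OF is_hom_id(1), of "($) q'" m 1] by simp
    have "?r (p', l') = eval_biv p' h ?f / eval_biv p' h ?g"
      if P': "(p', l') \<in> U" "h \<in> l'" "eval_biv p' h ?g \<noteq> 0" for p' l' h
    proof -
      obtain q' where q': "q' \<in> sat U" "(p', l') = pt q'" using zariski_openE[OF U] P'(1) by metis
      then have e: "p' = stuv q'" "l' = proj_point (vector [q' $ hv 1, q' $ hv 2])" using pt by simp_all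
      have "\<forall>h\<in>proj_point (vector [q' $ hv 1, q' $ hv 2]). \<exists>c. c \<noteq> 0 \<and> h = vector [c * q' $ hv 1, c * q' $ hv 2]"
        unfolding ball_proj_point by blast
      then obtain c where c: "c \<noteq> 0" "h = vector [c * q' $ hv 1, c * q' $ hv 2]" using P'(2) e(2) by blast
      have b: "eval_biv p' h ?f = c ^ ?d * (q' $ hv k ^ N * eval_at q' F)"
        "eval_biv p' h ?g = c ^ ?d * (q' $ hv k ^ N * monval (($) q') m)"
        unfolding c(2) e(1) eval_biv_scale[OF hf] eval_biv_scale[OF hg] eval_pullback[symmetric] ef eg by (rule refl)+
      then have kN: "q' $ hv k ^ N \<noteq> 0" using P'(3) by auto
      show ?thesis unfolding b q'(2) coord_value(2)[OF F m q'(1)]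
          mult_divide_mult_cancel_left[OF power_not_zero[OF c(1)]] mult_divide_mult_cancel_left[OF kN] by (rule refl)
    qed
    moreover have "\<forall>h\<in>snd P. eval_biv (fst P) h ?g \<noteq> 0"
      unfolding q(2) pt fst_conv snd_conv nonvanishing_pullback[OF hg] eg using k monval_nonzero[OF m q(1)] by simp
    ultimately show ?thesis using hf hg by blast
  qed
  then show ?thesis unfolding regular_functions_def restrict_coord_def by fastforce
qed

text \<open>The cross-multiplied numerators agree on \<open>sat U\<close>, hence as polynomials by
  \<open>sat_dense\<close>.\<close>

lemma restrict_coord_inj: "inj_on (restrict_coord U) (loc_ring S)"
proof (rule inj_onI)
  fix f f' assume "f \<in> loc_ring S" "f' \<in> loc_ring S" and eq: "restrict_coord U f = restrict_coord U f'"
  then obtain F m F' m' where f: "f = frac F / frac (sg m 1)" "homog (wt m) F" "ks m \<subseteq> aidx ` S"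
    and f': "f' = frac F' / frac (sg m' 1)" "homog (wt m') F'" "ks m' \<subseteq> aidx ` S" unfolding loc_ring_def by blast
  have "F * sg m' 1 = F' * sg m 1"
  proof (rule sat_dense[OF U])
    fix q assume q: "q \<in> sat U"
    have M: "eval_at q (sg n 1) = monval (($) q) n" for n
      using insertion_single[OF is_hom_id(1), of "($) q" n 1] by simp
    have "eval_at q F / monval (($) q) m = eval_at q F' / monval (($) q) m'"
      using eq coord_value(2)[OF f(2,3) q] coord_value(2)[OF f'(2,3) q] unfolding f(1) f'(1) by simp
    then show "eval_at q (F * sg m' 1) = eval_at q (F' * sg m 1)"
      unfolding is_homD(3)[OF is_hom_eval] M
      using monval_nonzero[OF f(3) q] monval_nonzero[OF f'(3) q] by (simp add: frac_eq_eq)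
  qed
  then have "frac F * frac (sg m' 1) = frac F' * frac (sg m 1)" by (metis is_homD(3)[OF is_hom_frac])
  then show "f = f'" unfolding f(1) f'(1) by (simp add: frac_eq_eq frac_eq_0_iff sg_1_nonzero)
qed

text \<open>Under \<open>pullback\<close> a fraction in affine and homogeneous coordinates becomes
  one in x, y, z, w; the representative with factor 1 is evaluated.\<close>

lemma regular_function_local:
  assumes "r \<in> regular_functions U" "q0 \<in> sat U"
  shows "\<exists>F G. eval_at q0 G \<noteq> 0 \<and>
    (\<forall>q\<in>sat U. eval_at q G \<noteq> 0 \<longrightarrow> r (pt q) = eval_at q F / eval_at q G)"
proof -
  have "pt q0 \<in> U" using assms(2) unfolding sat_def by blast
  then have P: "(stuv q0, proj_point (vector [q0 $ hv 1, q0 $ hv 2])) \<in> U" unfolding pt .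
  obtain d f g where h: "proj_homogeneous d g"
    "\<forall>h\<in>proj_point (vector [q0 $ hv 1, q0 $ hv 2]). eval_biv (stuv q0) h g \<noteq> 0"
    and r: "\<forall>(p', l')\<in>U. \<forall>h\<in>l'. eval_biv p' h g \<noteq> 0 \<longrightarrow> r (p', l') = eval_biv p' h f / eval_biv p' h g"
    using assms(1) P unfolding regular_functions_def by blast
  have "r (pt q) = eval_at q (pullback f) / eval_at q (pullback g)"
    if q: "q \<in> sat U" and nz: "eval_at q (pullback g) \<noteq> 0" for q
  proof -
    have "\<forall>h\<in>proj_point (vector [q $ hv 1, q $ hv 2]). eval_biv (stuv q) h g \<noteq> 0 \<longrightarrow>
        r (pt q) = eval_biv (stuv q) h f / eval_biv (stuv q) h g"
      using r q unfolding sat_def pt by blast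
    then show ?thesis using nz unfolding ball_proj_point eval_pullback by (auto dest: spec[of _ 1])
  qed
  moreover have "eval_at q0 (pullback g) \<noteq> 0" using h(2) nonvanishing_pullback[OF h(1)] by blast
  ultimately show ?thesis by blast
qed

text \<open>One local fraction F/G is put in lowest terms. Any other local expression F1/G1
  satisfies F G1 = G F1, so G divides G1 and cannot vanish where G1 does not.\<close>

lemma regular_function_global:
  assumes r: "r \<in> regular_functions U"
  shows "\<exists>F G. \<forall>q\<in>sat U. eval_at q G \<noteq> 0 \<and> r (pt q) = eval_at q F / eval_at q G"
proof -
  note hm = is_homD[OF is_hom_eval]
  obtain q0 where q0: "q0 \<in> sat U" using zariski_openE[OF U] U(2) by (metis ex_in_conv)
  obtain F0 G0 where G0: "eval_at q0 G0 \<noteq> 0"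
    and r0: "\<And>q. q \<in> sat U \<Longrightarrow> eval_at q G0 \<noteq> 0 \<Longrightarrow> r (pt q) = eval_at q F0 / eval_at q G0"
    using regular_function_local[OF r q0] by blast
  have nz: "G0 \<noteq> 0" using G0 by (auto simp: hm(4))
  obtain d F G where d: "F0 = d * F" "G0 = d * G" and cop: "\<And>h k. F * h = G * k \<Longrightarrow> G dvd h"
    using cpoly_coprime_decomposition[OF nz, of F0] by metis
  have "eval_at q G \<noteq> 0 \<and> r (pt q) = eval_at q F / eval_at q G" if q: "q \<in> sat U" for q
  proof -
    obtain F1 G1 where G1: "eval_at q G1 \<noteq> 0"
      and r1: "\<And>q. q \<in> sat U \<Longrightarrow> eval_at q G1 \<noteq> 0 \<Longrightarrow> r (pt q) = eval_at q F1 / eval_at q G1"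
      using regular_function_local[OF r q] by blast
    \<comment> \<open>The two expressions are known to agree only where both denominators are
      nonzero; the extra factor \<open>G0 * G1\<close> makes the identity hold on all of
      \<open>sat U\<close>.\<close>
    have "F1 * G0 * (G0 * G1) = F0 * G1 * (G0 * G1)"
    proof (rule sat_dense[OF U])
      fix q' assume q': "q' \<in> sat U"
      show "eval_at q' (F1 * G0 * (G0 * G1)) = eval_at q' (F0 * G1 * (G0 * G1))"
      proof (cases "eval_at q' G0 = 0 \<or> eval_at q' G1 = 0")
        case False
        then have "eval_at q' F0 / eval_at q' G0 = eval_at q' F1 / eval_at q' G1"
          using r0[OF q'] r1[OF q'] by simp
        then have "eval_at q' F0 * eval_at q' G1 = eval_at q' F1 * eval_at q' G0"
          using False by (simp add: frac_eq_eq)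
        then show ?thesis by (simp add: hm(3))
      qed (auto simp: hm(3))
    qed
    moreover have "G1 \<noteq> 0" using G1 by (auto simp: hm(4))
    ultimately have "F1 * G0 = F0 * G1" using nz by simp
    then have e: "F * G1 = G * F1" using nz unfolding d by (simp add: mult_ac)
    then obtain h where "G1 = G * h" using cop by (metis dvdE)
    then have Gq: "eval_at q G \<noteq> 0" using G1 by (auto simp: hm(3))
    moreover have "eval_at q F * eval_at q G1 = eval_at q G * eval_at q F1" using e by (metis hm(3))
    ultimately show ?thesis using r1[OF q G1] G1 by (simp add: frac_eq_eq mult_ac)
  qed
  then show ?thesis by blast
qed

text \<open>Each variable of the monomial denominator vanishes nowhere on \<open>sat U\<close>, so
  it belongs to an arrow of the common support.\<close>

lemma restrict_coord_surj:
  assumes A: "arrow_locus X pt U" and r: "r \<in> regular_functions U"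
  shows "r \<in> restrict_coord U ` loc_ring S"
proof -
  note hm = is_homD[OF is_hom_eval]
  obtain F0 G where G: "\<And>q. q \<in> sat U \<Longrightarrow> eval_at q G \<noteq> 0"
    and r0: "\<And>q. q \<in> sat U \<Longrightarrow> r (pt q) = eval_at q F0 / eval_at q G"
    using regular_function_global[OF r] by blast
  have torus: "q \<in> sat U" if q: "\<forall>i. q $ i \<noteq> 0" for q
  proof -
    have "pt q \<in> {pt q |q. out q src \<and> (\<forall>a\<in>S. q $ aidx a \<noteq> 0)}" using q out_torus_point by blast
    then show ?thesis using A out_torus_point[OF q] unfolding arrow_locus_iff sat_def by blast
  qed
  then obtain m c where mc: "c \<noteq> 0" "G = sg m c" using torus_unit_monomial[of G] G by blast
  have eG: "eval_at q G = c * monval (($) q) m" for q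
    unfolding mc(2) using insertion_single[OF is_hom_id(1), of "($) q" m c] by simp
  have m: "ks m \<subseteq> aidx ` S"
  proof
    fix k assume k: "k \<in> ks m"
    obtain a where a: "aidx a = k" using aidx_surj by blast
    have "q $ k \<noteq> 0" if q: "q \<in> sat U" for q
      using G[OF q] k monval_eq_0_iff[of q m] unfolding eG by auto
    then show "k \<in> aidx ` S" using a common_support_iff by blast
  qed
  define F where "F = const (inverse c) * F0"
  have eF: "eval_at q F = eval_at q F0 / c" for q
    unfolding F_def hm(3) using insertion_const[OF is_hom_id(1), of "($) q"] by (simp add: field_simps)
  have rF: "r (pt q) = eval_at q F / monval (($) q) m" if "q \<in> sat U" for q
    using r0[OF that] unfolding eG eF by simp
  \<comment> \<open>As r is constant on torus orbits, the numerator must scale like the monomial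
    below it, and is therefore homogeneous of the same weight.\<close>
  have "scaling 2 F = const (2 powi wt m) * F"
  proof (rule cpoly_eqI)
    fix q :: "complex ^ 4" assume q: "\<forall>i. q $ i \<noteq> 0"
    have q2: "\<forall>i. torus_vec 2 q $ i \<noteq> 0" using q by (simp add: forall_4)
    have "pt q = pt (torus_vec 2 q)" using pt_eq[OF out_torus_point[OF q]] by (metis zero_neq_numeral)
    then have "eval_at q F / monval (($) q) m = eval_at (torus_vec 2 q) F / monval (($) (torus_vec 2 q)) m"
      using rF[OF torus[OF q]] rF[OF torus[OF q2]] by simp
    moreover have "monval (($) q) m \<noteq> 0" using monval_nonzero[OF m torus[OF q]] .
    ultimately have "eval_at (torus_vec 2 q) F = 2 powi wt m * eval_at q F"
      using monval_torus[of 2 q m] by (simp add: field_simps)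
    then show "eval_at q (scaling 2 F) = eval_at q (const (2 powi wt m) * F)"
      unfolding eval_scaling hm(3) using insertion_const[OF is_hom_id(1), of "($) q"] by simp
  qed
  then have F: "homog (wt m) F" by (simp add: homog_iff_scaling)
  have "r = restrict_coord U (frac F / frac (sg m 1))"
  proof (rule extensionalityI)
    show "r \<in> extensional U" using r unfolding regular_functions_def by blast
    show "restrict_coord U (frac F / frac (sg m 1)) \<in> extensional U" unfolding restrict_coord_def by simp
    fix P assume "P \<in> U"
    then obtain q where "q \<in> sat U" "P = pt q" using zariski_openE[OF U] by metis
    then show "r P = restrict_coord U (frac F / frac (sg m 1)) P"
      using rF coord_value(2)[OF F m] by simp
  qed
  moreover have "frac F / frac (sg m 1) \<in> loc_ring S" using F m unfolding loc_ring_def by blast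
  ultimately show ?thesis by blast
qed

lemma restrict_coord_properties:
  "inj_on (restrict_coord U) (loc_ring S)" "restrict_coord U ` loc_ring S \<subseteq> regular_functions U"
  "\<And>f V q. f \<in> loc_ring S \<Longrightarrow> V \<in> X \<Longrightarrow> acts_by V q \<Longrightarrow> pt q \<in> U \<Longrightarrow> has_value f q (restrict_coord U f (pt q))"
  "arrow_locus X pt U \<Longrightarrow> restrict_coord U ` loc_ring S = regular_functions U"
proof -
  show "inj_on (restrict_coord U) (loc_ring S)" by (rule restrict_coord_inj)
  show sub: "restrict_coord U ` loc_ring S \<subseteq> regular_functions U"
    using restrict_coord_regular unfolding loc_ring_def by blast
  show "restrict_coord U ` loc_ring S = regular_functions U" if "arrow_locus X pt U"
    using sub restrict_coord_surj[OF that] by blast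
  fix f V q assume f: "f \<in> loc_ring S" and V: "V \<in> X" "acts_by V q" "pt q \<in> U"
  obtain F m where Fm: "f = frac F / frac (sg m 1)" "homog (wt m) F" "ks m \<subseteq> aidx ` S"
    using f unfolding loc_ring_def by blast
  have q: "q \<in> sat U" using acts_by_X[OF V(1,2)] V(3) unfolding sat_def by blast
  show "has_value f q (restrict_coord U f (pt q))"
    unfolding Fm(1) coord_value(2)[OF Fm(2,3) q] by (rule coord_value(1)[OF Fm(2,3) q])
qed

end

lemma impression_coords_agree: "impression_coords_agree X pt Y"
  unfolding impression_coords_agree_def Let_def induced_coords_eq
proof (intro conjI allI impI)
  fix U assume "zariski_open Y U \<and> U \<noteq> {}"
  then have U: "zariski_open Y U" "U \<noteq> {}" by blast+
  note p = restrict_coord_properties[OF U]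
  let ?S = "common_support X pt U"
  show "\<exists>\<Phi>. inj_on \<Phi> (loc_ring ?S) \<and> \<Phi> ` loc_ring ?S \<subseteq> regular_functions U \<and>
      (\<forall>f\<in>loc_ring ?S. \<forall>V\<in>X. \<forall>q. acts_by V q \<and> pt q \<in> U \<longrightarrow> has_value f q (\<Phi> f (pt q))) \<and>
      (arrow_locus X pt U \<longrightarrow> \<Phi> ` loc_ring ?S = regular_functions U)"
    by (rule exI[of _ "restrict_coord U"], intro conjI ballI allI impI)
      (rule p(1), rule p(2), rule p(3), assumption+, blast, blast, rule p(4))
qed (rule zariski_open_standard_chart arrow_locus_standard_chart)+

end

lemma impression_coords_minus:
  "impression_coords_agree (large_modules \<union> almost_large_modules_with_socle 2) point_minus Y_minus"
proof -
  let ?hv = "\<lambda>k :: 2. if k = 1 then 1 else 2 :: 4" and ?jv = "\<lambda>k :: 2. if k = 1 then 3 else 4 :: 4"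
  \<comment> \<open>Positions of the products (xz, xw, yz, yw), row by row.\<close>
  let ?ps = "\<lambda>a b :: 2. if a = 1 then (if b = 1 then 1 else 2) else (if b = 1 then 3 else 4 :: 4)"
  interpret resolution_side ?hv ?jv ?ps 1 "1"
    "large_modules \<union> almost_large_modules_with_socle 2" point_minus Y_minus
  proof
    show "UNIV = {?hv 1, ?hv 2, ?jv 1, ?jv 2}" using exhaust_4 by auto
    show "distinct [?hv 1, ?hv 2, ?jv 1, ?jv 2]" by simp
    show "stuv q $ ?ps a b = q $ ?hv a * q $ ?jv b" for q :: "complex ^ 4" and a b by simp
    show "point_minus q = (stuv q, proj_point (vector [q $ ?hv 1, q $ ?hv 2]))" for q by (simp add: point_minus_def)
    show "1 * wt m = int (lk m (?hv 1)) + int (lk m (?hv 2)) - int (lk m (?jv 1)) - int (lk m (?jv 2))" for m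
      by (simp add: wt_def)
    show "out q 1 \<longleftrightarrow> q $ ?hv 1 \<noteq> 0 \<or> q $ ?hv 2 \<noteq> 0" for q by (simp add: out_simps)
  qed (rule Y_minus_iff, erule point_minus_eq_iff, rule large_or_almost_large_iff[OF two_distinct(2)])
  show ?thesis by (rule impression_coords_agree)
qed

lemma impression_coords_plus:
  "impression_coords_agree (large_modules \<union> almost_large_modules_with_socle 1) point_plus Y_plus"
proof -
  let ?hv = "\<lambda>k :: 2. if k = 1 then 3 else 4 :: 4" and ?jv = "\<lambda>k :: 2. if k = 1 then 1 else 2 :: 4"
  \<comment> \<open>Now z, w are the homogeneous coordinates, so rows and columns are exchanged: t
    and u trade places, and the weight changes sign.\<close>
  let ?ps = "\<lambda>a b :: 2. if a = 1 then (if b = 1 then 1 else 3) else (if b = 1 then 2 else 4 :: 4)"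
  interpret resolution_side ?hv ?jv ?ps 2 "- 1"
    "large_modules \<union> almost_large_modules_with_socle 1" point_plus Y_plus
  proof
    show "UNIV = {?hv 1, ?hv 2, ?jv 1, ?jv 2}" using exhaust_4 by auto
    show "distinct [?hv 1, ?hv 2, ?jv 1, ?jv 2]" by simp
    show "stuv q $ ?ps a b = q $ ?hv a * q $ ?jv b" for q :: "complex ^ 4" and a b by simp
    show "point_plus q = (stuv q, proj_point (vector [q $ ?hv 1, q $ ?hv 2]))" for q by (simp add: point_plus_def)
    show "- 1 * wt m = int (lk m (?hv 1)) + int (lk m (?hv 2)) - int (lk m (?jv 1)) - int (lk m (?jv 2))" for m
      by (simp add: wt_def)
    show "out q 2 \<longleftrightarrow> q $ ?hv 1 \<noteq> 0 \<or> q $ ?hv 2 \<noteq> 0" for q by (simp add: out_simps)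
  qed (rule Y_plus_iff, erule point_plus_eq_iff, rule large_or_almost_large_iff[OF two_distinct(1)])
  show ?thesis by (rule impression_coords_agree)
qed

text \<open>The isomorphism \<open>psi\<close> comes first because it fixes how annihilators in the
  center become maximal ideals of R. The parameterizations by all of \<open>Y_minus\<close> and
  \<open>Y_plus\<close> identify the spaces of modules on which the two coordinate structures are
  then compared.\<close>

theorem proposition4p1:
  shows
    "(psi \<in> ring_iso (center conifold_algebra) conifold_ring \<and>
      (\<forall>c. \<forall>z\<in>carrier (center conifold_algebra).
         psi (c \<odot>\<^bsub>conifold_algebra\<^esub> z) = c \<odot>\<^bsub>conifold_ring\<^esub> psi z)) \<and>
     parameterized_by conifold_algebra large_modules smooth_locus
       (\<lambda>V m. m = psi ` ann (carrier (center conifold_algebra)) V) \<and>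
     parameterized_by conifold_algebra (almost_large_modules_with_socle 2) (exceptional_locus Y_minus)
       (\<lambda>V P. \<exists>q. acts_by V q \<and> P = (0, proj_point (vector [q $ 1, q $ 2]))) \<and>
     parameterized_by conifold_algebra (almost_large_modules_with_socle 1) (exceptional_locus Y_plus)
       (\<lambda>V P. \<exists>q. acts_by V q \<and> P = (0, proj_point (vector [q $ 3, q $ 4]))) \<and>
     parameterized_by conifold_algebra (large_modules \<union> almost_large_modules_with_socle 2) Y_minus
       (\<lambda>V P. \<exists>q. acts_by V q \<and> P = point_minus q) \<and>
     impression_coords_agree (large_modules \<union> almost_large_modules_with_socle 2) point_minus Y_minus \<and>
     parameterized_by conifold_algebra (large_modules \<union> almost_large_modules_with_socle 1) Y_plus
       (\<lambda>V P. \<exists>q. acts_by V q \<and> P = point_plus q) \<and>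
     impression_coords_agree (large_modules \<union> almost_large_modules_with_socle 1) point_plus Y_plus"
  using psi_ring_iso psi_scale parameterized_large parameterized_exceptional_minus
    parameterized_exceptional_plus parameterized_Y_minus impression_coords_minus
    parameterized_Y_plus impression_coords_plus
  by blast

end
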